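(* Let $V\in L^\infty(\mathbb{R}^d)$ be real-valued and let $(X_t)_{t\ge0}$ be a $d$-dimensional Cauchy process. Then for all $f,g\in L^2(\mathbb{R}^d)$ and all $t\ge0$, $$\left(f,e^{-t(\sqrt{-\Delta}+V)}g\right)=\int_{\mathbb{R}^d}dx\,\mathbb{E}^x\left[\overline{f(X_0)}\,g(X_t)\,e^{-\int_0^tV(X_s)\,ds}\right].$$
   Context: $(f,g)=\int_{\mathbb{R}^d}\overline{f}g\,dx$ is the inner product of $L^2(\mathbb{R}^d)$. $\sqrt{-\Delta}$ is the self-adjoint operator with domain $\{f\in L^2(\mathbb{R}^d):|k|\hat f\in L^2(\mathbb{R}^d)\}$ defined by $\widehat{\sqrt{-\Delta}f}(k)=|k|\hat f(k)$; for bounded real Borel measurable $V$, acting by multiplication, $\sqrt{-\Delta}+V$ is self-adjoint on the same domain. The $d$-dimensional Cauchy process is the Lévy process on $\mathbb{R}^d$ with càdlàg paths and $\mathbb{E}^0[e^{i\xi\cdot X_t}]=e^{-t|\xi|}$, $\xi\in\mathbb{R}^d$; $\mathbb{E}^x$ denotes expectation for the process started at $x$. *)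

theory Defs
  imports "HOL-Probability.Probability"
begin

section \<open>The Hilbert space of square integrable functions\<close>

text \<open>Elements of the Hilbert space are represented by Borel measurable functions; two of them
  denote the same element iff they agree almost everywhere.\<close>

definition l2 :: "('a::euclidean_space \<Rightarrow> complex) set" where
  "l2 = {f \<in> borel_measurable lborel. integrable lborel (\<lambda>x. (cmod (f x))\<^sup>2)}"

definition l2_inner :: "('a::euclidean_space \<Rightarrow> complex) \<Rightarrow> ('a \<Rightarrow> complex) \<Rightarrow> complex" where
  "l2_inner f g = (LINT x|lborel. cnj (f x) * g x)"

text \<open>The extended integral is used so that a non-integrable difference does not count as small.\<close>

definition l2_tendsto :: "(nat \<Rightarrow> 'a::euclidean_space \<Rightarrow> complex) \<Rightarrow> ('a \<Rightarrow> complex) \<Rightarrow> bool" where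
  "l2_tendsto u f \<longleftrightarrow>
     (\<lambda>n. \<integral>\<^sup>+x. ennreal ((cmod (u n x - f x))\<^sup>2) \<partial>lborel) \<longlonglongrightarrow> 0"

section \<open>The Fourier transform\<close>

definition fourier_L1 :: "('a::euclidean_space \<Rightarrow> complex) \<Rightarrow> 'a \<Rightarrow> complex" where
  "fourier_L1 f k =
     complex_of_real ((2 * pi) powr (- real DIM('a) / 2)) * (LINT x|lborel. cis (- (k \<bullet> x)) * f x)"

text \<open>The Plancherel extension to square integrable functions: the limit in the mean of the
  transforms of the truncations. It is determined up to null sets.\<close>

definition fourier_L2 :: "('a::euclidean_space \<Rightarrow> complex) \<Rightarrow> 'a \<Rightarrow> complex" where
  "fourier_L2 f = (SOME F. F \<in> l2 \<and>
     l2_tendsto (\<lambda>n. fourier_L1 (\<lambda>x. indicator (cball 0 (real n)) x * f x)) F)"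

section \<open>Unbounded operators\<close>

text \<open>An operator is given by its graph, which is closed under almost everywhere
  equality in both components.\<close>

type_synonym 'a l2_operator = "(('a \<Rightarrow> complex) \<times> ('a \<Rightarrow> complex)) set"

definition op_apply :: "'a::euclidean_space l2_operator \<Rightarrow> ('a \<Rightarrow> complex) \<Rightarrow> 'a \<Rightarrow> complex" where
  "op_apply T f = (SOME u. (f, u) \<in> T)"

definition op_plus ::
  "'a::euclidean_space l2_operator \<Rightarrow> 'a l2_operator \<Rightarrow> 'a l2_operator" where
  "op_plus S T = {(f, u). u \<in> l2 \<and>
     (\<exists>a b. (f, a) \<in> S \<and> (f, b) \<in> T \<and> (AE x in lborel. u x = a x + b x))}"

definition mult_op :: "('a::euclidean_space \<Rightarrow> real) \<Rightarrow> 'a l2_operator" where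
  "mult_op V = {(f, u). f \<in> l2 \<and> u \<in> l2 \<and> (AE x in lborel. u x = complex_of_real (V x) * f x)}"

definition sqrt_neg_laplacian :: "'a::euclidean_space l2_operator" where
  "sqrt_neg_laplacian = {(f, u). f \<in> l2 \<and> u \<in> l2 \<and>
     (\<lambda>k. complex_of_real (norm k) * fourier_L2 f k) \<in> l2 \<and>
     (AE k in lborel. fourier_L2 u k = complex_of_real (norm k) * fourier_L2 f k)}"

section \<open>Functional calculus of a self-adjoint operator\<close>

text \<open>The second condition makes every \<open>E B\<close> a symmetric operator defined on the whole space;
  this entails linearity and, together with multiplicativity, that \<open>E B\<close> is an orthogonal
  projection.\<close>

definition projection_valued_measure ::
  "(real set \<Rightarrow> ('a::euclidean_space \<Rightarrow> complex) \<Rightarrow> 'a \<Rightarrow> complex) \<Rightarrow> bool" where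
  "projection_valued_measure E \<longleftrightarrow>
     (\<forall>B\<in>sets borel. \<forall>f\<in>l2. E B f \<in> l2) \<and>
     (\<forall>B\<in>sets borel. \<forall>f\<in>l2. \<forall>g\<in>l2. l2_inner f (E B g) = l2_inner (E B f) g) \<and>
     (\<forall>A\<in>sets borel. \<forall>B\<in>sets borel. \<forall>f\<in>l2. AE x in lborel. E A (E B f) x = E (A \<inter> B) f x) \<and>
     (\<forall>f\<in>l2. AE x in lborel. E UNIV f x = f x) \<and>
     (\<forall>A. range A \<subseteq> sets borel \<longrightarrow> disjoint_family A \<longrightarrow>
        (\<forall>f\<in>l2. l2_tendsto (\<lambda>n x. \<Sum>i<n. E (A i) f x) (E (\<Union>i. A i) f)))"

definition spectral_measure ::
  "(real set \<Rightarrow> ('a::euclidean_space \<Rightarrow> complex) \<Rightarrow> 'a \<Rightarrow> complex) \<Rightarrow> ('a \<Rightarrow> complex) \<Rightarrow> real measure"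
  where
  "spectral_measure E f = measure_of UNIV (sets borel) (\<lambda>B. ennreal (Re (l2_inner f (E B f))))"

definition spectral_domain ::
  "(real set \<Rightarrow> ('a::euclidean_space \<Rightarrow> complex) \<Rightarrow> 'a \<Rightarrow> complex) \<Rightarrow> (real \<Rightarrow> real) \<Rightarrow>
     ('a \<Rightarrow> complex) set" where
  "spectral_domain E \<phi> = {f \<in> l2. integrable (spectral_measure E f) (\<lambda>r. (\<phi> r)\<^sup>2)}"

text \<open>The integral of \<open>\<phi>\<close> against the complex measure that sends \<open>B\<close> to \<open>l2_inner f (E B g)\<close>,
  obtained by polarization from the measures \<open>spectral_measure E f\<close>.\<close>

definition spectral_form ::
  "(real set \<Rightarrow> ('a::euclidean_space \<Rightarrow> complex) \<Rightarrow> 'a \<Rightarrow> complex) \<Rightarrow> (real \<Rightarrow> real) \<Rightarrow>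
     ('a \<Rightarrow> complex) \<Rightarrow> ('a \<Rightarrow> complex) \<Rightarrow> complex" where
  "spectral_form E \<phi> f g =
     (\<Sum>k<4. inverse (\<i> ^ k) *
        complex_of_real (LINT r|spectral_measure E (\<lambda>x. f x + \<i> ^ k * g x). \<phi> r)) / 4"

definition spectral_integral ::
  "(real set \<Rightarrow> ('a::euclidean_space \<Rightarrow> complex) \<Rightarrow> 'a \<Rightarrow> complex) \<Rightarrow> (real \<Rightarrow> real) \<Rightarrow>
     'a l2_operator" where
  "spectral_integral E \<phi> = {(g, u). g \<in> spectral_domain E \<phi> \<and> u \<in> l2 \<and>
     (\<forall>f\<in>spectral_domain E \<phi>. l2_inner f u = spectral_form E \<phi> f g)}"

text \<open>By the spectral theorem the resolution exists for every self-adjoint operator, and it is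
  unique up to almost everywhere equality.\<close>

definition spectral_resolution ::
  "'a::euclidean_space l2_operator \<Rightarrow>
     (real set \<Rightarrow> ('a \<Rightarrow> complex) \<Rightarrow> 'a \<Rightarrow> complex) \<Rightarrow> bool" where
  "spectral_resolution H E \<longleftrightarrow> projection_valued_measure E \<and> spectral_integral E (\<lambda>r. r) = H"

definition op_fun :: "(real \<Rightarrow> real) \<Rightarrow> 'a::euclidean_space l2_operator \<Rightarrow> 'a l2_operator" where
  "op_fun \<phi> H = spectral_integral (SOME E. spectral_resolution H E) \<phi>"

section \<open>The Cauchy process\<close>

text \<open>The processes below have time set \<open>{0..}\<close> and start at the origin; values at negative
  times are irrelevant.\<close>

definition cadlag :: "(real \<Rightarrow> 'a::euclidean_space) \<Rightarrow> bool" where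
  "cadlag p \<longleftrightarrow> (\<forall>t\<ge>0. (p \<longlongrightarrow> p t) (at_right t)) \<and> (\<forall>t>0. \<exists>l. (p \<longlongrightarrow> l) (at_left t))"

locale levy_process = prob_space M
  for M :: "'w measure" and X :: "real \<Rightarrow> 'w \<Rightarrow> 'a::euclidean_space" +
  assumes random_variable: "t \<ge> 0 \<Longrightarrow> X t \<in> borel_measurable M"
    and start: "AE \<omega> in M. X 0 \<omega> = 0"
    and independent_increments:
      "0 \<le> \<tau> 0 \<Longrightarrow> (\<And>i. i < n \<Longrightarrow> \<tau> i < \<tau> (Suc i)) \<Longrightarrow>
         indep_vars (\<lambda>_. borel) (\<lambda>i \<omega>. X (\<tau> (Suc i)) \<omega> - X (\<tau> i) \<omega>) {..<n}"
    and stationary_increments: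
      "0 \<le> s \<Longrightarrow> 0 \<le> t \<Longrightarrow>
         distr M borel (\<lambda>\<omega>. X (s + t) \<omega> - X s \<omega>) = distr M borel (\<lambda>\<omega>. X t \<omega> - X 0 \<omega>)"
    and cadlag_paths: "\<omega> \<in> space M \<Longrightarrow> cadlag (\<lambda>t. X t \<omega>)"

locale cauchy_process = levy_process M X
  for M :: "'w measure" and X :: "real \<Rightarrow> 'w \<Rightarrow> 'a::euclidean_space" +
  assumes characteristic_function:
    "0 \<le> t \<Longrightarrow> expectation (\<lambda>\<omega>. cis (\<xi> \<bullet> X t \<omega>)) = complex_of_real (exp (- t * norm \<xi>))"

definition started_at ::
  "(real \<Rightarrow> 'w \<Rightarrow> 'a::euclidean_space) \<Rightarrow> 'a \<Rightarrow> real \<Rightarrow> 'w \<Rightarrow> 'a" where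
  "started_at X x t \<omega> = x + X t \<omega>"

end

theory Submission
  imports Defs
begin

text \<open>Let \<open>P t\<close> be the operator defined by the right-hand side and \<open>G \<lambda>\<close> its Laplace transform.
  With \<open>W = C - V \<ge> 0\<close>, expanding \<open>exp (\<integral>W)\<close> into a Dyson series and applying the Markov property at
  the ordered times gives \<open>G \<lambda> = R (\<lambda> + C) (1 + W G \<lambda>)\<close>, where \<open>R\<close> is the resolvent of the
  process without potential. The characteristic function and Plancherel's theorem identify \<open>R \<lambda>\<close>
  with the inverse of \<open>\<surd>(-\<Delta>) + \<lambda>\<close>, so \<open>G \<lambda>\<close> is the inverse of \<open>H + \<lambda>\<close> for \<open>\<lambda> > C\<close>, with \<open>H = \<surd>(-\<Delta>) + V\<close>.

  The operator \<open>G (C + 1)\<close> is a positive contraction. Its spectral measure, obtained from the moments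
  of its powers by Bernstein polynomials, is mapped by \<open>s \<mapsto> 1 / s - (C + 1)\<close> to a resolution of \<open>H\<close>.
  Conversely every resolution \<open>E\<close> of \<open>H\<close> satisfies \<open>(f, G \<lambda> g) = \<integral> 1 / (r + \<lambda>) d(f, E g)\<close> for all \<open>\<lambda> > C\<close>.
  Hence \<open>t \<mapsto> (f, P t g)\<close> and \<open>t \<mapsto> \<integral> exp (- t r) d(f, E g)\<close> have the same Laplace transform. For
  continuous \<open>f\<close> and \<open>g\<close> of bounded support both are right-continuous, so they coincide, and density
  extends this to all \<open>f\<close> and \<open>g\<close>.\<close>

section \<open>The real Hilbert space of square integrable functions\<close>

text \<open>\<open>op_fun\<close> picks an unspecified resolution of \<open>H\<close>, so existence
  must be proved and the formula must hold for every resolution. The two sides are compared through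
  resolvents because an inverse is pinned down by an algebraic fixed-point equation. With
  \<open>W = C - V\<close> every term of the Dyson series is nonnegative: expansion, exchange of
  integrals and the fixed-point equation hold in \<open>ennreal\<close> by Tonelli and monotone
  convergence, and finiteness enters only when the equation is carried over to L2. The price is a
  shift of the parameter, \<open>e^{-lam t} e^{-\<integral>V} = e^{-(lam + C) t}
  e^{\<integral>W}\<close>, so the free resolvent is taken at \<open>lam + C\<close>. At
  \<open>lam = C + 1\<close> the lower bound \<open>-C\<close> of \<open>H\<close> turns the
  resolvent into a contraction with spectrum in the unit interval; it is injective, so the point 0
  carries no spectral mass and \<open>1 / s\<close> makes sense almost everywhere. Spectral
  integrals stay real throughout: a bilinear form, polarized from positive measures, takes the place
  of complex measures, and the imaginary part comes from commuting with \<open>\<i>\<close>.\<close>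

lemma l2_measurable: "f \<in> l2 \<Longrightarrow> f \<in> borel_measurable borel"
  by (auto simp: l2_def)

lemma l2_integrable: "f \<in> l2 \<Longrightarrow> integrable lborel (\<lambda>x. (cmod (f x))\<^sup>2)"
  by (auto simp: l2_def)

lemma l2I: "f \<in> borel_measurable borel \<Longrightarrow> integrable lborel (\<lambda>x. (cmod (f x))\<^sup>2) \<Longrightarrow> f \<in> l2"
  by (auto simp: l2_def)

lemma l2_bound:
  assumes g: "g \<in> l2" and f: "f \<in> borel_measurable borel"
    and le: "AE x in lborel. cmod (f x) \<le> K * cmod (g x)"
  shows "f \<in> l2"
proof (rule l2I[OF f])
  have gm: "g \<in> borel_measurable borel" using g by (rule l2_measurable)
  show "integrable lborel (\<lambda>x. (cmod (f x))\<^sup>2)"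
  proof (rule Bochner_Integration.integrable_bound)
    show "integrable lborel (\<lambda>x. K\<^sup>2 * (cmod (g x))\<^sup>2)" using l2_integrable[OF g] by simp
    show "AE x in lborel. norm ((cmod (f x))\<^sup>2) \<le> norm (K\<^sup>2 * (cmod (g x))\<^sup>2)"
      using le
    proof eventually_elim
      case (elim x)
      then have "(cmod (f x))\<^sup>2 \<le> (K * cmod (g x))\<^sup>2" by (intro power_mono) auto
      then show ?case by (simp add: power_mult_distrib)
    qed
  qed (use f in measurable)
qed

lemma l2_scale: "f \<in> l2 \<Longrightarrow> (\<lambda>x. c * f x) \<in> l2"
  by (rule l2_bound[where K="cmod c" and g=f]) (auto dest: l2_measurable simp: norm_mult)

lemma l2_bdd_mult:
  "f \<in> l2 \<Longrightarrow> w \<in> borel_measurable borel \<Longrightarrow> (\<And>x. cmod (w x) \<le> K) \<Longrightarrow> (\<lambda>x. w x * f x) \<in> l2"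
  by (rule l2_bound[where K=K and g=f]) (auto dest: l2_measurable simp: norm_mult mult_right_mono)

lemma norm_add_square_le: "(norm (a + b))\<^sup>2 \<le> 2 * (norm a)\<^sup>2 + 2 * (norm (b::'b::real_normed_vector))\<^sup>2"
proof -
  have "(norm (a + b))\<^sup>2 \<le> (norm a + norm b)\<^sup>2" by (intro power_mono norm_triangle_ineq) auto
  also have "\<dots> \<le> 2 * (norm a)\<^sup>2 + 2 * (norm b)\<^sup>2"
    using zero_le_power2[of "norm a - norm b"] by (simp add: power2_eq_square algebra_simps)
  finally show ?thesis .
qed

lemma l2_add:
  assumes "f \<in> l2" "g \<in> l2" shows "(\<lambda>x. f x + g x) \<in> l2"
proof (rule l2I)
  have [measurable]: "f \<in> borel_measurable borel" "g \<in> borel_measurable borel"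
    using assms by (auto dest: l2_measurable)
  show "(\<lambda>x. f x + g x) \<in> borel_measurable borel" by measurable
  show "integrable lborel (\<lambda>x. (cmod (f x + g x))\<^sup>2)"
    by (rule Bochner_Integration.integrable_bound[where f="\<lambda>x. 2 * (cmod (f x))\<^sup>2 + 2 * (cmod (g x))\<^sup>2"])
       (use assms norm_add_square_le in \<open>auto dest!: l2_integrable\<close>)
qed

lemma l2_zero: "(\<lambda>x. 0) \<in> l2"
  by (auto simp: l2_def)

lemma l2_uminus: "f \<in> l2 \<Longrightarrow> (\<lambda>x. - f x) \<in> l2"
  using l2_scale[of f "-1"] by simp

lemma l2_diff: "f \<in> l2 \<Longrightarrow> g \<in> l2 \<Longrightarrow> (\<lambda>x. f x - g x) \<in> l2"
  using l2_add[OF _ l2_uminus, of f g] by simp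

lemma l2_scaleR: "f \<in> l2 \<Longrightarrow> (\<lambda>x. r *\<^sub>R f x) \<in> l2"
  using l2_scale[of f "of_real r"] by (simp add: scaleR_conv_of_real)

lemma l2_sum: "(\<And>i. i \<in> I \<Longrightarrow> f i \<in> l2) \<Longrightarrow> (\<lambda>x. \<Sum>i\<in>I. f i x) \<in> l2"
  by (induction I rule: infinite_finite_induct) (auto intro: l2_zero l2_add)

lemma l2_integrable_mult:
  assumes "f \<in> l2" "g \<in> l2"
  shows "integrable lborel (\<lambda>x. f x * g x)"
proof (rule Bochner_Integration.integrable_bound[where f="\<lambda>x. (cmod (f x))\<^sup>2 + (cmod (g x))\<^sup>2"])
  show "integrable lborel (\<lambda>x. (cmod (f x))\<^sup>2 + (cmod (g x))\<^sup>2)"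
    using assms by (auto dest: l2_integrable)
  have "a * b \<le> a\<^sup>2 + b\<^sup>2" if "0 \<le> a" "0 \<le> b" for a b :: real
    using sum_squares_bound[of a b] mult_nonneg_nonneg[OF that] by linarith
  then show "AE x in lborel. norm (f x * g x) \<le> norm ((cmod (f x))\<^sup>2 + (cmod (g x))\<^sup>2)"
    by (auto simp: norm_mult)
qed (use assms in \<open>auto dest!: l2_measurable\<close>)

lemma borel_measurable_cnj [measurable (raw)]:
  "f \<in> borel_measurable M \<Longrightarrow> (\<lambda>x. cnj (f x)) \<in> borel_measurable M"
  by (rule measurable_compose[OF _ borel_measurable_continuous_onI]) (auto intro!: continuous_intros)

lemma l2_cnj: "f \<in> l2 \<Longrightarrow> (\<lambda>x. cnj (f x)) \<in> l2"
  by (rule l2_bound[where K=1 and g=f]) (auto dest: l2_measurable)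

lemma l2_integrable_inner: "f \<in> l2 \<Longrightarrow> g \<in> l2 \<Longrightarrow> integrable lborel (\<lambda>x. cnj (f x) * g x)"
  by (intro l2_integrable_mult l2_cnj)

section \<open>The quotient modulo null sets as a real inner product space\<close>

definition l2_eq :: "('a::euclidean_space \<Rightarrow> complex) \<Rightarrow> ('a \<Rightarrow> complex) \<Rightarrow> bool" where
  "l2_eq f g \<longleftrightarrow> f \<in> l2 \<and> g \<in> l2 \<and> (AE x in lborel. f x = g x)"

quotient_type (overloaded) 'a L2 = "'a::euclidean_space \<Rightarrow> complex" / partial: l2_eq
proof (rule part_equivpI)
  show "\<exists>x. l2_eq x x" using l2_zero by (auto simp: l2_eq_def)
  show "symp l2_eq" by (auto simp: symp_def l2_eq_def)
  show "transp l2_eq" by (auto simp: transp_def l2_eq_def)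
qed

lemma l2_eq_cong_inner:
  assumes "l2_eq f f'" "l2_eq g g'" shows "l2_inner f g = l2_inner f' g'"
  unfolding l2_inner_def
proof (rule integral_cong_AE)
  have 1: "f \<in> l2" "f' \<in> l2" "g \<in> l2" "g' \<in> l2" using assms by (auto simp: l2_eq_def)
  show "(\<lambda>x. cnj (f x) * g x) \<in> borel_measurable lborel"
       "(\<lambda>x. cnj (f' x) * g' x) \<in> borel_measurable lborel"
    by (intro borel_measurable_integrable l2_integrable_inner 1)+
  have "AE x in lborel. f x = f' x" "AE x in lborel. g x = g' x" using assms by (auto simp: l2_eq_def)
  then show "AE x in lborel. cnj (f x) * g x = cnj (f' x) * g' x" by eventually_elim simp
qed

lemma l2_inner_self: "l2_inner f f = complex_of_real (LINT x|lborel. (cmod (f x))\<^sup>2)"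
  unfolding l2_inner_def integral_complex_of_real[symmetric]
  by (intro Bochner_Integration.integral_cong refl) (metis complex_norm_square mult.commute)

lemma l2_inner_commute: "l2_inner g f = cnj (l2_inner f g)"
  unfolding l2_inner_def by (subst Bochner_Integration.integral_cnj[symmetric]) (metis complex_cnj_cnj complex_cnj_mult mult.commute)

lemma l2_inner_add_right:
  "f \<in> l2 \<Longrightarrow> g \<in> l2 \<Longrightarrow> h \<in> l2 \<Longrightarrow> l2_inner f (\<lambda>x. g x + h x) = l2_inner f g + l2_inner f h"
  unfolding l2_inner_def ring_distribs by (intro Bochner_Integration.integral_add l2_integrable_inner)

lemma l2_inner_scale_right: "l2_inner f (\<lambda>x. c * g x) = c * l2_inner f g"
proof -
  have "cnj (f x) * (c * g x) = c * (cnj (f x) * g x)" for x by (rule mult.left_commute)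
  then show ?thesis unfolding l2_inner_def by (simp only: integral_mult_right_zero)
qed

instantiation L2 :: (euclidean_space) real_vector
begin
lift_definition zero_L2 :: "'a L2" is "\<lambda>x. 0" by (simp add: l2_eq_def l2_zero)
lift_definition plus_L2 :: "'a L2 \<Rightarrow> 'a L2 \<Rightarrow> 'a L2" is "\<lambda>f g x. f x + g x"
  by (auto simp: l2_eq_def l2_add)
lift_definition minus_L2 :: "'a L2 \<Rightarrow> 'a L2 \<Rightarrow> 'a L2" is "\<lambda>f g x. f x - g x"
  by (auto simp: l2_eq_def l2_diff)
lift_definition uminus_L2 :: "'a L2 \<Rightarrow> 'a L2" is "\<lambda>f x. - f x"
  by (auto simp: l2_eq_def l2_uminus)
lift_definition scaleR_L2 :: "real \<Rightarrow> 'a L2 \<Rightarrow> 'a L2" is "\<lambda>r f x. r *\<^sub>R f x"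
  by (auto simp: l2_eq_def l2_scaleR)
instance
  by standard (transfer; simp add: l2_eq_def scaleR_add_left scaleR_add_right l2_add l2_scaleR l2_uminus l2_diff l2_zero ac_simps)+
end

instantiation L2 :: (euclidean_space) real_inner
begin
lift_definition inner_L2 :: "'a L2 \<Rightarrow> 'a L2 \<Rightarrow> real" is "\<lambda>f g. Re (l2_inner f g)"
  using l2_eq_cong_inner by metis
definition norm_L2 :: "'a L2 \<Rightarrow> real" where "norm_L2 F = sqrt (inner F F)"
definition dist_L2 :: "'a L2 \<Rightarrow> 'a L2 \<Rightarrow> real" where "dist_L2 F G = norm (F - G)"
definition sgn_L2 :: "'a L2 \<Rightarrow> 'a L2" where "sgn_L2 F = F /\<^sub>R norm F"
definition uniformity_L2 :: "('a L2 \<times> 'a L2) filter"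
  where "uniformity_L2 = (INF e\<in>{0 <..}. principal {(x, y). dist x y < e})"
definition open_L2 :: "'a L2 set \<Rightarrow> bool"
  where "open_L2 U \<longleftrightarrow> (\<forall>x\<in>U. eventually (\<lambda>(x', y). x' = x \<longrightarrow> y \<in> U) uniformity)"
instance
proof
  fix F G K :: "'a L2" and r :: real
  show "dist F G = norm (F - G)" by (simp add: dist_L2_def)
  show "sgn F = F /\<^sub>R norm F" by (simp add: sgn_L2_def)
  show "(uniformity::('a L2 \<times> 'a L2) filter) = (INF e\<in>{0 <..}. principal {(x, y). dist x y < e})"
    by (simp add: uniformity_L2_def)
  show "open U \<longleftrightarrow> (\<forall>x\<in>U. eventually (\<lambda>(x', y). x' = x \<longrightarrow> y \<in> U) uniformity)" for U :: "'a L2 set"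
    by (simp add: open_L2_def)
  show "inner F G = inner G F" by transfer (subst l2_inner_commute, simp)
  show "inner (F + G) K = inner F K + inner G K"
  proof transfer
    fix f g k :: "'a \<Rightarrow> complex" assume "l2_eq f f" "l2_eq g g" "l2_eq k k"
    then have "l2_inner k (\<lambda>x. f x + g x) = l2_inner k f + l2_inner k g"
      by (intro l2_inner_add_right) (auto simp: l2_eq_def)
    then show "Re (l2_inner (\<lambda>x. f x + g x) k) = Re (l2_inner f k) + Re (l2_inner g k)"
      unfolding l2_inner_commute[of _ k] by simp
  qed
  show "inner (r *\<^sub>R F) G = r * inner F G"
  proof (transfer fixing: r)
    fix f g :: "'a \<Rightarrow> complex"
    assume "l2_eq f f" "l2_eq g g"
    have "l2_inner g (\<lambda>x. r *\<^sub>R f x) = of_real r * l2_inner g f"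
      unfolding scaleR_conv_of_real by (rule l2_inner_scale_right)
    then show "Re (l2_inner (\<lambda>x. r *\<^sub>R f x) g) = r * Re (l2_inner f g)"
      unfolding l2_inner_commute[of _ g] by simp
  qed
  show "0 \<le> inner F F"
    by transfer (simp add: l2_inner_self)
  show "inner F F = 0 \<longleftrightarrow> F = 0"
  proof transfer
    fix f :: "'a \<Rightarrow> complex" assume "l2_eq f f"
    then have f: "f \<in> l2" by (simp add: l2_eq_def)
    show "(Re (l2_inner f f) = 0) = l2_eq f (\<lambda>x. 0)"
      using integral_nonneg_eq_0_iff_AE[OF l2_integrable[OF f]] f
      by (auto simp: l2_inner_self l2_eq_def l2_zero)
  qed
  show "norm F = sqrt (inner F F)" by (simp add: norm_L2_def)
qed
end

lemma rep_L2_l2 [simp]: "rep_L2 F \<in> l2"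
  using Quotient_rep_reflp[OF Quotient_L2, of F] by (simp add: l2_eq_def)

lemma rep_L2_measurable [measurable]: "rep_L2 F \<in> borel_measurable borel"
  by (intro l2_measurable rep_L2_l2)

lemma abs_rep_L2 [simp]: "abs_L2 (rep_L2 F) = F"
  by (rule Quotient_abs_rep[OF Quotient_L2])

lemma abs_L2_eq_iff: "f \<in> l2 \<Longrightarrow> g \<in> l2 \<Longrightarrow> abs_L2 f = abs_L2 g \<longleftrightarrow> (AE x in lborel. f x = g x)"
  using Quotient_rel[OF Quotient_L2, of f g] by (auto simp: l2_eq_def)

lemma rep_abs_L2: "f \<in> l2 \<Longrightarrow> AE x in lborel. rep_L2 (abs_L2 f) x = f x"
  by (subst abs_L2_eq_iff[symmetric]) auto

lemma abs_L2_add: "f \<in> l2 \<Longrightarrow> g \<in> l2 \<Longrightarrow> abs_L2 (\<lambda>x. f x + g x) = abs_L2 f + abs_L2 g"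
  by (subst plus_L2.abs_eq) (auto simp: l2_eq_def)

lemma abs_L2_diff: "f \<in> l2 \<Longrightarrow> g \<in> l2 \<Longrightarrow> abs_L2 (\<lambda>x. f x - g x) = abs_L2 f - abs_L2 g"
  by (subst minus_L2.abs_eq) (auto simp: l2_eq_def)

lemma abs_L2_scaleR: "f \<in> l2 \<Longrightarrow> abs_L2 (\<lambda>x. r *\<^sub>R f x) = r *\<^sub>R abs_L2 f"
  by (subst scaleR_L2.abs_eq) (auto simp: l2_eq_def)

lemma abs_L2_zero: "abs_L2 (\<lambda>x. 0) = 0"
  by (simp add: zero_L2.abs_eq)

lemma inner_abs_L2: "f \<in> l2 \<Longrightarrow> g \<in> l2 \<Longrightarrow> inner (abs_L2 f) (abs_L2 g) = Re (l2_inner f g)"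
  by (subst inner_L2.abs_eq) (auto simp: l2_eq_def)

lemma norm_abs_L2: "f \<in> l2 \<Longrightarrow> (norm (abs_L2 f))\<^sup>2 = (LINT x|lborel. (cmod (f x))\<^sup>2)"
  by (simp add: power2_norm_eq_inner inner_abs_L2 l2_inner_self)

lemma nn_integral_l2:
  "f \<in> l2 \<Longrightarrow> (\<integral>\<^sup>+x. ennreal ((cmod (f x))\<^sup>2) \<partial>lborel) = ennreal ((norm (abs_L2 f))\<^sup>2)"
  by (simp add: norm_abs_L2 nn_integral_eq_integral l2_integrable)

lemma l2_iff_nn_integral:
  "f \<in> l2 \<longleftrightarrow> f \<in> borel_measurable borel \<and> (\<integral>\<^sup>+x. ennreal ((cmod (f x))\<^sup>2) \<partial>lborel) < \<infinity>"
  by (auto simp: l2_def integrable_iff_bounded)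

text \<open>Lets the limits in \<open>projection_valued_measure\<close> and
  \<open>fourier_L2\<close> be treated as limits in a complete normed space.\<close>

lemma l2_tendsto_iff:
  assumes "\<And>n. u n \<in> l2" "f \<in> l2"
  shows "l2_tendsto u f \<longleftrightarrow> (\<lambda>n. abs_L2 (u n)) \<longlonglongrightarrow> abs_L2 f"
proof -
  have "l2_tendsto u f \<longleftrightarrow> (\<lambda>n. ennreal ((norm (abs_L2 (u n) - abs_L2 f))\<^sup>2)) \<longlonglongrightarrow> ennreal 0"
    unfolding l2_tendsto_def using assms by (simp add: nn_integral_l2 l2_diff abs_L2_diff)
  also have "\<dots> \<longleftrightarrow> (\<lambda>n. (norm (abs_L2 (u n) - abs_L2 f))\<^sup>2) \<longlonglongrightarrow> 0"
    by (subst tendsto_ennreal_iff) auto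
  also have "\<dots> \<longleftrightarrow> (\<lambda>n. norm (abs_L2 (u n) - abs_L2 f)) \<longlonglongrightarrow> 0"
  proof
    assume "(\<lambda>n. (norm (abs_L2 (u n) - abs_L2 f))\<^sup>2) \<longlonglongrightarrow> 0"
    from tendsto_real_sqrt[OF this] show "(\<lambda>n. norm (abs_L2 (u n) - abs_L2 f)) \<longlonglongrightarrow> 0" by simp
  next
    assume "(\<lambda>n. norm (abs_L2 (u n) - abs_L2 f)) \<longlonglongrightarrow> 0"
    from tendsto_power[OF this, of 2] show "(\<lambda>n. (norm (abs_L2 (u n) - abs_L2 f))\<^sup>2) \<longlonglongrightarrow> 0" by simp
  qed
  also have "\<dots> \<longleftrightarrow> (\<lambda>n. abs_L2 (u n)) \<longlonglongrightarrow> abs_L2 f"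
    by (simp add: tendsto_norm_zero_iff LIM_zero_iff)
  finally show ?thesis .
qed

text \<open>Only the real inner product \<open>Re (f, g)\<close> is used on the quotient; the imaginary part is recovered
  from multiplication by \<open>\<i>\<close>.\<close>

lift_definition iL2 :: "'a::euclidean_space L2 \<Rightarrow> 'a L2" is "\<lambda>f x. \<i> * f x"
  by (auto simp: l2_eq_def l2_scale)

lemma abs_L2_i: "f \<in> l2 \<Longrightarrow> abs_L2 (\<lambda>x. \<i> * f x) = iL2 (abs_L2 f)"
  by (subst iL2.abs_eq) (auto simp: l2_eq_def)

lemma iL2_add: "iL2 (F + G) = iL2 F + iL2 G"
  by transfer (auto simp: l2_eq_def ring_distribs intro!: l2_add l2_scale)

lemma iL2_scaleR: "iL2 (r *\<^sub>R F) = r *\<^sub>R iL2 F"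
  by transfer (auto simp: l2_eq_def intro!: l2_scaleR l2_scale)

lemma iL2_iL2: "iL2 (iL2 F) = - F"
  by transfer (auto simp: l2_eq_def intro!: l2_uminus)

lemma inner_iL2: "inner (iL2 F) (iL2 G) = inner F G"
proof -
  have "cnj (\<i> * a) * (\<i> * b) = cnj a * b" for a b by (simp add: complex_eq_iff algebra_simps)
  then show ?thesis by transfer (simp add: l2_inner_def)
qed

lemma norm_iL2 [simp]: "norm (iL2 F) = norm F"
  by (simp add: norm_eq_sqrt_inner inner_iL2)

lemma bounded_linear_iL2: "bounded_linear iL2"
  by (rule bounded_linear_intro[where K=1]) (simp_all add: iL2_add iL2_scaleR)

lemma inner_iL2_left: "inner (iL2 F) G = - inner F (iL2 G)"
  using inner_iL2[of F "iL2 G"] by (simp add: iL2_iL2)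

text \<open>Since \<open>Re (\<i> z) = - Im z\<close>, each identity between complex inner products
  splits into two real ones, the second with \<open>iL2\<close> in one slot.\<close>

lemma l2_inner_eq:
  assumes "f \<in> l2" "g \<in> l2"
  shows "l2_inner f g = Complex (inner (abs_L2 f) (abs_L2 g)) (- inner (abs_L2 f) (iL2 (abs_L2 g)))"
  using assms by (simp add: abs_L2_i[symmetric] inner_abs_L2 l2_scale l2_inner_scale_right complex_eq_iff)

text \<open>Riesz-Fischer by reduction to L1. A positive integrable weight \<open>h \<le> 1\<close>
  is square integrable, so by Cauchy-Schwarz the products \<open>H * s n\<close> are Cauchy in L1
  and a subsequence is Cauchy almost everywhere. Dividing by the positive weight gives the pointwise
  limit.\<close>

lemma L2_Cauchy_convergent:
  fixes S :: "nat \<Rightarrow> 'a::euclidean_space L2"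
  assumes C: "Cauchy S" shows "convergent S"
proof -
  define s where "s n = rep_L2 (S n)" for n
  have s: "s n \<in> l2" and S: "abs_L2 (s n) = S n" for n by (simp_all add: s_def)
  have [measurable]: "s n \<in> borel_measurable borel" for n by (simp add: s_def)
  obtain h :: "'a \<Rightarrow> real" where h[measurable]: "h \<in> borel_measurable lborel"
    and hpos: "\<And>x. h x > 0" and h1: "\<And>x. h x \<le> 1" and hint: "integrable lborel h"
    using sigma_finite_measure.obtain_positive_integrable_function[OF sigma_finite_lborel] by blast
  define H where "H x = complex_of_real (h x)" for x
  have H: "H \<in> l2"
  proof (rule l2I)
    show "H \<in> borel_measurable borel" unfolding H_def using h by measurable
    show "integrable lborel (\<lambda>x. (cmod (H x))\<^sup>2)"
    proof (rule Bochner_Integration.integrable_bound[OF hint])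
      have "h x * h x \<le> h x" for x using mult_left_le[of "h x" "h x"] h1[of x] hpos[of x] by simp
      then show "AE x in lborel. norm ((cmod (H x))\<^sup>2) \<le> norm (h x)"
        using hpos by (simp add: H_def power2_eq_square less_imp_le)
    qed (simp add: H_def)
  qed
  have L1: "integrable lborel (\<lambda>x. H x * s n x)" for n by (rule l2_integrable_mult[OF H s])
  have CS: "(LINT x|lborel. norm (H x * s i x - H x * s j x)) \<le> norm (abs_L2 H) * norm (S i - S j)" for i j
  proof -
    define d where "d x = complex_of_real (cmod (s i x - s j x))" for x
    have dif: "(\<lambda>x. s i x - s j x) \<in> l2" by (intro l2_diff s)
    have d: "d \<in> l2"
      by (rule l2_bound[where K=1, OF dif]) (auto simp: d_def[abs_def])
    have nd: "norm (abs_L2 d) = norm (S i - S j)"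
    proof -
      have "(norm (abs_L2 d))\<^sup>2 = (norm (S i - S j))\<^sup>2"
        unfolding S[symmetric] abs_L2_diff[OF s s, symmetric] norm_abs_L2[OF d] norm_abs_L2[OF dif] by (simp add: d_def)
      then show ?thesis by simp
    qed
    have "(LINT x|lborel. norm (H x * s i x - H x * s j x)) = Re (l2_inner H d)"
    proof -
      have "(LINT x|lborel. norm (H x * s i x - H x * s j x)) = (LINT x|lborel. Re (cnj (H x) * d x))"
      proof (rule Bochner_Integration.integral_cong[OF refl])
        fix x
        have "norm (H x * s i x - H x * s j x) = h x * cmod (s i x - s j x)"
          unfolding right_diff_distrib[symmetric] norm_mult using hpos[of x] by (simp add: H_def)
        then show "norm (H x * s i x - H x * s j x) = Re (cnj (H x) * d x)"
          by (simp add: H_def d_def)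
      qed
      also have "\<dots> = Re (l2_inner H d)"
        unfolding l2_inner_def by (rule integral_Re) (rule l2_integrable_inner[OF H d])
      finally show ?thesis .
    qed
    also have "\<dots> = inner (abs_L2 H) (abs_L2 d)" by (simp add: inner_abs_L2 H d)
    also have "\<dots> \<le> norm (abs_L2 H) * norm (abs_L2 d)" by (rule norm_cauchy_schwarz)
    finally show ?thesis by (simp add: nd)
  qed
  have "\<exists>N. \<forall>i\<ge>N. \<forall>j\<ge>N. (LINT x|lborel. norm (H x * s i x - H x * s j x)) < e" if "e > 0" for e
  proof -
    have "e / (norm (abs_L2 H) + 1) > 0" using that by (simp add: add_nonneg_pos)
    then obtain N where N: "\<forall>i\<ge>N. \<forall>j\<ge>N. norm (S i - S j) < e / (norm (abs_L2 H) + 1)"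
      using C unfolding Cauchy_def dist_norm by meson
    show ?thesis
    proof (intro exI allI impI)
      fix i j assume "i \<ge> N" "j \<ge> N"
      then have "norm (S i - S j) < e / (norm (abs_L2 H) + 1)" using N by blast
      then have "(norm (abs_L2 H) + 1) * norm (S i - S j) < e"
        by (subst (asm) pos_less_divide_eq) (auto simp: add_nonneg_pos mult.commute)
      moreover have "norm (abs_L2 H) * norm (S i - S j) \<le> (norm (abs_L2 H) + 1) * norm (S i - S j)"
        by (intro mult_right_mono) auto
      ultimately show "(LINT x|lborel. norm (H x * s i x - H x * s j x)) < e"
        using CS[of i j] by linarith
    qed
  qed
  with L1 obtain r where r: "strict_mono r" and AEC: "AE x in lborel. Cauchy (\<lambda>i. H x * s (r i) x)"
    by (rule cauchy_L1_AE_cauchy_subseq[where s="\<lambda>n x. H x * s n x" and M=lborel]) blast+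
  define f where "f x = lim (\<lambda>i. s (r i) x)" for x
  have fm[measurable]: "f \<in> borel_measurable borel" unfolding f_def[abs_def] by measurable
  have conv: "AE x in lborel. (\<lambda>i. s (r i) x) \<longlonglongrightarrow> f x"
    using AEC
  proof eventually_elim
    case (elim x)
    then have "convergent (\<lambda>i. H x * s (r i) x)" by (simp add: Cauchy_convergent_iff)
    then obtain L where "(\<lambda>i. H x * s (r i) x) \<longlonglongrightarrow> L" by (auto simp: convergent_def)
    then have "(\<lambda>i. inverse (H x) * (H x * s (r i) x)) \<longlonglongrightarrow> inverse (H x) * L" by (intro tendsto_intros)
    moreover have "(\<lambda>i. inverse (H x) * (H x * s (r i) x)) = (\<lambda>i. s (r i) x)"
      using hpos[of x] by (simp add: H_def fun_eq_iff)
    ultimately have "convergent (\<lambda>i. s (r i) x)" unfolding convergent_def by metis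
    then show ?case unfolding f_def by (simp add: convergent_LIMSEQ_iff)
  qed
  \<comment> \<open>Fatou's lemma: the distance from \<open>s n\<close> to the pointwise limit is at
    most the limit inferior of its distances to the subsequence, which the Cauchy property
    bounds.\<close>
  have main: "\<exists>N. \<forall>n\<ge>N. (\<integral>\<^sup>+x. ennreal ((cmod (f x - s n x))\<^sup>2) \<partial>lborel) \<le> ennreal (e\<^sup>2)" if "e > 0" for e
  proof -
    obtain N where N: "\<And>i j. i \<ge> N \<Longrightarrow> j \<ge> N \<Longrightarrow> norm (S i - S j) < e"
      using C \<open>e > 0\<close> unfolding Cauchy_def dist_norm by meson
    show ?thesis
    proof (intro exI allI impI)
      fix n assume n: "n \<ge> N"
      have "(\<integral>\<^sup>+x. ennreal ((cmod (f x - s n x))\<^sup>2) \<partial>lborel)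
          = (\<integral>\<^sup>+x. liminf (\<lambda>i. ennreal ((cmod (s (r i) x - s n x))\<^sup>2)) \<partial>lborel)"
      proof (rule nn_integral_cong_AE, use conv in eventually_elim)
        case (elim x)
        then have "(\<lambda>i. ennreal ((cmod (s (r i) x - s n x))\<^sup>2)) \<longlonglongrightarrow> ennreal ((cmod (f x - s n x))\<^sup>2)"
          by (intro tendsto_intros)
        then show ?case by (intro lim_imp_Liminf[symmetric]) simp_all
      qed
      also have "\<dots> \<le> liminf (\<lambda>i. \<integral>\<^sup>+x. ennreal ((cmod (s (r i) x - s n x))\<^sup>2) \<partial>lborel)"
        by (rule nn_integral_liminf) measurable
      also have "\<dots> \<le> ennreal (e\<^sup>2)"
      proof (rule Liminf_le)
        have "\<forall>i\<ge>N. (\<integral>\<^sup>+x. ennreal ((cmod (s (r i) x - s n x))\<^sup>2) \<partial>lborel) \<le> ennreal (e\<^sup>2)"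
        proof (intro allI impI)
          fix i assume "i \<ge> N"
          then have "r i \<ge> N" using seq_suble[OF r, of i] by linarith
          then have "(norm (S (r i) - S n))\<^sup>2 \<le> e\<^sup>2" using N[of "r i" n] n by (intro power_mono) auto
          then show "(\<integral>\<^sup>+x. ennreal ((cmod (s (r i) x - s n x))\<^sup>2) \<partial>lborel) \<le> ennreal (e\<^sup>2)"
            unfolding nn_integral_l2[OF l2_diff[OF s s]] abs_L2_diff[OF s s] S by (rule ennreal_leI)
        qed
        then show "\<forall>\<^sub>F i in sequentially. (\<integral>\<^sup>+x. ennreal ((cmod (s (r i) x - s n x))\<^sup>2) \<partial>lborel) \<le> ennreal (e\<^sup>2)"
          by (auto simp: eventually_sequentially)
      qed simp
      finally show "(\<integral>\<^sup>+x. ennreal ((cmod (f x - s n x))\<^sup>2) \<partial>lborel) \<le> ennreal (e\<^sup>2)" .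
    qed
  qed
  have fl2: "f \<in> l2"
  proof -
    obtain n where n: "(\<integral>\<^sup>+x. ennreal ((cmod (f x - s n x))\<^sup>2) \<partial>lborel) \<le> ennreal (1\<^sup>2)"
      using main[OF zero_less_one] by blast
    have "(\<lambda>x. f x - s n x) \<in> l2"
      unfolding l2_iff_nn_integral by (intro conjI le_less_trans[OF n]) simp_all
    from l2_add[OF this s[of n]] show ?thesis by simp
  qed
  have "S \<longlonglongrightarrow> abs_L2 f"
  proof (rule LIMSEQ_I)
    fix e :: real assume e: "e > 0"
    then obtain N where N: "\<And>n. n \<ge> N \<Longrightarrow> (\<integral>\<^sup>+x. ennreal ((cmod (f x - s n x))\<^sup>2) \<partial>lborel) \<le> ennreal ((e/2)\<^sup>2)"
      using main[OF half_gt_zero[OF e]] by blast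
    show "\<exists>N. \<forall>n\<ge>N. norm (S n - abs_L2 f) < e"
    proof (intro exI allI impI)
      fix n assume "n \<ge> N"
      from N[OF this] have "ennreal ((norm (abs_L2 f - S n))\<^sup>2) \<le> ennreal ((e/2)\<^sup>2)"
        unfolding nn_integral_l2[OF l2_diff[OF fl2 s]] abs_L2_diff[OF fl2 s] S .
      then have "(norm (abs_L2 f - S n))\<^sup>2 \<le> (e/2)\<^sup>2" by (simp only: ennreal_le_iff zero_le_power2)
      then have "norm (abs_L2 f - S n) \<le> e/2" by (rule power2_le_imp_le) (use e in simp)
      then show "norm (S n - abs_L2 f) < e" using e by (simp add: norm_minus_commute)
    qed
  qed
  then show ?thesis by (auto simp: convergent_def)
qed

instance L2 :: (euclidean_space) complete_space
  by standard (rule L2_Cauchy_convergent)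

instance L2 :: (euclidean_space) banach ..

section \<open>Dominated convergence and density of continuous functions of compact support\<close>

lemma L2_dominated_convergence:
  fixes u :: "nat \<Rightarrow> 'a::euclidean_space \<Rightarrow> complex"
  assumes u[measurable]: "\<And>n. u n \<in> borel_measurable borel" and f[measurable]: "f \<in> borel_measurable borel"
    and g: "g \<in> l2"
    and lim: "AE x in lborel. (\<lambda>n. u n x) \<longlonglongrightarrow> f x"
    and bd: "\<And>n. AE x in lborel. cmod (u n x) \<le> cmod (g x)"
  shows "(\<lambda>n. abs_L2 (u n)) \<longlonglongrightarrow> abs_L2 f" "f \<in> l2" "u n \<in> l2"
proof -
  have ul: "u n \<in> l2" for n using bd[of n] by (intro l2_bound[OF g u, where K=1]) auto
  have bdf: "AE x in lborel. cmod (f x) \<le> cmod (g x)"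
    using lim AE_all_countable[THEN iffD2, OF allI, OF bd]
  proof eventually_elim
    fix x assume "(\<lambda>n. u n x) \<longlonglongrightarrow> f x" "\<forall>n. cmod (u n x) \<le> cmod (g x)"
    then show "cmod (f x) \<le> cmod (g x)" by (intro LIMSEQ_le_const2[OF tendsto_norm]) auto
  qed
  have fl: "f \<in> l2" using bdf by (intro l2_bound[OF g f, where K=1]) auto
  \<comment> \<open>The limit is the integral of the zero function; the summand
    \<open>0 * norm x\<close> pins the type of \<open>x\<close>.\<close>
  have "(\<lambda>n. LINT x|lborel. (cmod (u n x - f x))\<^sup>2) \<longlonglongrightarrow> (LINT x|lborel. (0::real) + 0 * norm (x::'a))"
  proof (rule integral_dominated_convergence[where w="\<lambda>x. 4 * (cmod (g x))\<^sup>2"])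
    show "integrable lborel (\<lambda>x. 4 * (cmod (g x))\<^sup>2)" using l2_integrable[OF g] by simp
    show "AE x in lborel. (\<lambda>n. (cmod (u n x - f x))\<^sup>2) \<longlonglongrightarrow> 0 + 0 * norm x"
      using lim
    proof eventually_elim
      case (elim x)
      then have "(\<lambda>n. (cmod (u n x - f x))\<^sup>2) \<longlonglongrightarrow> (cmod (f x - f x))\<^sup>2" by (intro tendsto_intros)
      then show ?case by simp
    qed
    show "AE x in lborel. norm ((cmod (u n x - f x))\<^sup>2) \<le> 4 * (cmod (g x))\<^sup>2" for n
      using bd[of n] bdf
    proof eventually_elim
      case (elim x)
      then have "cmod (u n x - f x) \<le> 2 * cmod (g x)" using norm_triangle_ineq4[of "u n x" "f x"] by linarith
      then have "(cmod (u n x - f x))\<^sup>2 \<le> (2 * cmod (g x))\<^sup>2" by (intro power_mono) auto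
      then show ?case by (simp add: power_mult_distrib)
    qed
  qed simp_all
  then have "(\<lambda>n. (norm (abs_L2 (u n) - abs_L2 f))\<^sup>2) \<longlonglongrightarrow> 0"
    by (simp add: abs_L2_diff[symmetric] ul fl norm_abs_L2 l2_diff)
  from tendsto_real_sqrt[OF this] show "(\<lambda>n. abs_L2 (u n)) \<longlonglongrightarrow> abs_L2 f"
    by (simp add: tendsto_norm_zero_iff LIM_zero_iff)
  show "f \<in> l2" "u n \<in> l2" by fact+
qed

lemma l2_bounded_support:
  assumes f[measurable]: "f \<in> borel_measurable borel" and K: "\<And>x. cmod (f x) \<le> K" and r: "\<And>x. norm x > r \<Longrightarrow> f x = 0"
  shows "f \<in> l2"
proof (rule l2I[OF f])
  show "integrable lborel (\<lambda>x. (cmod (f x))\<^sup>2)"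
  proof (rule Bochner_Integration.integrable_bound[where f="\<lambda>x::'a. K\<^sup>2 * indicator (cball 0 r) x"])
    show "integrable lborel (\<lambda>x::'a. K\<^sup>2 * indicator (cball 0 r) x)"
      using emeasure_lborel_cball_finite[of 0 r] by (intro integrable_mult_right integrable_real_indicator) (auto simp: less_top)
    show "AE x in lborel. norm ((cmod (f x))\<^sup>2) \<le> norm (K\<^sup>2 * indicator (cball 0 r) x)"
      using K r by (auto simp: indicator_def power_mono not_le)
  qed simp
qed

definition nice :: "('a::euclidean_space \<Rightarrow> complex) \<Rightarrow> bool" where
  "nice k \<longleftrightarrow> continuous_on UNIV k \<and> (\<exists>K. \<forall>x. cmod (k x) \<le> K) \<and> (\<exists>r. \<forall>x. norm x > r \<longrightarrow> k x = 0)"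

lemma nice_measurable: "nice k \<Longrightarrow> k \<in> borel_measurable borel"
  unfolding nice_def by (auto intro: borel_measurable_continuous_onI)

lemma nice_l2: "nice k \<Longrightarrow> k \<in> l2"
  using nice_measurable[of k] by (auto simp: nice_def intro: l2_bounded_support)

lemma nice_integrable:
  assumes "nice k" shows "integrable lborel k"
proof -
  obtain K r where K: "\<And>x. cmod (k x) \<le> K" and r: "\<And>x. norm x > r \<Longrightarrow> k x = 0"
    using assms unfolding nice_def by auto
  show ?thesis
  proof (rule Bochner_Integration.integrable_bound[where f="\<lambda>x::'a. K * indicator (cball 0 r) x"])
    show "integrable lborel (\<lambda>x::'a. K * indicator (cball 0 r) x)"
      using emeasure_lborel_cball_finite[of 0 r] by (intro integrable_mult_right integrable_real_indicator) (auto simp: less_top)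
    show "AE x in lborel. norm (k x) \<le> norm (K * indicator (cball 0 r) x)"
      using K r by (intro AE_I2) (auto simp: indicator_def not_le intro: order_trans[OF K])
  qed (use nice_measurable[OF assms] in simp)
qed

text \<open>The radial retraction of the plane onto the disc of radius \<open>K\<close>: it bounds
  the values and keeps continuity.\<close>

definition clip :: "real \<Rightarrow> complex \<Rightarrow> complex" where
  "clip K z = z /\<^sub>R max 1 (cmod z / K)"

lemma clip_bound: "K > 0 \<Longrightarrow> cmod (clip K z) \<le> K"
  unfolding clip_def by (auto simp: field_simps max_def)

lemma clip_id: "K > 0 \<Longrightarrow> cmod z \<le> K \<Longrightarrow> clip K z = z"
  unfolding clip_def by (auto simp: field_simps max_def)

lemma continuous_on_clip: "K > 0 \<Longrightarrow> continuous_on S (clip K)"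
  unfolding clip_def[abs_def] by (intro continuous_intros) (auto simp: max_def)

text \<open>A measurable function is an almost everywhere limit of continuous functions
  \<open>g n\<close>. Clipping their values at \<open>K'\<close> and cutting off in space gives a
  common square integrable bound, and neither operation changes the limit \<open>f\<close>, which is
  already bounded by \<open>K\<close> and supported in the ball of radius \<open>r\<close>.\<close>

lemma nice_dense_bounded:
  fixes f :: "'a::euclidean_space \<Rightarrow> complex"
  assumes f[measurable]: "f \<in> borel_measurable borel" and K: "\<And>x. cmod (f x) \<le> K"
    and r: "\<And>x. norm x > r \<Longrightarrow> f x = 0" and e: "e > 0"
  shows "\<exists>k. nice k \<and> norm (abs_L2 k - abs_L2 f) < e"
proof -
  define K' where "K' = max 1 K"
  have K': "K' > 0" "\<And>x. cmod (f x) \<le> K'" using K by (auto simp: K'_def le_max_iff_disj)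
  have "f \<in> borel_measurable lebesgue" by (intro measurable_completion) simp
  then obtain N g where N: "negligible N" and cont: "\<And>n. continuous_on UNIV (g n)"
    and lim: "\<And>x. x \<notin> N \<Longrightarrow> (\<lambda>n. g n x) \<longlonglongrightarrow> f x"
    using lebesgue_measurable_imp_measurable_on[of f UNIV] unfolding measurable_on_def by auto
  have AEN: "AE x in lborel. x \<notin> N"
    using AE_not_in[of N lebesgue] N unfolding negligible_iff_null_sets AE_completion_iff by blast
  \<comment> \<open>A continuous cutoff that is 1 on the ball of radius \<open>r\<close> and 0
    outside the ball of radius \<open>r + 1\<close>.\<close>
  define c where "c x = max 0 (min 1 (r + 1 - norm x))" for x :: 'a
  have c01: "0 \<le> c x" "c x \<le> 1" for x by (auto simp: c_def)
  have cc: "continuous_on UNIV c" unfolding c_def[abs_def] by (intro continuous_intros)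
  define u where "u n x = c x *\<^sub>R clip K' (g n x)" for n x
  have ucont: "continuous_on UNIV (u n)" for n
    unfolding u_def[abs_def] using K'
    by (intro continuous_intros cc continuous_on_compose2[OF continuous_on_clip cont]) auto
  have ubd: "cmod (u n x) \<le> K' * indicator (cball 0 (r + 1)) x" for n x
  proof (cases "norm x \<le> r + 1")
    case True
    have "c x * cmod (clip K' (g n x)) \<le> 1 * K'"
      using clip_bound[OF K'(1), of "g n x"] c01[of x] by (intro mult_mono) auto
    then show ?thesis using True c01[of x] by (simp add: u_def)
  qed (simp add: u_def c_def)
  have unice: "nice (u n)" for n
    unfolding nice_def
  proof (intro conjI exI allI impI ucont)
    show "cmod (u n x) \<le> K'" for x by (rule order_trans[OF ubd]) (use K'(1) in \<open>auto simp: indicator_def\<close>)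
    show "u n x = 0" if "norm x > r + 1" for x using that by (simp add: u_def c_def)
  qed
  have ulim: "AE x in lborel. (\<lambda>n. u n x) \<longlonglongrightarrow> f x"
    using AEN
  proof eventually_elim
    case (elim x)
    have "isCont (clip K') (f x)" using continuous_on_clip[OF K'(1), of UNIV] by (simp add: continuous_on_eq_continuous_at)
    then have "(\<lambda>n. u n x) \<longlonglongrightarrow> c x *\<^sub>R clip K' (f x)"
      unfolding u_def by (intro tendsto_intros isCont_tendsto_compose[OF _ lim] elim)
    moreover have "c x *\<^sub>R clip K' (f x) = f x"
      using clip_id[OF K'(1) K'(2)[of x]] r[of x] by (cases "norm x > r") (auto simp: c_def)
    ultimately show ?case by simp
  qed
  define d where "d x = complex_of_real (K' * indicator (cball 0 (r + 1)) x)" for x :: 'a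
  have "d \<in> l2"
    by (rule l2_bounded_support[where K=K' and r="r+1"])
       (use K'(1) in \<open>auto simp: d_def[abs_def] indicator_def\<close>)
  moreover have "cmod (u n x) \<le> cmod (d x)" for n x
    using ubd[of n x] K'(1) by (simp add: d_def norm_mult del: of_real_mult)
  ultimately have "(\<lambda>n. abs_L2 (u n)) \<longlonglongrightarrow> abs_L2 f"
    by (intro L2_dominated_convergence(1)[OF nice_measurable[OF unice] f _ ulim]) auto
  from LIMSEQ_D[OF this e] unice show ?thesis by blast
qed

lemma truncation_tendsto:
  assumes "f \<in> l2"
  shows "(\<lambda>n. abs_L2 (\<lambda>x. indicator (cball 0 (real n)) x * f x)) \<longlonglongrightarrow> abs_L2 f"
proof (rule L2_dominated_convergence(1)[OF _ _ assms])
  show "AE x in lborel. (\<lambda>n. indicator (cball 0 (real n)) x * f x) \<longlonglongrightarrow> f x"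
  proof (rule AE_I2)
    fix x :: 'a
    have "\<forall>\<^sub>F n in sequentially. f x = indicator (cball 0 (real n)) x * f x"
      using eventually_ge_at_top[of "nat \<lceil>norm x\<rceil>"]
      by eventually_elim (auto simp: indicator_def)
    then show "(\<lambda>n. indicator (cball 0 (real n)) x * f x) \<longlonglongrightarrow> f x"
      by (rule Lim_transform_eventually[OF tendsto_const])
  qed
qed (use l2_measurable[OF assms] in \<open>auto simp: indicator_def\<close>)

lemma bounded_truncation_tendsto:
  assumes f: "f \<in> l2"
  shows "(\<lambda>n. abs_L2 (\<lambda>x. if norm x \<le> real n \<and> cmod (f x) \<le> real n then f x else 0)) \<longlonglongrightarrow> abs_L2 f"
proof (rule L2_dominated_convergence(1)[OF _ _ f])
  have [measurable]: "f \<in> borel_measurable borel" by (rule l2_measurable[OF f])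
  show "(\<lambda>x. if norm x \<le> real n \<and> cmod (f x) \<le> real n then f x else 0) \<in> borel_measurable borel" for n
    by measurable
  show "AE x in lborel. (\<lambda>n. if norm x \<le> real n \<and> cmod (f x) \<le> real n then f x else 0) \<longlonglongrightarrow> f x"
  proof (rule AE_I2)
    fix x :: 'a
    have "\<forall>\<^sub>F n in sequentially. f x = (if norm x \<le> real n \<and> cmod (f x) \<le> real n then f x else 0)"
      using eventually_ge_at_top[of "nat \<lceil>norm x\<rceil>"] eventually_ge_at_top[of "nat \<lceil>cmod (f x)\<rceil>"]
      by eventually_elim (auto simp: not_le; linarith)
    then show "(\<lambda>n. if norm x \<le> real n \<and> cmod (f x) \<le> real n then f x else 0) \<longlonglongrightarrow> f x"
      by (rule Lim_transform_eventually[OF tendsto_const])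
  qed
qed (use l2_measurable[OF f] in auto)

lemma nice_dense:
  fixes F :: "'a::euclidean_space L2"
  assumes "e > 0"
  obtains k where "nice k" "norm (abs_L2 k - F) < e"
proof -
  define f where "f = rep_L2 F"
  define v where "v n x = (if norm x \<le> real n \<and> cmod (f x) \<le> real n then f x else 0)" for n :: nat and x
  have f: "f \<in> l2" "abs_L2 f = F" by (simp_all add: f_def)
  have [measurable]: "f \<in> borel_measurable borel" by (rule l2_measurable[OF f(1)])
  have "(\<lambda>n. abs_L2 (v n)) \<longlonglongrightarrow> F"
    using bounded_truncation_tendsto[OF f(1)] unfolding v_def f(2) .
  from LIMSEQ_D[OF this, of "e/2"] assms obtain n where n: "norm (abs_L2 (v n) - F) < e/2" by auto
  have "\<exists>k. nice k \<and> norm (abs_L2 k - abs_L2 (v n)) < e/2"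
    by (rule nice_dense_bounded[where K="real n" and r="real n"]) (use assms in \<open>auto simp: v_def[abs_def]\<close>)
  then obtain k where k: "nice k" "norm (abs_L2 k - abs_L2 (v n)) < e/2" by blast
  then have "norm (abs_L2 k - F) < e"
    using n norm_triangle_ineq[of "abs_L2 k - abs_L2 (v n)" "abs_L2 (v n) - F"] by simp
  with k show ?thesis using that by blast
qed

section \<open>Weighted translations\<close>

lemma nn_integral_lborel_translate:
  assumes [measurable]: "f \<in> borel_measurable borel"
  shows "(\<integral>\<^sup>+x. f (x + c) \<partial>lborel) = (\<integral>\<^sup>+x. f x \<partial>(lborel :: 'a::euclidean_space measure))"
proof -
  have "(\<integral>\<^sup>+x. f x \<partial>lborel) = (\<integral>\<^sup>+x. f x \<partial>(distr lborel borel ((+) c)))"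
    by (simp add: lborel_distr_plus)
  also have "\<dots> = (\<integral>\<^sup>+x. f (x + c) \<partial>lborel)" by (subst nn_integral_distr) (simp_all add: add.commute)
  finally show ?thesis by simp
qed

text \<open>One form covers every operator that comes from randomness: Gaussian averaging in
  Plancherel's theorem, the resolvents, where \<open>Q\<close> lives on pairs of a time and a path,
  and the path integral at a fixed time, where \<open>Q\<close> is \<open>M\<close>.\<close>

definition weighted_translation ::
  "'b measure \<Rightarrow> ('a \<Rightarrow> 'b \<Rightarrow> real) \<Rightarrow> ('b \<Rightarrow> 'a) \<Rightarrow> ('a::euclidean_space \<Rightarrow> complex) \<Rightarrow> 'a \<Rightarrow> complex" where
  "weighted_translation Q k Y f x = (LINT w|Q. complex_of_real (k x w) * f (x + Y w))"

definition translation_op ::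
  "'b measure \<Rightarrow> ('a \<Rightarrow> 'b \<Rightarrow> real) \<Rightarrow> ('b \<Rightarrow> 'a) \<Rightarrow> 'a::euclidean_space L2 \<Rightarrow> 'a L2" where
  "translation_op Q k Y F = abs_L2 (weighted_translation Q k Y (rep_L2 F))"

locale translation_weight = finite_measure Q for Q :: "'b measure" +
  fixes k :: "'a::euclidean_space \<Rightarrow> 'b \<Rightarrow> real" and Y :: "'b \<Rightarrow> 'a" and K :: real
  assumes k_measurable [measurable]: "(\<lambda>(x, w). k x w) \<in> borel_measurable (borel \<Otimes>\<^sub>M Q)"
    and Y_measurable [measurable]: "Y \<in> borel_measurable Q"
    and k_bound: "\<And>x w. \<bar>k x w\<bar> \<le> K"
begin

sublocale P: pair_sigma_finite "lborel :: 'a measure" Q ..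

lemma K_nonneg: "0 \<le> K" using k_bound[of undefined undefined] by linarith

lemma nn_integral_translate:
  assumes f[measurable]: "f \<in> borel_measurable borel"
  shows "(\<integral>\<^sup>+x. \<integral>\<^sup>+w. f (x + Y w) \<partial>Q \<partial>lborel) = emeasure Q (space Q) * (\<integral>\<^sup>+x. f x \<partial>lborel)"
proof -
  have "(\<integral>\<^sup>+x. \<integral>\<^sup>+w. f (x + Y w) \<partial>Q \<partial>lborel) = (\<integral>\<^sup>+w. \<integral>\<^sup>+x. f (x + Y w) \<partial>lborel \<partial>Q)"
    by (rule P.Fubini'[of "\<lambda>x w. f (x + Y w)", symmetric]) measurable
  also have "\<dots> = (\<integral>\<^sup>+w. (\<integral>\<^sup>+x. f x \<partial>lborel) \<partial>Q)" by (simp add: nn_integral_lborel_translate)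
  finally show ?thesis by (simp add: mult.commute)
qed

lemma integrable_pair_square:
  assumes f: "f \<in> l2"
  shows "integrable (lborel \<Otimes>\<^sub>M Q) (\<lambda>(x, w). (cmod (f (x + Y w)))\<^sup>2)"
proof -
  have [measurable]: "f \<in> borel_measurable borel" by (rule l2_measurable[OF f])
  show ?thesis
  proof (subst integrable_iff_bounded, intro conjI)
    have "(\<integral>\<^sup>+z. ennreal (norm (case z of (x, w) \<Rightarrow> (cmod (f (x + Y w)))\<^sup>2)) \<partial>(lborel \<Otimes>\<^sub>M Q)) =
       (\<integral>\<^sup>+x. \<integral>\<^sup>+w. ennreal ((cmod (f (x + Y w)))\<^sup>2) \<partial>Q \<partial>lborel)"
      by (subst nn_integral_fst[symmetric]) (auto simp: split_beta')
    also have "\<dots> < \<infinity>"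
      by (subst nn_integral_translate) (simp_all add: nn_integral_l2 f emeasure_eq_measure ennreal_mult[symmetric])
    finally show "(\<integral>\<^sup>+z. ennreal (norm (case z of (x, w) \<Rightarrow> (cmod (f (x + Y w)))\<^sup>2)) \<partial>(lborel \<Otimes>\<^sub>M Q)) < \<infinity>" .
  qed measurable
qed

lemma AE_integrable_square:
  assumes f: "f \<in> l2"
  shows "AE x in lborel. integrable Q (\<lambda>w. (cmod (f (x + Y w)))\<^sup>2)"
  using P.AE_integrable_fst'[OF integrable_pair_square[OF f]] by simp

text \<open>For a finite measure \<open>Q\<close>, square integrability along the random shift gives
  integrability through \<open>cmod z \<le> 1 + (cmod z)\<^sup>2\<close>.\<close>

lemma AE_integrable_translate:
  assumes f: "f \<in> l2"
  shows "AE x in lborel. integrable Q (\<lambda>w. complex_of_real (k x w) * f (x + Y w))"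
  using AE_integrable_square[OF f]
proof eventually_elim
  case (elim x)
  have [measurable]: "f \<in> borel_measurable borel" by (rule l2_measurable[OF f])
  have "integrable Q (\<lambda>w. K * (1 + (cmod (f (x + Y w)))\<^sup>2))" using elim by simp
  then show ?case
  proof (rule Bochner_Integration.integrable_bound)
    have "cmod z \<le> 1 + (cmod z)\<^sup>2" for z
      using sum_squares_bound[of "cmod z" 1] norm_ge_zero[of z] by (simp only: power_one mult_1_right)
    then have "\<bar>k x w\<bar> * cmod (f (x + Y w)) \<le> K * (1 + (cmod (f (x + Y w)))\<^sup>2)" for w
      using k_bound[of x w] K_nonneg by (intro mult_mono) auto
    then show "AE w in Q. norm (complex_of_real (k x w) * f (x + Y w)) \<le> norm (K * (1 + (cmod (f (x + Y w)))\<^sup>2))"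
      using K_nonneg by (auto simp: norm_mult abs_mult)
  qed measurable
qed

lemma weighted_translation_measurable [measurable]:
  assumes [measurable]: "f \<in> borel_measurable borel"
  shows "weighted_translation Q k Y f \<in> borel_measurable borel"
  unfolding weighted_translation_def[abs_def] by measurable

text \<open>Cauchy-Schwarz in \<open>w\<close> against the constant \<open>K\<close> yields one
  factor \<open>K\<^sup>2\<close> times the mass of \<open>Q\<close>; translation invariance and
  Tonelli yield the second factor of the mass. Together they are the square of the operator
  bound.\<close>

lemma nn_integral_weighted_translation:
  assumes f: "f \<in> l2"
  shows "(\<integral>\<^sup>+x. ennreal ((cmod (weighted_translation Q k Y f x))\<^sup>2) \<partial>lborel)
    \<le> ennreal ((K * measure Q (space Q) * norm (abs_L2 f))\<^sup>2)"
proof -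
  let ?q = "measure Q (space Q)"
  have [measurable]: "f \<in> borel_measurable borel" by (rule l2_measurable[OF f])
  have "(\<integral>\<^sup>+x. ennreal ((cmod (weighted_translation Q k Y f x))\<^sup>2) \<partial>lborel) \<le>
      (\<integral>\<^sup>+x. ennreal (K\<^sup>2 * ?q) * (\<integral>\<^sup>+w. ennreal ((cmod (f (x + Y w)))\<^sup>2) \<partial>Q) \<partial>lborel)"
  proof (rule nn_integral_mono)
    fix x :: 'a
    \<comment> \<open>The bound holds at every \<open>x\<close>: where the integrand is not
      integrable, the Bochner integral is 0 by default.\<close>
    have "ennreal (cmod (weighted_translation Q k Y f x)) \<le> (\<integral>\<^sup>+w. ennreal (norm (complex_of_real (k x w) * f (x + Y w))) \<partial>Q)"
    proof (cases "integrable Q (\<lambda>w. complex_of_real (k x w) * f (x + Y w))")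
      case True
      then show ?thesis unfolding weighted_translation_def by (rule integral_norm_bound_ennreal)
    next
      case False
      then show ?thesis by (simp add: weighted_translation_def not_integrable_integral_eq)
    qed
    also have "\<dots> \<le> (\<integral>\<^sup>+w. ennreal K * ennreal (cmod (f (x + Y w))) \<partial>Q)"
      using k_bound K_nonneg
      by (intro nn_integral_mono) (auto simp: norm_mult ennreal_mult[symmetric] intro!: ennreal_leI mult_right_mono)
    finally have *: "ennreal (cmod (weighted_translation Q k Y f x)) \<le> (\<integral>\<^sup>+w. ennreal K * ennreal (cmod (f (x + Y w))) \<partial>Q)" .
    have "ennreal ((cmod (weighted_translation Q k Y f x))\<^sup>2) = (ennreal (cmod (weighted_translation Q k Y f x)))\<^sup>2"
      by (simp add: ennreal_power)
    also have "\<dots> \<le> (\<integral>\<^sup>+w. ennreal K * ennreal (cmod (f (x + Y w))) \<partial>Q)\<^sup>2" by (intro power_mono *) auto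
    also have "\<dots> \<le> (\<integral>\<^sup>+w. (ennreal K)\<^sup>2 \<partial>Q) * (\<integral>\<^sup>+w. (ennreal (cmod (f (x + Y w))))\<^sup>2 \<partial>Q)"
      by (rule Cauchy_Schwarz_nn_integral) measurable
    also have "(\<integral>\<^sup>+w. (ennreal K)\<^sup>2 \<partial>Q) = ennreal (K\<^sup>2 * ?q)"
      using K_nonneg by (simp add: ennreal_power emeasure_eq_measure ennreal_mult)
    also have "(\<integral>\<^sup>+w. (ennreal (cmod (f (x + Y w))))\<^sup>2 \<partial>Q) = (\<integral>\<^sup>+w. ennreal ((cmod (f (x + Y w)))\<^sup>2) \<partial>Q)"
      by (simp add: ennreal_power)
    finally show "ennreal ((cmod (weighted_translation Q k Y f x))\<^sup>2)
      \<le> ennreal (K\<^sup>2 * ?q) * (\<integral>\<^sup>+w. ennreal ((cmod (f (x + Y w)))\<^sup>2) \<partial>Q)" .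
  qed
  also have "\<dots> = ennreal (K\<^sup>2 * ?q) * (\<integral>\<^sup>+x. (\<integral>\<^sup>+w. ennreal ((cmod (f (x + Y w)))\<^sup>2) \<partial>Q) \<partial>lborel)"
    by (rule nn_integral_cmult) measurable
  also have "\<dots> = ennreal (K\<^sup>2 * ?q) * (ennreal ?q * ennreal ((norm (abs_L2 f))\<^sup>2))"
    by (subst nn_integral_translate) (simp_all add: nn_integral_l2 f emeasure_eq_measure)
  also have "\<dots> = ennreal ((K * ?q * norm (abs_L2 f))\<^sup>2)"
    using K_nonneg by (simp add: ennreal_mult[symmetric] power_mult_distrib power2_eq_square mult_ac)
  finally show ?thesis .
qed

lemma weighted_translation_l2: "f \<in> l2 \<Longrightarrow> weighted_translation Q k Y f \<in> l2"
  unfolding l2_iff_nn_integral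
  using le_less_trans[OF nn_integral_weighted_translation[of f] ennreal_less_top] weighted_translation_measurable[of f]
  by (auto simp: l2_measurable l2_iff_nn_integral)

lemma norm_weighted_translation:
  assumes f: "f \<in> l2"
  shows "norm (abs_L2 (weighted_translation Q k Y f)) \<le> K * measure Q (space Q) * norm (abs_L2 f)"
proof (rule power2_le_imp_le)
  show "(norm (abs_L2 (weighted_translation Q k Y f)))\<^sup>2 \<le> (K * measure Q (space Q) * norm (abs_L2 f))\<^sup>2"
    using nn_integral_weighted_translation[OF f]
    unfolding nn_integral_l2[OF weighted_translation_l2[OF f]] by (simp only: ennreal_le_iff zero_le_power2)
  show "0 \<le> K * measure Q (space Q) * norm (abs_L2 f)" using K_nonneg by simp
qed

lemma weighted_translation_add:
  assumes "f \<in> l2" "g \<in> l2"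
  shows "AE x in lborel. weighted_translation Q k Y (\<lambda>x. f x + g x) x
    = weighted_translation Q k Y f x + weighted_translation Q k Y g x"
  using AE_integrable_translate[OF assms(1)] AE_integrable_translate[OF assms(2)]
  by eventually_elim (simp add: weighted_translation_def ring_distribs)

lemma weighted_translation_scale:
  "weighted_translation Q k Y (\<lambda>x. c * f x) x = c * weighted_translation Q k Y f x"
proof -
  have "complex_of_real (k x w) * (c * f (x + Y w)) = c * (complex_of_real (k x w) * f (x + Y w))" for w
    by (rule mult.left_commute)
  then show ?thesis unfolding weighted_translation_def by (simp only: integral_mult_right_zero)
qed

lemma abs_weighted_translation_add:
  assumes "f \<in> l2" "g \<in> l2"
  shows "abs_L2 (weighted_translation Q k Y (\<lambda>x. f x + g x))
    = abs_L2 (weighted_translation Q k Y f) + abs_L2 (weighted_translation Q k Y g)"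
  unfolding abs_L2_add[OF weighted_translation_l2 weighted_translation_l2, OF assms, symmetric]
  by (subst abs_L2_eq_iff) (auto intro!: l2_add weighted_translation_l2 assms weighted_translation_add)

text \<open>The norm bound applied to the null difference shows that the class of the image depends
  only on the class of the argument.\<close>

lemma abs_weighted_translation_cong:
  assumes "f \<in> l2" "g \<in> l2" "abs_L2 f = abs_L2 g"
  shows "abs_L2 (weighted_translation Q k Y f) = abs_L2 (weighted_translation Q k Y g)"
proof -
  let ?d = "\<lambda>x. f x - g x"
  have d: "?d \<in> l2" using assms by (intro l2_diff)
  have "abs_L2 (weighted_translation Q k Y f) = abs_L2 (weighted_translation Q k Y (\<lambda>x. ?d x + g x))" by simp
  also have "\<dots> = abs_L2 (weighted_translation Q k Y ?d) + abs_L2 (weighted_translation Q k Y g)"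
    by (rule abs_weighted_translation_add[OF d assms(2)])
  also have "abs_L2 (weighted_translation Q k Y ?d) = 0"
    using norm_weighted_translation[OF d] by (simp add: abs_L2_diff assms)
  finally show ?thesis by simp
qed

lemma translation_op_abs:
  "f \<in> l2 \<Longrightarrow> translation_op Q k Y (abs_L2 f) = abs_L2 (weighted_translation Q k Y f)"
  unfolding translation_op_def by (rule abs_weighted_translation_cong) auto

lemma translation_op_add: "translation_op Q k Y (F + G) = translation_op Q k Y F + translation_op Q k Y G"
proof -
  have "F + G = abs_L2 (\<lambda>x. rep_L2 F x + rep_L2 G x)" by (simp add: abs_L2_add)
  then show ?thesis
    by (simp add: translation_op_abs l2_add abs_weighted_translation_add) (simp add: translation_op_def)
qed

lemma translation_op_scaleR: "translation_op Q k Y (r *\<^sub>R F) = r *\<^sub>R translation_op Q k Y F"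
proof -
  have "r *\<^sub>R F = abs_L2 (\<lambda>x. r *\<^sub>R rep_L2 F x)" by (simp add: abs_L2_scaleR)
  then show ?thesis
    by (simp add: translation_op_abs l2_scaleR)
      (simp add: translation_op_def scaleR_conv_of_real weighted_translation_scale[abs_def]
        abs_L2_scaleR[OF weighted_translation_l2, unfolded scaleR_conv_of_real, symmetric])
qed

lemma translation_op_iL2: "translation_op Q k Y (iL2 F) = iL2 (translation_op Q k Y F)"
proof -
  have "iL2 F = abs_L2 (\<lambda>x. \<i> * rep_L2 F x)" by (simp add: abs_L2_i)
  then show ?thesis
    by (simp add: translation_op_abs l2_scale)
      (simp add: translation_op_def weighted_translation_scale[abs_def] abs_L2_i weighted_translation_l2)
qed

lemma norm_translation_op: "norm (translation_op Q k Y F) \<le> K * measure Q (space Q) * norm F"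
  using norm_weighted_translation[of "rep_L2 F"] by (simp add: translation_op_def)

lemma bounded_linear_translation_op: "bounded_linear (translation_op Q k Y)"
  by (rule bounded_linear_intro[where K="K * measure Q (space Q)"])
     (auto simp: translation_op_add translation_op_scaleR mult.commute[of "norm _"] norm_translation_op)

lemma integrable_pair_inner:
  assumes f: "f \<in> l2" and g: "g \<in> l2"
  shows "integrable (lborel \<Otimes>\<^sub>M Q) (\<lambda>(x, w). cnj (g x) * (complex_of_real (k x w) * f (x + Y w)))"
proof (rule Bochner_Integration.integrable_bound)
  have [measurable]: "f \<in> borel_measurable borel" "g \<in> borel_measurable borel"
    using f g by (auto dest: l2_measurable)
  have "integrable (lborel \<Otimes>\<^sub>M Q) (\<lambda>(x, w). (cmod (g x))\<^sup>2)"
  proof (subst integrable_iff_bounded, intro conjI)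
    have "(\<integral>\<^sup>+z. ennreal (norm (case z of (x, w) \<Rightarrow> (cmod (g x))\<^sup>2)) \<partial>(lborel \<Otimes>\<^sub>M Q)) =
       (\<integral>\<^sup>+x. \<integral>\<^sup>+w. ennreal ((cmod (g x))\<^sup>2) \<partial>Q \<partial>lborel)"
      by (subst nn_integral_fst[symmetric]) (auto simp: split_beta')
    also have "\<dots> = ennreal ((norm (abs_L2 g))\<^sup>2) * emeasure Q (space Q)"
      by (simp add: nn_integral_multc nn_integral_l2 g)
    also have "\<dots> < \<infinity>" by (simp add: emeasure_eq_measure ennreal_mult[symmetric])
    finally show "(\<integral>\<^sup>+z. ennreal (norm (case z of (x, w) \<Rightarrow> (cmod (g x))\<^sup>2)) \<partial>(lborel \<Otimes>\<^sub>M Q)) < \<infinity>" .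
  qed measurable
  then show "integrable (lborel \<Otimes>\<^sub>M Q)
      (\<lambda>z. K * ((case z of (x, w) \<Rightarrow> (cmod (g x))\<^sup>2) + (case z of (x, w) \<Rightarrow> (cmod (f (x + Y w)))\<^sup>2)))"
    using integrable_pair_square[OF f] by simp
  show "(\<lambda>(x, w). cnj (g x) * (complex_of_real (k x w) * f (x + Y w))) \<in> borel_measurable (lborel \<Otimes>\<^sub>M Q)"
    by measurable
  have ab: "a * b \<le> a\<^sup>2 + b\<^sup>2" if "0 \<le> a" "0 \<le> b" for a b :: real
    using sum_squares_bound[of a b] mult_nonneg_nonneg[OF that] by linarith
  have "cmod (g x) * (\<bar>k x w\<bar> * cmod (f (x + Y w))) \<le> K * ((cmod (g x))\<^sup>2 + (cmod (f (x + Y w)))\<^sup>2)" for x w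
  proof -
    have "cmod (g x) * (\<bar>k x w\<bar> * cmod (f (x + Y w))) = \<bar>k x w\<bar> * (cmod (g x) * cmod (f (x + Y w)))" by simp
    also have "\<dots> \<le> K * ((cmod (g x))\<^sup>2 + (cmod (f (x + Y w)))\<^sup>2)"
      using k_bound[of x w] K_nonneg ab by (intro mult_mono) auto
    finally show ?thesis .
  qed
  then show "AE z in lborel \<Otimes>\<^sub>M Q. norm (case z of (x, w) \<Rightarrow> cnj (g x) * (complex_of_real (k x w) * f (x + Y w)))
      \<le> norm (K * ((case z of (x, w) \<Rightarrow> (cmod (g x))\<^sup>2) + (case z of (x, w) \<Rightarrow> (cmod (f (x + Y w)))\<^sup>2)))"
    using K_nonneg by (intro AE_I2) (auto simp: norm_mult abs_mult split: prod.split)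
qed

lemma l2_inner_weighted_translation:
  assumes f: "f \<in> l2" and g: "g \<in> l2"
  shows "l2_inner g (weighted_translation Q k Y f)
    = (LINT w|Q. LINT x|lborel. cnj (g x) * (complex_of_real (k x w) * f (x + Y w)))"
  unfolding l2_inner_def weighted_translation_def
  using P.Fubini_integral[OF integrable_pair_inner[OF f g]] by simp

end

section \<open>Plancherel's theorem\<close>

text \<open>The real Cauchy-Schwarz inequality suffices once the second argument is multiplied by
  the phase \<open>c\<close> that makes the complex inner product real and nonnegative.\<close>

lemma cmod_l2_inner_le:
  assumes f: "f \<in> l2" and g: "g \<in> l2"
  shows "cmod (l2_inner f g) \<le> norm (abs_L2 f) * norm (abs_L2 g)"
proof (cases "l2_inner f g = 0")
  case False
  define c where "c = cnj (sgn (l2_inner f g))"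
  have c: "cmod c = 1" using False by (simp add: c_def norm_sgn)
  have cg: "(\<lambda>x. c * g x) \<in> l2" by (rule l2_scale[OF g])
  have "(norm (abs_L2 (\<lambda>x. c * g x)))\<^sup>2 = (norm (abs_L2 g))\<^sup>2"
    by (simp add: norm_abs_L2 cg g norm_mult c)
  then have ng: "norm (abs_L2 (\<lambda>x. c * g x)) = norm (abs_L2 g)" by simp
  have "cmod (l2_inner f g) = Re (c * l2_inner f g)"
    using False by (simp add: c_def sgn_eq mult.commute[of "cnj _"] complex_norm_square[symmetric] power2_eq_square)
  also have "\<dots> = inner (abs_L2 f) (abs_L2 (\<lambda>x. c * g x))"
    by (simp add: inner_abs_L2 f cg l2_inner_scale_right)
  also have "\<dots> \<le> norm (abs_L2 f) * norm (abs_L2 (\<lambda>x. c * g x))" by (rule norm_cauchy_schwarz)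
  finally show ?thesis by (simp add: ng)
qed simp

lemma l2_translate:
  assumes "f \<in> l2" shows "(\<lambda>x. f (x + c)) \<in> l2" "norm (abs_L2 (\<lambda>x. f (x + c))) = norm (abs_L2 f)"
proof -
  have [measurable]: "f \<in> borel_measurable borel" by (rule l2_measurable[OF assms])
  have eq: "(\<integral>\<^sup>+x. ennreal ((cmod (f (x + c)))\<^sup>2) \<partial>lborel) = (\<integral>\<^sup>+x. ennreal ((cmod (f x))\<^sup>2) \<partial>lborel)"
    by (rule nn_integral_lborel_translate) simp
  show *: "(\<lambda>x. f (x + c)) \<in> l2"
    using assms unfolding l2_iff_nn_integral eq by simp
  show "norm (abs_L2 (\<lambda>x. f (x + c))) = norm (abs_L2 f)"
    using eq unfolding nn_integral_l2[OF *] nn_integral_l2[OF assms] by simp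
qed

lemma l2_inner_diff_right:
  "f \<in> l2 \<Longrightarrow> g \<in> l2 \<Longrightarrow> h \<in> l2 \<Longrightarrow> l2_inner f (\<lambda>x. g x - h x) = l2_inner f g - l2_inner f h"
  unfolding l2_inner_def right_diff_distrib by (intro Bochner_Integration.integral_diff l2_integrable_inner)

text \<open>In the second slot \<open>f\<close> is replaced by a continuous \<open>k\<close> of
  compact support. The error is uniform in the shift because translations are isometric, and for
  \<open>k\<close> dominated convergence applies, as \<open>f\<close> is integrable and
  \<open>k\<close> bounded.\<close>

lemma l2_inner_translate_tendsto:
  fixes f :: "'a::euclidean_space \<Rightarrow> complex"
  assumes f: "f \<in> l2" and f1: "integrable lborel f" and w: "w \<longlonglongrightarrow> 0"
  shows "(\<lambda>n. l2_inner f (\<lambda>x. f (x + w n))) \<longlonglongrightarrow> l2_inner f f"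
proof (rule LIMSEQ_I)
  fix e :: real assume e: "e > 0"
  \<comment> \<open>Chosen so that an error \<open>d\<close> in one slot, paired with
    \<open>f\<close> in the other, costs less than \<open>e / 4\<close>; the added 1 keeps the
    denominator positive when \<open>f\<close> is null.\<close>
  define d where "d = e / (4 * (norm (abs_L2 f) + 1))"
  have d: "d > 0" using e by (simp add: d_def add_nonneg_pos)
  have fd: "norm (abs_L2 f) * d < e / 4"
  proof -
    have "norm (abs_L2 f) * d < (norm (abs_L2 f) + 1) * d" using d by simp
    also have "(norm (abs_L2 f) + 1) * d = e / 4"
      by (simp add: d_def add_nonneg_eq_0_iff field_simps)
    finally show ?thesis .
  qed
  obtain k where k: "nice k" "norm (abs_L2 k - abs_L2 f) < d" using nice_dense[OF d, of "abs_L2 f"] .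
  note kl = nice_l2[OF k(1)]
  obtain K where K: "\<And>x. cmod (k x) \<le> K" using k(1) by (auto simp: nice_def)
  have [measurable]: "f \<in> borel_measurable borel" "k \<in> borel_measurable borel"
    by (rule l2_measurable[OF f], rule nice_measurable[OF k(1)])
  have "(\<lambda>n. l2_inner f (\<lambda>x. k (x + w n))) \<longlonglongrightarrow> l2_inner f k"
    unfolding l2_inner_def
  proof (rule integral_dominated_convergence[where w="\<lambda>x. cmod (f x) * K"])
    show "integrable lborel (\<lambda>x. cmod (f x) * K)" using f1 by simp
    show "AE x in lborel. (\<lambda>n. cnj (f x) * k (x + w n)) \<longlonglongrightarrow> cnj (f x) * k x"
    proof (rule AE_I2)
      fix x
      have "isCont k x" using k(1) by (simp add: nice_def continuous_on_eq_continuous_at)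
      moreover have "(\<lambda>n. x + w n) \<longlonglongrightarrow> x" using tendsto_add[OF tendsto_const w, of x] by simp
      ultimately show "(\<lambda>n. cnj (f x) * k (x + w n)) \<longlonglongrightarrow> cnj (f x) * k x"
        by (intro tendsto_intros isCont_tendsto_compose[of x k])
    qed
    show "AE x in lborel. norm (cnj (f x) * k (x + w n)) \<le> cmod (f x) * K" for n
      using K by (intro AE_I2) (simp add: norm_mult mult_left_mono)
  qed measurable
  from LIMSEQ_D[OF this, of "e/4"] e obtain N
    where N: "\<And>n. n \<ge> N \<Longrightarrow> cmod (l2_inner f (\<lambda>x. k (x + w n)) - l2_inner f k) < e/4" by auto
  have fk: "(\<lambda>x. f x - k x) \<in> l2" by (rule l2_diff[OF f kl])
  have nfk: "norm (abs_L2 (\<lambda>x. f x - k x)) < d"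
    using k(2) by (simp add: abs_L2_diff f kl norm_minus_commute)
  show "\<exists>N. \<forall>n\<ge>N. cmod (l2_inner f (\<lambda>x. f (x + w n)) - l2_inner f f) < e"
  proof (intro exI allI impI)
    fix n assume "n \<ge> N"
    have 1: "cmod (l2_inner f (\<lambda>x. f (x + w n) - k (x + w n))) \<le> e/4"
      using cmod_l2_inner_le[OF f l2_translate(1)[OF fk], of "w n"] l2_translate(2)[OF fk, of "w n"]
        mult_left_mono[OF less_imp_le[OF nfk] norm_ge_zero[of "abs_L2 f"]] fd by simp
    have 2: "cmod (l2_inner f (\<lambda>x. f x - k x)) \<le> e/4"
      using cmod_l2_inner_le[OF f fk] mult_left_mono[OF less_imp_le[OF nfk] norm_ge_zero[of "abs_L2 f"]] fd by simp
    have "l2_inner f (\<lambda>x. f (x + w n)) - l2_inner f f =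
        l2_inner f (\<lambda>x. f (x + w n) - k (x + w n)) + (l2_inner f (\<lambda>x. k (x + w n)) - l2_inner f k)
        - l2_inner f (\<lambda>x. f x - k x)"
      by (simp add: l2_inner_diff_right f kl l2_translate)
    also have "cmod \<dots> \<le> e/4 + e/4 + e/4"
    proof -
      have "norm (a + b - c) \<le> e/4 + e/4 + e/4" if "norm a \<le> e/4" "norm b \<le> e/4" "norm c \<le> e/4" for a b c :: complex
        using that norm_triangle_ineq4[of "a + b" c] norm_triangle_ineq[of a b] by linarith
      then show ?thesis using 1 2 less_imp_le[OF N[OF \<open>n \<ge> N\<close>]] by blast
    qed
    also have "\<dots> < e" using e by simp
    finally show "cmod (l2_inner f (\<lambda>x. f (x + w n)) - l2_inner f f) < e" .
  qed
qed

section \<open>Gaussian functions and the regularized Plancherel identity\<close>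

definition gauss :: "'a::euclidean_space \<Rightarrow> real" where
  "gauss x = exp (- (norm x)\<^sup>2 / 2)"

lemma gauss_measurable [measurable]: "gauss \<in> borel_measurable borel"
  unfolding gauss_def[abs_def] by measurable

lemma gauss_pos: "0 < gauss x" and gauss_le_1: "gauss x \<le> 1" and gauss_uminus: "gauss (- x) = gauss x"
  by (auto simp: gauss_def)

text \<open>Up to the factor \<open>sqrt (2 * pi)\<close> this is the characteristic function of the
  standard normal distribution.\<close>

lemma gauss_fourier_real:
  "integrable lborel (\<lambda>x::real. cis (u * x) * complex_of_real (exp (- x\<^sup>2 / 2)))"
  "(LINT x::real|lborel. cis (u * x) * complex_of_real (exp (- x\<^sup>2 / 2))) = complex_of_real (sqrt (2 * pi) * exp (- u\<^sup>2 / 2))"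
proof -
  have *: "cis (u * x) * complex_of_real (exp (- x\<^sup>2 / 2)) = complex_of_real (sqrt (2 * pi)) * (std_normal_density x *\<^sub>R iexp (u * x))" for x
    by (simp add: std_normal_density_def cis_conv_exp scaleR_conv_of_real)
  have i: "integrable lborel (\<lambda>x. std_normal_density x *\<^sub>R iexp (u * x))"
  proof (rule Bochner_Integration.integrable_bound)
    show "integrable lborel std_normal_density" using integrable_normal_moment[of 1 0 0] by simp
  qed simp_all
  then show "integrable lborel (\<lambda>x::real. cis (u * x) * complex_of_real (exp (- x\<^sup>2 / 2)))"
    unfolding * by (rule integrable_mult_right)
  have "(LINT x|lborel. std_normal_density x *\<^sub>R iexp (u * x)) = complex_of_real (exp (- u\<^sup>2 / 2))"
    using fun_cong[OF char_std_normal_distribution, of u]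
    unfolding char_def by (subst (asm) integral_density) auto
  then show "(LINT x::real|lborel. cis (u * x) * complex_of_real (exp (- x\<^sup>2 / 2))) = complex_of_real (sqrt (2 * pi) * exp (- u\<^sup>2 / 2))"
    unfolding * integral_mult_right_zero by simp
qed

text \<open>Both the Gaussian and the character factor over the coordinates, and
  \<open>lborel\<close> is the image of a product of one-dimensional Lebesgue measures.\<close>

lemma gauss_fourier:
  fixes v :: "'a::euclidean_space"
  shows "(LINT x|lborel. cis (v \<bullet> x) * complex_of_real (gauss x)) = complex_of_real ((2 * pi) powr (real DIM('a) / 2) * gauss v)"
proof -
  interpret product_sigma_finite "\<lambda>b::'a. lborel :: real measure" by standard
  have prod: "cis (v \<bullet> (\<Sum>b\<in>Basis. f b *\<^sub>R b)) * complex_of_real (gauss (\<Sum>b\<in>Basis. f b *\<^sub>R b)) =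
      (\<Prod>b\<in>Basis. cis ((v \<bullet> b) * f b) * complex_of_real (exp (- (f b)\<^sup>2 / 2)))" for f :: "'a \<Rightarrow> real"
  proof -
    have n: "(norm (\<Sum>b\<in>Basis. f b *\<^sub>R b))\<^sup>2 = (\<Sum>b\<in>Basis. (f b)\<^sup>2)"
      by (subst power2_norm_eq_inner, subst euclidean_inner) (simp add: inner_sum_left_Basis power2_eq_square)
    have i: "v \<bullet> (\<Sum>b\<in>Basis. f b *\<^sub>R b) = (\<Sum>b\<in>Basis. (v \<bullet> b) * f b)"
      by (simp add: inner_sum_right mult.commute)
    show ?thesis
      unfolding gauss_def n i prod.distrib cis_conv_exp
      by (simp add: exp_sum[symmetric] sum_negf[symmetric] sum_divide_distrib sum_distrib_left flip: exp_of_real)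
  qed
  have "(LINT x|lborel. cis (v \<bullet> x) * complex_of_real (gauss x)) =
      (LINT f|(\<Pi>\<^sub>M b\<in>Basis. lborel). cis (v \<bullet> (\<Sum>b\<in>Basis. f b *\<^sub>R b)) * complex_of_real (gauss (\<Sum>b\<in>Basis. f b *\<^sub>R b)))"
    by (subst lborel_eq, subst integral_distr) (auto intro!: borel_measurable_continuous_onI continuous_intros simp: gauss_def cis_conv_exp)
  also have "\<dots> = (\<Prod>b\<in>Basis. LINT x|lborel. cis ((v \<bullet> b) * x) * complex_of_real (exp (- x\<^sup>2 / 2)))"
    unfolding prod by (rule product_integral_prod[OF finite_Basis gauss_fourier_real(1)])
  also have "\<dots> = complex_of_real (\<Prod>b\<in>Basis. sqrt (2 * pi) * exp (- (v \<bullet> b)\<^sup>2 / 2))"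
    by (simp only: gauss_fourier_real of_real_prod)
  also have "(\<Prod>b\<in>(Basis::'a set). sqrt (2 * pi) * exp (- (v \<bullet> b)\<^sup>2 / 2)) = (2 * pi) powr (real DIM('a) / 2) * gauss v"
  proof -
    have "(\<Prod>b\<in>(Basis::'a set). exp (- (v \<bullet> b)\<^sup>2 / 2)) = gauss v"
    proof -
      have "(norm v)\<^sup>2 = (\<Sum>b\<in>Basis. (v \<bullet> b)\<^sup>2)"
        by (subst power2_norm_eq_inner, subst euclidean_inner) (simp add: power2_eq_square)
      then show ?thesis unfolding gauss_def by (simp add: exp_sum[symmetric] sum_negf sum_divide_distrib)
    qed
    moreover have "(\<Prod>b\<in>(Basis::'a set). sqrt (2 * pi)) = (2 * pi) powr (real DIM('a) / 2)"
      by (simp add: powr_half_sqrt[symmetric] powr_power mult.commute)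
    ultimately show ?thesis by (simp add: prod.distrib)
  qed
  finally show ?thesis .
qed

lemma gauss_integral: "(LINT x|lborel. gauss (x::'a::euclidean_space)) = (2 * pi) powr (real DIM('a) / 2)"
proof -
  have "complex_of_real (LINT x|lborel. gauss (x::'a)) = complex_of_real ((2 * pi) powr (real DIM('a) / 2))"
    using gauss_fourier[of "0::'a"] by (simp add: gauss_def)
  then show ?thesis by (simp only: of_real_eq_iff)
qed

text \<open>A function that is not integrable has Bochner integral 0, whereas the integral has just
  been found to be positive.\<close>

lemma gauss_integrable: "integrable lborel (gauss :: 'a::euclidean_space \<Rightarrow> real)"
  using gauss_integral[where 'a='a] not_integrable_integral_eq[of lborel "gauss :: 'a \<Rightarrow> real"] by (force simp: powr_eq_0_iff)

lemma integral_lborel_affine: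
  fixes h :: "'a::euclidean_space \<Rightarrow> complex"
  assumes [measurable]: "h \<in> borel_measurable borel" and c: "c > 0"
  shows "(LINT x|lborel. h x) = complex_of_real (c ^ DIM('a)) * (LINT x|lborel. h (t + c *\<^sub>R x))"
  using c by (subst lborel_affine[of c t]) (simp_all add: integral_density integral_distr scaleR_conv_of_real)

lemma integrable_lborel_affine:
  fixes h :: "'a::euclidean_space \<Rightarrow> real"
  assumes i: "integrable lborel h" and c: "c > 0"
  shows "integrable lborel (\<lambda>x. h (t + c *\<^sub>R x))"
proof -
  have [measurable]: "h \<in> borel_measurable borel" using borel_measurable_integrable[OF i] by simp
  have "integrable (density (distr lborel borel (\<lambda>x. t + c *\<^sub>R x)) (\<lambda>_. \<bar>c\<bar>^DIM('a))) h"
    using i c lborel_affine[of c t] by simp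
  then show ?thesis using c by (simp add: integrable_density integrable_distr_eq)
qed

lemma gauss_scaled_fourier:
  fixes v :: "'a::euclidean_space"
  assumes e: "e > 0"
  shows "(LINT k|lborel. cis (k \<bullet> v) * complex_of_real (gauss (e *\<^sub>R k)))
    = complex_of_real ((2 * pi) powr (real DIM('a) / 2) * inverse e ^ DIM('a) * gauss (inverse e *\<^sub>R v))"
proof -
  have e': "inverse e > 0" using e by simp
  have "(LINT k|lborel. cis (k \<bullet> v) * complex_of_real (gauss (e *\<^sub>R k)))
     = complex_of_real (inverse e ^ DIM('a)) * (LINT x|lborel. cis ((0 + inverse e *\<^sub>R x) \<bullet> v) * complex_of_real (gauss (e *\<^sub>R (0 + inverse e *\<^sub>R x))))"
    by (rule integral_lborel_affine[OF _ e']) (simp add: cis_conv_exp)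
  also have "(LINT x|lborel. cis ((0 + inverse e *\<^sub>R x) \<bullet> v) * complex_of_real (gauss (e *\<^sub>R (0 + inverse e *\<^sub>R x))))
     = (LINT x|lborel. cis ((inverse e *\<^sub>R v) \<bullet> x) * complex_of_real (gauss x))"
    using e by (simp add: inner_commute)
  finally show ?thesis unfolding gauss_fourier by (simp only: of_real_mult ac_simps)
qed

lemma gauss_nonneg [simp]: "0 \<le> gauss x"
  using gauss_pos[of x] by simp

lemma fourier_L1_measurable [measurable]:
  assumes [measurable]: "f \<in> borel_measurable borel"
  shows "fourier_L1 f \<in> borel_measurable borel"
  unfolding fourier_L1_def[abs_def] cis_conv_exp by measurable

lemma integrable_cis_mult:
  assumes "integrable M f" "g \<in> borel_measurable M"
  shows "integrable M (\<lambda>x. cis (g x) * f x)"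
  using assms(1)
proof (rule Bochner_Integration.integrable_bound)
  show "(\<lambda>x. cis (g x) * f x) \<in> borel_measurable M"
    using assms unfolding cis_conv_exp by (auto intro!: borel_measurable_times borel_measurable_integrable)
qed (simp add: norm_mult)

lemma fourier_L1_add:
  assumes "integrable lborel f" "integrable lborel g"
  shows "fourier_L1 (\<lambda>x. f x + g x) k = fourier_L1 f k + fourier_L1 g k"
  unfolding fourier_L1_def ring_distribs
  by (subst Bochner_Integration.integral_add) (auto intro!: integrable_cis_mult assms simp: ring_distribs)

lemma fourier_L1_scale: "fourier_L1 (\<lambda>x. c * f x) k = c * fourier_L1 f k"
proof -
  have "cis (- (k \<bullet> x)) * (c * f x) = c * (cis (- (k \<bullet> x)) * f x)" for x by (rule mult.left_commute)
  then show ?thesis unfolding fourier_L1_def by (simp only: integral_mult_right_zero mult.left_commute)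
qed

lemma fourier_L1_cong_AE:
  assumes "AE x in lborel. f x = g x" and [measurable]: "f \<in> borel_measurable borel" "g \<in> borel_measurable borel"
  shows "fourier_L1 f = fourier_L1 g"
proof
  fix k
  have "(LINT x|lborel. cis (- (k \<bullet> x)) * f x) = (LINT x|lborel. cis (- (k \<bullet> x)) * g x)"
    unfolding cis_conv_exp using assms(1) by (intro integral_cong_AE) auto
  then show "fourier_L1 f k = fourier_L1 g k" by (simp add: fourier_L1_def)
qed

abbreviation fourier_const :: "'a::euclidean_space itself \<Rightarrow> real" where
  "fourier_const _ \<equiv> (2 * pi) powr (- real DIM('a) / 2)"

lemma cmod_fourier_L1_le:
  "cmod (fourier_L1 f k) \<le> fourier_const TYPE('a) * (LINT x|lborel. cmod (f (x::'a::euclidean_space)))"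
proof -
  have "cmod (LINT x|lborel. cis (- (k \<bullet> x)) * f x) \<le> (LINT x|lborel. cmod (cis (- (k \<bullet> x)) * f x))"
    by (rule integral_norm_bound)
  then show ?thesis by (simp add: fourier_L1_def norm_mult mult_left_mono)
qed

lemma translation_weight_gauss:
  "translation_weight (density lborel (gauss :: 'a::euclidean_space \<Rightarrow> real)) (\<lambda>_ _. 1) (\<lambda>z. e *\<^sub>R z :: 'a) 1"
proof -
  have "emeasure (density lborel (gauss :: 'a \<Rightarrow> real)) UNIV = ennreal (LINT x|lborel. gauss (x::'a))"
    by (simp add: emeasure_density nn_integral_eq_integral gauss_integrable)
  then show ?thesis
    by (intro translation_weight.intro translation_weight_axioms.intro finite_measureI) simp_all
qed

text \<open>The Gaussian damping in \<open>k\<close> makes Fubini available. The squared transform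
  is a double integral of \<open>cnj (f x) * f y\<close> against a character of
  \<open>x - y\<close>; integrating over \<open>k\<close> first turns the character into a narrow
  Gaussian kernel, so what remains is the autocorrelation of \<open>f\<close> averaged over shifts
  of size \<open>e\<close>.\<close>

lemma plancherel_regularized:
  fixes f :: "'a::euclidean_space \<Rightarrow> complex"
  assumes f: "f \<in> l2" and f1: "integrable lborel f" and e: "e > 0"
  shows "(LINT k|lborel. complex_of_real ((cmod (fourier_L1 f k))\<^sup>2 * gauss (e *\<^sub>R k))) =
    complex_of_real (fourier_const TYPE('a)) * (LINT z|density lborel gauss. l2_inner f (\<lambda>x. f (x + e *\<^sub>R z)))"
proof -
  interpret tw: translation_weight "density lborel (gauss :: 'a \<Rightarrow> real)" "\<lambda>_ _. 1" "\<lambda>z. e *\<^sub>R z :: 'a" 1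
    by (rule translation_weight_gauss)
  have [measurable]: "f \<in> borel_measurable borel" by (rule l2_measurable[OF f])
  let ?c = "fourier_const TYPE('a)"
  define u where "u p = cnj (f (fst p)) * f (snd p)" for p :: "'a \<times> 'a"
  have [measurable]: "u \<in> borel_measurable borel" unfolding u_def[abs_def] by (simp flip: borel_prod)
  have [measurable]: "fst \<in> borel_measurable (borel :: ('a \<times> 'a) measure)" "snd \<in> borel_measurable (borel :: ('a \<times> 'a) measure)"
    by (simp_all add: borel_prod[symmetric])
  have f1n: "integrable lborel (\<lambda>x. cmod (f x))" using f1 by simp
  have u_int: "integrable lborel u"
  proof -
    have "integrable (lborel \<Otimes>\<^sub>M lborel) (\<lambda>(x, y). cnj (f x) * f y)"
    proof (rule lborel_pair.Fubini_integrable)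
      show "(\<lambda>(x, y). cnj (f x) * f y) \<in> borel_measurable (lborel \<Otimes>\<^sub>M lborel)" by measurable
      show "integrable lborel (\<lambda>x. LINT y|lborel. norm (case (x, y) of (x, y) \<Rightarrow> cnj (f x) * f y))"
        using f1n by (simp add: norm_mult)
      show "AE x in lborel. integrable lborel (\<lambda>y. case (x, y) of (x, y) \<Rightarrow> cnj (f x) * f y)"
        using f1 by simp
    qed
    then show ?thesis by (simp add: lborel_prod u_def[abs_def] split_beta')
  qed
  \<comment> \<open>A product of two integrals over \<open>x\<close> and \<open>y\<close> is written
    as a single integral over the pair \<open>p\<close>, so that it can be exchanged with the
    integral over \<open>k\<close>.\<close>
  have ft2: "complex_of_real ((cmod (fourier_L1 f k))\<^sup>2) =
      complex_of_real (?c\<^sup>2) * (LINT p|lborel. cis (k \<bullet> (fst p - snd p)) * u p)" for k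
  proof -
    let ?h = "\<lambda>x. cis (- (k \<bullet> x)) * f x"
    have hi: "integrable lborel ?h" by (intro integrable_cis_mult f1) simp
    have eq: "cis (k \<bullet> (x - y)) * (cnj (f x) * f y) = cnj (?h x) * ?h y" for x y
    proof -
      have "cis (k \<bullet> (x - y)) = cnj (cis (- (k \<bullet> x))) * cis (- (k \<bullet> y))"
        by (simp add: inner_diff_right cis_cnj cis_mult)
      then show ?thesis by (simp only: complex_cnj_mult mult_ac)
    qed
    have "(LINT p|lborel. cis (k \<bullet> (fst p - snd p)) * u p) = (LINT p|(lborel \<Otimes>\<^sub>M lborel). cnj (?h (fst p)) * ?h (snd p))"
      unfolding u_def eq lborel_prod ..
    also have "\<dots> = (LINT x|lborel. LINT y|lborel. cnj (?h x) * ?h y)"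
    proof (subst lborel_pair.integral_fst'[symmetric])
      have "integrable lborel (\<lambda>p. cis (k \<bullet> (fst p - snd p)) * u p)"
        by (intro integrable_cis_mult u_int) (simp flip: borel_prod)
      then show "integrable (lborel \<Otimes>\<^sub>M lborel) (\<lambda>p. cnj (?h (fst p)) * ?h (snd p))"
        unfolding u_def eq lborel_prod .
    qed simp
    also have "\<dots> = cnj (integral\<^sup>L lborel ?h) * integral\<^sup>L lborel ?h"
      by (simp only: integral_mult_right_zero integral_mult_left_zero Bochner_Integration.integral_cnj)
    also have "\<dots> = complex_of_real ((cmod (integral\<^sup>L lborel ?h))\<^sup>2)"
      by (rule trans[OF mult.commute complex_norm_square[symmetric]])
    finally have "(LINT p|lborel. cis (k \<bullet> (fst p - snd p)) * u p) = complex_of_real ((cmod (integral\<^sup>L lborel ?h))\<^sup>2)" .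
    then show ?thesis by (simp add: fourier_L1_def norm_mult power_mult_distrib)
  qed
  have gi: "integrable lborel (\<lambda>k::'a. gauss (e *\<^sub>R k))"
    using integrable_lborel_affine[OF gauss_integrable e, of 0] by simp
  have Fub: "integrable (lborel \<Otimes>\<^sub>M lborel) (\<lambda>(k, p). complex_of_real (gauss (e *\<^sub>R k)) * (cis (k \<bullet> (fst p - snd p)) * u p))"
  proof (rule lborel_pair.Fubini_integrable)
    show "(\<lambda>(k, p). complex_of_real (gauss (e *\<^sub>R k)) * (cis (k \<bullet> (fst p - snd p)) * u p)) \<in> borel_measurable (lborel \<Otimes>\<^sub>M lborel)"
      unfolding cis_conv_exp by measurable
    have "(LINT p|lborel. norm (complex_of_real (gauss (e *\<^sub>R k)) * (cis (k \<bullet> (fst p - snd p)) * u p)))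
        = gauss (e *\<^sub>R k) * (LINT p|lborel. norm (u p))" for k
      by (simp add: norm_mult)
    then show "integrable lborel (\<lambda>k. LINT p|lborel. norm (case (k, p) of (k, p) \<Rightarrow> complex_of_real (gauss (e *\<^sub>R k)) * (cis (k \<bullet> (fst p - snd p)) * u p)))"
      using gi by simp
    show "AE k in lborel. integrable lborel (\<lambda>p. case (k, p) of (k, p) \<Rightarrow> complex_of_real (gauss (e *\<^sub>R k)) * (cis (k \<bullet> (fst p - snd p)) * u p))"
      by (intro AE_I2) (simp only: prod.case, intro integrable_mult_right integrable_cis_mult u_int, measurable)
  qed
  let ?g = "\<lambda>v. complex_of_real (inverse e ^ DIM('a) * gauss (inverse e *\<^sub>R v))"
  have "(LINT k|lborel. complex_of_real ((cmod (fourier_L1 f k))\<^sup>2 * gauss (e *\<^sub>R k))) =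
      (LINT k|lborel. complex_of_real (?c\<^sup>2) * (LINT p|lborel. complex_of_real (gauss (e *\<^sub>R k)) * (cis (k \<bullet> (fst p - snd p)) * u p)))"
  proof (rule Bochner_Integration.integral_cong[OF refl])
    fix k
    show "complex_of_real ((cmod (fourier_L1 f k))\<^sup>2 * gauss (e *\<^sub>R k)) =
      complex_of_real (?c\<^sup>2) * (LINT p|lborel. complex_of_real (gauss (e *\<^sub>R k)) * (cis (k \<bullet> (fst p - snd p)) * u p))"
      unfolding of_real_mult[of "(cmod (fourier_L1 f k))\<^sup>2"] ft2 integral_mult_right_zero by (simp only: mult_ac)
  qed
  also have "\<dots> = complex_of_real (?c\<^sup>2) * (LINT k|lborel. LINT p|lborel. complex_of_real (gauss (e *\<^sub>R k)) * (cis (k \<bullet> (fst p - snd p)) * u p))"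
    by (rule integral_mult_right_zero)
  also have "(LINT k|lborel. LINT p|lborel. complex_of_real (gauss (e *\<^sub>R k)) * (cis (k \<bullet> (fst p - snd p)) * u p)) =
      (LINT p|lborel. LINT k|lborel. complex_of_real (gauss (e *\<^sub>R k)) * (cis (k \<bullet> (fst p - snd p)) * u p))"
    using lborel_pair.Fubini_integral[OF Fub] by simp
  also have "\<dots> = (LINT p|lborel. complex_of_real ((2 * pi) powr (real DIM('a) / 2)) * (?g (fst p - snd p) * u p))"
  proof (rule Bochner_Integration.integral_cong[OF refl])
    fix p :: "'a \<times> 'a"
    have "(LINT k|lborel. complex_of_real (gauss (e *\<^sub>R k)) * (cis (k \<bullet> (fst p - snd p)) * u p)) =
       (LINT k|lborel. (cis (k \<bullet> (fst p - snd p)) * complex_of_real (gauss (e *\<^sub>R k))) * u p)" by (simp add: mult_ac)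
    also have "\<dots> = (LINT k|lborel. cis (k \<bullet> (fst p - snd p)) * complex_of_real (gauss (e *\<^sub>R k))) * u p"
      by (rule integral_mult_left_zero)
    finally show "(LINT k|lborel. complex_of_real (gauss (e *\<^sub>R k)) * (cis (k \<bullet> (fst p - snd p)) * u p)) =
       complex_of_real ((2 * pi) powr (real DIM('a) / 2)) * (?g (fst p - snd p) * u p)"
      unfolding gauss_scaled_fourier[OF e] by (simp only: of_real_mult mult.assoc)
  qed
  also have "\<dots> = complex_of_real ((2 * pi) powr (real DIM('a) / 2)) * (LINT p|lborel. ?g (fst p - snd p) * u p)"
    by (rule integral_mult_right_zero)
  also have "(LINT p|lborel. ?g (fst p - snd p) * u p) = (LINT x|lborel. LINT y|lborel. ?g (x - y) * (cnj (f x) * f y))"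
  proof -
    have "integrable lborel (\<lambda>p. ?g (fst p - snd p) * u p)"
    proof (rule Bochner_Integration.integrable_bound)
      show "integrable lborel (\<lambda>p. (inverse e ^ DIM('a)) * norm (u p))" using u_int by simp
      show "(\<lambda>p. ?g (fst p - snd p) * u p) \<in> borel_measurable lborel" by measurable
      show "AE p in lborel. norm (?g (fst p - snd p) * u p) \<le> norm (inverse e ^ DIM('a) * norm (u p))"
      proof (rule AE_I2)
        fix p :: "'a \<times> 'a"
        have "norm (?g (fst p - snd p) * u p) = (inverse e ^ DIM('a) * gauss (inverse e *\<^sub>R (fst p - snd p))) * norm (u p)"
          unfolding norm_mult norm_of_real using e by simp
        also have "\<dots> \<le> (inverse e ^ DIM('a) * 1) * norm (u p)"
          by (intro mult_right_mono mult_left_mono gauss_le_1) (use e in simp_all)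
        finally show "norm (?g (fst p - snd p) * u p) \<le> norm (inverse e ^ DIM('a) * norm (u p))"
          using e by simp
      qed
    qed
    then have "integrable (lborel \<Otimes>\<^sub>M lborel) (\<lambda>p. ?g (fst p - snd p) * u p)" by (simp add: lborel_prod)
    from lborel_pair.integral_fst'[OF this] show ?thesis by (simp add: lborel_prod u_def)
  qed
  also have "\<dots> = (LINT x|lborel. cnj (f x) * weighted_translation (density lborel gauss) (\<lambda>_ _. 1) (\<lambda>z. e *\<^sub>R z) f x)"
  proof (rule Bochner_Integration.integral_cong[OF refl])
    fix x :: 'a
    have "(LINT y|lborel. ?g (x - y) * (cnj (f x) * f y)) = cnj (f x) * (LINT y|lborel. ?g (x - y) * f y)"
      by (subst integral_mult_right_zero[symmetric]) (simp only: mult.left_commute)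
    \<comment> \<open>Substitution \<open>y = x + e z\<close>: the Jacobian cancels the
      normalization of the kernel \<open>?g\<close> and leaves a standard Gaussian in
      \<open>z\<close>.\<close>
    also have "(LINT y|lborel. ?g (x - y) * f y) =
        complex_of_real (e ^ DIM('a)) * (LINT z|lborel. ?g (x - (x + e *\<^sub>R z)) * f (x + e *\<^sub>R z))"
      by (rule integral_lborel_affine[OF _ e]) measurable
    also have "\<dots> = (LINT z|lborel. gauss z *\<^sub>R f (x + e *\<^sub>R z))"
    proof -
      have "complex_of_real (e ^ DIM('a)) * (?g (x - (x + e *\<^sub>R z)) * f (x + e *\<^sub>R z)) = gauss z *\<^sub>R f (x + e *\<^sub>R z)" for z
        using e by (simp add: gauss_uminus scaleR_conv_of_real power_inverse)
      then show ?thesis by (simp only: integral_mult_right_zero[symmetric])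
    qed
    also have "\<dots> = weighted_translation (density lborel gauss) (\<lambda>_ _. 1) (\<lambda>z. e *\<^sub>R z) f x"
      unfolding weighted_translation_def by (subst integral_density) (auto simp: less_imp_le)
    finally show "(LINT y|lborel. ?g (x - y) * (cnj (f x) * f y)) =
        cnj (f x) * weighted_translation (density lborel gauss) (\<lambda>_ _. 1) (\<lambda>z. e *\<^sub>R z) f x" .
  qed
  also have "\<dots> = (LINT z|density lborel gauss. l2_inner f (\<lambda>x. f (x + e *\<^sub>R z)))"
    using tw.l2_inner_weighted_translation[OF f f] by (simp add: l2_inner_def)
  finally show ?thesis
    by (simp add: power2_eq_square powr_minus field_simps)
qed

text \<open>The regularization is removed by letting \<open>e\<close> tend to 0. On the Fourier side
  the damping factors increase to 1, so convergence is monotone; on the other side the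
  autocorrelations tend to the squared norm and are bounded by it.\<close>

lemma plancherel_L1:
  fixes f :: "'a::euclidean_space \<Rightarrow> complex"
  assumes f: "f \<in> l2" and f1: "integrable lborel f"
  shows "(\<integral>\<^sup>+k. ennreal ((cmod (fourier_L1 f k))\<^sup>2) \<partial>lborel) = ennreal ((norm (abs_L2 f))\<^sup>2)"
proof -
  interpret tw: translation_weight "density lborel (gauss :: 'a \<Rightarrow> real)" "\<lambda>_ _. 1" "\<lambda>z. z :: 'a" 1
    using translation_weight_gauss[of 1] by simp
  have [measurable]: "f \<in> borel_measurable borel" by (rule l2_measurable[OF f])
  let ?c = "fourier_const TYPE('a)"
  define e where "e n = inverse (real (Suc n))" for n
  have e: "e n > 0" for n by (simp add: e_def)
  have e0: "e \<longlonglongrightarrow> 0" unfolding e_def by (rule LIMSEQ_inverse_real_of_nat)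
  have edec: "m \<le> n \<Longrightarrow> e n \<le> e m" for m n by (simp add: e_def)
  let ?u = "\<lambda>n k. ennreal ((cmod (fourier_L1 f k))\<^sup>2 * gauss (e n *\<^sub>R k))"
  have lim1: "(\<lambda>n. \<integral>\<^sup>+k. ?u n k \<partial>lborel) \<longlonglongrightarrow> (\<integral>\<^sup>+k. ennreal ((cmod (fourier_L1 f k))\<^sup>2) \<partial>lborel)"
  proof (rule nn_integral_LIMSEQ)
    show "incseq ?u"
    proof (intro incseq_SucI le_funI ennreal_leI mult_left_mono)
      show "gauss (e n *\<^sub>R k) \<le> gauss (e (Suc n) *\<^sub>R k)" for n and k :: 'a
        using edec[of n "Suc n"] e[of "Suc n"] unfolding gauss_def
        by (auto intro!: power_mono mult_right_mono simp: power_mult_distrib)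
    qed simp
    show "(\<lambda>n. ?u n k) \<longlonglongrightarrow> ennreal ((cmod (fourier_L1 f k))\<^sup>2)" for k
    proof -
      have "(\<lambda>n. (cmod (fourier_L1 f k))\<^sup>2 * gauss (e n *\<^sub>R k)) \<longlonglongrightarrow> (cmod (fourier_L1 f k))\<^sup>2 * exp (- (norm (0 *\<^sub>R k))\<^sup>2 / 2)"
        unfolding gauss_def by (intro tendsto_intros e0) auto
      then show ?thesis by (intro tendsto_ennrealI) simp
    qed
  qed measurable
  have int: "integrable lborel (\<lambda>k. (cmod (fourier_L1 f k))\<^sup>2 * gauss (e n *\<^sub>R k))" for n
  proof (rule Bochner_Integration.integrable_bound)
    show "integrable lborel (\<lambda>k::'a. (?c * (LINT x|lborel. cmod (f x)))\<^sup>2 * gauss (e n *\<^sub>R k))"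
      using integrable_lborel_affine[OF gauss_integrable[where 'a='a] e[of n], of 0] by simp
    show "AE k in lborel. norm ((cmod (fourier_L1 f k))\<^sup>2 * gauss (e n *\<^sub>R k)) \<le> norm ((?c * (LINT x|lborel. cmod (f x)))\<^sup>2 * gauss (e n *\<^sub>R k))"
      using cmod_fourier_L1_le[of f] gauss_pos by (intro AE_I2) (auto simp: abs_mult intro!: mult_right_mono power_mono)
  qed measurable
  have eq: "(\<integral>\<^sup>+k. ?u n k \<partial>lborel) = ennreal (?c * Re (LINT z|density lborel gauss. l2_inner f (\<lambda>x. f (x + e n *\<^sub>R z))))" for n
  proof -
    have "(\<integral>\<^sup>+k. ?u n k \<partial>lborel) = ennreal (LINT k|lborel. (cmod (fourier_L1 f k))\<^sup>2 * gauss (e n *\<^sub>R k))"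
      by (intro nn_integral_eq_integral int) auto
    also have "(LINT k|lborel. (cmod (fourier_L1 f k))\<^sup>2 * gauss (e n *\<^sub>R k)) =
        Re (LINT k|lborel. complex_of_real ((cmod (fourier_L1 f k))\<^sup>2 * gauss (e n *\<^sub>R k)))"
      unfolding integral_complex_of_real by simp
    also have "\<dots> = ?c * Re (LINT z|density lborel gauss. l2_inner f (\<lambda>x. f (x + e n *\<^sub>R z)))"
      unfolding plancherel_regularized[OF f f1 e] by simp
    finally show ?thesis .
  qed
  have "(\<lambda>n. LINT z|density lborel gauss. l2_inner f (\<lambda>x. f (x + e n *\<^sub>R z))) \<longlonglongrightarrow> (LINT z|density lborel (gauss :: 'a \<Rightarrow> real). l2_inner f f)"
  proof (rule integral_dominated_convergence[where w="\<lambda>z. norm (abs_L2 f) * norm (abs_L2 f)"])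
    show "AE z in density lborel gauss. (\<lambda>n. l2_inner f (\<lambda>x. f (x + e n *\<^sub>R z))) \<longlonglongrightarrow> l2_inner f f"
    proof (rule AE_I2)
      fix z :: 'a
      have "(\<lambda>n. e n *\<^sub>R z) \<longlonglongrightarrow> 0" using tendsto_scaleR[OF e0 tendsto_const, of z] by simp
      then show "(\<lambda>n. l2_inner f (\<lambda>x. f (x + e n *\<^sub>R z))) \<longlonglongrightarrow> l2_inner f f"
        by (rule l2_inner_translate_tendsto[OF f f1])
    qed
    show "AE z in density lborel gauss. norm (l2_inner f (\<lambda>x. f (x + e n *\<^sub>R z))) \<le> norm (abs_L2 f) * norm (abs_L2 f)" for n
      using cmod_l2_inner_le[OF f l2_translate(1)[OF f]] l2_translate(2)[OF f] by (intro AE_I2) metis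
    show "(\<lambda>z. l2_inner f (\<lambda>x. f (x + e n *\<^sub>R z))) \<in> borel_measurable (density lborel gauss)" for n
      unfolding l2_inner_def by measurable
  qed simp_all
  then have limc: "(\<lambda>n. ?c * Re (LINT z|density lborel gauss. l2_inner f (\<lambda>x. f (x + e n *\<^sub>R z)))) \<longlonglongrightarrow>
      ?c * Re (LINT z|density lborel (gauss :: 'a \<Rightarrow> real). l2_inner f f)"
    by (intro tendsto_intros)
  \<comment> \<open>The total mass \<open>(2 * pi) powr (real DIM('a) / 2)\<close> of the Gaussian
    cancels the normalization \<open>?c\<close>.\<close>
  have ceq: "?c * Re (LINT z|density lborel (gauss :: 'a \<Rightarrow> real). l2_inner f f) = (norm (abs_L2 f))\<^sup>2"
  proof -
    have "measure (density lborel (gauss :: 'a \<Rightarrow> real)) UNIV = (LINT x|lborel. gauss (x::'a))"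
      by (simp add: measure_def emeasure_density nn_integral_eq_integral gauss_integrable less_imp_le integral_nonneg)
    then have "Re (LINT z|density lborel (gauss :: 'a \<Rightarrow> real). l2_inner f f) = (2 * pi) powr (real DIM('a) / 2) * (norm (abs_L2 f))\<^sup>2"
      by (simp add: gauss_integral l2_inner_self norm_abs_L2 f scaleR_conv_of_real)
    then show ?thesis by (simp add: powr_minus)
  qed
  have "(\<lambda>n. \<integral>\<^sup>+k. ?u n k \<partial>lborel) \<longlonglongrightarrow> ennreal ((norm (abs_L2 f))\<^sup>2)"
    unfolding eq by (intro tendsto_ennrealI limc[unfolded ceq])
  from LIMSEQ_unique[OF lim1 this] show ?thesis .
qed

section \<open>Bounded multiplication operators\<close>

definition mult_L2 :: "('a \<Rightarrow> complex) \<Rightarrow> 'a::euclidean_space L2 \<Rightarrow> 'a L2" where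
  "mult_L2 m F = abs_L2 (\<lambda>x. m x * rep_L2 F x)"

context
  fixes m :: "'a::euclidean_space \<Rightarrow> complex" and K :: real
  assumes m[measurable]: "m \<in> borel_measurable borel" and bd: "\<And>x. cmod (m x) \<le> K"
begin

lemma mult_L2_abs: "f \<in> l2 \<Longrightarrow> mult_L2 m (abs_L2 f) = abs_L2 (\<lambda>x. m x * f x)"
  unfolding mult_L2_def
  by (subst abs_L2_eq_iff) (auto intro!: l2_bdd_mult[OF _ m bd] elim: AE_mp[OF rep_abs_L2])

lemma mult_L2_add: "mult_L2 m (F + G) = mult_L2 m F + mult_L2 m G"
proof -
  have "F + G = abs_L2 (\<lambda>x. rep_L2 F x + rep_L2 G x)" by (simp add: abs_L2_add)
  then have "mult_L2 m (F + G) = abs_L2 (\<lambda>x. m x * rep_L2 F x + m x * rep_L2 G x)"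
    by (simp add: mult_L2_abs l2_add ring_distribs)
  then show ?thesis unfolding mult_L2_def by (subst (asm) abs_L2_add) (auto intro!: l2_bdd_mult[OF _ m bd])
qed

lemma mult_L2_scaleR: "mult_L2 m (r *\<^sub>R F) = r *\<^sub>R mult_L2 m F"
proof -
  have "r *\<^sub>R F = abs_L2 (\<lambda>x. r *\<^sub>R rep_L2 F x)" by (simp add: abs_L2_scaleR)
  then have "mult_L2 m (r *\<^sub>R F) = abs_L2 (\<lambda>x. r *\<^sub>R (m x * rep_L2 F x))"
    by (simp add: mult_L2_abs l2_scaleR)
  then show ?thesis unfolding mult_L2_def by (subst (asm) abs_L2_scaleR) (auto intro!: l2_bdd_mult[OF _ m bd])
qed

lemma mult_L2_iL2: "mult_L2 m (iL2 F) = iL2 (mult_L2 m F)"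
proof -
  have "iL2 F = abs_L2 (\<lambda>x. \<i> * rep_L2 F x)" by (simp add: abs_L2_i)
  then have "mult_L2 m (iL2 F) = abs_L2 (\<lambda>x. \<i> * (m x * rep_L2 F x))"
    by (simp add: mult_L2_abs l2_scale mult.left_commute)
  then show ?thesis unfolding mult_L2_def by (subst (asm) abs_L2_i) (auto intro!: l2_bdd_mult[OF _ m bd])
qed

lemma norm_mult_L2: "norm (mult_L2 m F) \<le> K * norm F"
proof (rule power2_le_imp_le)
  have K: "0 \<le> K" using bd[of 0] norm_ge_zero[of "m 0"] by linarith
  then show "0 \<le> K * norm F" by simp
  have "(norm (mult_L2 m F))\<^sup>2 = (LINT x|lborel. (cmod (m x * rep_L2 F x))\<^sup>2)"
    unfolding mult_L2_def by (rule norm_abs_L2) (rule l2_bdd_mult[OF _ m bd], simp)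
  also have "\<dots> \<le> (LINT x|lborel. K\<^sup>2 * (cmod (rep_L2 F x))\<^sup>2)"
  proof (rule integral_mono)
    show "integrable lborel (\<lambda>x. (cmod (m x * rep_L2 F x))\<^sup>2)"
      by (rule l2_integrable) (rule l2_bdd_mult[OF _ m bd], simp)
    show "integrable lborel (\<lambda>x. K\<^sup>2 * (cmod (rep_L2 F x))\<^sup>2)" using l2_integrable[of "rep_L2 F"] by simp
    show "(cmod (m x * rep_L2 F x))\<^sup>2 \<le> K\<^sup>2 * (cmod (rep_L2 F x))\<^sup>2" for x
      unfolding norm_mult power_mult_distrib using bd[of x] by (intro mult_right_mono power_mono) auto
  qed
  also have "\<dots> = (K * norm F)\<^sup>2"
    using norm_abs_L2[of "rep_L2 F"] by (simp add: power_mult_distrib)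
  finally show "(norm (mult_L2 m F))\<^sup>2 \<le> (K * norm F)\<^sup>2" .
qed

lemma bounded_linear_mult_L2: "bounded_linear (mult_L2 m)"
  by (rule bounded_linear_intro[where K=K]) (auto simp: mult_L2_add mult_L2_scaleR mult.commute[of "norm _"] norm_mult_L2)

end

section \<open>The Fourier transform as an isometry of the quotient\<close>

abbreviation ball_trunc :: "nat \<Rightarrow> ('a::euclidean_space \<Rightarrow> complex) \<Rightarrow> 'a \<Rightarrow> complex" where
  "ball_trunc n f \<equiv> (\<lambda>x. indicator (cball 0 (real n)) x * f x)"

lemma ball_trunc_l2: "f \<in> l2 \<Longrightarrow> ball_trunc n f \<in> l2"
  by (rule l2_bdd_mult[where K=1]) (auto simp: indicator_def)

lemma ball_trunc_integrable:
  assumes "f \<in> l2" shows "integrable lborel (ball_trunc n f)"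
proof (rule l2_integrable_mult[OF _ assms])
  show "(\<lambda>x::'a. indicator (cball 0 (real n)) x :: complex) \<in> l2"
    by (rule l2_bounded_support[where K=1 and r="real n"]) (auto simp: indicator_def)
qed

lemma fourier_L1_l2:
  assumes "f \<in> l2" "integrable lborel f"
  shows "fourier_L1 f \<in> l2" "norm (abs_L2 (fourier_L1 f)) = norm (abs_L2 f)"
proof -
  have [measurable]: "f \<in> borel_measurable borel" by (rule l2_measurable[OF assms(1)])
  show *: "fourier_L1 f \<in> l2"
    unfolding l2_iff_nn_integral plancherel_L1[OF assms] by simp
  show "norm (abs_L2 (fourier_L1 f)) = norm (abs_L2 f)"
    using plancherel_L1[OF assms] unfolding nn_integral_l2[OF *] by simp
qed

lemma fourier_L1_diff:
  assumes "integrable lborel f" "integrable lborel g"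
  shows "fourier_L1 (\<lambda>x. f x - g x) k = fourier_L1 f k - fourier_L1 g k"
  using fourier_L1_add[of f "\<lambda>x. (-1) * g x"] fourier_L1_scale[of "-1" g k] assms by simp

lemma norm_abs_fourier_L1_diff:
  assumes "f \<in> l2" "integrable lborel f" "g \<in> l2" "integrable lborel g"
  shows "norm (abs_L2 (fourier_L1 f) - abs_L2 (fourier_L1 g)) = norm (abs_L2 f - abs_L2 g)"
proof -
  have "norm (abs_L2 (fourier_L1 (\<lambda>x. f x - g x))) = norm (abs_L2 (\<lambda>x. f x - g x))"
    using assms by (intro fourier_L1_l2 l2_diff) auto
  moreover have "fourier_L1 (\<lambda>x. f x - g x) = (\<lambda>k. fourier_L1 f k - fourier_L1 g k)"
    using assms by (simp add: fourier_L1_diff fun_eq_iff)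
  ultimately show ?thesis using assms by (simp add: abs_L2_diff fourier_L1_l2)
qed

text \<open>The choice in \<open>fourier_L2\<close> has a witness: the truncations are Cauchy, the
  transform is isometric on integrable elements of \<open>l2\<close>, and the quotient is
  complete.\<close>

lemma fourier_L2:
  assumes f: "f \<in> l2"
  shows "fourier_L2 f \<in> l2" "(\<lambda>n. abs_L2 (fourier_L1 (ball_trunc n f))) \<longlonglongrightarrow> abs_L2 (fourier_L2 f)"
proof -
  let ?S = "\<lambda>n. abs_L2 (fourier_L1 (ball_trunc n f))"
  note t = ball_trunc_l2[OF f] ball_trunc_integrable[OF f]
  have "Cauchy (\<lambda>n. abs_L2 (ball_trunc n f))"
    using truncation_tendsto[OF f] by (auto intro: LIMSEQ_imp_Cauchy)
  then have "Cauchy ?S"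
    unfolding Cauchy_def dist_norm norm_abs_fourier_L1_diff[OF t t] .
  then obtain G where G: "?S \<longlonglongrightarrow> G" by (auto simp: Cauchy_convergent_iff convergent_def)
  have iff: "F \<in> l2 \<and> l2_tendsto (\<lambda>n. fourier_L1 (ball_trunc n f)) F \<longleftrightarrow> F \<in> l2 \<and> ?S \<longlonglongrightarrow> abs_L2 F" for F
    using l2_tendsto_iff[OF fourier_L1_l2(1)[OF t], of F] by auto
  have "\<exists>F. F \<in> l2 \<and> ?S \<longlonglongrightarrow> abs_L2 F" using G by (intro exI[of _ "rep_L2 G"]) simp
  from someI_ex[OF this] show "fourier_L2 f \<in> l2" "?S \<longlonglongrightarrow> abs_L2 (fourier_L2 f)"
    unfolding fourier_L2_def iff by auto
qed

text \<open>For integrable \<open>f\<close> the distance between the transforms of \<open>f\<close>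
  and of its truncations equals the distance between the functions, so both limits coincide.\<close>

lemma abs_fourier_L2_eq_L1:
  assumes f: "f \<in> l2" and f1: "integrable lborel f"
  shows "abs_L2 (fourier_L2 f) = abs_L2 (fourier_L1 f)"
proof -
  note t = ball_trunc_l2[OF f] ball_trunc_integrable[OF f]
  have "(\<lambda>n. norm (abs_L2 (fourier_L1 (ball_trunc n f)) - abs_L2 (fourier_L1 f))) \<longlonglongrightarrow> 0"
    unfolding norm_abs_fourier_L1_diff[OF t f f1]
    using truncation_tendsto[OF f] by (simp add: tendsto_norm_zero_iff LIM_zero_iff)
  then have "(\<lambda>n. abs_L2 (fourier_L1 (ball_trunc n f))) \<longlonglongrightarrow> abs_L2 (fourier_L1 f)"
    by (simp add: tendsto_norm_zero_iff LIM_zero_iff)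
  from LIMSEQ_unique[OF fourier_L2(2)[OF f] this] show ?thesis .
qed

definition fourier_op :: "'a::euclidean_space L2 \<Rightarrow> 'a L2" where
  "fourier_op F = abs_L2 (fourier_L2 (rep_L2 F))"

lemma fourier_op_abs:
  assumes f: "f \<in> l2" shows "fourier_op (abs_L2 f) = abs_L2 (fourier_L2 f)"
proof -
  have [measurable]: "f \<in> borel_measurable borel" by (rule l2_measurable[OF f])
  have "fourier_L1 (ball_trunc n (rep_L2 (abs_L2 f))) = fourier_L1 (ball_trunc n f)" for n
  proof (rule fourier_L1_cong_AE)
    show "AE x in lborel. ball_trunc n (rep_L2 (abs_L2 f)) x = ball_trunc n f x"
      using rep_abs_L2[OF f] by eventually_elim simp
  qed (auto intro!: l2_measurable ball_trunc_l2 f)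
  then show ?thesis
    using fourier_L2(2)[OF f] fourier_L2(2)[OF rep_L2_l2[of "abs_L2 f"]] unfolding fourier_op_def
    by (auto intro: LIMSEQ_unique)
qed

lemma norm_fourier_op [simp]: "norm (fourier_op F) = norm F"
proof -
  let ?f = "rep_L2 F"
  note t = ball_trunc_l2[OF rep_L2_l2[of F]] ball_trunc_integrable[OF rep_L2_l2[of F]]
  have "(\<lambda>n. norm (abs_L2 (fourier_L1 (ball_trunc n ?f)))) \<longlonglongrightarrow> norm (fourier_op F)"
    unfolding fourier_op_def by (intro tendsto_norm fourier_L2(2)) simp
  moreover have "(\<lambda>n. norm (abs_L2 (fourier_L1 (ball_trunc n ?f)))) \<longlonglongrightarrow> norm F"
    unfolding fourier_L1_l2(2)[OF t] using tendsto_norm[OF truncation_tendsto[OF rep_L2_l2[of F]]] by simp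
  ultimately show ?thesis by (rule LIMSEQ_unique)
qed

lemma abs_fourier_L2_add:
  assumes "f \<in> l2" "g \<in> l2"
  shows "abs_L2 (fourier_L2 (\<lambda>x. f x + g x)) = abs_L2 (fourier_L2 f) + abs_L2 (fourier_L2 g)"
proof -
  note t = ball_trunc_l2 ball_trunc_integrable
  have "fourier_L1 (ball_trunc n (\<lambda>x. f x + g x)) = (\<lambda>k. fourier_L1 (ball_trunc n f) k + fourier_L1 (ball_trunc n g) k)" for n
    by (rule ext, subst fourier_L1_add[symmetric]) (auto intro!: t assms simp: ring_distribs)
  then have "abs_L2 (fourier_L1 (ball_trunc n (\<lambda>x. f x + g x))) =
      abs_L2 (fourier_L1 (ball_trunc n f)) + abs_L2 (fourier_L1 (ball_trunc n g))" for n
    by (simp add: abs_L2_add fourier_L1_l2 t assms)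
  then have "(\<lambda>n. abs_L2 (fourier_L1 (ball_trunc n (\<lambda>x. f x + g x)))) \<longlonglongrightarrow> abs_L2 (fourier_L2 f) + abs_L2 (fourier_L2 g)"
    by (simp add: tendsto_add fourier_L2(2) assms)
  from LIMSEQ_unique[OF fourier_L2(2)[OF l2_add[OF assms]] this] show ?thesis .
qed

lemma abs_fourier_L2_scaleR:
  assumes f: "f \<in> l2"
  shows "abs_L2 (fourier_L2 (\<lambda>x. r *\<^sub>R f x)) = r *\<^sub>R abs_L2 (fourier_L2 f)"
proof -
  note t = ball_trunc_l2 ball_trunc_integrable
  have "fourier_L1 (ball_trunc n (\<lambda>x. r *\<^sub>R f x)) = (\<lambda>k. r *\<^sub>R fourier_L1 (ball_trunc n f) k)" for n
    unfolding scaleR_conv_of_real by (rule ext, subst fourier_L1_scale[symmetric]) (simp only: mult.left_commute)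
  then have "abs_L2 (fourier_L1 (ball_trunc n (\<lambda>x. r *\<^sub>R f x))) = r *\<^sub>R abs_L2 (fourier_L1 (ball_trunc n f))" for n
    by (simp add: abs_L2_scaleR fourier_L1_l2 t f)
  then have "(\<lambda>n. abs_L2 (fourier_L1 (ball_trunc n (\<lambda>x. r *\<^sub>R f x)))) \<longlonglongrightarrow> r *\<^sub>R abs_L2 (fourier_L2 f)"
    by (simp add: tendsto_scaleR[OF tendsto_const] fourier_L2(2) f)
  from LIMSEQ_unique[OF fourier_L2(2)[OF l2_scaleR[OF f]] this] show ?thesis .
qed

lemma bounded_linear_fourier_op: "bounded_linear fourier_op"
proof (rule bounded_linear_intro[where K=1])
  fix F G :: "'a L2" and r :: real
  have "F + G = abs_L2 (\<lambda>x. rep_L2 F x + rep_L2 G x)" by (simp add: abs_L2_add)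
  then show "fourier_op (F + G) = fourier_op F + fourier_op G"
    by (simp add: fourier_op_abs l2_add abs_fourier_L2_add) (simp add: fourier_op_def)
  have "r *\<^sub>R F = abs_L2 (\<lambda>x. r *\<^sub>R rep_L2 F x)" by (simp add: abs_L2_scaleR)
  then show "fourier_op (r *\<^sub>R F) = r *\<^sub>R fourier_op F"
    by (simp add: fourier_op_abs l2_scaleR abs_fourier_L2_scaleR) (simp add: fourier_op_def)
qed simp

text \<open>Expand the norm of \<open>F + G\<close>: a linear map that preserves norms preserves the
  real inner product.\<close>

lemma inner_fourier_op: "inner (fourier_op F) (fourier_op G) = inner F G"
proof -
  interpret bounded_linear fourier_op by (rule bounded_linear_fourier_op)
  have "(norm (fourier_op (F + G)))\<^sup>2 = (norm (F + G))\<^sup>2" by simp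
  then show ?thesis
    unfolding add power2_norm_eq_inner inner_add_left inner_add_right
    using norm_fourier_op[of F] norm_fourier_op[of G] by (simp add: norm_eq_sqrt_inner inner_commute)
qed

lemma fourier_op_inject: "fourier_op F = fourier_op G \<longleftrightarrow> F = G"
proof
  interpret bounded_linear fourier_op by (rule bounded_linear_fourier_op)
  assume "fourier_op F = fourier_op G"
  then have "fourier_op (F - G) = 0" by (simp add: diff)
  then have "norm (F - G) = 0" using norm_fourier_op[of "F - G"] by simp
  then show "F = G" by simp
qed simp

text \<open>The convolution theorem: averaging over random shifts \<open>Y\<close> becomes
  multiplication by the characteristic function of \<open>Y\<close> under \<open>Q\<close>. Fubini
  proves it for integrable elements of \<open>l2\<close>; both sides are bounded operators, so
  truncations carry it to all of L2.\<close>

lemma fourier_translation_op: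
  fixes Y :: "'b \<Rightarrow> 'a::euclidean_space"
  assumes "translation_weight Q (\<lambda>_ _. 1) Y 1"
  defines "m k \<equiv> (LINT w|Q. cis (k \<bullet> Y w))"
  shows "fourier_op (translation_op Q (\<lambda>_ _. 1) Y F) = mult_L2 m (fourier_op F)"
proof -
  interpret tw: translation_weight Q "\<lambda>_ _. 1" Y 1 by fact
  let ?T = "weighted_translation Q (\<lambda>_ _. 1) Y"
  have m_meas[measurable]: "m \<in> borel_measurable borel"
    unfolding m_def[abs_def] cis_conv_exp by measurable
  have m_bd: "cmod (m k) \<le> measure Q (space Q)" for k
    unfolding m_def using integral_norm_bound[of Q "\<lambda>w. cis (k \<bullet> Y w)"] by simp
  have L1: "integrable lborel (?T f)" "fourier_L1 (?T f) k = m k * fourier_L1 f k"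
    if f: "f \<in> l2" and f1: "integrable lborel f" for f k
  proof -
    have [measurable]: "f \<in> borel_measurable borel" by (rule l2_measurable[OF f])
    have i: "integrable (lborel \<Otimes>\<^sub>M Q) (\<lambda>(x, w). f (x + Y w))"
    proof (subst integrable_iff_bounded, intro conjI)
      have "(\<integral>\<^sup>+z. ennreal (norm (case z of (x, w) \<Rightarrow> f (x + Y w))) \<partial>(lborel \<Otimes>\<^sub>M Q)) =
         (\<integral>\<^sup>+x. \<integral>\<^sup>+w. ennreal (cmod (f (x + Y w))) \<partial>Q \<partial>lborel)"
        by (subst tw.nn_integral_fst[symmetric]) (auto simp: split_beta')
      also have "\<dots> < \<infinity>"
        using f1 by (subst tw.nn_integral_translate)
          (auto simp: tw.emeasure_eq_measure integrable_iff_bounded ennreal_mult_less_top)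
      finally show "(\<integral>\<^sup>+z. ennreal (norm (case z of (x, w) \<Rightarrow> f (x + Y w))) \<partial>(lborel \<Otimes>\<^sub>M Q)) < \<infinity>" .
    qed measurable
    show "integrable lborel (?T f)"
      using tw.P.integrable_fst'[OF i] unfolding weighted_translation_def by simp
    have ic: "integrable (lborel \<Otimes>\<^sub>M Q) (\<lambda>(x, w). cis (- (k \<bullet> x)) * f (x + Y w))"
      using integrable_cis_mult[OF i, of "\<lambda>p. - (k \<bullet> fst p)"] by (simp add: split_beta')
    have "(LINT x|lborel. cis (- (k \<bullet> x)) * ?T f x) = (LINT x|lborel. LINT w|Q. cis (- (k \<bullet> x)) * f (x + Y w))"
      unfolding weighted_translation_def by simp
    also have "\<dots> = (LINT w|Q. LINT x|lborel. cis (- (k \<bullet> x)) * f (x + Y w))"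
      using tw.P.Fubini_integral[OF ic] by simp
    also have "\<dots> = (LINT w|Q. cis (k \<bullet> Y w) * (LINT x|lborel. cis (- (k \<bullet> x)) * f x))"
    proof (rule Bochner_Integration.integral_cong[OF refl])
      fix w
      have "cis (k \<bullet> Y w) * (LINT x|lborel. cis (- (k \<bullet> x)) * f x) = (LINT x|lborel. cis (k \<bullet> Y w) * (cis (- (k \<bullet> x)) * f x))"
        by (rule integral_mult_right_zero[symmetric])
      \<comment> \<open>The affine substitution is used with scale 1, that is, as translation by
        \<open>Y w\<close>.\<close>
      also have "\<dots> = complex_of_real (1 ^ DIM('a)) *
          (LINT x|lborel. cis (k \<bullet> Y w) * (cis (- (k \<bullet> (Y w + 1 *\<^sub>R x))) * f (Y w + 1 *\<^sub>R x)))"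
        by (rule integral_lborel_affine) (simp_all add: cis_conv_exp)
      also have "\<dots> = (LINT x|lborel. cis (- (k \<bullet> x)) * f (x + Y w))"
        by (simp add: mult.assoc[symmetric] cis_mult inner_add_right add.commute)
      finally show "(LINT x|lborel. cis (- (k \<bullet> x)) * f (x + Y w)) = cis (k \<bullet> Y w) * (LINT x|lborel. cis (- (k \<bullet> x)) * f x)" ..
    qed
    also have "\<dots> = m k * (LINT x|lborel. cis (- (k \<bullet> x)) * f x)" unfolding m_def by (rule integral_mult_left_zero)
    finally show "fourier_L1 (?T f) k = m k * fourier_L1 f k"
      by (simp add: fourier_L1_def)
  qed
  let ?f = "rep_L2 F"
  let ?t = "\<lambda>n. ball_trunc n ?f"
  note t = ball_trunc_l2[OF rep_L2_l2[of F]] ball_trunc_integrable[OF rep_L2_l2[of F]]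
  have eq: "fourier_op (translation_op Q (\<lambda>_ _. 1) Y (abs_L2 (?t n))) = mult_L2 m (abs_L2 (fourier_L1 (?t n)))" for n
  proof -
    have "fourier_op (translation_op Q (\<lambda>_ _. 1) Y (abs_L2 (?t n))) = abs_L2 (fourier_L1 (?T (?t n)))"
      by (simp only: tw.translation_op_abs[OF t(1)] fourier_op_abs[OF tw.weighted_translation_l2[OF t(1)]]
          abs_fourier_L2_eq_L1[OF tw.weighted_translation_l2[OF t(1)] L1(1)[OF t]])
    also have "fourier_L1 (?T (?t n)) = (\<lambda>k. m k * fourier_L1 (?t n) k)" by (rule ext) (rule L1(2)[OF t])
    also have "abs_L2 \<dots> = mult_L2 m (abs_L2 (fourier_L1 (?t n)))"
      by (rule mult_L2_abs[OF m_meas m_bd, symmetric]) (rule fourier_L1_l2[OF t])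
    finally show ?thesis .
  qed
  have "(\<lambda>n. fourier_op (translation_op Q (\<lambda>_ _. 1) Y (abs_L2 (?t n)))) \<longlonglongrightarrow> fourier_op (translation_op Q (\<lambda>_ _. 1) Y F)"
    using truncation_tendsto[OF rep_L2_l2[of F]]
    by (intro bounded_linear.tendsto[OF bounded_linear_fourier_op] bounded_linear.tendsto[OF tw.bounded_linear_translation_op]) simp
  moreover have "(\<lambda>n. mult_L2 m (abs_L2 (fourier_L1 (?t n)))) \<longlonglongrightarrow> mult_L2 m (fourier_op F)"
    unfolding fourier_op_def
    by (intro bounded_linear.tendsto[OF bounded_linear_mult_L2[OF m_meas m_bd]] fourier_L2(2)) simp
  ultimately show ?thesis unfolding eq by (rule LIMSEQ_unique)
qed

section \<open>Real projection-valued measures\<close>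

text \<open>The list stands for the signed measure with terms \<open>c\<close>, \<open>M\<close> and
  density \<open>k\<close>. A signed measure that vanishes on every set integrates every admissible
  function to 0; this uniqueness principle replaces complex measures in all later comparisons of
  spectral integrals.\<close>

lemma signed_integral_zero_nonneg:
  fixes L :: "(real \<times> 'a measure \<times> ('a \<Rightarrow> real)) list" and \<phi> :: "'a \<Rightarrow> real"
  assumes L: "\<And>c M k. (c, M, k) \<in> set L \<Longrightarrow> sets M = sets N \<and> integrable M k"
    and zero: "\<And>B. B \<in> sets N \<Longrightarrow> (\<Sum>(c, M, k)\<leftarrow>L. c * (LINT x|M. indicator B x * k x)) = 0"
    and phi: "\<phi> \<in> borel_measurable N" "\<And>x. 0 \<le> \<phi> x"
    and int: "\<And>c M k. (c, M, k) \<in> set L \<Longrightarrow> integrable M (\<lambda>x. \<phi> x * k x)"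
  shows "(\<Sum>(c, M, k)\<leftarrow>L. c * (LINT x|M. \<phi> x * k x)) = 0"
proof -
  let ?I = "\<lambda>u. \<forall>(c, M, k)\<in>set L. integrable M (\<lambda>x. u x * k x)"
  \<comment> \<open>Integrability descends from \<open>v\<close> to any smaller nonnegative
    \<open>u\<close>; this supplies it to summands and approximants in the induction.\<close>
  have dom: "?I u" if I: "?I v" and le: "\<And>x. 0 \<le> u x" "\<And>x. x \<in> space N \<Longrightarrow> u x \<le> v x" and u: "u \<in> borel_measurable N" for u v
  proof safe
    fix c M k assume cMk: "(c, M, k) \<in> set L"
    have sp: "space M = space N" by (rule sets_eq_imp_space_eq[OF conjunct1[OF L[OF cMk]]])
    have [measurable]: "u \<in> borel_measurable M" "k \<in> borel_measurable M"
      using u L[OF cMk] by (auto simp: measurable_cong_sets[of M N borel borel])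
    show "integrable M (\<lambda>x. u x * k x)"
    proof (rule Bochner_Integration.integrable_bound)
      show "integrable M (\<lambda>x. v x * k x)" using I cMk by auto
      show "AE x in M. norm (u x * k x) \<le> norm (v x * k x)"
      proof (rule AE_I2)
        fix x assume "x \<in> space M"
        then have "\<bar>u x\<bar> \<le> \<bar>v x\<bar>" using le(1)[of x] le(2)[of x] sp by simp
        then show "norm (u x * k x) \<le> norm (v x * k x)" by (simp add: abs_mult mult_right_mono)
      qed
    qed measurable
  qed
  \<comment> \<open>Integrability is a premise inside the induction claim because it has to be
    rederived for each function from which the current one is built.\<close>
  have "?I \<phi> \<longrightarrow> (\<Sum>(c, M, k)\<leftarrow>L. c * (LINT x|M. \<phi> x * k x)) = 0"
    using phi
  proof (induction rule: borel_measurable_induct_real)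
    case (set A)
    then show ?case using zero by simp
  next
    case (mult u c)
    show ?case
    proof
      assume I: "?I (\<lambda>x. c * u x)"
      show "(\<Sum>(d, M, k)\<leftarrow>L. d * (LINT x|M. c * u x * k x)) = 0"
      proof (cases "c = 0")
        case False
        then have "?I u" using I by (auto simp: mult.assoc)
        with mult have "(\<Sum>(d, M, k)\<leftarrow>L. d * (LINT x|M. u x * k x)) = 0" by simp
        moreover have "(\<Sum>(d, M, k)\<leftarrow>L. d * (LINT x|M. c * u x * k x)) = c * (\<Sum>(d, M, k)\<leftarrow>L. d * (LINT x|M. u x * k x))"
          unfolding sum_list_const_mult[symmetric]
          by (intro arg_cong[where f=sum_list] map_cong refl) (auto simp: mult.assoc mult.left_commute)
        ultimately show ?thesis by simp
      qed (auto simp: split_beta' intro!: sum_list_0)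
    qed
  next
    case (add u v)
    show ?case
    proof
      assume I: "?I (\<lambda>x. v x + u x)"
      have Iu: "?I u" by (rule dom[OF I]) (use add in auto)
      have Iv: "?I v" by (rule dom[OF I]) (use add in auto)
      have "(\<Sum>(c, M, k)\<leftarrow>L. c * (LINT x|M. (v x + u x) * k x)) =
         (\<Sum>z\<leftarrow>L. (case z of (c, M, k) \<Rightarrow> c * (LINT x|M. v x * k x)) + (case z of (c, M, k) \<Rightarrow> c * (LINT x|M. u x * k x)))"
      proof (intro arg_cong[where f=sum_list] map_cong refl)
        fix z assume "z \<in> set L"
        obtain c M k where z: "z = (c, M, k)" by (metis prod_cases3)
        with \<open>z \<in> set L\<close> Iu Iv have "integrable M (\<lambda>x. v x * k x)" "integrable M (\<lambda>x. u x * k x)" by auto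
        then show "(case z of (c, M, k) \<Rightarrow> c * (LINT x|M. (v x + u x) * k x)) =
           (case z of (c, M, k) \<Rightarrow> c * (LINT x|M. v x * k x)) + (case z of (c, M, k) \<Rightarrow> c * (LINT x|M. u x * k x))"
          by (simp add: z distrib_right distrib_left)
      qed
      then show "(\<Sum>(c, M, k)\<leftarrow>L. c * (LINT x|M. (v x + u x) * k x)) = 0"
        using add Iu Iv by (simp add: sum_list_addf)
    qed
  next
    case (seq U)
    show ?case
    proof
      assume I: "?I \<phi>"
      have le: "x \<in> space N \<Longrightarrow> U i x \<le> \<phi> x" for i x
        using incseq_le[of "\<lambda>i. U i x" "\<phi> x" i] seq by (auto simp: incseq_def le_fun_def)
      have IU: "?I (U i)" for i by (rule dom[OF I]) (use seq le in auto)
      have lim: "(\<lambda>i. LINT x|M. U i x * k x) \<longlonglongrightarrow> (LINT x|M. \<phi> x * k x)" if cMk: "(c, M, k) \<in> set L" for c M k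
      proof (rule integral_dominated_convergence[where w="\<lambda>x. \<bar>\<phi> x * k x\<bar>"])
        have sp: "space M = space N" by (rule sets_eq_imp_space_eq[OF conjunct1[OF L[OF cMk]]])
        show "(\<lambda>x. \<phi> x * k x) \<in> borel_measurable M" "integrable M (\<lambda>x. \<bar>\<phi> x * k x\<bar>)"
          using I cMk by auto
        show "(\<lambda>x. U i x * k x) \<in> borel_measurable M" for i using IU[of i] cMk by auto
        show "AE x in M. (\<lambda>i. U i x * k x) \<longlonglongrightarrow> \<phi> x * k x"
          using seq sp by (intro AE_I2 tendsto_intros) auto
        show "AE x in M. norm (U i x * k x) \<le> \<bar>\<phi> x * k x\<bar>" for i
        proof (rule AE_I2)
          fix x assume "x \<in> space M"
          then have "\<bar>U i x\<bar> \<le> \<bar>\<phi> x\<bar>" using le[of x i] seq(2)[of i x] sp by simp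
          then show "norm (U i x * k x) \<le> \<bar>\<phi> x * k x\<bar>" by (simp add: abs_mult mult_right_mono)
        qed
      qed
      have "(\<lambda>i. \<Sum>(c, M, k)\<leftarrow>L. c * (LINT x|M. U i x * k x)) \<longlonglongrightarrow> (\<Sum>(c, M, k)\<leftarrow>L. c * (LINT x|M. \<phi> x * k x))"
        using lim
      proof (induction L)
        case (Cons z L)
        obtain c M k where z: "z = (c, M, k)" by (metis prod_cases3)
        have "(\<lambda>i. c * (LINT x|M. U i x * k x)) \<longlonglongrightarrow> c * (LINT x|M. \<phi> x * k x)"
          by (intro tendsto_intros Cons.prems[of c]) (simp add: z)
        moreover have "(\<lambda>i. \<Sum>(c, M, k)\<leftarrow>L. c * (LINT x|M. U i x * k x)) \<longlonglongrightarrow> (\<Sum>(c, M, k)\<leftarrow>L. c * (LINT x|M. \<phi> x * k x))"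
          by (rule Cons.IH) (erule Cons.prems[OF list.set_intros(2)])
        ultimately show ?case by (simp add: z tendsto_add)
      qed simp
      moreover have "(\<Sum>(c, M, k)\<leftarrow>L. c * (LINT x|M. U i x * k x)) = 0" for i using seq.IH[of i] IU[of i] by blast
      ultimately show "(\<Sum>(c, M, k)\<leftarrow>L. c * (LINT x|M. \<phi> x * k x)) = 0" by (simp add: LIMSEQ_const_iff)
    qed
  qed
  then show ?thesis using int by auto
qed

text \<open>The cases \<open>s = 1\<close> and \<open>s = -1\<close> of
  \<open>max 0 (s * \<phi> x)\<close> are the positive and negative parts, both dominated by the
  absolute value of \<open>\<phi>\<close>.\<close>

lemma signed_integral_zero:
  fixes L :: "(real \<times> 'a measure \<times> ('a \<Rightarrow> real)) list" and \<phi> :: "'a \<Rightarrow> real"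
  assumes L: "\<And>c M k. (c, M, k) \<in> set L \<Longrightarrow> sets M = sets N \<and> integrable M k"
    and zero: "\<And>B. B \<in> sets N \<Longrightarrow> (\<Sum>(c, M, k)\<leftarrow>L. c * (LINT x|M. indicator B x * k x)) = 0"
    and phi: "\<phi> \<in> borel_measurable N"
    and int: "\<And>c M k. (c, M, k) \<in> set L \<Longrightarrow> integrable M (\<lambda>x. \<phi> x * k x)"
  shows "(\<Sum>(c, M, k)\<leftarrow>L. c * (LINT x|M. \<phi> x * k x)) = 0"
proof -
  have I: "integrable M (\<lambda>x. max 0 (s * \<phi> x) * k x)" if cMk: "(c, M, k) \<in> set L" and s: "\<bar>s\<bar> = 1" for c M k s
  proof (rule Bochner_Integration.integrable_bound[OF int[OF cMk]])
    have "\<phi> \<in> borel_measurable M" "k \<in> borel_measurable M"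
      using phi L[OF cMk] by (auto simp: measurable_cong_sets[of M N borel borel])
    then show "(\<lambda>x. max 0 (s * \<phi> x) * k x) \<in> borel_measurable M" by measurable
    show "AE x in M. norm (max 0 (s * \<phi> x) * k x) \<le> norm (\<phi> x * k x)"
    proof (rule AE_I2)
      fix x
      have "\<bar>max 0 (s * \<phi> x)\<bar> \<le> \<bar>\<phi> x\<bar>"
        using s by (cases "s \<ge> 0") (auto simp: max_def)
      then show "norm (max 0 (s * \<phi> x) * k x) \<le> norm (\<phi> x * k x)" by (simp add: abs_mult mult_right_mono)
    qed
  qed
  have Z: "(\<Sum>(c, M, k)\<leftarrow>L. c * (LINT x|M. max 0 (s * \<phi> x) * k x)) = 0" if "\<bar>s\<bar> = 1" for s
    by (rule signed_integral_zero_nonneg[OF L zero]) (use phi I[OF _ that] in auto)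
  have "(\<Sum>(c, M, k)\<leftarrow>L. c * (LINT x|M. \<phi> x * k x)) =
     (\<Sum>z\<leftarrow>L. (case z of (c, M, k) \<Rightarrow> c * (LINT x|M. max 0 (1 * \<phi> x) * k x)) - (case z of (c, M, k) \<Rightarrow> c * (LINT x|M. max 0 ((-1) * \<phi> x) * k x)))"
  proof (intro arg_cong[where f=sum_list] map_cong refl)
    fix z assume zL: "z \<in> set L"
    obtain c M k where z: "z = (c, M, k)" by (metis prod_cases3)
    have "(LINT x|M. \<phi> x * k x) = (LINT x|M. max 0 (1 * \<phi> x) * k x - max 0 ((-1) * \<phi> x) * k x)"
      by (intro Bochner_Integration.integral_cong) (auto simp: max_def)
    also have "\<dots> = (LINT x|M. max 0 (1 * \<phi> x) * k x) - (LINT x|M. max 0 ((-1) * \<phi> x) * k x)"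
      using zL by (intro Bochner_Integration.integral_diff I) (auto simp: z)
    finally show "(case z of (c, M, k) \<Rightarrow> c * (LINT x|M. \<phi> x * k x)) =
      (case z of (c, M, k) \<Rightarrow> c * (LINT x|M. max 0 (1 * \<phi> x) * k x)) - (case z of (c, M, k) \<Rightarrow> c * (LINT x|M. max 0 ((-1) * \<phi> x) * k x))"
      by (simp only: z prod.case right_diff_distrib)
  qed
  also have "\<dots> = 0" unfolding sum_list_subtractf using Z[of 1] Z[of "-1"] by simp
  finally show ?thesis .
qed

text \<open>The axioms of \<open>projection_valued_measure\<close> on a real inner product space,
  with equality in place of almost everywhere equality. Both the projections built from a
  contraction and those of a given resolution are instances.\<close>

locale real_pvm =
  fixes E :: "real set \<Rightarrow> 'h::real_inner \<Rightarrow> 'h"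
  assumes sym: "B \<in> sets borel \<Longrightarrow> inner x (E B y) = inner (E B x) y"
    and mult: "A \<in> sets borel \<Longrightarrow> B \<in> sets borel \<Longrightarrow> E A (E B x) = E (A \<inter> B) x"
    and E_UNIV: "E UNIV x = x"
    and sums: "range F \<subseteq> sets borel \<Longrightarrow> disjoint_family F \<Longrightarrow> (\<lambda>n. \<Sum>i<n. E (F i) x) \<longlonglongrightarrow> E (\<Union>i. F i) x"
begin

text \<open>A vector is determined by its inner products, so linearity of \<open>E B\<close> follows
  from its symmetry.\<close>

lemma E_add: "B \<in> sets borel \<Longrightarrow> E B (x + y) = E B x + E B y"
  by (subst vector_eq_rdot[symmetric]) (simp add: sym[symmetric] inner_add_left)

lemma E_scaleR: "B \<in> sets borel \<Longrightarrow> E B (r *\<^sub>R x) = r *\<^sub>R E B x"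
  by (subst vector_eq_rdot[symmetric]) (simp add: sym[symmetric])

lemma E_minus: "B \<in> sets borel \<Longrightarrow> E B (- x) = - E B x"
  using E_scaleR[of B "-1" x] by simp

lemma E_diff: "B \<in> sets borel \<Longrightarrow> E B (x - y) = E B x - E B y"
  using E_add[of B x "- y"] by (simp add: E_minus)

text \<open>The constant series of \<open>E {} x\<close> converges, hence its terms tend to
  0.\<close>

lemma E_empty: "E {} x = 0"
proof -
  have "(\<lambda>n. \<Sum>i<n. E {} x) \<longlonglongrightarrow> E {} x"
    using sums[of "\<lambda>_::nat. {}" x] by (simp add: disjoint_family_on_def)
  then have 1: "(\<lambda>n. (\<Sum>i<Suc n. E {} x) - (\<Sum>i<n. E {} x)) \<longlonglongrightarrow> E {} x - E {} x"
    by (intro tendsto_diff LIMSEQ_Suc)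
  have "(\<lambda>n::nat. E {} x) \<longlonglongrightarrow> 0" using 1 by simp
  then show ?thesis by (simp only: LIMSEQ_const_iff)
qed

lemma inner_E_self: "B \<in> sets borel \<Longrightarrow> inner x (E B x) = (norm (E B x))\<^sup>2"
  using mult[of B B x] by (simp add: power2_norm_eq_inner sym[symmetric])

definition \<mu> :: "'h \<Rightarrow> real measure" where
  "\<mu> x = measure_of UNIV (sets borel) (\<lambda>B. ennreal (inner x (E B x)))"

lemma sets_mu [simp, measurable_cong]: "sets (\<mu> x) = sets borel"
  using sets.sigma_sets_eq[of "borel :: real measure"] by (simp add: \<mu>_def)

lemma space_mu [simp]: "space (\<mu> x) = UNIV"
  by (simp add: \<mu>_def)

lemma emeasure_mu: "B \<in> sets borel \<Longrightarrow> emeasure (\<mu> x) B = ennreal (inner x (E B x))"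
proof (rule emeasure_measure_of[OF \<mu>_def])
  show "positive (sets (\<mu> x)) (\<lambda>B. ennreal (inner x (E B x)))"
    by (simp add: positive_def E_empty)
  show "countably_additive (sets (\<mu> x)) (\<lambda>B. ennreal (inner x (E B x)))"
  proof (rule countably_additiveI)
    fix A :: "nat \<Rightarrow> real set" assume A: "range A \<subseteq> sets (\<mu> x)" "disjoint_family A"
    have "(\<lambda>n. inner x (\<Sum>i<n. E (A i) x)) \<longlonglongrightarrow> inner x (E (\<Union>i. A i) x)"
      using A by (intro tendsto_intros sums) auto
    then have "(\<lambda>i. inner x (E (A i) x)) sums inner x (E (\<Union>i. A i) x)"
      by (simp add: sums_def inner_sum_right)
    then show "(\<Sum>i. ennreal (inner x (E (A i) x))) = ennreal (inner x (E (\<Union>i. A i) x))"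
      using A by (intro suminf_ennreal_eq) (auto simp: inner_E_self)
  qed
qed (auto dest: sets.sets_into_space)

sublocale mu: finite_measure "\<mu> x" for x
  by (rule finite_measureI) (simp add: emeasure_mu E_UNIV)

lemma measure_mu: "B \<in> sets borel \<Longrightarrow> measure (\<mu> x) B = inner x (E B x)"
  by (simp add: measure_def emeasure_mu inner_E_self)

lemma mu_cong: "(\<And>B. B \<in> sets borel \<Longrightarrow> inner x (E B x) = inner y (E B y)) \<Longrightarrow> \<mu> x = \<mu> y"
  by (rule measure_eqI) (simp_all add: emeasure_mu)

lemma mu_minus: "\<mu> (- x) = \<mu> x"
  by (rule mu_cong) (simp add: E_minus)

text \<open>The integral of \<open>\<phi>\<close> against the signed measure sending
  \<open>B\<close> to \<open>inner x (E B y)\<close>, expressed by real polarization so that only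
  the positive measures \<open>\<mu>\<close> occur.\<close>

definition bform :: "(real \<Rightarrow> real) \<Rightarrow> 'h \<Rightarrow> 'h \<Rightarrow> real" where
  "bform \<phi> x y = ((LINT r|\<mu> (x + y). \<phi> r) - (LINT r|\<mu> (x - y). \<phi> r)) / 4"

lemma inner_E_polar:
  "B \<in> sets borel \<Longrightarrow> inner x (E B y) = (inner (x + y) (E B (x + y)) - inner (x - y) (E B (x - y))) / 4"
proof -
  assume B: "B \<in> sets borel"
  have "inner y (E B x) = inner x (E B y)" using sym[OF B, of y x] by (simp add: inner_commute)
  then show ?thesis by (simp add: E_add E_diff B inner_add_left inner_add_right inner_diff_left inner_diff_right)
qed

lemma bform_indicator: "B \<in> sets borel \<Longrightarrow> bform (indicator B) x y = inner x (E B y)"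
  unfolding bform_def by (subst inner_E_polar) (simp_all add: measure_mu)

lemma integrable_mu_bounded:
  fixes \<phi> :: "real \<Rightarrow> real"
  shows "\<phi> \<in> borel_measurable borel \<Longrightarrow> (\<And>r. \<bar>\<phi> r\<bar> \<le> K) \<Longrightarrow> integrable (\<mu> x) \<phi>"
  by (rule mu.integrable_const_bound[where B=K]) (auto simp: measurable_cong_sets[of "\<mu> x" borel borel borel])

text \<open>For indicators this is the parallelogram law for the quadratic form of a projection. Its
  use is that integrability under \<open>\<mu> x\<close> and \<open>\<mu> y\<close> passes to
  \<open>\<mu> (x + y)\<close> and \<open>\<mu> (x - y)\<close>, so that both halves of a
  \<open>bform\<close> make sense.\<close>

lemma nn_integral_parallelogram:
  assumes "\<phi> \<in> borel_measurable borel"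
  shows "(\<integral>\<^sup>+r. \<phi> r \<partial>\<mu> (x + y)) + (\<integral>\<^sup>+r. \<phi> r \<partial>\<mu> (x - y)) = 2 * (\<integral>\<^sup>+r. \<phi> r \<partial>\<mu> x) + 2 * (\<integral>\<^sup>+r. \<phi> r \<partial>\<mu> y)"
  using assms
proof (induction rule: borel_measurable_induct)
  case (cong f g)
  then show ?case by (simp cong: nn_integral_cong)
next
  case (set A)
  have "inner (x + y) (E A (x + y)) + inner (x - y) (E A (x - y)) = 2 * inner x (E A x) + 2 * inner y (E A y)"
    using set by (simp add: E_add E_diff inner_add_left inner_add_right inner_diff_left inner_diff_right)
  moreover have "0 \<le> inner z (E A z)" for z using set by (simp add: inner_E_self)
  ultimately show ?case using set
    by (simp add: emeasure_mu ennreal_plus[symmetric] ennreal_mult[symmetric] del: ennreal_plus flip: ennreal_numeral)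
next
  case (mult u c)
  have "c * a + c * b = 2 * (c * p) + 2 * (c * q)" if "a + b = 2 * p + 2 * q" for a b p q :: ennreal
  proof -
    have "c * a + c * b = c * (2 * p + 2 * q)" by (simp only: distrib_left[symmetric] that)
    then show ?thesis by (simp only: distrib_left mult.left_commute)
  qed
  then show ?case using mult by (simp add: nn_integral_cmult)
next
  case (add u v)
  have "(\<integral>\<^sup>+r. u r \<partial>\<mu> (x + y)) + (\<integral>\<^sup>+r. u r \<partial>\<mu> (x - y)) + ((\<integral>\<^sup>+r. v r \<partial>\<mu> (x + y)) + (\<integral>\<^sup>+r. v r \<partial>\<mu> (x - y)))
     = 2 * (\<integral>\<^sup>+r. u r \<partial>\<mu> x) + 2 * (\<integral>\<^sup>+r. u r \<partial>\<mu> y) + (2 * (\<integral>\<^sup>+r. v r \<partial>\<mu> x) + 2 * (\<integral>\<^sup>+r. v r \<partial>\<mu> y))"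
    using add by simp
  then show ?case using add by (simp add: nn_integral_add distrib_left ac_simps)
next
  case (seq U)
  have m: "(\<integral>\<^sup>+r. (SUP i. U i) r \<partial>\<mu> z) = (SUP i. \<integral>\<^sup>+r. U i r \<partial>\<mu> z)" for z
    unfolding SUP_apply using seq by (intro nn_integral_monotone_convergence_SUP) auto
  have inc: "incseq (\<lambda>i. \<integral>\<^sup>+r. U i r \<partial>\<mu> z)" for z
    using seq by (auto simp: incseq_def le_fun_def intro!: nn_integral_mono)
  have inc2: "incseq (\<lambda>i. 2 * (\<integral>\<^sup>+r. U i r \<partial>\<mu> z))" for z
    using inc[of z] by (auto simp: incseq_def intro!: mult_left_mono)
  show ?case unfolding m SUP_mult_left_ennreal
    by (subst (1 2) ennreal_SUP_add[symmetric]) (simp_all add: inc inc2 seq)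
qed

lemma integrable_mu_add:
  fixes \<phi> :: "real \<Rightarrow> real"
  assumes [measurable]: "\<phi> \<in> borel_measurable borel" and "integrable (\<mu> x) \<phi>" "integrable (\<mu> y) \<phi>"
  shows "integrable (\<mu> (x + y)) \<phi>" "integrable (\<mu> (x - y)) \<phi>"
proof -
  have m: "\<phi> \<in> borel_measurable (\<mu> z)" for z by measurable
  have "(\<integral>\<^sup>+r. ennreal (norm (\<phi> r)) \<partial>\<mu> x) < \<infinity>" "(\<integral>\<^sup>+r. ennreal (norm (\<phi> r)) \<partial>\<mu> y) < \<infinity>"
    using assms(2,3) unfolding integrable_iff_bounded by blast+
  then have "(\<integral>\<^sup>+r. ennreal (norm (\<phi> r)) \<partial>\<mu> (x + y)) + (\<integral>\<^sup>+r. ennreal (norm (\<phi> r)) \<partial>\<mu> (x - y)) < \<infinity>"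
    by (subst nn_integral_parallelogram) (auto simp: ennreal_mult_less_top)
  then show "integrable (\<mu> (x + y)) \<phi>" "integrable (\<mu> (x - y)) \<phi>"
    unfolding integrable_iff_bounded using m by auto
qed

text \<open>If the signed measures of \<open>(x, y)\<close> with density \<open>k\<close> and of
  \<open>(x', y')\<close> with density \<open>k'\<close> agree on sets, they agree on functions.
  This is how an operator moves from a vector into the integrand.\<close>

lemma bform_transfer:
  assumes [measurable]: "k \<in> borel_measurable borel" "k' \<in> borel_measurable borel" "\<phi> \<in> borel_measurable borel"
    and eq: "\<And>B. B \<in> sets borel \<Longrightarrow> bform (\<lambda>r. indicator B r * k r) x y = bform (\<lambda>r. indicator B r * k' r) x' y'"
    and "integrable (\<mu> (x + y)) k" "integrable (\<mu> (x - y)) k" "integrable (\<mu> (x' + y')) k'" "integrable (\<mu> (x' - y')) k'"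
    and "integrable (\<mu> (x + y)) (\<lambda>r. \<phi> r * k r)" "integrable (\<mu> (x - y)) (\<lambda>r. \<phi> r * k r)"
      "integrable (\<mu> (x' + y')) (\<lambda>r. \<phi> r * k' r)" "integrable (\<mu> (x' - y')) (\<lambda>r. \<phi> r * k' r)"
  shows "bform (\<lambda>r. \<phi> r * k r) x y = bform (\<lambda>r. \<phi> r * k' r) x' y'"
proof -
  let ?L = "[(1::real, \<mu> (x + y), k), (-1, \<mu> (x - y), k), (-1, \<mu> (x' + y'), k'), (1, \<mu> (x' - y'), k')]"
  have "(\<Sum>(c, M, k)\<leftarrow>?L. c * (LINT r|M. \<phi> r * k r)) = 0"
  proof (rule signed_integral_zero[where N=borel])
    show "(\<Sum>(c, M, k)\<leftarrow>?L. c * (LINT r|M. indicator B r * k r)) = 0" if "B \<in> sets borel" for B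
      using eq[OF that] by (simp add: bform_def)
  qed (use assms(5-12) in \<open>auto simp only: set_simps prod.inject insert_iff empty_iff sets_mu assms(3)\<close>)
  then show ?thesis by (simp add: bform_def)
qed

lemma bform_transfer_indicator:
  assumes [measurable]: "\<phi> \<in> borel_measurable borel"
    and eq: "\<And>B. B \<in> sets borel \<Longrightarrow> inner x (E B y) = inner x' (E B y')"
    and "integrable (\<mu> (x + y)) \<phi>" "integrable (\<mu> (x - y)) \<phi>" "integrable (\<mu> (x' + y')) \<phi>" "integrable (\<mu> (x' - y')) \<phi>"
  shows "bform \<phi> x y = bform \<phi> x' y'"
  using bform_transfer[of "\<lambda>_. 1" "\<lambda>_. 1" \<phi> x y x' y'] assms(3-6) by (simp add: bform_indicator eq assms(1))

text \<open>With equal arguments the polarization collapses: \<open>\<mu> (x + x)\<close> is four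
  times \<open>\<mu> x\<close>, and \<open>\<mu> (x - x)\<close> vanishes.\<close>

lemma bform_self:
  assumes [measurable]: "\<phi> \<in> borel_measurable borel" and i: "integrable (\<mu> x) \<phi>"
  shows "bform \<phi> x x = (LINT r|\<mu> x. \<phi> r)"
proof -
  define u v where "u = x + x" and "v = x - x"
  note uv = integrable_mu_add[OF assms(1) i i, folded u_def v_def]
  let ?L = "[(1::real, \<mu> u, \<lambda>_. 1), (-1, \<mu> v, \<lambda>_. 1), (-4, \<mu> x, \<lambda>_. 1 :: real)]"
  have "(\<Sum>(c, M, k)\<leftarrow>?L. c * (LINT r|M. \<phi> r * k r)) = 0"
  proof (rule signed_integral_zero[where N=borel])
    show "(\<Sum>(c, M, k)\<leftarrow>?L. c * (LINT r|M. indicator B r * k r)) = 0" if "B \<in> sets borel" for B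
      using that by (simp add: measure_mu u_def v_def E_add E_empty E_diff inner_add_left inner_add_right)
  qed (use uv i in auto)
  then show ?thesis by (simp add: bform_def u_def v_def)
qed

end

section \<open>The spectral theorem for positive contractions\<close>

locale positive_contraction =
  fixes A :: "'h::{real_inner, complete_space} \<Rightarrow> 'h"
  assumes bl: "bounded_linear A"
    and A_sym: "inner x (A y) = inner (A x) y"
    and A_pos: "0 \<le> inner x (A x)"
    and A_le: "inner x (A x) \<le> inner x x"
begin

lemma A_add: "A (x + y) = A x + A y" using bl by (simp add: linear_simps)
lemma A_scaleR: "A (r *\<^sub>R x) = r *\<^sub>R A x" using bl by (simp add: linear_simps)
lemma A_zero: "A 0 = 0" using bl by (simp add: linear_simps)
text \<open>The vector \<open>p(A) x\<close>, computed by the Horner scheme.\<close>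

definition pA :: "real poly \<Rightarrow> 'h \<Rightarrow> 'h" where
  "pA p x = fold_coeffs (\<lambda>a y. a *\<^sub>R x + A y) p 0"

lemma pA_0 [simp]: "pA 0 x = 0" by (simp add: pA_def)

lemma pA_pCons: "pA (pCons a p) x = a *\<^sub>R x + A (pA p x)"
  by (cases "p = 0"; cases "a = 0") (simp_all add: pA_def A_zero)

lemma pA_add: "pA (p + q) x = pA p x + pA q x"
proof (induction p arbitrary: q)
  case (pCons a p)
  then show ?case by (cases q) (simp add: pA_pCons A_add algebra_simps)
qed simp

lemma pA_smult: "pA (smult c p) x = c *\<^sub>R pA p x"
  by (induction p) (simp_all add: pA_pCons A_scaleR algebra_simps)

lemma pA_minus: "pA (- p) x = - pA p x"
  using pA_smult[of "-1" p x] by simp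

lemma pA_diff: "pA (p - q) x = pA p x - pA q x"
  using pA_add[of p "- q" x] by (simp add: pA_minus)

lemma pA_sum: "pA (\<Sum>i\<in>I. p i) x = (\<Sum>i\<in>I. pA (p i) x)"
  by (induction I rule: infinite_finite_induct) (simp_all add: pA_add)

lemma pA_arg_add: "pA p (x + y) = pA p x + pA p y"
  by (induction p) (simp_all add: pA_pCons A_add algebra_simps)

lemma pA_arg_scaleR: "pA p (r *\<^sub>R x) = r *\<^sub>R pA p x"
  by (induction p) (simp_all add: pA_pCons A_scaleR algebra_simps)

lemma pA_commute:
  assumes "bounded_linear S" "\<And>x. S (A x) = A (S x)"
  shows "pA p (S x) = S (pA p x)"
  using assms by (induction p) (simp_all add: pA_pCons linear_simps)

lemma pA_A: "pA p (A x) = A (pA p x)"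
  by (rule pA_commute[OF bl]) simp

lemma pA_mult: "pA (p * q) x = pA p (pA q x)"
  by (induction p) (simp_all add: pA_pCons pA_add pA_smult)

lemma pA_1 [simp]: "pA 1 x = x"
  by (simp add: one_pCons pA_pCons A_zero)

lemma pA_X [simp]: "pA [:0, 1:] x = A x"
  by (simp add: pA_pCons A_zero)

lemma pA_sym: "inner x (pA p y) = inner (pA p x) y"
  by (induction p arbitrary: y) (simp_all add: pA_pCons inner_add_left inner_add_right A_sym pA_A[symmetric])

lemma pA_one_minus_X: "pA [:1, -1:] x = x - A x"
  by (simp add: pA_pCons A_zero A_scaleR[of "-1", simplified])

text \<open>Even powers split off as \<open>q\<close> on both sides of the form, by symmetry. The
  remaining \<open>r\<close> is one of 1, \<open>X\<close>, \<open>1 - X\<close> and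
  \<open>X (1 - X)\<close>; the first three are nonnegative by assumption.\<close>

lemma pA_Bernstein_nonneg: "0 \<le> inner x (pA ([:0, 1:] ^ k * [:1, -1:] ^ m) x)"
proof -
  let ?X = "[:0, 1:] :: real poly" and ?Y = "[:1, -1:] :: real poly"
  define q r where "q = ?X ^ (k div 2) * ?Y ^ (m div 2)" and "r = ?X ^ (k mod 2) * ?Y ^ (m mod 2)"
  have kk: "?X ^ k = ?X ^ (k div 2) * ?X ^ (k div 2) * ?X ^ (k mod 2)"
    by (metis div_mult_mod_eq mult_2_right power_add)
  have mm: "?Y ^ m = ?Y ^ (m div 2) * ?Y ^ (m div 2) * ?Y ^ (m mod 2)"
    by (metis div_mult_mod_eq mult_2_right power_add)
  have eq: "?X ^ k * ?Y ^ m = q * (r * q)"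
    unfolding q_def r_def kk mm by (simp only: mult_ac)
  have Y: "0 \<le> inner y (pA ?Y y)" for y
    unfolding pA_one_minus_X using A_le[of y] by (simp add: inner_diff_right)
  have X: "0 \<le> inner y (pA ?X y)" for y using A_pos[of y] by simp
  have XY: "0 \<le> inner y (pA (?X * ?Y) y)" for y
  proof -
    \<comment> \<open>As \<open>?X + ?Y = 1\<close>, the product is a sum of two terms of the form
      \<open>S T S\<close> with \<open>S\<close> symmetric and \<open>T\<close> nonnegative.\<close>
    have "?X * ?Y = ?X * (?Y * ?X) + ?Y * (?X * ?Y)" by simp
    then have "pA (?X * ?Y) y = pA ?X (pA ?Y (pA ?X y)) + pA ?Y (pA ?X (pA ?Y y))"
      by (metis (no_types) pA_add pA_mult)
    then have "inner y (pA (?X * ?Y) y) = inner (pA ?X y) (pA ?Y (pA ?X y)) + inner (pA ?Y y) (pA ?X (pA ?Y y))"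
      by (simp only: inner_add_right pA_sym)
    then show ?thesis using X Y by simp
  qed
  have "0 \<le> inner y (pA r y)" for y
  proof -
    have "k mod 2 = 0 \<or> k mod 2 = 1" "m mod 2 = 0 \<or> m mod 2 = 1" by auto
    then show ?thesis unfolding r_def using X Y XY by (elim disjE) (simp_all del: mult_pCons_left mult_pCons_right)
  qed
  moreover have "inner x (pA ([:0, 1:] ^ k * [:1, -1:] ^ m) x) = inner (pA q x) (pA r (pA q x))"
    unfolding eq by (simp only: pA_mult pA_sym)
  ultimately show ?thesis by simp
qed

definition bernstein_poly :: "nat \<Rightarrow> nat \<Rightarrow> real poly" where
  "bernstein_poly n k = smult (of_nat (n choose k)) ([:0, 1:] ^ k * [:1, -1:] ^ (n - k))"

lemma pA_bernstein_poly_nonneg: "0 \<le> inner x (pA (bernstein_poly n k) x)"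
  unfolding bernstein_poly_def pA_smult inner_scaleR_right
  by (intro mult_nonneg_nonneg pA_Bernstein_nonneg) simp

text \<open>The factorial moments of the binomial distribution, as identities of polynomials. They
  come from \<open>(n choose k) * (k choose j) = (n choose j) * ((n - j) choose (k - j))\<close> and
  the binomial theorem, and are exact, unlike ordinary moments.\<close>

lemma bernstein_moment:
  assumes "j \<le> n"
  shows "(\<Sum>k\<le>n. smult (of_nat (k choose j)) (bernstein_poly n k)) = smult (of_nat (n choose j)) ([:0, 1:] ^ j)"
proof (rule poly_eq_poly_eq_iff[THEN iffD1], rule ext)
  fix t :: real
  have "poly (\<Sum>k\<le>n. smult (of_nat (k choose j)) (bernstein_poly n k)) t =
      (\<Sum>k\<le>n. real (k choose j) * (real (n choose k) * (t ^ k * (1 - t) ^ (n - k))))"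
    by (simp add: poly_sum bernstein_poly_def mult.assoc)
  also have "\<dots> = (\<Sum>k\<in>{j..n}. real (k choose j) * (real (n choose k) * (t ^ k * (1 - t) ^ (n - k))))"
    by (rule sum.mono_neutral_right) (auto simp: not_le binomial_eq_0)
  also have "\<dots> = (\<Sum>k\<in>{j..n}. real (n choose j) * t ^ j * (real ((n - j) choose (k - j)) * t ^ (k - j) * (1 - t) ^ (n - j - (k - j))))"
  proof (rule sum.cong[OF refl])
    fix k assume k: "k \<in> {j..n}"
    have "real (n choose k) * real (k choose j) = real (n choose j) * real ((n - j) choose (k - j))"
      using choose_mult[of j k n] k by (simp flip: of_nat_mult)
    moreover have "t ^ k = t ^ j * t ^ (k - j)" using k by (simp flip: power_add)
    moreover have "n - k = n - j - (k - j)" using k by simp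
    ultimately show "real (k choose j) * (real (n choose k) * (t ^ k * (1 - t) ^ (n - k))) =
      real (n choose j) * t ^ j * (real ((n - j) choose (k - j)) * t ^ (k - j) * (1 - t) ^ (n - j - (k - j)))"
      by (simp add: mult_ac)
  qed
  also have "\<dots> = (\<Sum>i\<le>n - j. real (n choose j) * t ^ j * (real ((n - j) choose i) * t ^ i * (1 - t) ^ (n - j - i)))"
    using assms by (intro sum.reindex_bij_witness[of _ "\<lambda>i. i + j" "\<lambda>k. k - j"]) auto
  also have "\<dots> = real (n choose j) * t ^ j * (t + (1 - t)) ^ (n - j)"
    unfolding sum_distrib_left[symmetric] binomial_ring by simp
  finally show "poly (\<Sum>k\<le>n. smult (of_nat (k choose j)) (bernstein_poly n k)) t = poly (smult (of_nat (n choose j)) ([:0, 1:] ^ j)) t"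
    by simp
qed

end

lemma poly_measurable [measurable]: "poly (p :: real poly) \<in> borel_measurable borel"
  by (intro borel_measurable_continuous_onI continuous_intros)

text \<open>Compares the power \<open>(k / n)^j\<close> with the ratio of falling factorials. Each
  new factor \<open>(k - j) / (n - j)\<close> differs from \<open>k / n\<close> by at most
  \<open>j / (n - j)\<close>, and these errors add up to less than the stated bound.\<close>

lemma falling_ratio_approx:
  fixes k n j :: nat
  assumes kn: "k \<le> n" and jn: "j < n"
  shows "\<bar>(real k / real n) ^ j - real (k choose j) / real (n choose j)\<bar> \<le> real (j * j) / real (n - j)"
  using jn
proof (induction j)
  case (Suc j)
  define t a b where "t = real k / real n" and "a = real (k choose j) / real (n choose j)"
    and "b = (real k - real j) / (real n - real j)"
  have n0: "real n > 0" "real n - real j > 0" using Suc.prems by auto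
  have rec: "real (m choose Suc j) * real (Suc j) = real (m choose j) * (real m - real j)" for m
  proof (cases "j \<le> m")
    case True
    have "Suc j * (m choose Suc j) = (m - j) * (m choose j)"
      using binomial_absorb_comp[of m j] binomial_absorption[of j m] by (simp add: binomial_absorb_comp)
    then have "real (Suc j * (m choose Suc j)) = real ((m - j) * (m choose j))" by simp
    then show ?thesis using True by (simp only: of_nat_mult of_nat_diff mult.commute)
  next
    case False
    then show ?thesis by (simp add: binomial_eq_0)
  qed
  have pos: "real (n choose j) > 0" "real (n choose Suc j) > 0" using Suc.prems by auto
  have next_ratio: "real (k choose Suc j) / real (n choose Suc j) = a * b"
  proof -
    have "real (k choose Suc j) / real (n choose Suc j) = (real (k choose Suc j) * real (Suc j)) / (real (n choose Suc j) * real (Suc j))"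
      by simp
    then show ?thesis unfolding rec a_def b_def by simp
  qed
  have t01: "0 \<le> t" "t \<le> 1" using kn n0 by (auto simp: t_def)
  have a01: "0 \<le> a" "a \<le> 1" using pos binomial_mono[of k n j] kn by (auto simp: a_def binomial_right_mono)
  have tb: "\<bar>t - b\<bar> \<le> real j / real (n - j)"
  proof -
    have "t - b = real j * (real n - real k) / (real n * (real n - real j))"
      using n0 by (simp add: t_def b_def field_simps)
    also have "\<bar>\<dots>\<bar> \<le> real j * real n / (real n * (real n - real j))"
    proof -
      have "0 \<le> real j * (real n - real k) / (real n * (real n - real j))"
        using n0 kn by (intro divide_nonneg_nonneg mult_nonneg_nonneg) auto
      moreover have "real j * (real n - real k) / (real n * (real n - real j)) \<le> real j * real n / (real n * (real n - real j))"
        by (intro divide_right_mono mult_left_mono mult_nonneg_nonneg) (use n0 in auto)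
      ultimately show ?thesis by (simp only: abs_of_nonneg)
    qed
    also have "\<dots> = real j / real (n - j)" using n0 Suc.prems by (simp add: of_nat_diff)
    finally show ?thesis .
  qed
  have "\<bar>t ^ Suc j - a * b\<bar> = \<bar>t * (t ^ j - a) + a * (t - b)\<bar>" by (simp add: algebra_simps)
  also have "\<dots> \<le> \<bar>t\<bar> * \<bar>t ^ j - a\<bar> + \<bar>a\<bar> * \<bar>t - b\<bar>" by (metis abs_mult abs_triangle_ineq)
  also have "\<dots> \<le> 1 * \<bar>t ^ j - a\<bar> + 1 * \<bar>t - b\<bar>" using t01 a01 by (intro add_mono mult_right_mono) auto
  also have "\<dots> \<le> real (j * j) / real (n - j) + real j / real (n - j)"
    using Suc.IH Suc.prems tb by (simp add: t_def a_def)
  also have "\<dots> = real (j * j + j) / real (n - j)" by (simp add: add_divide_distrib)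
  also have "\<dots> \<le> real (Suc j * Suc j) / real (n - Suc j)"
    using Suc.prems by (intro frac_le) auto
  finally show ?case unfolding next_ratio[symmetric] t_def .
qed simp

section \<open>Scalar spectral measures from moments\<close>

context positive_contraction
begin

text \<open>Hausdorff's moment problem. The Bernstein polynomials evaluated at the operator give
  nonnegative weights of sum 1 on a grid in the unit interval. These probability measures are tight,
  so some subsequence converges weakly; their factorial moments are exact up to normalization, hence
  their ordinary moments converge to those of the operator.\<close>

lemma unit_spectral_measure:
  assumes x: "norm x = 1"
  shows "\<exists>M. real_distribution M \<and> (AE s in M. 0 \<le> s \<and> s \<le> 1) \<and> (\<forall>j. (LINT s|M. s ^ j) = inner x (pA ([:0, 1:] ^ j) x))"
proof -
  \<comment> \<open>Degree \<open>Suc n\<close> rather than \<open>n\<close> keeps the denominators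
    of the grid points \<open>k / (n + 1)\<close> nonzero.\<close>
  define w where "w n k = inner x (pA (bernstein_poly (Suc n) k) x)" for n k
  have w0: "0 \<le> w n k" for n k unfolding w_def by (rule pA_bernstein_poly_nonneg)
  have wmom: "(\<Sum>k\<le>Suc n. real (k choose j) / real (Suc n choose j) * w n k) = inner x (pA ([:0, 1:] ^ j) x)" if "j \<le> Suc n" for n j
  proof -
    have "inner x (pA (\<Sum>k\<le>Suc n. smult (of_nat (k choose j)) (bernstein_poly (Suc n) k)) x) = (\<Sum>k\<le>Suc n. real (k choose j) * w n k)"
      by (simp add: pA_sum pA_smult inner_sum_right w_def del: sum.atMost_Suc)
    then have "(\<Sum>k\<le>Suc n. real (k choose j) * w n k) = real (Suc n choose j) * inner x (pA ([:0, 1:] ^ j) x)"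
      unfolding bernstein_moment[OF that] by (simp add: pA_smult)
    moreover have "real (Suc n choose j) \<noteq> 0" using that by simp
    ultimately show ?thesis
      by (simp add: sum_divide_distrib[symmetric] del: sum.atMost_Suc)
  qed
  have w1: "(\<Sum>k\<le>Suc n. w n k) = 1" for n
    using wmom[of 0 n] x by (simp add: norm_eq_sqrt_inner del: sum.atMost_Suc)
  define D where "D n = distr (point_measure {..Suc n} (\<lambda>k. ennreal (w n k))) borel (\<lambda>k. real k / real (Suc n))" for n
  have int_D: "integral\<^sup>L (D n) f = (\<Sum>k\<le>Suc n. w n k * f (real k / real (Suc n)))"
    if [measurable]: "f \<in> borel_measurable borel" for f :: "real \<Rightarrow> real" and n
    unfolding D_def using w0
    by (subst integral_distr) (auto simp: lebesgue_integral_point_measure_finite simp del: sum.atMost_Suc)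
  have rd: "real_distribution (D n)" for n
  proof -
    have "emeasure (point_measure {..Suc n} (\<lambda>k. ennreal (w n k))) {..Suc n} = ennreal (\<Sum>k\<le>Suc n. w n k)"
      using w0 by (subst emeasure_point_measure_finite) (auto simp del: sum.atMost_Suc)
    then have "prob_space (point_measure {..Suc n} (\<lambda>k. ennreal (w n k)))"
      by (intro prob_spaceI) (simp add: w1 space_point_measure del: sum.atMost_Suc)
    then show ?thesis
      unfolding D_def by (intro real_distribution.intro prob_space.prob_space_distr real_distribution_axioms.intro) auto
  qed
  have tight: "tight D"
    unfolding tight_def
  proof (intro conjI allI impI rd)
    fix e :: real assume e: "e > 0"
    \<comment> \<open>Tightness is phrased with half-open intervals; the left end -1 makes sure that
      the grid point 0 is included.\<close>
    have "measure (D n) {-1<..1} > 1 - e" for n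
    proof -
      interpret real_distribution "D n" by (rule rd)
      have "measure (D n) {-1<..1} = (LINT s|D n. indicator {-1<..1} s)" by simp
      also have "\<dots> = (\<Sum>k\<le>Suc n. w n k * indicator {-1<..1} (real k / real (Suc n)))" by (rule int_D) simp
      also have "\<dots> = (\<Sum>k\<le>Suc n. w n k)"
      proof (rule sum.cong[OF refl])
        fix k assume "k \<in> {..Suc n}"
        then have "0 \<le> real k / real (Suc n)" "real k / real (Suc n) \<le> 1" by auto
        then have "q \<in> {-1<..1}" if "q = real k / real (Suc n)" for q unfolding that[symmetric] by simp
        then show "w n k * indicator {-1<..1} (real k / real (Suc n)) = w n k" by (simp only: indicator_simps mult_1_right)
      qed
      finally show ?thesis using w1[of n] e by simp
    qed
    then show "\<exists>a b. a < b \<and> (\<forall>n. measure (D n) {a<..b} > 1 - e)" by (intro exI[of _ "-1"] exI[of _ 1]) auto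
  qed
  obtain r M where r: "strict_mono (r :: nat \<Rightarrow> nat)" and M: "real_distribution M" and wc: "weak_conv_m (D \<circ> id \<circ> r) M"
    using tight_imp_convergent_subsubsequence[OF tight strict_mono_id] by auto
  interpret M: real_distribution M by fact
  have conv: "(\<lambda>n. integral\<^sup>L (D (r n)) f) \<longlonglongrightarrow> integral\<^sup>L M f" if f: "\<And>s. isCont f s" "\<And>s. norm (f s) \<le> B" for f :: "real \<Rightarrow> real" and B
  proof -
    have "(\<lambda>n. integral\<^sup>L ((D \<circ> id \<circ> r) n) f) \<longlonglongrightarrow> integral\<^sup>L M f"
      by (rule weak_conv_imp_integral_bdd_continuous_conv[OF _ M wc f]) (simp add: rd)
    then show ?thesis by simp
  qed
  have supp: "AE s in M. 0 \<le> s \<and> s \<le> 1"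
  proof -
    \<comment> \<open>A bounded continuous function that is positive exactly outside the unit
      interval. Its integral vanishes along the sequence, hence also in the limit.\<close>
    define g where "g s = min 1 (max 0 (max (- s) (s - 1)))" for s :: real
    have gc: "isCont g s" for s unfolding g_def[abs_def] by (intro continuous_intros)
    have gb: "norm (g s) \<le> 1" for s by (auto simp: g_def)
    have [measurable]: "g \<in> borel_measurable borel" unfolding g_def[abs_def] by measurable
    have "integral\<^sup>L (D n) g = 0" for n
      unfolding int_D[OF \<open>g \<in> borel_measurable borel\<close>] by (rule sum.neutral) (auto simp: g_def)
    then have "integral\<^sup>L M g = 0" using conv[OF gc gb] by (simp add: LIMSEQ_const_iff)
    moreover have "integrable M g" using gb by (intro M.integrable_const_bound[where B=1]) auto
    moreover have "0 \<le> g s" for s by (simp add: g_def)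
    ultimately have "AE s in M. g s = 0" using integral_nonneg_eq_0_iff_AE[of M g] by auto
    then show ?thesis by eventually_elim (auto simp: g_def min_def max_def split: if_splits)
  qed
  have mom: "(LINT s|M. s ^ j) = inner x (pA ([:0, 1:] ^ j) x)" for j
  proof -
    \<comment> \<open>Powers are unbounded on the line, so the weak limit is tested with this
      bounded continuous function, which equals the power on the unit interval.\<close>
    define f where "f s = (max 0 (min 1 s)) ^ j" for s :: real
    have fc: "isCont f s" for s unfolding f_def[abs_def] by (intro continuous_intros)
    have fb: "norm (f s) \<le> 1" for s by (auto simp: f_def intro!: power_le_one)
    have [measurable]: "f \<in> borel_measurable borel" unfolding f_def[abs_def] by measurable
    have "(LINT s|M. s ^ j) = integral\<^sup>L M f"
    proof (rule integral_cong_AE)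
      show "AE s in M. s ^ j = f s" using supp by eventually_elim (simp add: f_def)
    qed (auto simp: measurable_cong_sets[OF M.events_eq_borel refl])
    moreover have "(\<lambda>n. integral\<^sup>L (D (r n)) f) \<longlonglongrightarrow> inner x (pA ([:0, 1:] ^ j) x)"
    proof (rule LIMSEQ_I)
      fix e :: real assume e: "e > 0"
      have "(\<lambda>n. real (j * j) / real (Suc n - j)) \<longlonglongrightarrow> 0"
      proof (rule LIMSEQ_offset[where k=j])
        show "(\<lambda>n. real (j * j) / real (Suc (n + j) - j)) \<longlonglongrightarrow> 0"
          using tendsto_mult[OF tendsto_const LIMSEQ_inverse_real_of_nat, of "real (j * j)"]
          by (simp add: Suc_diff_le divide_inverse del: of_nat_Suc)
      qed
      from LIMSEQ_D[OF this e] obtain N where N: "\<And>n. n \<ge> N \<Longrightarrow> real (j * j) / real (Suc n - j) < e" by force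
      show "\<exists>N. \<forall>n\<ge>N. norm (integral\<^sup>L (D (r n)) f - inner x (pA ([:0, 1:] ^ j) x)) < e"
      proof (intro exI allI impI)
        fix n assume n: "n \<ge> max N j"
        define m where "m = r n"
        have m: "m \<ge> N" "m \<ge> j" using n seq_suble[OF r, of n] by (auto simp: m_def)
        have "integral\<^sup>L (D m) f - inner x (pA ([:0, 1:] ^ j) x) =
          (\<Sum>k\<le>Suc m. w m k * ((real k / real (Suc m)) ^ j - real (k choose j) / real (Suc m choose j)))"
        proof -
          have "integral\<^sup>L (D m) f = (\<Sum>k\<le>Suc m. w m k * (real k / real (Suc m)) ^ j)"
            unfolding int_D[OF \<open>f \<in> borel_measurable borel\<close>]
            by (rule sum.cong[OF refl]) (auto simp: f_def)
          then show ?thesis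
            using wmom[of j m] m by (simp add: right_diff_distrib sum_subtractf mult.commute del: sum.atMost_Suc)
        qed
        also have "norm \<dots> \<le> (\<Sum>k\<le>Suc m. w m k * (real (j * j) / real (Suc m - j)))"
        proof (rule order_trans[OF norm_sum], rule sum_mono)
          fix k assume "k \<in> {..Suc m}"
          then show "norm (w m k * ((real k / real (Suc m)) ^ j - real (k choose j) / real (Suc m choose j))) \<le> w m k * (real (j * j) / real (Suc m - j))"
            unfolding real_norm_def abs_mult abs_of_nonneg[OF w0] using m
            by (intro mult_left_mono falling_ratio_approx w0) auto
        qed
        also have "\<dots> = real (j * j) / real (Suc m - j)"
          unfolding sum_distrib_right[symmetric] w1 by simp
        also have "\<dots> < e" using N m by blast
        finally show "norm (integral\<^sup>L (D (r n)) f - inner x (pA ([:0, 1:] ^ j) x)) < e" by (simp only: m_def)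
      qed
    qed
    ultimately show ?thesis using LIMSEQ_unique[OF conv[OF fc fb]] by simp
  qed
  show ?thesis using M supp mom by blast
qed

text \<open>Rescaling to a unit vector gives the density \<open>(norm x)\<^sup>2\<close>, and
  linearity in the moments extends the formula to all polynomials; the zero vector gets the null
  measure.\<close>

lemma spectral_measure_exists:
  "\<exists>M. finite_measure M \<and> sets M = sets borel \<and> (AE s in M. 0 \<le> s \<and> s \<le> 1) \<and> (\<forall>p. (LINT s|M. poly p s) = inner x (pA p x))"
proof (cases "x = 0")
  case True
  have "pA p 0 = 0" for p using pA_arg_scaleR[of p 0 0] by simp
  then show ?thesis using True
    by (intro exI[of _ "null_measure borel"]) (auto intro: finite_measureI intro!: AE_I[where N=UNIV])
next
  case False
  define u where "u = x /\<^sub>R norm x"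
  have u: "norm u = 1" "x = norm x *\<^sub>R u" using False by (auto simp: u_def)
  obtain M where M: "real_distribution M" and supp: "AE s in M. 0 \<le> s \<and> s \<le> 1"
    and mom: "\<And>j. (LINT s|M. s ^ j) = inner u (pA ([:0, 1:] ^ j) u)"
    using unit_spectral_measure[OF u(1)] by blast
  interpret M: real_distribution M by fact
  have int: "integrable M (\<lambda>s. s ^ j)" for j
  proof (rule M.integrable_const_bound[where B=1])
    show "AE s in M. norm (s ^ j) \<le> 1" using supp by eventually_elim (simp add: power_le_one)
  qed (simp add: measurable_cong_sets[OF M.events_eq_borel refl])
  have poly: "(LINT s|M. poly p s) = inner u (pA p u)" for p
  proof -
    have "(LINT s|M. poly p s) = (\<Sum>i\<le>degree p. coeff p i * (LINT s|M. s ^ i))"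
      unfolding poly_altdef using int by simp
    also have "\<dots> = inner u (pA (\<Sum>i\<le>degree p. smult (coeff p i) ([:0, 1:] ^ i)) u)"
      by (simp add: mom pA_sum pA_smult inner_sum_right)
    also have "(\<Sum>i\<le>degree p. smult (coeff p i) ([:0, 1:] ^ i)) = p"
      using poly_as_sum_of_monoms[of p] by (simp add: monom_altdef)
    finally show ?thesis .
  qed
  let ?c = "(norm x)\<^sup>2"
  let ?M = "density M (\<lambda>_. ?c)"
  have "emeasure ?M (space ?M) = ennreal ?c" using M.emeasure_space_1 by (simp add: emeasure_density)
  then have "finite_measure ?M" by (intro finite_measureI) simp
  moreover have "(LINT s|?M. poly p s) = inner x (pA p x)" for p
  proof -
    have "(LINT s|?M. poly p s) = (LINT s|M. ?c *\<^sub>R poly p s)"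
      by (subst integral_density) (auto simp: measurable_cong_sets[OF M.events_eq_borel refl])
    also have "\<dots> = ?c * inner u (pA p u)" by (simp add: poly)
    also have "\<dots> = inner (norm x *\<^sub>R u) (pA p (norm x *\<^sub>R u))" by (simp add: pA_arg_scaleR power2_eq_square)
    finally show ?thesis using u(2) by simp
  qed
  moreover have "AE s in ?M. 0 \<le> s \<and> s \<le> 1"
    using supp by (subst AE_density) (auto elim: AE_mp)
  ultimately show ?thesis by (intro exI[of _ ?M]) auto
qed

end

section \<open>Mean square approximation of indicators by polynomials\<close>

lemma poly_bounded_unit: "\<exists>K. \<forall>s\<in>{0..1::real}. \<bar>poly p s\<bar> \<le> K"
proof -
  have "bounded (poly p ` {0..1})"
    by (intro compact_imp_bounded compact_continuous_image continuous_intros compact_Icc)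
  then show ?thesis by (auto simp: bounded_iff)
qed

locale unit_measure = finite_measure N for N :: "real measure" +
  assumes sets_N [simp, measurable_cong]: "sets N = sets borel"
    and AE_unit: "AE s in N. 0 \<le> s \<and> s \<le> 1"
begin

text \<open>Boundedness is asked on the unit interval, which carries \<open>N\<close>; so
  polynomials qualify.\<close>

definition bdd :: "(real \<Rightarrow> real) \<Rightarrow> bool" where
  "bdd a \<longleftrightarrow> a \<in> borel_measurable borel \<and> (\<exists>K. \<forall>s\<in>{0..1}. \<bar>a s\<bar> \<le> K)"

lemma bdd_integrable: "bdd a \<Longrightarrow> integrable N a"
proof -
  assume "bdd a"
  then obtain K where [measurable]: "a \<in> borel_measurable borel" and K: "\<And>s. s \<in> {0..1} \<Longrightarrow> \<bar>a s\<bar> \<le> K"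
    unfolding bdd_def by blast
  show ?thesis
  proof (rule integrable_const_bound[where B=K])
    show "AE s in N. norm (a s) \<le> K" using AE_unit by eventually_elim (simp add: K)
  qed measurable
qed

lemma bdd_poly: "bdd (poly p)"
  using poly_bounded_unit[of p] by (simp add: bdd_def)

lemma bdd_indicator: "B \<in> sets borel \<Longrightarrow> bdd (indicator B)"
  by (auto simp: bdd_def indicator_def intro!: exI[of _ 1])

lemma bdd_const: "bdd (\<lambda>_. c)"
  by (auto simp: bdd_def)

lemma bdd_id: "bdd (\<lambda>s. s)"
  by (auto simp: bdd_def intro!: exI[of _ 1])

lemma bdd_add: "bdd a \<Longrightarrow> bdd b \<Longrightarrow> bdd (\<lambda>s. a s + b s)"
proof -
  assume "bdd a" "bdd b"
  then obtain K L where K: "\<And>s. s \<in> {0..1} \<Longrightarrow> \<bar>a s\<bar> \<le> K" "\<And>s. s \<in> {0..1} \<Longrightarrow> \<bar>b s\<bar> \<le> L"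
    and [measurable]: "a \<in> borel_measurable borel" "b \<in> borel_measurable borel" unfolding bdd_def by blast
  have "\<bar>a s + b s\<bar> \<le> K + L" if "s \<in> {0..1}" for s using K(1)[OF that] K(2)[OF that] by linarith
  then show ?thesis unfolding bdd_def by (intro conjI exI[of _ "K + L"] ballI) measurable
qed

lemma bdd_mult: "bdd a \<Longrightarrow> bdd b \<Longrightarrow> bdd (\<lambda>s. a s * b s)"
proof -
  assume "bdd a" "bdd b"
  then obtain K L where K: "\<And>s. s \<in> {0..1} \<Longrightarrow> \<bar>a s\<bar> \<le> K" "\<And>s. s \<in> {0..1} \<Longrightarrow> \<bar>b s\<bar> \<le> L"
    and [measurable]: "a \<in> borel_measurable borel" "b \<in> borel_measurable borel" unfolding bdd_def by blast
  have "\<bar>a s * b s\<bar> \<le> K * L" if "s \<in> {0..1}" for s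
    using K(1)[OF that] K(2)[OF that] by (simp add: abs_mult mult_mono')
  then show ?thesis unfolding bdd_def by (intro conjI exI[of _ "K * L"] ballI) measurable
qed

lemma bdd_diff: "bdd a \<Longrightarrow> bdd b \<Longrightarrow> bdd (\<lambda>s. a s - b s)"
  using bdd_add[of a "\<lambda>s. (-1) * b s"] bdd_mult[OF bdd_const[of "-1"], of b] by simp

lemma bdd_square: "bdd a \<Longrightarrow> bdd (\<lambda>s. (a s)\<^sup>2)"
  unfolding power2_eq_square by (rule bdd_mult)

lemma square_sum_le:
  assumes "bdd a" "bdd b"
  shows "(LINT s|N. (a s + b s)\<^sup>2) \<le> 2 * (LINT s|N. (a s)\<^sup>2) + 2 * (LINT s|N. (b s)\<^sup>2)"
proof -
  have "(LINT s|N. (a s + b s)\<^sup>2) \<le> (LINT s|N. 2 * (a s)\<^sup>2 + 2 * (b s)\<^sup>2)"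
    using assms norm_add_square_le[of "a _" "b _"]
    by (intro integral_mono) (auto intro!: bdd_integrable bdd_square bdd_add bdd_mult bdd_const)
  then show ?thesis using assms by (simp add: bdd_integrable bdd_square)
qed

lemma L2_imp_L1_tendsto:
  assumes g: "\<And>n. bdd (g n)" and lim: "(\<lambda>n. LINT s|N. (g n s)\<^sup>2) \<longlonglongrightarrow> 0"
  shows "(\<lambda>n. LINT s|N. \<bar>g n s\<bar>) \<longlonglongrightarrow> 0"
proof (rule tendsto_sandwich[where f="\<lambda>_. 0" and h="\<lambda>n. sqrt ((LINT s|N. (g n s)\<^sup>2) * measure N (space N))"])
  show "(\<lambda>n. sqrt ((LINT s|N. (g n s)\<^sup>2) * measure N (space N))) \<longlonglongrightarrow> 0"
    using tendsto_real_sqrt[OF tendsto_mult_right[OF lim, of "measure N (space N)"]] by simp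
  have m[measurable]: "g n \<in> borel_measurable borel" for n using g[of n] by (simp add: bdd_def)
  have "(LINT s|N. \<bar>g n s\<bar>) \<le> sqrt ((LINT s|N. (g n s)\<^sup>2) * measure N (space N))" for n
  proof (rule real_le_rsqrt)
    have i: "integrable N (\<lambda>s. \<bar>g n s\<bar>)" "integrable N (\<lambda>s. (g n s)\<^sup>2)" using g by (auto intro: bdd_integrable bdd_square)
    have "(\<integral>\<^sup>+s. ennreal \<bar>g n s\<bar> * 1 \<partial>N)\<^sup>2 \<le> (\<integral>\<^sup>+s. (ennreal \<bar>g n s\<bar>)\<^sup>2 \<partial>N) * (\<integral>\<^sup>+s. 1\<^sup>2 \<partial>N)"
      by (rule Cauchy_Schwarz_nn_integral) measurable
    then have "(ennreal (LINT s|N. \<bar>g n s\<bar>))\<^sup>2 \<le> ennreal (LINT s|N. (g n s)\<^sup>2) * ennreal (measure N (space N))"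
      using i by (simp add: nn_integral_eq_integral ennreal_power emeasure_eq_measure)
    then show "(LINT s|N. \<bar>g n s\<bar>)\<^sup>2 \<le> (LINT s|N. (g n s)\<^sup>2) * measure N (space N)"
      by (simp add: ennreal_power ennreal_mult[symmetric] integral_nonneg)
  qed
  then show "\<forall>\<^sub>F n in sequentially. (LINT s|N. \<bar>g n s\<bar>) \<le> sqrt ((LINT s|N. (g n s)\<^sup>2) * measure N (space N))"
    by simp
qed auto

end

lemma continuous_poly_approx:
  assumes "continuous_on {0..1} f" "d > 0"
  shows "\<exists>p. \<forall>s\<in>{0..1::real}. \<bar>f s - poly p s\<bar> < d"
proof -
  obtain g where g: "real_polynomial_function g" "\<And>x. x \<in> {0..1} \<Longrightarrow> \<bar>f x - g x\<bar> < d"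
    using Stone_Weierstrass_real_polynomial_function[OF compact_Icc assms] by blast
  then obtain a n where a: "g = (\<lambda>x. \<Sum>i\<le>n. a i * x ^ i)" by (auto simp: real_polynomial_function_iff_sum)
  have "poly (\<Sum>i\<le>n. monom (a i) i) s = g s" for s by (simp add: a poly_sum poly_monom)
  then show ?thesis using g(2) by metis
qed

text \<open>A single polynomial must serve finitely many measures, since the polarized form of a
  pair of vectors involves several of them. The sets with this property contain the half-lines, by
  Weierstrass applied to continuous ramps, and are closed under complements and disjoint
  unions.\<close>

lemma poly_approx_indicator:
  assumes fin: "finite \<N>" and N: "\<And>N. N \<in> \<N> \<Longrightarrow> unit_measure N"
    and B: "B \<in> sets borel" and e: "e > 0"
  shows "\<exists>p. \<forall>N\<in>\<N>. (LINT s|N. (indicator B s - poly p s)\<^sup>2) < e"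
proof -
  let ?G = "range (\<lambda>a::real. {..a})"
  let ?P = "\<lambda>B. B \<in> sets borel \<and> (\<forall>e>0. \<exists>p. \<forall>N\<in>\<N>. (LINT s|N. (indicator B s - poly p s)\<^sup>2) < e)"
  have borel: "sets (borel :: real measure) = sigma_sets UNIV ?G" by (subst borel_eq_atMost) simp
  \<comment> \<open>Closure under bounded pointwise limits of approximable functions. The quarters
    of \<open>e\<close> come from \<open>(a + b)^2 \<le> 2 a^2 + 2 b^2\<close>.\<close>
  have lim_approx: "?P B" if B: "B \<in> sets borel"
    and f: "\<And>n::nat. f n \<in> borel_measurable borel" "\<And>n s. \<bar>f n s\<bar> \<le> 1" "\<And>s. (\<lambda>n. f n s) \<longlonglongrightarrow> indicator B s"
    and ap: "\<And>n e. e > 0 \<Longrightarrow> \<exists>p. \<forall>N\<in>\<N>. (LINT s|N. (f n s - poly p s)\<^sup>2) < e" for B f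
  proof (intro conjI B allI impI)
    fix e :: real assume e: "e > 0"
    have "\<forall>\<^sub>F n in sequentially. \<forall>N\<in>\<N>. (LINT s|N. (indicator B s - f n s)\<^sup>2) < e/4"
    proof (rule eventually_ball_finite[OF fin], rule ballI)
      fix N assume "N \<in> \<N>"
      then interpret unit_measure N by (rule N)
      have [measurable]: "f n \<in> borel_measurable borel" for n by (rule f)
      have [measurable]: "B \<in> sets borel" by (rule B)
      have "(\<lambda>n. LINT s|N. (indicator B s - f n s)\<^sup>2) \<longlonglongrightarrow> (LINT s|N. (indicator B s - indicator B s)\<^sup>2)"
      proof (rule integral_dominated_convergence[where w="\<lambda>_. 4"])
        show "AE s in N. (\<lambda>n. (indicator B s - f n s)\<^sup>2) \<longlonglongrightarrow> (indicator B s - indicator B s)\<^sup>2"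
          by (intro AE_I2 tendsto_intros f)
        show "AE s in N. norm ((indicator B s - f n s)\<^sup>2) \<le> 4" for n
        proof (rule AE_I2)
          fix s
          have "\<bar>indicator B s - f n s\<bar> \<le> 2" using f(2)[of n s] by (auto simp: indicator_def)
          then have "\<bar>indicator B s - f n s\<bar>\<^sup>2 \<le> 2\<^sup>2" by (intro power_mono) auto
          then show "norm ((indicator B s - f n s)\<^sup>2) \<le> 4" by simp
        qed
      qed simp_all
      then have "(\<lambda>n. LINT s|N. (indicator B s - f n s)\<^sup>2) \<longlonglongrightarrow> 0" by simp
      then show "\<forall>\<^sub>F n in sequentially. (LINT s|N. (indicator B s - f n s)\<^sup>2) < e/4"
        by (rule order_tendstoD) (use e in simp)
    qed
    then obtain n where n: "\<And>N. N \<in> \<N> \<Longrightarrow> (LINT s|N. (indicator B s - f n s)\<^sup>2) < e/4"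
      by (auto simp: eventually_sequentially)
    obtain p where p: "\<And>N. N \<in> \<N> \<Longrightarrow> (LINT s|N. (f n s - poly p s)\<^sup>2) < e/4" using ap[of "e/4" n] e by auto
    show "\<exists>p. \<forall>N\<in>\<N>. (LINT s|N. (indicator B s - poly p s)\<^sup>2) < e"
    proof (intro exI ballI)
      fix N assume NN: "N \<in> \<N>"
      then interpret unit_measure N by (rule N)
      have bf: "bdd (f n)" using f(1,2) by (auto simp: bdd_def)
      have "(LINT s|N. ((indicator B s - f n s) + (f n s - poly p s))\<^sup>2) \<le>
         2 * (LINT s|N. (indicator B s - f n s)\<^sup>2) + 2 * (LINT s|N. (f n s - poly p s)\<^sup>2)"
        by (intro square_sum_le bdd_diff bdd_indicator bdd_poly bf B)
      then show "(LINT s|N. (indicator B s - poly p s)\<^sup>2) < e" using n[OF NN] p[OF NN] by simp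
    qed
  qed
  have "Int_stable ?G" by (auto simp: Int_stable_def)
  moreover have "?G \<subseteq> Pow UNIV" by simp
  moreover have "B \<in> sigma_sets UNIV ?G" using B borel by simp
  ultimately have "?P B"
  proof (induction rule: sigma_sets_induct_disjoint)
    case (basic C)
    then obtain a where C: "C = {..a}" by auto
    \<comment> \<open>Ramps that equal 1 up to \<open>a\<close> and then fall to 0 with slope
      \<open>-n\<close>; they decrease to the indicator of the half-line.\<close>
    define f where "f n s = max 0 (min 1 (1 - real n * (s - a)))" for n :: nat and s
    show ?case unfolding C
    proof (rule lim_approx[where f=f])
      show "f n \<in> borel_measurable borel" for n unfolding f_def[abs_def] by measurable
      show "\<bar>f n s\<bar> \<le> 1" for n s by (auto simp: f_def)
      show "(\<lambda>n. f n s) \<longlonglongrightarrow> indicator {..a} s" for s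
      proof (cases "s \<le> a")
        case True
        then have "f n s = indicator {..a} s" for n by (auto simp: f_def mult_nonneg_nonpos)
        then show ?thesis by simp
      next
        case False
        have "\<forall>\<^sub>F n in sequentially. indicator {..a} s = f n s"
          using eventually_ge_at_top[of "nat \<lceil>1 / (s - a)\<rceil>"]
        proof eventually_elim
          case (elim n)
          then have "1 / (s - a) \<le> real n" by linarith
          then have "1 \<le> real n * (s - a)" using False by (simp add: field_simps)
          then show ?case using False by (simp add: f_def)
        qed
        then show ?thesis by (rule Lim_transform_eventually[OF tendsto_const])
      qed
      fix n and e :: real assume e: "e > 0"
      \<comment> \<open>\<open>S\<close> strictly exceeds the mass of every measure in the family,
        so a uniform error \<open>d\<close> with \<open>d\<^sup>2 * S = e\<close> gives a mean
        square error strictly below \<open>e\<close>.\<close>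
      define S where "S = (\<Sum>N\<in>\<N>. measure N (space N)) + 1"
      have S: "S > 0" "\<And>N. N \<in> \<N> \<Longrightarrow> measure N (space N) < S"
      proof -
        show "S > 0" unfolding S_def by (intro add_nonneg_pos sum_nonneg) auto
        fix N assume "N \<in> \<N>"
        then have "measure N (space N) \<le> (\<Sum>N\<in>\<N>. measure N (space N))" by (intro member_le_sum fin) auto
        then show "measure N (space N) < S" by (simp add: S_def)
      qed
      define d where "d = sqrt (e / S)"
      have d: "d > 0" "d\<^sup>2 = e / S" using e S by (auto simp: d_def)
      have "continuous_on {0..1} (f n)" unfolding f_def[abs_def] by (intro continuous_intros)
      from continuous_poly_approx[OF this d(1)] obtain p where p: "\<And>s. s \<in> {0..1} \<Longrightarrow> \<bar>f n s - poly p s\<bar> < d" by blast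
      show "\<exists>p. \<forall>N\<in>\<N>. (LINT s|N. (f n s - poly p s)\<^sup>2) < e"
      proof (intro exI ballI)
        fix N assume NN: "N \<in> \<N>"
        then interpret unit_measure N by (rule N)
        have bf: "bdd (f n)" by (auto simp: bdd_def f_def[abs_def] intro!: exI[of _ 1])
        have "(LINT s|N. (f n s - poly p s)\<^sup>2) \<le> (LINT s|N. d\<^sup>2)"
        proof (rule integral_mono_AE)
          show "AE s in N. (f n s - poly p s)\<^sup>2 \<le> d\<^sup>2"
            using AE_unit
          proof eventually_elim
            case (elim s)
            then have "\<bar>f n s - poly p s\<bar> \<le> d" using p[of s] by simp
            then have "\<bar>f n s - poly p s\<bar>\<^sup>2 \<le> d\<^sup>2" by (intro power_mono) auto
            then show ?case by simp
          qed
        qed (auto intro!: bdd_integrable bdd_square bdd_diff bdd_poly bf)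
        also have "\<dots> = (e / S) * measure N (space N)" by (simp add: d)
        also have "\<dots> < (e / S) * S" using S e NN by (intro mult_strict_left_mono) auto
        finally show "(LINT s|N. (f n s - poly p s)\<^sup>2) < e" using S by simp
      qed
    qed simp
  next
    case empty
    show ?case by (auto intro!: exI[of _ 0])
  next
    case (compl C)
    show ?case
    proof (intro conjI allI impI)
      show "UNIV - C \<in> sets borel" using compl by auto
      fix e :: real assume "e > 0"
      then obtain p where p: "\<forall>N\<in>\<N>. (LINT s|N. (indicator C s - poly p s)\<^sup>2) < e" using compl by blast
      have "(indicator (UNIV - C) s - poly (1 - p) s)\<^sup>2 = (indicator C s - poly p s)\<^sup>2" for s
        by (auto simp: indicator_def power2_eq_square algebra_simps)
      then show "\<exists>p. \<forall>N\<in>\<N>. (LINT s|N. (indicator (UNIV - C) s - poly p s)\<^sup>2) < e"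
        using p by (intro exI[of _ "1 - p"]) simp
    qed
  next
    case (union C)
    have C: "C i \<in> sets borel" for i using union by auto
    define f where "f n = (indicator (\<Union>i<n. C i) :: real \<Rightarrow> real)" for n
    show ?case
    proof (rule lim_approx[where f=f])
      show "(\<Union>i. C i) \<in> sets borel" "f n \<in> borel_measurable borel" for n using C by (auto simp: f_def)
      show "\<bar>f n s\<bar> \<le> 1" for n s by (auto simp: f_def indicator_def)
      show "(\<lambda>n. f n s) \<longlonglongrightarrow> indicator (\<Union>i. C i) s" for s
        unfolding f_def by (rule LIMSEQ_indicator_UN)
      show "\<exists>p. \<forall>N\<in>\<N>. (LINT s|N. (f n s - poly p s)\<^sup>2) < e" if "e > 0" for n e
        using that
      proof (induction n arbitrary: e)
        case 0
        then show ?case by (auto simp: f_def intro!: exI[of _ 0])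
      next
        case (Suc n)
        obtain p where p: "\<And>N. N \<in> \<N> \<Longrightarrow> (LINT s|N. (f n s - poly p s)\<^sup>2) < e/4" using Suc.IH[of "e/4"] Suc.prems by auto
        obtain q where q: "\<And>N. N \<in> \<N> \<Longrightarrow> (LINT s|N. (indicator (C n) s - poly q s)\<^sup>2) < e/4"
        proof -
          have "e/4 > 0" using Suc.prems by simp
          then show ?thesis using union(3)[of n] that by blast
        qed
        have eq: "f (Suc n) s = f n s + indicator (C n) s" for s
        proof -
          have "s \<notin> C i" if "s \<in> C n" "i < n" for i
            using union(1) that unfolding disjoint_family_on_def by (metis IntI UNIV_I empty_iff less_irrefl)
          then show ?thesis unfolding f_def by (auto simp: indicator_def less_Suc_eq)
        qed
        show ?case
        proof (intro exI[of _ "p + q"] ballI)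
          fix N assume NN: "N \<in> \<N>"
          then interpret unit_measure N by (rule N)
          have bf: "bdd (f n)" unfolding f_def by (rule bdd_indicator) (use C in auto)
          have le: "(LINT s|N. ((f n s - poly p s) + (indicator (C n) s - poly q s))\<^sup>2) \<le>
             2 * (LINT s|N. (f n s - poly p s)\<^sup>2) + 2 * (LINT s|N. (indicator (C n) s - poly q s)\<^sup>2)"
            by (intro square_sum_le bdd_diff bdd_indicator bdd_poly bf C)
          have eq2: "f (Suc n) s - poly (p + q) s = (f n s - poly p s) + (indicator (C n) s - poly q s)" for s
            by (simp add: eq)
          show "(LINT s|N. (f (Suc n) s - poly (p + q) s)\<^sup>2) < e"
            unfolding eq2 using le p[OF NN] q[OF NN] by linarith
        qed
      qed
    qed
  qed
  then show ?thesis using e by blast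
qed

section \<open>The spectral projections of the contraction\<close>

context positive_contraction
begin

definition nu :: "'h \<Rightarrow> real measure" where
  "nu x = (SOME M. finite_measure M \<and> sets M = sets borel \<and> (AE s in M. 0 \<le> s \<and> s \<le> 1) \<and>
     (\<forall>p. (LINT s|M. poly p s) = inner x (pA p x)))"

lemma nu: "unit_measure (nu x)" "(LINT s|nu x. poly p s) = inner x (pA p x)"
proof -
  have *: "finite_measure (nu x) \<and> sets (nu x) = sets borel \<and> (AE s in nu x. 0 \<le> s \<and> s \<le> 1) \<and>
     (\<forall>p. (LINT s|nu x. poly p s) = inner x (pA p x))"
    unfolding nu_def by (rule someI_ex[OF spectral_measure_exists])
  then show "unit_measure (nu x)" by (simp only: unit_measure_def unit_measure_axioms_def)
  show "(LINT s|nu x. poly p s) = inner x (pA p x)" using * by blast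
qed

sublocale nu: unit_measure "nu x" for x by (rule nu)

text \<open>The map from \<open>p\<close> to \<open>p(A) x\<close> is isometric for the mean square
  norm of \<open>nu x\<close>; therefore polynomials converging to an indicator there yield
  convergent vectors.\<close>

lemma norm_pA: "(norm (pA p x))\<^sup>2 = (LINT s|nu x. (poly p s)\<^sup>2)"
proof -
  have "(norm (pA p x))\<^sup>2 = inner x (pA (p * p) x)" by (simp only: power2_norm_eq_inner pA_mult pA_sym)
  then show ?thesis using nu(2)[of x "p * p"] by (simp add: power2_eq_square)
qed

lemma inner_pA_polar: "inner z (pA p x) = ((LINT s|nu (z + x). poly p s) - (LINT s|nu (z - x). poly p s)) / 4"
proof -
  have "inner x (pA p z) = inner z (pA p x)" by (subst pA_sym) (rule inner_commute)
  then show ?thesis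
    using pA_arg_scaleR[of p "-1" x] pA_arg_add[of p z "- x"]
    by (simp add: nu(2) pA_arg_add inner_add_left inner_add_right inner_diff_left inner_diff_right)
qed

text \<open>One sequence for all vectors of \<open>F\<close> at once: polarized identities involve
  \<open>nu\<close> of several vectors and must be taken to the limit along the same
  polynomials.\<close>

definition approx :: "real set \<Rightarrow> 'h set \<Rightarrow> (nat \<Rightarrow> real poly) \<Rightarrow> bool" where
  "approx B F p \<longleftrightarrow> (\<forall>x\<in>F. (\<lambda>n. LINT s|nu x. (indicator B s - poly (p n) s)\<^sup>2) \<longlonglongrightarrow> 0)"

lemma approx_exists:
  assumes "finite F" "B \<in> sets borel"
  shows "\<exists>p. approx B F p"
proof -
  have "\<forall>n. \<exists>p. \<forall>N\<in>nu ` F. (LINT s|N. (indicator B s - poly p s)\<^sup>2) < inverse (real (Suc n))"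
    by (intro allI poly_approx_indicator) (use assms nu in auto)
  from choice[OF this] obtain p where "\<forall>n. \<forall>N\<in>nu ` F. (LINT s|N. (indicator B s - poly (p n) s)\<^sup>2) < inverse (real (Suc n))" ..
  then have p: "\<And>n x. x \<in> F \<Longrightarrow> (LINT s|nu x. (indicator B s - poly (p n) s)\<^sup>2) < inverse (real (Suc n))" by blast
  have "(\<lambda>n. LINT s|nu x. (indicator B s - poly (p n) s)\<^sup>2) \<longlonglongrightarrow> 0" if "x \<in> F" for x
    by (rule tendsto_sandwich[OF _ _ tendsto_const LIMSEQ_inverse_real_of_nat])
      (use p[OF that] in \<open>auto intro!: always_eventually less_imp_le simp del: of_nat_Suc\<close>)
  then show ?thesis by (auto simp: approx_def)
qed

lemma norm_pA_diff_le:
  assumes B: "B \<in> sets borel"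
  shows "(norm (pA p x - pA q x))\<^sup>2 \<le> 2 * (LINT s|nu x. (indicator B s - poly p s)\<^sup>2) + 2 * (LINT s|nu x. (indicator B s - poly q s)\<^sup>2)"
proof -
  have "(norm (pA p x - pA q x))\<^sup>2 = (LINT s|nu x. ((indicator B s - poly q s) + (-1) * (indicator B s - poly p s))\<^sup>2)"
    using norm_pA[of "p - q" x] by (simp add: pA_diff algebra_simps)
  also have "\<dots> \<le> 2 * (LINT s|nu x. (indicator B s - poly q s)\<^sup>2) + 2 * (LINT s|nu x. ((-1) * (indicator B s - poly p s))\<^sup>2)"
    by (intro nu.square_sum_le nu.bdd_diff nu.bdd_mult nu.bdd_const nu.bdd_indicator nu.bdd_poly B)
  finally show ?thesis by (simp add: power2_commute)
qed

lemma approx_convergent: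
  assumes B: "B \<in> sets borel" and p: "approx B F p" and x: "x \<in> F"
  shows "convergent (\<lambda>n. pA (p n) x)"
proof -
  define a where "a n = (LINT s|nu x. (indicator B s - poly (p n) s)\<^sup>2)" for n
  have a: "a \<longlonglongrightarrow> 0" using p x unfolding approx_def a_def by auto
  have "Cauchy (\<lambda>n. pA (p n) x)"
  proof (rule CauchyI)
    fix e :: real assume e: "e > 0"
    then have "\<forall>\<^sub>F n in sequentially. a n < e\<^sup>2 / 4" by (intro order_tendstoD(2)[OF a]) simp
    then obtain N where N: "\<And>n. n \<ge> N \<Longrightarrow> a n < e\<^sup>2 / 4" by (auto simp: eventually_sequentially)
    show "\<exists>M. \<forall>m\<ge>M. \<forall>n\<ge>M. norm (pA (p m) x - pA (p n) x) < e"
    proof (intro exI allI impI)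
      fix m n assume "m \<ge> N" "n \<ge> N"
      then have "(norm (pA (p m) x - pA (p n) x))\<^sup>2 < e\<^sup>2"
        using norm_pA_diff_le[OF B, of "p m" x "p n"] N[of m] N[of n] unfolding a_def by linarith
      then show "norm (pA (p m) x - pA (p n) x) < e" using e by (auto intro: power_less_imp_less_base)
    qed
  qed
  then show ?thesis by (simp add: Cauchy_convergent_iff)
qed

lemma approx_unique:
  assumes B: "B \<in> sets borel" and p: "approx B F p" "x \<in> F" and q: "approx B G q" "x \<in> G"
    and P: "(\<lambda>n. pA (p n) x) \<longlonglongrightarrow> y" and Q: "(\<lambda>n. pA (q n) x) \<longlonglongrightarrow> z"
  shows "y = z"
proof -
  have "(\<lambda>n. (norm (pA (p n) x - pA (q n) x))\<^sup>2) \<longlonglongrightarrow> 0"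
  proof (rule tendsto_sandwich[OF _ _ tendsto_const])
    show "\<forall>\<^sub>F n in sequentially. (norm (pA (p n) x - pA (q n) x))\<^sup>2 \<le>
      2 * (LINT s|nu x. (indicator B s - poly (p n) s)\<^sup>2) + 2 * (LINT s|nu x. (indicator B s - poly (q n) s)\<^sup>2)"
      using norm_pA_diff_le[OF B] by simp
    have "(\<lambda>n. 2 * (LINT s|nu x. (indicator B s - poly (p n) s)\<^sup>2) + 2 * (LINT s|nu x. (indicator B s - poly (q n) s)\<^sup>2)) \<longlonglongrightarrow> 2 * 0 + 2 * 0"
      using p q unfolding approx_def by (intro tendsto_intros) auto
    then show "(\<lambda>n. 2 * (LINT s|nu x. (indicator B s - poly (p n) s)\<^sup>2) + 2 * (LINT s|nu x. (indicator B s - poly (q n) s)\<^sup>2)) \<longlonglongrightarrow> 0" by simp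
  qed simp
  moreover have "(\<lambda>n. (norm (pA (p n) x - pA (q n) x))\<^sup>2) \<longlonglongrightarrow> (norm (y - z))\<^sup>2" by (intro tendsto_intros P Q)
  ultimately have "(norm (y - z))\<^sup>2 = 0" by (rule LIMSEQ_unique[rotated])
  then show ?thesis by simp
qed

text \<open>The vector obtained by applying the indicator of \<open>B\<close> to the operator, as a
  limit of polynomials in it. The choice is harmless: by \<open>approx_unique\<close> the limit does
  not depend on the sequence.\<close>

definition EA :: "real set \<Rightarrow> 'h \<Rightarrow> 'h" where
  "EA B x = (SOME y. \<exists>p. approx B {x} p \<and> (\<lambda>n. pA (p n) x) \<longlonglongrightarrow> y)"

lemma EA_tendsto:
  assumes B: "B \<in> sets borel" and p: "approx B F p" and x: "x \<in> F"
  shows "(\<lambda>n. pA (p n) x) \<longlonglongrightarrow> EA B x"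
proof -
  obtain y where y: "(\<lambda>n. pA (p n) x) \<longlonglongrightarrow> y" using approx_convergent[OF assms] by (auto simp: convergent_def)
  have px: "approx B {x} p" using p x by (auto simp: approx_def)
  have "\<exists>p. approx B {x} p \<and> (\<lambda>n. pA (p n) x) \<longlonglongrightarrow> EA B x"
    unfolding EA_def by (rule someI[of _ y]) (use px y in auto)
  then obtain q where "approx B {x} q" "(\<lambda>n. pA (q n) x) \<longlonglongrightarrow> EA B x" by blast
  then have "y = EA B x" using approx_unique[OF B px _ _ _ y] by auto
  then show ?thesis using y by simp
qed

lemma approx_integral:
  assumes B: "B \<in> sets borel" and p: "approx B F p" and x: "x \<in> F" and h: "nu.bdd h"
  shows "(\<lambda>n. LINT s|nu x. poly (p n) s * h s) \<longlonglongrightarrow> (LINT s|nu x. indicator B s * h s)"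
proof -
  obtain K where K: "\<And>s. s \<in> {0..1} \<Longrightarrow> \<bar>h s\<bar> \<le> K" using h unfolding nu.bdd_def by blast
  have K0: "0 \<le> K" using K[of 0] by auto
  have bd: "nu.bdd (\<lambda>s. indicator B s - poly (p n) s)" for n by (intro nu.bdd_diff nu.bdd_indicator nu.bdd_poly B)
  have l1: "(\<lambda>n. LINT s|nu x. \<bar>indicator B s - poly (p n) s\<bar>) \<longlonglongrightarrow> 0"
    by (rule nu.L2_imp_L1_tendsto[OF bd]) (use p x in \<open>auto simp: approx_def\<close>)
  have "(\<lambda>n. (LINT s|nu x. indicator B s * h s) - (LINT s|nu x. poly (p n) s * h s)) \<longlonglongrightarrow> 0"
  proof (rule Lim_null_comparison)
    show "(\<lambda>n. K * (LINT s|nu x. \<bar>indicator B s - poly (p n) s\<bar>)) \<longlonglongrightarrow> 0"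
      using tendsto_mult_right_zero[OF l1] .
    show "\<forall>\<^sub>F n in sequentially. norm ((LINT s|nu x. indicator B s * h s) - (LINT s|nu x. poly (p n) s * h s)) \<le> K * (LINT s|nu x. \<bar>indicator B s - poly (p n) s\<bar>)"
    proof (intro always_eventually allI)
      fix n
      have "(LINT s|nu x. indicator B s * h s) - (LINT s|nu x. poly (p n) s * h s) = (LINT s|nu x. (indicator B s - poly (p n) s) * h s)"
        unfolding left_diff_distrib
        by (intro Bochner_Integration.integral_diff[symmetric] nu.bdd_integrable nu.bdd_mult nu.bdd_indicator nu.bdd_poly B h)
      also have "norm \<dots> \<le> (LINT s|nu x. \<bar>(indicator B s - poly (p n) s) * h s\<bar>)"
        using integral_norm_bound[of "nu x" "\<lambda>s. (indicator B s - poly (p n) s) * h s"] by simp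
      also have "\<dots> \<le> (LINT s|nu x. K * \<bar>indicator B s - poly (p n) s\<bar>)"
      proof (rule integral_mono_AE)
        show "AE s in nu x. \<bar>(indicator B s - poly (p n) s) * h s\<bar> \<le> K * \<bar>indicator B s - poly (p n) s\<bar>"
          using nu.AE_unit by eventually_elim (simp add: abs_mult K mult.commute[of K] mult_left_mono)
        show "integrable (nu x) (\<lambda>s. \<bar>(indicator B s - poly (p n) s) * h s\<bar>)"
          by (intro integrable_abs nu.bdd_integrable nu.bdd_mult bd h)
        show "integrable (nu x) (\<lambda>s. K * \<bar>indicator B s - poly (p n) s\<bar>)"
          by (intro integrable_mult_right integrable_abs nu.bdd_integrable bd)
      qed
      finally show "norm ((LINT s|nu x. indicator B s * h s) - (LINT s|nu x. poly (p n) s * h s)) \<le> K * (LINT s|nu x. \<bar>indicator B s - poly (p n) s\<bar>)" by simp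
    qed
  qed
  from tendsto_minus[OF this] show ?thesis by (simp add: LIM_zero_iff)
qed

lemma approx_integral_1:
  assumes B: "B \<in> sets borel" and p: "approx B F p" and x: "x \<in> F"
  shows "(\<lambda>n. LINT s|nu x. poly (p n) s) \<longlonglongrightarrow> measure (nu x) B"
  using approx_integral[OF assms nu.bdd_const[of 1]] B by simp

text \<open>With errors \<open>a\<close> and \<open>b\<close> of the two approximations, the error
  of the product is \<open>a b - 1_B b - a 1_C\<close>. The first term is controlled by the squares
  of \<open>a\<close> and \<open>b\<close>, the others by their L1 norms, which mean square
  convergence on a finite measure makes small.\<close>

lemma approx_integral_mult:
  assumes B: "B \<in> sets borel" and p: "approx B F p" and C: "C \<in> sets borel" and q: "approx C F q" and x: "x \<in> F"
  shows "(\<lambda>n. LINT s|nu x. poly (p n * q n) s) \<longlonglongrightarrow> measure (nu x) (B \<inter> C)"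
proof -
  define a b where "a n s = indicator B s - poly (p n) s" and "b n s = indicator C s - poly (q n) s" for n and s :: real
  have ba: "nu.bdd (a n)" and bb: "nu.bdd (b n)" for n
    unfolding a_def b_def by (intro nu.bdd_diff nu.bdd_indicator nu.bdd_poly B C)+
  have a2: "(\<lambda>n. LINT s|nu x. (a n s)\<^sup>2) \<longlonglongrightarrow> 0" and b2: "(\<lambda>n. LINT s|nu x. (b n s)\<^sup>2) \<longlonglongrightarrow> 0"
    using p q x by (auto simp: approx_def a_def b_def)
  note a1 = nu.L2_imp_L1_tendsto[OF ba a2] and b1 = nu.L2_imp_L1_tendsto[OF bb b2]
  have int: "integrable (nu x) (\<lambda>s. \<bar>a n s\<bar>)" "integrable (nu x) (\<lambda>s. \<bar>b n s\<bar>)" "integrable (nu x) (\<lambda>s. (a n s)\<^sup>2)" "integrable (nu x) (\<lambda>s. (b n s)\<^sup>2)" for n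
    by (intro integrable_abs nu.bdd_integrable nu.bdd_square ba bb)+
  have pq: "integrable (nu x) (poly (p n * q n))" for n by (intro nu.bdd_integrable nu.bdd_poly)
  have BC: "B \<inter> C \<in> sets borel" using B C by auto
  have "(\<lambda>n. (LINT s|nu x. poly (p n * q n) s) - (LINT s|nu x. indicator (B \<inter> C) s)) \<longlonglongrightarrow> 0"
  proof (rule Lim_null_comparison)
    have "(\<lambda>n. (LINT s|nu x. \<bar>a n s\<bar>) + (LINT s|nu x. \<bar>b n s\<bar>) + (LINT s|nu x. (a n s)\<^sup>2) + (LINT s|nu x. (b n s)\<^sup>2)) \<longlonglongrightarrow> 0 + 0 + 0 + 0"
      by (intro tendsto_intros a1 b1 a2 b2)
    then show "(\<lambda>n. (LINT s|nu x. \<bar>a n s\<bar>) + (LINT s|nu x. \<bar>b n s\<bar>) + (LINT s|nu x. (a n s)\<^sup>2) + (LINT s|nu x. (b n s)\<^sup>2)) \<longlonglongrightarrow> 0" by simp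
    show "\<forall>\<^sub>F n in sequentially. norm ((LINT s|nu x. poly (p n * q n) s) - (LINT s|nu x. indicator (B \<inter> C) s)) \<le>
       (LINT s|nu x. \<bar>a n s\<bar>) + (LINT s|nu x. \<bar>b n s\<bar>) + (LINT s|nu x. (a n s)\<^sup>2) + (LINT s|nu x. (b n s)\<^sup>2)"
    proof (intro always_eventually allI)
      fix n
      have "(LINT s|nu x. poly (p n * q n) s) - (LINT s|nu x. indicator (B \<inter> C) s) = (LINT s|nu x. poly (p n * q n) s - indicator (B \<inter> C) s)"
        by (intro Bochner_Integration.integral_diff[symmetric] pq nu.bdd_integrable nu.bdd_indicator BC)
      also have "norm \<dots> \<le> (LINT s|nu x. norm (poly (p n * q n) s - indicator (B \<inter> C) s))" by (rule integral_norm_bound)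
      also have "\<dots> \<le> (LINT s|nu x. \<bar>a n s\<bar> + \<bar>b n s\<bar> + (a n s)\<^sup>2 + (b n s)\<^sup>2)"
      proof (rule integral_mono)
        show "integrable (nu x) (\<lambda>s. norm (poly (p n * q n) s - indicator (B \<inter> C) s))"
          by (intro integrable_norm Bochner_Integration.integrable_diff pq nu.bdd_integrable nu.bdd_indicator BC)
        show "integrable (nu x) (\<lambda>s. \<bar>a n s\<bar> + \<bar>b n s\<bar> + (a n s)\<^sup>2 + (b n s)\<^sup>2)"
          by (intro Bochner_Integration.integrable_add int)
        fix s
        have eq: "poly (p n * q n) s - indicator (B \<inter> C) s = a n s * b n s - indicator B s * b n s - a n s * indicator C s"
          by (simp add: a_def b_def algebra_simps indicator_inter_arith)
        have "\<bar>a n s * b n s\<bar> \<le> (a n s)\<^sup>2 + (b n s)\<^sup>2"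
          using sum_squares_bound[of "\<bar>a n s\<bar>" "\<bar>b n s\<bar>"] abs_ge_zero[of "a n s * b n s"]
          unfolding abs_mult power2_abs by linarith
        moreover have "\<bar>indicator B s * b n s\<bar> \<le> \<bar>b n s\<bar>" "\<bar>a n s * indicator C s\<bar> \<le> \<bar>a n s\<bar>"
          by (auto simp: indicator_def)
        ultimately show "norm (poly (p n * q n) s - indicator (B \<inter> C) s) \<le> \<bar>a n s\<bar> + \<bar>b n s\<bar> + (a n s)\<^sup>2 + (b n s)\<^sup>2"
          unfolding eq real_norm_def by linarith
      qed
      also have "\<dots> = (LINT s|nu x. \<bar>a n s\<bar>) + (LINT s|nu x. \<bar>b n s\<bar>) + (LINT s|nu x. (a n s)\<^sup>2) + (LINT s|nu x. (b n s)\<^sup>2)"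
        using int by (simp add: Bochner_Integration.integral_add)
      finally show "norm ((LINT s|nu x. poly (p n * q n) s) - (LINT s|nu x. indicator (B \<inter> C) s)) \<le>
       (LINT s|nu x. \<bar>a n s\<bar>) + (LINT s|nu x. \<bar>b n s\<bar>) + (LINT s|nu x. (a n s)\<^sup>2) + (LINT s|nu x. (b n s)\<^sup>2)" .
    qed
  qed
  then show ?thesis using BC by (simp add: LIM_zero_iff)
qed

lemma inner_EA_self: "B \<in> sets borel \<Longrightarrow> inner x (EA B x) = measure (nu x) B"
proof -
  assume B: "B \<in> sets borel"
  obtain p where p: "approx B {x} p" using approx_exists[OF _ B, of "{x}"] by auto
  have "(\<lambda>n. inner x (pA (p n) x)) \<longlonglongrightarrow> inner x (EA B x)" by (intro tendsto_intros EA_tendsto[OF B p]) simp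
  moreover have "(\<lambda>n. inner x (pA (p n) x)) \<longlonglongrightarrow> measure (nu x) B"
    using approx_integral_1[OF B p] by (simp add: nu)
  ultimately show ?thesis by (rule LIMSEQ_unique)
qed

lemma EA_sym: "B \<in> sets borel \<Longrightarrow> inner x (EA B y) = inner (EA B x) y"
proof -
  assume B: "B \<in> sets borel"
  obtain p where p: "approx B {x, y} p" using approx_exists[OF _ B, of "{x, y}"] by auto
  have "(\<lambda>n. inner x (pA (p n) y)) \<longlonglongrightarrow> inner x (EA B y)" by (intro tendsto_intros EA_tendsto[OF B p]) simp
  moreover have "(\<lambda>n. inner (pA (p n) x) y) \<longlonglongrightarrow> inner (EA B x) y" by (intro tendsto_intros EA_tendsto[OF B p]) simp
  ultimately show ?thesis unfolding pA_sym by (rule LIMSEQ_unique)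
qed

lemma inner_EA_polar:
  assumes B: "B \<in> sets borel"
  shows "inner z (EA B x) = (measure (nu (z + x)) B - measure (nu (z - x)) B) / 4"
proof -
  obtain p where p: "approx B {x, z + x, z - x} p" using approx_exists[OF _ B, of "{x, z + x, z - x}"] by auto
  have "(\<lambda>n. inner z (pA (p n) x)) \<longlonglongrightarrow> inner z (EA B x)" by (intro tendsto_intros EA_tendsto[OF B p]) simp
  moreover have "(\<lambda>n. inner z (pA (p n) x)) \<longlonglongrightarrow> (measure (nu (z + x)) B - measure (nu (z - x)) B) / 4"
    unfolding inner_pA_polar by (intro tendsto_intros approx_integral_1[OF B p]) auto
  ultimately show ?thesis by (rule LIMSEQ_unique)
qed

text \<open>Polynomials in the operator multiply exactly; moving one factor to the other side of the
  inner product and polarizing reduces the limit to integrals of products of approximants.\<close>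

lemma EA_mult:
  assumes B: "B \<in> sets borel" and C: "C \<in> sets borel"
  shows "EA B (EA C x) = EA (B \<inter> C) x"
proof (subst vector_eq_ldot[symmetric], rule allI)
  fix z
  let ?F = "{x, z, z + x, z - x}"
  obtain p where p: "approx B ?F p" using approx_exists[OF _ B, of ?F] by auto
  obtain q where q: "approx C ?F q" using approx_exists[OF _ C, of ?F] by auto
  have l1: "(\<lambda>n. inner (pA (p n) z) (pA (q n) x)) \<longlonglongrightarrow> inner (EA B z) (EA C x)"
    by (intro tendsto_intros EA_tendsto[OF B p] EA_tendsto[OF C q]) auto
  have eq: "inner (pA (p n) z) (pA (q n) x) = ((LINT s|nu (z + x). poly (p n * q n) s) - (LINT s|nu (z - x). poly (p n * q n) s)) / 4" for n
    unfolding inner_pA_polar[symmetric] by (simp only: pA_mult pA_sym)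
  have l2: "(\<lambda>n. ((LINT s|nu (z + x). poly (p n * q n) s) - (LINT s|nu (z - x). poly (p n * q n) s)) / 4) \<longlonglongrightarrow> (measure (nu (z + x)) (B \<inter> C) - measure (nu (z - x)) (B \<inter> C)) / 4"
    by (intro tendsto_intros approx_integral_mult[OF B p C q]) auto
  have "inner (EA B z) (EA C x) = (measure (nu (z + x)) (B \<inter> C) - measure (nu (z - x)) (B \<inter> C)) / 4"
    by (rule LIMSEQ_unique[OF l1[unfolded eq] l2])
  then show "inner z (EA B (EA C x)) = inner z (EA (B \<inter> C) x)"
    using B C by (simp add: EA_sym inner_EA_polar[symmetric] inner_EA_polar[of "B \<inter> C" z x])
qed

lemma EA_UNIV: "EA UNIV x = x"
proof -
  have "approx UNIV {x} (\<lambda>_. 1)" by (simp add: approx_def)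
  from EA_tendsto[OF _ this, of x] show ?thesis by (simp add: LIMSEQ_const_iff)
qed

lemma EA_Un:
  assumes "B \<in> sets borel" "C \<in> sets borel" "B \<inter> C = {}"
  shows "EA (B \<union> C) x = EA B x + EA C x"
  by (subst vector_eq_ldot[symmetric])
     (use assms in \<open>simp add: inner_add_right inner_EA_polar nu.finite_measure_Union diff_divide_distrib add_divide_distrib\<close>)

lemma norm_EA: "B \<in> sets borel \<Longrightarrow> (norm (EA B x))\<^sup>2 = measure (nu x) B"
  using EA_mult[of B B x] by (simp add: power2_norm_eq_inner EA_sym[symmetric] inner_EA_self)

text \<open>A partial sum is the projection of a finite union, and the squared norm of the remainder
  is the \<open>nu x\<close> mass of the tail, which tends to 0 by continuity of the
  measure.\<close>

lemma EA_sums: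
  assumes F: "range F \<subseteq> sets borel" "disjoint_family F"
  shows "(\<lambda>n. \<Sum>i<n. EA (F i) x) \<longlonglongrightarrow> EA (\<Union>i. F i) x"
proof -
  have Fi: "F i \<in> sets borel" for i using F by auto
  have fin: "(\<Sum>i<n. EA (F i) x) = EA (\<Union>i<n. F i) x" for n
  proof (induction n)
    case 0
    have "EA {} x = 0" using norm_EA[of "{}" x] by simp
    then show ?case by simp
  next
    case (Suc n)
    have "EA ((\<Union>i<n. F i) \<union> F n) x = EA (\<Union>i<n. F i) x + EA (F n) x"
    proof (rule EA_Un)
      show "(\<Union>i<n. F i) \<inter> F n = {}"
        using F(2) unfolding disjoint_family_on_def by (auto simp: disjoint_iff) (metis IntI UNIV_I empty_iff less_irrefl)
    qed (use Fi in auto)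
    moreover have "(\<Union>i<Suc n. F i) = (\<Union>i<n. F i) \<union> F n" by (auto simp: lessThan_Suc)
    ultimately show ?case by (simp add: Suc)
  qed
  have rest: "EA (\<Union>i. F i) x - (\<Sum>i<n. EA (F i) x) = EA ((\<Union>i. F i) - (\<Union>i<n. F i)) x" for n
  proof -
    have "EA ((\<Union>i<n. F i) \<union> ((\<Union>i. F i) - (\<Union>i<n. F i))) x = EA (\<Union>i<n. F i) x + EA ((\<Union>i. F i) - (\<Union>i<n. F i)) x"
      using Fi by (intro EA_Un) auto
    moreover have "(\<Union>i<n. F i) \<union> ((\<Union>i. F i) - (\<Union>i<n. F i)) = (\<Union>i. F i)" by auto
    ultimately show ?thesis by (simp add: fin)
  qed
  have "(\<lambda>n. measure (nu x) ((\<Union>i. F i) - (\<Union>i<n. F i))) \<longlonglongrightarrow> 0"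
  proof -
    have "(\<lambda>n. measure (nu x) (\<Union>i<n. F i)) \<longlonglongrightarrow> measure (nu x) (\<Union>n. \<Union>i<n. F i)"
    proof (rule nu.finite_Lim_measure_incseq)
      show "incseq (\<lambda>n. \<Union>i<n. F i)" unfolding incseq_def by (intro allI impI UN_mono) auto
    qed (use Fi in auto)
    moreover have "(\<Union>n. \<Union>i<n. F i) = (\<Union>i. F i)" by auto
    ultimately have "(\<lambda>n. measure (nu x) (\<Union>i. F i) - measure (nu x) (\<Union>i<n. F i)) \<longlonglongrightarrow> measure (nu x) (\<Union>i. F i) - measure (nu x) (\<Union>i. F i)"
      by (intro tendsto_intros) simp
    moreover have "measure (nu x) ((\<Union>i. F i) - (\<Union>i<n. F i)) = measure (nu x) (\<Union>i. F i) - measure (nu x) (\<Union>i<n. F i)" for n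
      by (rule nu.finite_measure_Diff) (use Fi in auto)
    ultimately show ?thesis by simp
  qed
  then have "(\<lambda>n. (norm (EA (\<Union>i. F i) x - (\<Sum>i<n. EA (F i) x)))\<^sup>2) \<longlonglongrightarrow> 0"
    unfolding rest using Fi by (simp add: norm_EA sets.Diff sets.countable_UN)
  from tendsto_real_sqrt[OF this] have "(\<lambda>n. EA (\<Union>i. F i) x - (\<Sum>i<n. EA (F i) x)) \<longlonglongrightarrow> 0"
    by (simp add: tendsto_norm_zero_iff)
  from tendsto_minus[OF this] show ?thesis by (simp add: LIM_zero_iff)
qed

sublocale real_pvm EA
  by unfold_locales (fact EA_sym EA_mult EA_UNIV EA_sums)+

lemma mu_eq_nu: "\<mu> x = nu x"
  by (rule measure_eqI) (simp_all add: emeasure_mu inner_EA_self nu.emeasure_eq_measure)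

text \<open>An operator that commutes with \<open>A\<close> commutes with its polynomials and hence
  with their limits. Applied to multiplication by \<open>\<i>\<close> it makes the projections
  complex linear.\<close>

lemma EA_commute:
  assumes S: "bounded_linear S" "\<And>x. S (A x) = A (S x)" and B: "B \<in> sets borel"
  shows "EA B (S x) = S (EA B x)"
proof -
  obtain p where p: "approx B {x, S x} p" using approx_exists[OF _ B, of "{x, S x}"] by auto
  have "(\<lambda>n. S (pA (p n) x)) \<longlonglongrightarrow> S (EA B x)"
    by (intro bounded_linear.tendsto[OF S(1)] EA_tendsto[OF B p]) simp
  moreover have "(\<lambda>n. pA (p n) (S x)) \<longlonglongrightarrow> EA B (S x)" by (rule EA_tendsto[OF B p]) simp
  ultimately show ?thesis unfolding pA_commute[OF S] by (auto intro: LIMSEQ_unique)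
qed

text \<open>The spectral representation of \<open>A\<close> itself, localized to \<open>B\<close>:
  approximate the indicator by \<open>p n\<close> and use that \<open>p n(A) A\<close> is the
  polynomial \<open>p n\<close> times \<open>X\<close>.\<close>

lemma inner_EA_A:
  assumes B: "B \<in> sets borel"
  shows "inner x (EA B (A y)) = bform (\<lambda>s. indicator B s * s) x y"
proof -
  obtain p where p: "approx B {A y, x + y, x - y} p" using approx_exists[OF _ B, of "{A y, x + y, x - y}"] by auto
  have l1: "(\<lambda>n. inner x (pA (p n) (A y))) \<longlonglongrightarrow> inner x (EA B (A y))"
    by (intro tendsto_intros EA_tendsto[OF B p]) simp
  have eq: "inner x (pA (p n) (A y)) = ((LINT s|nu (x + y). poly (p n) s * s) - (LINT s|nu (x - y). poly (p n) s * s)) / 4" for n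
    using inner_pA_polar[of x "p n * [:0, 1:]" y] by (simp only: pA_mult pA_X) (simp add: mult.commute)
  have l2: "(\<lambda>n. ((LINT s|nu (x + y). poly (p n) s * s) - (LINT s|nu (x - y). poly (p n) s * s)) / 4) \<longlonglongrightarrow>
      ((LINT s|nu (x + y). indicator B s * s) - (LINT s|nu (x - y). indicator B s * s)) / 4"
    by (intro tendsto_intros approx_integral[OF B p] nu.bdd_id) auto
  show ?thesis unfolding bform_def mu_eq_nu by (rule LIMSEQ_unique[OF l1[unfolded eq] l2])
qed

end

section \<open>The Markov property and the Dyson series\<close>

text \<open>Integration by parts for tail integrals. The product \<open>U s * V s\<close> is an
  integral over a quadrant; the diagonal is null and cuts it into two triangles, each of which is
  one term on the left.\<close>

lemma nn_integral_parts:
  fixes u v :: "real \<Rightarrow> ennreal"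
  assumes [measurable]: "u \<in> borel_measurable borel" "v \<in> borel_measurable borel"
  defines "U r \<equiv> (\<integral>\<^sup>+q. indicator {r<..} q * u q \<partial>lborel)" and "V r \<equiv> (\<integral>\<^sup>+q. indicator {r<..} q * v q \<partial>lborel)"
  shows "(\<integral>\<^sup>+r. indicator {s<..} r * (u r * V r) \<partial>lborel) + (\<integral>\<^sup>+r. indicator {s<..} r * (v r * U r) \<partial>lborel) = U s * V s"
proof -
  let ?T = "\<lambda>r q :: real. indicator {s<..} r * u r * (indicator {s<..} q * v q)"
  have ind[measurable]: "(\<lambda>p::real \<times> real. indicator {fst p<..} (snd p) :: ennreal) \<in> borel_measurable (borel \<Otimes>\<^sub>M borel)"
  proof -
    have "(\<lambda>p::real \<times> real. indicator {fst p<..} (snd p) :: ennreal) = indicator {p. fst p < snd p}"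
      by (auto simp: indicator_def fun_eq_iff)
    moreover have "{p::real \<times> real. fst p < snd p} \<in> sets (borel \<Otimes>\<^sub>M borel)"
      unfolding borel_prod by (intro borel_open open_Collect_less continuous_intros)
    ultimately show ?thesis by simp
  qed
  have "U s * V s = (\<integral>\<^sup>+r. (\<integral>\<^sup>+q. ?T r q \<partial>lborel) \<partial>lborel)"
    unfolding U_def V_def by (simp add: nn_integral_cmult nn_integral_multc)
  also have "\<dots> = (\<integral>\<^sup>+r. (\<integral>\<^sup>+q. indicator {r<..} q * ?T r q + indicator {q<..} r * ?T r q \<partial>lborel) \<partial>lborel)"
  proof (rule nn_integral_cong, rule nn_integral_cong_AE)
    fix r :: real
    show "AE q in lborel. ?T r q = indicator {r<..} q * ?T r q + indicator {q<..} r * ?T r q"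
      using AE_lborel_singleton[of r]
    proof eventually_elim
      case (elim q)
      then show ?case by (cases "r < q") (auto simp: indicator_def)
    qed
  qed
  also have "\<dots> = (\<integral>\<^sup>+r. (\<integral>\<^sup>+q. indicator {r<..} q * ?T r q \<partial>lborel) \<partial>lborel) + (\<integral>\<^sup>+r. (\<integral>\<^sup>+q. indicator {q<..} r * ?T r q \<partial>lborel) \<partial>lborel)"
  proof -
    have m1: "(\<lambda>(r, q). indicator {r<..} q * ?T r q) \<in> borel_measurable (borel \<Otimes>\<^sub>M borel)"
      unfolding split_beta' by measurable
    have m2: "(\<lambda>(r, q). indicator {q<..} r * ?T r q) \<in> borel_measurable (borel \<Otimes>\<^sub>M borel)"
      using measurable_compose[OF measurable_pair_swap' ind] unfolding split_beta' by simp
    have [measurable]: "(\<lambda>q. indicator {q<..} r * ?T r q) \<in> borel_measurable borel" for r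
      using measurable_compose[OF measurable_Pair1' m2, of r] by simp
    have [measurable]: "(\<lambda>q. indicator {r<..} q * ?T r q) \<in> borel_measurable borel" for r by measurable
    have [measurable]: "(\<lambda>r. \<integral>\<^sup>+q. indicator {r<..} q * ?T r q \<partial>lborel) \<in> borel_measurable borel"
      using lborel.borel_measurable_nn_integral_fst[of "\<lambda>(r, q). indicator {r<..} q * ?T r q" borel] m1 by simp
    have [measurable]: "(\<lambda>r. \<integral>\<^sup>+q. indicator {q<..} r * ?T r q \<partial>lborel) \<in> borel_measurable borel"
      using lborel.borel_measurable_nn_integral_fst[of "\<lambda>(r, q). indicator {q<..} r * ?T r q" borel] m2 by simp
    show ?thesis by (simp add: nn_integral_add)
  qed
  also have "(\<integral>\<^sup>+r. (\<integral>\<^sup>+q. indicator {q<..} r * ?T r q \<partial>lborel) \<partial>lborel) = (\<integral>\<^sup>+q. (\<integral>\<^sup>+r. indicator {q<..} r * ?T r q \<partial>lborel) \<partial>lborel)"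
  proof (rule lborel_pair.Fubini'[symmetric])
    show "(\<lambda>(r, q). indicator {q<..} r * ?T r q) \<in> borel_measurable (lborel \<Otimes>\<^sub>M lborel)"
      using measurable_compose[OF measurable_pair_swap' ind] unfolding split_beta' by simp
  qed
  also have "(\<integral>\<^sup>+r. (\<integral>\<^sup>+q. indicator {r<..} q * ?T r q \<partial>lborel) \<partial>lborel) = (\<integral>\<^sup>+r. indicator {s<..} r * (u r * V r) \<partial>lborel)"
  proof (rule nn_integral_cong)
    fix r
    have "(\<integral>\<^sup>+q. indicator {r<..} q * ?T r q \<partial>lborel) = (\<integral>\<^sup>+q. (indicator {s<..} r * u r) * (indicator {r<..} q * v q) \<partial>lborel)"
      by (rule nn_integral_cong) (auto simp: indicator_def)
    then show "(\<integral>\<^sup>+q. indicator {r<..} q * ?T r q \<partial>lborel) = indicator {s<..} r * (u r * V r)"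
      unfolding V_def by (simp add: nn_integral_cmult mult.assoc)
  qed
  also have "(\<integral>\<^sup>+q. (\<integral>\<^sup>+r. indicator {q<..} r * ?T r q \<partial>lborel) \<partial>lborel) = (\<integral>\<^sup>+r. indicator {s<..} r * (v r * U r) \<partial>lborel)"
  proof (rule nn_integral_cong)
    fix q
    have "(\<integral>\<^sup>+r. indicator {q<..} r * ?T r q \<partial>lborel) = (\<integral>\<^sup>+r. (indicator {s<..} q * v q) * (indicator {q<..} r * u r) \<partial>lborel)"
      by (rule nn_integral_cong) (auto simp: indicator_def ac_simps)
    then show "(\<integral>\<^sup>+r. indicator {q<..} r * ?T r q \<partial>lborel) = indicator {s<..} q * (v q * U q)"
      unfolding U_def by (simp add: nn_integral_cmult mult.assoc)
  qed
  finally show ?thesis by simp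
qed

text \<open>The iterated integrals \<open>\<integral>\<^sub>s\<^sub><\<^sub>r\<^sub>1\<^sub><\<dots>\<^sub><\<^sub>r\<^sub>n w(r\<^sub>1)\<dots>w(r\<^sub>n)\<close> of the Dyson series.\<close>

primrec simplex_integral :: "(real \<Rightarrow> ennreal) \<Rightarrow> nat \<Rightarrow> real \<Rightarrow> ennreal" where
  "simplex_integral w 0 s = 1"
| "simplex_integral w (Suc n) s = (\<integral>\<^sup>+r. indicator {s<..} r * (w r * simplex_integral w n r) \<partial>lborel)"

lemma simplex_integral_measurable [measurable]:
  assumes [measurable]: "w \<in> borel_measurable borel"
  shows "simplex_integral w n \<in> borel_measurable borel"
proof (induction n)
  case (Suc n)
  note [measurable] = Suc
  have "(\<lambda>p::real \<times> real. indicator {fst p<..} (snd p) :: ennreal) = indicator {p. fst p < snd p}"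
    by (auto simp: indicator_def fun_eq_iff)
  moreover have "{p::real \<times> real. fst p < snd p} \<in> sets (borel \<Otimes>\<^sub>M borel)"
    unfolding borel_prod by (intro borel_open open_Collect_less continuous_intros)
  ultimately have [measurable]: "(\<lambda>p::real \<times> real. indicator {fst p<..} (snd p) :: ennreal) \<in> borel_measurable (borel \<Otimes>\<^sub>M borel)"
    by simp
  have "(\<lambda>s. \<integral>\<^sup>+r. (\<lambda>p. indicator {fst p<..} (snd p) * (w (snd p) * simplex_integral w n (snd p))) (s, r) \<partial>lborel) \<in> borel_measurable borel"
    by (rule lborel.borel_measurable_nn_integral_fst) measurable
  then show ?case by simp
qed simp

text \<open>For a product integrand the ordered simplex is a fraction \<open>1 / fact n\<close> of
  the cube. Induction on \<open>n\<close> needs only that integrating \<open>w a^m\<close> gives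
  \<open>a^(m+1) / (m+1)\<close> for the tail integral \<open>a\<close> of \<open>w\<close>.\<close>

lemma simplex_integral_eq:
  assumes w[measurable]: "w \<in> borel_measurable borel"
  shows "of_nat (fact n) * simplex_integral w n s = (\<integral>\<^sup>+r. indicator {s<..} r * w r \<partial>lborel) ^ n"
proof (induction n arbitrary: s)
  case (Suc n)
  define a where "a s = (\<integral>\<^sup>+r. indicator {s<..} r * w r \<partial>lborel)" for s
  have a_def1: "a = simplex_integral w 1" by (simp add: a_def fun_eq_iff)
  have [measurable]: "a \<in> borel_measurable borel" unfolding a_def1 by measurable
  \<comment> \<open>The derivative rule for powers of a tail integral, obtained by parts with
    \<open>v\<close> the formal derivative of the previous power; multiplied out, so that no
    division in \<open>ennreal\<close> occurs.\<close>
  have I: "of_nat (Suc m) * (\<integral>\<^sup>+r. indicator {s<..} r * (w r * a r ^ m) \<partial>lborel) = a s ^ Suc m" for m s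
  proof (induction m arbitrary: s)
    case 0
    then show ?case by (simp add: a_def)
  next
    case (Suc m)
    define v where "v r = of_nat (Suc m) * (w r * a r ^ m)" for r
    have [measurable]: "v \<in> borel_measurable borel" unfolding v_def[abs_def] by measurable
    have V: "(\<integral>\<^sup>+q. indicator {r<..} q * v q \<partial>lborel) = a r ^ Suc m" for r
    proof -
      have "(\<integral>\<^sup>+q. indicator {r<..} q * v q \<partial>lborel) = of_nat (Suc m) * (\<integral>\<^sup>+q. indicator {r<..} q * (w q * a q ^ m) \<partial>lborel)"
        unfolding v_def by (subst nn_integral_cmult[symmetric]) (simp_all add: mult.left_commute)
      then show ?thesis using Suc.IH by simp
    qed
    define X where "X = (\<integral>\<^sup>+r. indicator {s<..} r * (w r * a r ^ Suc m) \<partial>lborel)"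
    have v2: "(\<integral>\<^sup>+r. indicator {s<..} r * (v r * a r) \<partial>lborel) = of_nat (Suc m) * X"
      unfolding v_def X_def by (subst nn_integral_cmult[symmetric]) (auto intro!: nn_integral_cong simp: ac_simps)
    have "X + of_nat (Suc m) * X = a s * a s ^ Suc m"
      using nn_integral_parts[of w v s] unfolding V a_def[symmetric] v2 X_def by simp
    then show ?case unfolding X_def[symmetric] by (simp add: distrib_right add.commute)
  qed
  have "of_nat (fact (Suc n)) * simplex_integral w (Suc n) s =
      of_nat (Suc n) * (\<integral>\<^sup>+r. indicator {s<..} r * (w r * (of_nat (fact n) * simplex_integral w n r)) \<partial>lborel)"
  proof -
    have "(\<integral>\<^sup>+r. indicator {s<..} r * (w r * (of_nat (fact n) * simplex_integral w n r)) \<partial>lborel) =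
       of_nat (fact n) * (\<integral>\<^sup>+r. indicator {s<..} r * (w r * simplex_integral w n r) \<partial>lborel)"
      by (subst nn_integral_cmult[symmetric]) (auto intro!: nn_integral_cong simp: ac_simps)
    moreover have "of_nat (fact (Suc n) :: nat) = (of_nat (Suc n) * of_nat (fact n) :: ennreal)"
      by (simp only: fact_Suc of_nat_mult of_nat_id)
    ultimately show ?thesis by (simp only: mult.assoc simplex_integral.simps)
  qed
  also have "\<dots> = a s ^ Suc n"
    unfolding Suc.IH a_def[symmetric] by (rule I)
  finally show ?case by (simp only: a_def)
qed simp

lemma simplex_integral_suminf:
  assumes w: "w \<in> borel_measurable borel" and a: "(\<integral>\<^sup>+r. indicator {s<..} r * w r \<partial>lborel) = ennreal \<alpha>" "0 \<le> \<alpha>"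
  shows "(\<Sum>n. simplex_integral w n s) = ennreal (exp \<alpha>)"
proof -
  have eq: "simplex_integral w n s = ennreal (\<alpha> ^ n / fact n)" for n
  proof -
    have "ennreal (fact n) * simplex_integral w n s = ennreal (\<alpha> ^ n)"
      using simplex_integral_eq[OF w, of n s] a by (simp add: ennreal_power ennreal_of_nat_eq_real_of_nat)
    then have "ennreal (1 / fact n) * (ennreal (fact n) * simplex_integral w n s) = ennreal (1 / fact n) * ennreal (\<alpha> ^ n)" by simp
    moreover have "ennreal (1 / fact n) * ennreal (fact n) = 1"
      by (subst ennreal_mult[symmetric]) auto
    ultimately show ?thesis
      using a(2) by (simp add: mult.assoc[symmetric]) (simp add: ennreal_mult[symmetric])
  qed
  have "(\<lambda>n. \<alpha> ^ n / fact n) sums exp \<alpha>"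
    using exp_converges[of \<alpha>] by (simp add: scaleR_conv_of_real divide_inverse mult.commute)
  then show ?thesis unfolding eq using a(2) by (intro suminf_ennreal_eq) auto
qed

section \<open>Joint measurability and the Markov property\<close>

context cauchy_process
begin

text \<open>Nothing is assumed of \<open>X\<close> at negative times; freezing them at time 0 gives
  a process that is jointly measurable on the whole line.\<close>

definition Xp :: "real \<Rightarrow> 'w \<Rightarrow> 'a" where "Xp t = X (max 0 t)"

lemma Xp_eq: "0 \<le> t \<Longrightarrow> Xp t = X t"
  by (simp add: Xp_def max_def)

text \<open>Right-continuity makes the process the pointwise limit of its values at grid times
  approaching from the right, and for each grid these values are a countable gluing of random
  variables.\<close>

lemma Xp_measurable: "(\<lambda>(t, \<omega>). Xp t \<omega>) \<in> borel_measurable (borel \<Otimes>\<^sub>M M)"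
proof -
  \<comment> \<open>The added 1 puts the grid time strictly to the right of \<open>max 0 t\<close>,
    at distance at most \<open>1 / (n + 1)\<close>.\<close>
  define T where "T n t = (real (nat \<lfloor>max 0 t * real (Suc n)\<rfloor>) + 1) / real (Suc n)" for n and t :: real
  have T: "max 0 t < T n t" "T n t \<le> max 0 t + inverse (real (Suc n))" for n t
  proof -
    define m where "m = real (Suc n)"
    have m: "m > 0" by (simp add: m_def)
    define q where "q = max 0 t * m"
    have q: "0 \<le> q" using m by (simp add: q_def)
    then have f: "real (nat \<lfloor>q\<rfloor>) = of_int \<lfloor>q\<rfloor>" by simp
    have "q < of_int \<lfloor>q\<rfloor> + 1" by linarith
    then have "q / m < (of_int \<lfloor>q\<rfloor> + 1) / m" using m by (intro divide_strict_right_mono) auto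
    moreover have "q / m = max 0 t" using m by (simp add: q_def)
    ultimately show "max 0 t < T n t" unfolding T_def m_def[symmetric] q_def[symmetric] f by simp
    have "(of_int \<lfloor>q\<rfloor> + 1) / m \<le> (q + 1) / m" using m by (intro divide_right_mono) auto
    also have "(q + 1) / m = max 0 t + inverse m" using m by (simp add: q_def field_simps)
    finally show "T n t \<le> max 0 t + inverse (real (Suc n))" unfolding T_def m_def[symmetric] q_def[symmetric] f .
  qed
  have lim: "(\<lambda>n. X (T n (fst z)) (snd z)) \<longlonglongrightarrow> (case z of (t, \<omega>) \<Rightarrow> Xp t \<omega>)" if z: "z \<in> space (borel \<Otimes>\<^sub>M M)" for z
  proof -
    obtain t \<omega> where tw: "z = (t, \<omega>)" by (cases z)
    have w: "\<omega> \<in> space M" using z by (simp add: tw space_pair_measure)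
    have "((\<lambda>t. X t \<omega>) \<longlongrightarrow> X (max 0 t) \<omega>) (at_right (max 0 t))"
      using cadlag_paths[OF w] unfolding cadlag_def by simp
    moreover have "filterlim (\<lambda>n. T n t) (at_right (max 0 t)) sequentially"
      unfolding filterlim_at
    proof (intro conjI)
      show "(\<lambda>n. T n t) \<longlonglongrightarrow> max 0 t"
      proof (rule tendsto_sandwich[where f="\<lambda>_. max 0 t"])
        show "(\<lambda>n. max 0 t + inverse (real (Suc n))) \<longlonglongrightarrow> max 0 t"
          using tendsto_add[OF tendsto_const LIMSEQ_inverse_real_of_nat, of "max 0 t"] by simp
        show "\<forall>\<^sub>F n in sequentially. max 0 t \<le> T n t" using T(1)[of t] by (intro always_eventually allI less_imp_le)
        show "\<forall>\<^sub>F n in sequentially. T n t \<le> max 0 t + inverse (real (Suc n))" using T(2)[of _ t] by (intro always_eventually allI)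
      qed simp
      show "\<forall>\<^sub>F n in sequentially. T n t \<in> {max 0 t<..} \<and> T n t \<noteq> max 0 t"
        using T(1)[of t] by (auto intro!: always_eventually simp: less_imp_neq[symmetric])
    qed
    ultimately show ?thesis unfolding tw Xp_def by (auto intro: filterlim_compose)
  qed
  show ?thesis
  proof (rule borel_measurable_LIMSEQ_metric[where f="\<lambda>n z. X (T n (fst z)) (snd z)"])
    fix n
    have "(\<lambda>z. (\<lambda>i z. X ((real i + 1) / real (Suc n)) (snd z)) (nat \<lfloor>max 0 (fst z) * real (Suc n)\<rfloor>) z) \<in> borel_measurable (borel \<Otimes>\<^sub>M M)"
    proof (rule measurable_compose_countable[where f="\<lambda>i z. X ((real i + 1) / real (Suc n)) (snd z)"
        and g="\<lambda>z. nat \<lfloor>max 0 (fst z) * real (Suc n)\<rfloor>"])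
      show "(\<lambda>z. X ((real i + 1) / real (Suc n)) (snd z)) \<in> borel_measurable (borel \<Otimes>\<^sub>M M)" for i :: nat
        by (rule measurable_compose[OF measurable_snd random_variable]) simp
      show "(\<lambda>z. nat \<lfloor>max 0 (fst z) * real (Suc n)\<rfloor>) \<in> measurable (borel \<Otimes>\<^sub>M M) (count_space UNIV)"
        by measurable
    qed
    then show "(\<lambda>z. X (T n (fst z)) (snd z)) \<in> borel_measurable (borel \<Otimes>\<^sub>M M)" by (simp add: T_def)
  qed (rule lim)
qed

lemma Xp_measurable' [measurable (raw)]:
  "f \<in> borel_measurable N \<Longrightarrow> g \<in> measurable N M \<Longrightarrow> (\<lambda>z. Xp (f z) (g z)) \<in> borel_measurable N"
  using measurable_compose[OF measurable_Pair Xp_measurable, of f N g] by simp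

lemma AE_X0: "AE \<omega> in M. X 0 \<omega> = 0" by (rule start)

text \<open>\<open>past s Z\<close>: up to null sets, \<open>Z\<close> is a function of finitely many increments of the process
  before time \<open>s\<close>.\<close>

definition past :: "real \<Rightarrow> ('w \<Rightarrow> ennreal) \<Rightarrow> bool" where
  "past s Z \<longleftrightarrow> (\<exists>n \<tau> F. \<tau> 0 = 0 \<and> (\<forall>i<n. \<tau> i < \<tau> (Suc i)) \<and> \<tau> n = s \<and>
     F \<in> borel_measurable (PiM {..<n} (\<lambda>_. borel :: 'a measure)) \<and>
     (AE \<omega> in M. Z \<omega> = F (\<lambda>i\<in>{..<n}. X (\<tau> (Suc i)) \<omega> - X (\<tau> i) \<omega>)))"

lemma past_0: "past 0 (\<lambda>_. 1)"
  unfolding past_def by (intro exI[of _ 0] exI[of _ "\<lambda>_. 0"] exI[of _ "\<lambda>_. 1"]) auto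

lemma increments_sum: "(\<Sum>i<n. X (\<tau> (Suc i)) \<omega> - X (\<tau> i) \<omega>) = X (\<tau> n) \<omega> - X (\<tau> 0) \<omega>"
  by (induction n) auto

text \<open>The value at time \<open>r\<close> is the sum of all increments up to \<open>r\<close>,
  because the process starts at 0 almost surely; appending one increment therefore suffices.\<close>

lemma past_step:
  assumes Z: "past s Z" and r: "s < r" and h[measurable]: "h \<in> borel_measurable borel"
  shows "past r (\<lambda>\<omega>. Z \<omega> * h (X r \<omega>))"
proof -
  obtain n \<tau> F where \<tau>: "\<tau> 0 = 0" "\<forall>i<n. \<tau> i < \<tau> (Suc i)" "\<tau> n = s"
    and F[measurable]: "F \<in> borel_measurable (PiM {..<n} (\<lambda>_. borel :: 'a measure))"
    and ZF: "AE \<omega> in M. Z \<omega> = F (\<lambda>i\<in>{..<n}. X (\<tau> (Suc i)) \<omega> - X (\<tau> i) \<omega>)"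
    using Z unfolding past_def by blast
  define \<sigma> where "\<sigma> = \<tau>(Suc n := r)"
  define G where "G y = F (restrict y {..<n}) * h (\<Sum>i<Suc n. y i)" for y
  show ?thesis
    unfolding past_def
  proof (intro exI[of _ "Suc n"] exI[of _ \<sigma>] exI[of _ G] conjI)
    show "\<sigma> 0 = 0" "\<forall>i<Suc n. \<sigma> i < \<sigma> (Suc i)" "\<sigma> (Suc n) = r"
      using \<tau> r by (auto simp: \<sigma>_def less_Suc_eq)
    show "G \<in> borel_measurable (PiM {..<Suc n} (\<lambda>_. borel))"
      unfolding G_def
    proof (intro borel_measurable_times_ennreal)
      show "(\<lambda>y. F (restrict y {..<n})) \<in> borel_measurable (PiM {..<Suc n} (\<lambda>_. borel))"
        by (rule measurable_compose[OF measurable_restrict_subset F]) auto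
      show "(\<lambda>y. h (\<Sum>i<Suc n. y i)) \<in> borel_measurable (PiM {..<Suc n} (\<lambda>_. borel :: 'a measure))"
        by (intro measurable_compose[OF _ h] borel_measurable_sum measurable_component_singleton) auto
    qed
    show "AE \<omega> in M. Z \<omega> * h (X r \<omega>) = G (\<lambda>i\<in>{..<Suc n}. X (\<sigma> (Suc i)) \<omega> - X (\<sigma> i) \<omega>)"
      using ZF AE_X0
    proof eventually_elim
      case (elim \<omega>)
      have "restrict (\<lambda>i\<in>{..<Suc n}. X (\<sigma> (Suc i)) \<omega> - X (\<sigma> i) \<omega>) {..<n} = (\<lambda>i\<in>{..<n}. X (\<tau> (Suc i)) \<omega> - X (\<tau> i) \<omega>)"
        by (auto simp: \<sigma>_def restrict_def fun_eq_iff)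
      moreover have "(\<Sum>i<Suc n. (\<lambda>i\<in>{..<Suc n}. X (\<sigma> (Suc i)) \<omega> - X (\<sigma> i) \<omega>) i) = X r \<omega>"
      proof -
        have "(\<Sum>i<Suc n. (\<lambda>i\<in>{..<Suc n}. X (\<sigma> (Suc i)) \<omega> - X (\<sigma> i) \<omega>) i) = (\<Sum>i<Suc n. X (\<sigma> (Suc i)) \<omega> - X (\<sigma> i) \<omega>)"
          by (rule sum.cong) auto
        also have "\<dots> = X r \<omega>" unfolding increments_sum using elim(2) \<tau>(1) by (simp add: \<sigma>_def)
        finally show ?thesis .
      qed
      ultimately show ?case using elim(1) by (simp only: G_def)
    qed
  qed
qed

lemma past_nonneg: "past s Z \<Longrightarrow> 0 \<le> s"
proof -
  assume "past s Z"
  then obtain n \<tau> where \<tau>: "\<tau> 0 = (0::real)" "\<forall>i<n. \<tau> i < \<tau> (Suc i)" "\<tau> n = s" unfolding past_def by blast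
  have "i \<le> n \<Longrightarrow> 0 \<le> \<tau> i" for i
  proof (induction i)
    case (Suc i)
    then have "\<tau> i < \<tau> (Suc i)" using \<tau>(2) by auto
    with Suc show ?case by simp
  qed (simp add: \<tau>)
  then show ?thesis using \<tau>(3) by auto
qed

text \<open>The increment from \<open>s\<close> to \<open>s + d\<close> is appended to those that
  determine \<open>Z\<close>. Independence makes its joint law with them a product, and stationarity
  gives it the law of \<open>X d\<close>.\<close>

lemma markov:
  assumes Z: "past s Z" and d: "0 < d" and u[measurable]: "u \<in> borel_measurable borel"
  shows "(\<integral>\<^sup>+\<omega>. Z \<omega> * u (X (s + d) \<omega>) \<partial>M) = (\<integral>\<^sup>+\<omega>. Z \<omega> * (\<integral>\<^sup>+\<omega>'. u (X s \<omega> + X d \<omega>') \<partial>M) \<partial>M)"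
proof -
  obtain n \<tau> F where \<tau>: "\<tau> 0 = 0" "\<forall>i<n. \<tau> i < \<tau> (Suc i)" "\<tau> n = s"
    and F[measurable]: "F \<in> borel_measurable (PiM {..<n} (\<lambda>_. borel :: 'a measure))"
    and ZF: "AE \<omega> in M. Z \<omega> = F (\<lambda>i\<in>{..<n}. X (\<tau> (Suc i)) \<omega> - X (\<tau> i) \<omega>)"
    using Z unfolding past_def by blast
  have s: "0 \<le> s" by (rule past_nonneg[OF Z])
  define \<sigma> where "\<sigma> = \<tau>(Suc n := s + d)"
  define D where "D i \<omega> = X (\<sigma> (Suc i)) \<omega> - X (\<sigma> i) \<omega>" for i \<omega>
  have ind: "indep_vars (\<lambda>_. borel) D {..<Suc n}"
    unfolding D_def by (rule independent_increments) (use \<tau> d in \<open>auto simp: \<sigma>_def less_Suc_eq\<close>)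
  let ?P = "PiM {..<n} (\<lambda>_. borel :: 'a measure)"
  let ?R = "\<lambda>\<omega>. \<lambda>i\<in>{..<n}. D i \<omega>"
  let ?P' = "PiM {n} (\<lambda>_. borel :: 'a measure)" and ?R' = "\<lambda>\<omega>. \<lambda>i\<in>{n}. D i \<omega>"
  \<comment> \<open>The increments are grouped into the block before time \<open>s\<close> and the
    single last one.\<close>
  have iv: "indep_var ?P ?R ?P' ?R'"
    by (rule indep_var_restrict[OF ind]) auto
  have rv[measurable]: "?R \<in> measurable M ?P" "?R' \<in> measurable M ?P'"
    and joint: "distr M ?P ?R \<Otimes>\<^sub>M distr M ?P' ?R' = distr M (?P \<Otimes>\<^sub>M ?P') (\<lambda>\<omega>. (?R \<omega>, ?R' \<omega>))"
    using iv unfolding indep_var_distribution_eq by auto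
  have cm[measurable]: "(\<lambda>y. y n) \<in> borel_measurable ?P'" by (rule measurable_component_singleton) simp
  have Dm[measurable]: "D n \<in> borel_measurable M"
    using measurable_compose[OF rv(2) cm] by simp
  interpret DR: prob_space "distr M ?P ?R" by (rule prob_space_distr) measurable
  interpret DD: prob_space "distr M ?P' ?R'" by (rule prob_space_distr) measurable
  have Rs: "AE \<omega> in M. Z \<omega> = F (?R \<omega>) \<and> X s \<omega> = (\<Sum>i<n. ?R \<omega> i) \<and> X (s + d) \<omega> = (\<Sum>i<n. ?R \<omega> i) + D n \<omega>"
    using ZF AE_X0
  proof eventually_elim
    case (elim \<omega>)
    have 1: "?R \<omega> = (\<lambda>i\<in>{..<n}. X (\<tau> (Suc i)) \<omega> - X (\<tau> i) \<omega>)"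
      by (auto simp: D_def \<sigma>_def restrict_def fun_eq_iff)
    have 2: "(\<Sum>i<n. ?R \<omega> i) = X s \<omega>"
    proof -
      have "(\<Sum>i<n. ?R \<omega> i) = (\<Sum>i<n. X (\<tau> (Suc i)) \<omega> - X (\<tau> i) \<omega>)" unfolding 1 by (rule sum.cong) auto
      then show ?thesis unfolding increments_sum using elim(2) \<tau> by simp
    qed
    have "D n \<omega> = X (s + d) \<omega> - X s \<omega>" using \<tau>(3) by (simp add: D_def \<sigma>_def)
    then show ?case using elim(1) 1 2 by simp
  qed
  have Dn: "distr M borel (D n) = distr M borel (X d)"
  proof -
    have "distr M borel (D n) = distr M borel (\<lambda>\<omega>. X (s + d) \<omega> - X s \<omega>)"
      using \<tau>(3) by (simp add: D_def[abs_def] \<sigma>_def)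
    also have "\<dots> = distr M borel (\<lambda>\<omega>. X d \<omega> - X 0 \<omega>)" using s d by (intro stationary_increments) auto
    also have "\<dots> = distr M borel (X d)"
    proof (rule distr_cong_AE)
      show "AE \<omega> in M. X d \<omega> - X 0 \<omega> = X d \<omega>" using AE_X0 by eventually_elim simp
    qed (use d in \<open>auto intro!: random_variable borel_measurable_diff\<close>)
    finally show ?thesis .
  qed
  have [measurable]: "X d \<in> borel_measurable M" using d by (intro random_variable) simp
  have sm[measurable]: "(\<lambda>y. \<Sum>i<n. y i) \<in> borel_measurable ?P"
    by (intro borel_measurable_sum measurable_component_singleton) auto
  have inner_eq: "(\<integral>\<^sup>+z. F y * u (c + z n) \<partial>distr M ?P' ?R') = F y * (\<integral>\<^sup>+\<omega>'. u (c + X d \<omega>') \<partial>M)" for c y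
  proof -
    have "(\<integral>\<^sup>+z. F y * u (c + z n) \<partial>distr M ?P' ?R') = (\<integral>\<^sup>+\<omega>'. F y * u (c + D n \<omega>') \<partial>M)"
      by (subst nn_integral_distr) simp_all
    also have "\<dots> = F y * (\<integral>\<^sup>+z. u (c + z) \<partial>distr M borel (D n))"
      by (simp add: nn_integral_cmult nn_integral_distr)
    also have "\<dots> = F y * (\<integral>\<^sup>+\<omega>'. u (c + X d \<omega>') \<partial>M)" unfolding Dn by (simp add: nn_integral_distr)
    finally show ?thesis .
  qed
  have "(\<integral>\<^sup>+\<omega>. Z \<omega> * u (X (s + d) \<omega>) \<partial>M) = (\<integral>\<^sup>+\<omega>. (\<lambda>(y, z). F y * u ((\<Sum>i<n. y i) + z n)) (?R \<omega>, ?R' \<omega>) \<partial>M)"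
    by (rule nn_integral_cong_AE) (use Rs in \<open>eventually_elim, simp\<close>)
  also have "\<dots> = (\<integral>\<^sup>+p. (\<lambda>(y, z). F y * u ((\<Sum>i<n. y i) + z n)) p \<partial>distr M (?P \<Otimes>\<^sub>M ?P') (\<lambda>\<omega>. (?R \<omega>, ?R' \<omega>)))"
    by (subst nn_integral_distr) measurable
  also have "\<dots> = (\<integral>\<^sup>+y. \<integral>\<^sup>+z. F y * u ((\<Sum>i<n. y i) + z n) \<partial>distr M ?P' ?R' \<partial>distr M ?P ?R)"
    unfolding joint[symmetric] by (subst DD.nn_integral_fst[symmetric]) simp_all
  also have "\<dots> = (\<integral>\<^sup>+y. F y * (\<integral>\<^sup>+\<omega>'. u ((\<Sum>i<n. y i) + X d \<omega>') \<partial>M) \<partial>distr M ?P ?R)"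
    unfolding inner_eq ..
  also have "\<dots> = (\<integral>\<^sup>+\<omega>. F (?R \<omega>) * (\<integral>\<^sup>+\<omega>'. u ((\<Sum>i<n. ?R \<omega> i) + X d \<omega>') \<partial>M) \<partial>M)"
    by (rule nn_integral_distr) measurable
  also have "\<dots> = (\<integral>\<^sup>+\<omega>. Z \<omega> * (\<integral>\<^sup>+\<omega>'. u (X s \<omega> + X d \<omega>') \<partial>M) \<partial>M)"
    by (rule nn_integral_cong_AE) (use Rs in \<open>eventually_elim, simp\<close>)
  finally show ?thesis .
qed

end

lemma simplex_integral_measurable_pair:
  assumes w[measurable]: "(\<lambda>(z, r). w z r) \<in> borel_measurable (N \<Otimes>\<^sub>M borel)"
  shows "(\<lambda>(z, s). simplex_integral (w z) n s) \<in> borel_measurable (N \<Otimes>\<^sub>M borel)"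
proof (induction n)
  case (Suc n)
  note [measurable] = Suc
  have "(\<lambda>p::real \<times> real. indicator {fst p<..} (snd p) :: ennreal) = indicator {p. fst p < snd p}"
    by (auto simp: indicator_def fun_eq_iff)
  moreover have "{p::real \<times> real. fst p < snd p} \<in> sets (borel \<Otimes>\<^sub>M borel)"
    unfolding borel_prod by (intro borel_open open_Collect_less continuous_intros)
  ultimately have ind: "(\<lambda>p::real \<times> real. indicator {fst p<..} (snd p) :: ennreal) \<in> borel_measurable (borel \<Otimes>\<^sub>M borel)"
    by simp
  have [measurable]: "(\<lambda>p. indicator {snd (fst p)<..} (snd p) :: ennreal) \<in> borel_measurable ((N \<Otimes>\<^sub>M borel) \<Otimes>\<^sub>M (borel :: real measure))"
    using measurable_compose[OF measurable_Pair[OF measurable_compose[OF measurable_fst[of "N \<Otimes>\<^sub>M borel" borel] measurable_snd] measurable_snd] ind] by simp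
  have [measurable]: "(\<lambda>p. w (fst (fst p)) (snd p)) \<in> borel_measurable ((N \<Otimes>\<^sub>M borel) \<Otimes>\<^sub>M (borel :: real measure))"
    using measurable_compose[OF measurable_Pair[OF measurable_compose[OF measurable_fst measurable_fst] measurable_snd] w] by simp
  have [measurable]: "(\<lambda>p. simplex_integral (w (fst (fst p))) n (snd p)) \<in> borel_measurable ((N \<Otimes>\<^sub>M borel) \<Otimes>\<^sub>M (borel :: real measure))"
    using measurable_compose[OF measurable_Pair[OF measurable_compose[OF measurable_fst measurable_fst] measurable_snd] Suc] by simp
  have "(\<lambda>q. \<integral>\<^sup>+r. (\<lambda>p. indicator {snd (fst p)<..} (snd p) * (w (fst (fst p)) (snd p) * simplex_integral (w (fst (fst p))) n (snd p))) (q, r) \<partial>lborel)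
     \<in> borel_measurable (N \<Otimes>\<^sub>M borel)"
    by (rule lborel.borel_measurable_nn_integral_fst) measurable
  then show ?case by (simp add: split_beta')
qed simp

section \<open>The Dyson series of the path integral\<close>

context cauchy_process
begin

definition cauchy_resolvent :: "real \<Rightarrow> ('a \<Rightarrow> ennreal) \<Rightarrow> 'a \<Rightarrow> ennreal" where
  "cauchy_resolvent lam u y = (\<integral>\<^sup>+t. \<integral>\<^sup>+\<omega>. indicator {0<..} t * ennreal (exp (- lam * t)) * u (y + Xp t \<omega>) \<partial>M \<partial>lborel)"

lemma cauchy_resolvent_measurable [measurable]:
  assumes [measurable]: "u \<in> borel_measurable borel"
  shows "cauchy_resolvent lam u \<in> borel_measurable borel"
  unfolding cauchy_resolvent_def[abs_def] by measurable

lemma cauchy_resolvent_shift: "cauchy_resolvent lam (\<lambda>y. u (x + y)) z = cauchy_resolvent lam u (x + z)"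
  by (simp add: cauchy_resolvent_def add.assoc)

interpretation LM: pair_sigma_finite "lborel :: real measure" M ..

text \<open>The Markov property at time \<open>s\<close>, integrated over later times with the
  exponential clock restarted at \<open>s\<close>; after the shift \<open>d = t - s\<close> the
  inner integral is the resolvent at the current position.\<close>

lemma resolvent_past:
  assumes Z: "past s Z" and Zm[measurable]: "Z \<in> borel_measurable M" and u[measurable]: "u \<in> borel_measurable borel"
  shows "(\<integral>\<^sup>+\<omega>. Z \<omega> * (\<integral>\<^sup>+t. indicator {s<..} t * ennreal (exp (- lam * (t - s))) * u (Xp t \<omega>) \<partial>lborel) \<partial>M)
    = (\<integral>\<^sup>+\<omega>. Z \<omega> * cauchy_resolvent lam u (Xp s \<omega>) \<partial>M)"
proof -
  have s: "0 \<le> s" by (rule past_nonneg[OF Z])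
  let ?e = "\<lambda>t. ennreal (exp (- lam * (t - s)))"
  have "(\<integral>\<^sup>+\<omega>. Z \<omega> * (\<integral>\<^sup>+t. indicator {s<..} t * ?e t * u (Xp t \<omega>) \<partial>lborel) \<partial>M) =
      (\<integral>\<^sup>+\<omega>. \<integral>\<^sup>+t. indicator {s<..} t * ?e t * (Z \<omega> * u (Xp t \<omega>)) \<partial>lborel \<partial>M)"
    by (intro nn_integral_cong, subst nn_integral_cmult[symmetric]) (auto intro!: nn_integral_cong simp: ac_simps)
  also have "\<dots> = (\<integral>\<^sup>+t. \<integral>\<^sup>+\<omega>. indicator {s<..} t * ?e t * (Z \<omega> * u (Xp t \<omega>)) \<partial>M \<partial>lborel)"
    by (rule LM.Fubini') measurable
  also have "\<dots> = (\<integral>\<^sup>+t. indicator {s<..} t * ?e t * (\<integral>\<^sup>+\<omega>. Z \<omega> * u (Xp t \<omega>) \<partial>M) \<partial>lborel)"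
    by (intro nn_integral_cong nn_integral_cmult) measurable
  also have "\<dots> = (\<integral>\<^sup>+t. indicator {s<..} t * ?e t * (\<integral>\<^sup>+\<omega>. Z \<omega> * (\<integral>\<^sup>+\<omega>'. u (Xp s \<omega> + Xp (t - s) \<omega>') \<partial>M) \<partial>M) \<partial>lborel)"
  proof (rule nn_integral_cong)
    fix t :: real
    show "indicator {s<..} t * ?e t * (\<integral>\<^sup>+\<omega>. Z \<omega> * u (Xp t \<omega>) \<partial>M) =
       indicator {s<..} t * ?e t * (\<integral>\<^sup>+\<omega>. Z \<omega> * (\<integral>\<^sup>+\<omega>'. u (Xp s \<omega> + Xp (t - s) \<omega>') \<partial>M) \<partial>M)"
    proof (cases "s < t")
      case True
      then show ?thesis using markov[OF Z, of "t - s" u] s by (simp add: Xp_eq)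
    qed simp
  qed
  also have "\<dots> = (\<integral>\<^sup>+d. indicator {0<..} d * ennreal (exp (- lam * d)) * (\<integral>\<^sup>+\<omega>. Z \<omega> * (\<integral>\<^sup>+\<omega>'. u (Xp s \<omega> + Xp d \<omega>') \<partial>M) \<partial>M) \<partial>lborel)"
  proof -
    have "(\<integral>\<^sup>+d. (\<lambda>d. indicator {0<..} d * ennreal (exp (- lam * d)) * (\<integral>\<^sup>+\<omega>. Z \<omega> * (\<integral>\<^sup>+\<omega>'. u (Xp s \<omega> + Xp d \<omega>') \<partial>M) \<partial>M)) (d + (- s)) \<partial>lborel)
      = (\<integral>\<^sup>+d. indicator {0<..} d * ennreal (exp (- lam * d)) * (\<integral>\<^sup>+\<omega>. Z \<omega> * (\<integral>\<^sup>+\<omega>'. u (Xp s \<omega> + Xp d \<omega>') \<partial>M) \<partial>M) \<partial>lborel)"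
      by (rule nn_integral_lborel_translate) measurable
    moreover have "indicator {0<..} (t + (- s)) = (indicator {s<..} t :: ennreal)" for t :: real by (simp add: indicator_def)
    ultimately show ?thesis by simp
  qed
  also have "\<dots> = (\<integral>\<^sup>+d. \<integral>\<^sup>+\<omega>. Z \<omega> * (\<integral>\<^sup>+\<omega>'. indicator {0<..} d * ennreal (exp (- lam * d)) * u (Xp s \<omega> + Xp d \<omega>') \<partial>M) \<partial>M \<partial>lborel)"
    by (intro nn_integral_cong) (simp add: nn_integral_cmult[symmetric] mult.left_commute)
  also have "\<dots> = (\<integral>\<^sup>+\<omega>. \<integral>\<^sup>+d. Z \<omega> * (\<integral>\<^sup>+\<omega>'. indicator {0<..} d * ennreal (exp (- lam * d)) * u (Xp s \<omega> + Xp d \<omega>') \<partial>M) \<partial>lborel \<partial>M)"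
    by (rule LM.Fubini'[symmetric]) measurable
  also have "\<dots> = (\<integral>\<^sup>+\<omega>. Z \<omega> * cauchy_resolvent lam u (Xp s \<omega>) \<partial>M)"
    unfolding cauchy_resolvent_def by (intro nn_integral_cong nn_integral_cmult) measurable
  finally show ?thesis .
qed

text \<open>The terms \<open>(R W)^n R g\<close> of the Neumann series, with \<open>R\<close> the
  resolvent without potential.\<close>

primrec dyson :: "real \<Rightarrow> ('a \<Rightarrow> ennreal) \<Rightarrow> ('a \<Rightarrow> ennreal) \<Rightarrow> nat \<Rightarrow> 'a \<Rightarrow> ennreal" where
  "dyson lam W g 0 = cauchy_resolvent lam g"
| "dyson lam W g (Suc n) = cauchy_resolvent lam (\<lambda>y. W y * dyson lam W g n y)"

lemma dyson_measurable [measurable]: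
  assumes [measurable]: "W \<in> borel_measurable borel" "g \<in> borel_measurable borel"
  shows "dyson lam W g n \<in> borel_measurable borel"
  by (induction n) simp_all

lemma dyson_shift: "dyson lam (\<lambda>y. W (x + y)) (\<lambda>y. g (x + y)) n z = dyson lam W g n (x + z)"
proof (induction n arbitrary: z)
  case (Suc n)
  then show ?case using cauchy_resolvent_shift[of lam "\<lambda>y. W y * dyson lam W g n y" x z] by simp
qed (simp add: cauchy_resolvent_shift)

lemma indicator_lessThan_measurable [measurable (raw)]:
  fixes f h :: "'z \<Rightarrow> real"
  assumes "f \<in> borel_measurable N" "h \<in> borel_measurable N"
  shows "(\<lambda>z. indicator {..<f z} (h z) :: ennreal) \<in> borel_measurable N"
proof -
  have "(\<lambda>p::real \<times> real. indicator {..<fst p} (snd p) :: ennreal) = indicator {p. snd p < fst p}"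
    by (auto simp: indicator_def fun_eq_iff)
  moreover have "{p::real \<times> real. snd p < fst p} \<in> sets (borel \<Otimes>\<^sub>M borel)"
    unfolding borel_prod by (intro borel_open open_Collect_less continuous_intros)
  ultimately have i: "(\<lambda>p::real \<times> real. indicator {..<fst p} (snd p) :: ennreal) \<in> borel_measurable (borel \<Otimes>\<^sub>M borel)"
    by simp
  show ?thesis using measurable_compose[OF measurable_Pair[OF assms] i] by simp
qed

lemma path_simplex_measurable [measurable (raw)]:
  fixes f k :: "'z \<Rightarrow> real"
  assumes W[measurable]: "W \<in> borel_measurable borel"
    and fk: "f \<in> borel_measurable N" "h \<in> measurable N M" "k \<in> borel_measurable N"
  shows "(\<lambda>z. simplex_integral (\<lambda>r. indicator {..<f z} r * W (Xp r (h z))) n (k z)) \<in> borel_measurable N"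
proof -
  have i: "(\<lambda>(z, s). simplex_integral ((\<lambda>(t, \<omega>) r. indicator {..<t} r * W (Xp r \<omega>)) z) n s) \<in> borel_measurable ((borel \<Otimes>\<^sub>M M) \<Otimes>\<^sub>M borel)"
    by (rule simplex_integral_measurable_pair) (simp add: split_beta', measurable)
  show ?thesis using measurable_compose[OF measurable_Pair[OF measurable_Pair[OF fk(1,2)] fk(3)] i] by simp
qed

text \<open>The start time \<open>s\<close> and the past variable \<open>Z\<close> are arbitrary
  because the induction changes both: the earliest interaction time \<open>r\<close> becomes the new
  present, and \<open>W\<close> evaluated there joins the past.\<close>

lemma dyson_past:
  assumes W[measurable]: "W \<in> borel_measurable borel" and g[measurable]: "g \<in> borel_measurable borel"
    and Z: "past s Z" and Zm[measurable]: "Z \<in> borel_measurable M"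
  shows "(\<integral>\<^sup>+\<omega>. Z \<omega> * (\<integral>\<^sup>+t. indicator {s<..} t * ennreal (exp (- lam * (t - s))) *
      (simplex_integral (\<lambda>r. indicator {..<t} r * W (Xp r \<omega>)) n s * g (Xp t \<omega>)) \<partial>lborel) \<partial>M)
    = (\<integral>\<^sup>+\<omega>. Z \<omega> * dyson lam W g n (Xp s \<omega>) \<partial>M)"
  using Z Zm
proof (induction n arbitrary: s Z)
  case 0
  then show ?case using resolvent_past[OF 0 g, of lam] by simp
next
  case (Suc n)
  note [measurable] = Suc.prems(2)
  let ?S = "\<lambda>t \<omega> r. simplex_integral (\<lambda>r. indicator {..<t} r * W (Xp r \<omega>)) n r"
  note S' = path_simplex_measurable[OF W]
  let ?F = "\<lambda>\<omega> t r. indicator {s<..} r * ennreal (exp (- lam * (r - s))) * (Z \<omega> * W (Xp r \<omega>) *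
      (indicator {..<t} r * ennreal (exp (- lam * (t - r))) * (?S t \<omega> r * g (Xp t \<omega>))))"
  have "(\<integral>\<^sup>+\<omega>. Z \<omega> * (\<integral>\<^sup>+t. indicator {s<..} t * ennreal (exp (- lam * (t - s))) *
      (simplex_integral (\<lambda>r. indicator {..<t} r * W (Xp r \<omega>)) (Suc n) s * g (Xp t \<omega>)) \<partial>lborel) \<partial>M)
    = (\<integral>\<^sup>+\<omega>. \<integral>\<^sup>+t. \<integral>\<^sup>+r. ?F \<omega> t r \<partial>lborel \<partial>lborel \<partial>M)"
  proof (rule nn_integral_cong)
    fix \<omega> assume w[measurable]: "\<omega> \<in> space M"
    have [measurable]: "(\<lambda>r. W (Xp r \<omega>)) \<in> borel_measurable borel" "(\<lambda>r. g (Xp r \<omega>)) \<in> borel_measurable borel" by measurable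
    have Sm[measurable]: "(\<lambda>p. ?S (fst p) \<omega> (snd p)) \<in> borel_measurable (borel \<Otimes>\<^sub>M borel)"
      by (rule S') (use w in measurable)
    have "Z \<omega> * (\<integral>\<^sup>+t. indicator {s<..} t * ennreal (exp (- lam * (t - s))) *
      (simplex_integral (\<lambda>r. indicator {..<t} r * W (Xp r \<omega>)) (Suc n) s * g (Xp t \<omega>)) \<partial>lborel)
      = (\<integral>\<^sup>+t. Z \<omega> * (indicator {s<..} t * ennreal (exp (- lam * (t - s))) *
      (simplex_integral (\<lambda>r. indicator {..<t} r * W (Xp r \<omega>)) (Suc n) s * g (Xp t \<omega>))) \<partial>lborel)"
    proof (rule nn_integral_cmult[symmetric])
      have "(\<lambda>t. simplex_integral (\<lambda>r. indicator {..<t} r * W (Xp r \<omega>)) (Suc n) s) \<in> borel_measurable borel"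
        using measurable_compose[OF measurable_Pair[OF measurable_ident_sets[OF refl] measurable_const[of s]]
          simplex_integral_measurable_pair[of "\<lambda>t r. indicator {..<t} r * W (Xp r \<omega>)" borel "Suc n"]]
        by (simp add: split_beta' del: simplex_integral.simps)
      then show "(\<lambda>t. indicator {s<..} t * ennreal (exp (- lam * (t - s))) *
          (simplex_integral (\<lambda>r. indicator {..<t} r * W (Xp r \<omega>)) (Suc n) s * g (Xp t \<omega>))) \<in> borel_measurable lborel"
        by measurable
    qed
    also have "\<dots> = (\<integral>\<^sup>+t. \<integral>\<^sup>+r. ?F \<omega> t r \<partial>lborel \<partial>lborel)"
    proof (rule nn_integral_cong)
      fix t :: real
      let ?c = "Z \<omega> * (indicator {s<..} t * ennreal (exp (- lam * (t - s))) * g (Xp t \<omega>))"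
      \<comment> \<open>The exponential clock is split at \<open>r\<close>: one factor stays
        outside, the other is the clock restarted at \<open>r\<close>.\<close>
      have e: "ennreal (exp (- lam * (t - s))) = ennreal (exp (- lam * (r - s))) * ennreal (exp (- lam * (t - r)))" for r
        by (simp add: ennreal_mult[symmetric] exp_add[symmetric] algebra_simps)
      have "Z \<omega> * (indicator {s<..} t * ennreal (exp (- lam * (t - s))) * (simplex_integral (\<lambda>r. indicator {..<t} r * W (Xp r \<omega>)) (Suc n) s * g (Xp t \<omega>)))
        = ?c * (\<integral>\<^sup>+r. indicator {s<..} r * (indicator {..<t} r * W (Xp r \<omega>) * ?S t \<omega> r) \<partial>lborel)"
        by (simp add: mult_ac)
      also have "\<dots> = (\<integral>\<^sup>+r. ?c * (indicator {s<..} r * (indicator {..<t} r * W (Xp r \<omega>) * ?S t \<omega> r)) \<partial>lborel)"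
      proof (rule nn_integral_cmult[symmetric])
        have "(\<lambda>r. ?S t \<omega> r) \<in> borel_measurable borel" using measurable_compose[OF measurable_Pair1' Sm, of t] by simp
        then show "(\<lambda>r. indicator {s<..} r * (indicator {..<t} r * W (Xp r \<omega>) * ?S t \<omega> r)) \<in> borel_measurable lborel" by measurable
      qed
      also have "\<dots> = (\<integral>\<^sup>+r. ?F \<omega> t r \<partial>lborel)"
      proof (rule nn_integral_cong)
        fix r
        show "?c * (indicator {s<..} r * (indicator {..<t} r * W (Xp r \<omega>) * ?S t \<omega> r)) = ?F \<omega> t r"
        proof (cases "s < r \<and> r < t")
          case True
          then show ?thesis unfolding e[of r] by (simp add: ac_simps)
        qed (auto simp: indicator_def)
      qed
      finally show "Z \<omega> * (indicator {s<..} t * ennreal (exp (- lam * (t - s))) * (simplex_integral (\<lambda>r. indicator {..<t} r * W (Xp r \<omega>)) (Suc n) s * g (Xp t \<omega>)))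
        = (\<integral>\<^sup>+r. ?F \<omega> t r \<partial>lborel)" .
    qed
    finally show "Z \<omega> * (\<integral>\<^sup>+t. indicator {s<..} t * ennreal (exp (- lam * (t - s))) *
      (simplex_integral (\<lambda>r. indicator {..<t} r * W (Xp r \<omega>)) (Suc n) s * g (Xp t \<omega>)) \<partial>lborel) = (\<integral>\<^sup>+t. \<integral>\<^sup>+r. ?F \<omega> t r \<partial>lborel \<partial>lborel)" .
  qed
  also have "\<dots> = (\<integral>\<^sup>+\<omega>. \<integral>\<^sup>+r. \<integral>\<^sup>+t. ?F \<omega> t r \<partial>lborel \<partial>lborel \<partial>M)"
  proof (rule nn_integral_cong)
    fix \<omega> assume w[measurable]: "\<omega> \<in> space M"
    show "(\<integral>\<^sup>+t. \<integral>\<^sup>+r. ?F \<omega> t r \<partial>lborel \<partial>lborel) = (\<integral>\<^sup>+r. \<integral>\<^sup>+t. ?F \<omega> t r \<partial>lborel \<partial>lborel)"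
      by (rule lborel_pair.Fubini'[of "\<lambda>r t. ?F \<omega> t r"]) measurable
  qed
  also have "\<dots> = (\<integral>\<^sup>+r. \<integral>\<^sup>+\<omega>. \<integral>\<^sup>+t. ?F \<omega> t r \<partial>lborel \<partial>M \<partial>lborel)"
    by (rule LM.Fubini') measurable
  also have "\<dots> = (\<integral>\<^sup>+r. \<integral>\<^sup>+\<omega>. indicator {s<..} r * ennreal (exp (- lam * (r - s))) * (Z \<omega> * W (Xp r \<omega>) * dyson lam W g n (Xp r \<omega>)) \<partial>M \<partial>lborel)"
  proof (rule nn_integral_cong)
    fix r :: real
    show "(\<integral>\<^sup>+\<omega>. \<integral>\<^sup>+t. ?F \<omega> t r \<partial>lborel \<partial>M) =
      (\<integral>\<^sup>+\<omega>. indicator {s<..} r * ennreal (exp (- lam * (r - s))) * (Z \<omega> * W (Xp r \<omega>) * dyson lam W g n (Xp r \<omega>)) \<partial>M)"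
    proof (cases "s < r")
      case True
      have r0: "0 \<le> r" using past_nonneg[OF Suc.prems(1)] True by simp
      \<comment> \<open>\<open>Z\<close> times \<open>W\<close> at time \<open>r\<close> is again a
        function of finitely many increments, so the induction hypothesis applies with
        \<open>r\<close> in place of \<open>s\<close>.\<close>
      have p: "past r (\<lambda>\<omega>. Z \<omega> * W (Xp r \<omega>))"
        using past_step[OF Suc.prems(1) True W] r0 by (simp add: Xp_eq)
      have pm: "(\<lambda>\<omega>. Z \<omega> * W (Xp r \<omega>)) \<in> borel_measurable M" by measurable
      have "(\<integral>\<^sup>+\<omega>. \<integral>\<^sup>+t. ?F \<omega> t r \<partial>lborel \<partial>M) =
        (\<integral>\<^sup>+\<omega>. ennreal (exp (- lam * (r - s))) * (Z \<omega> * W (Xp r \<omega>) * (\<integral>\<^sup>+t. indicator {r<..} t * ennreal (exp (- lam * (t - r))) * (?S t \<omega> r * g (Xp t \<omega>)) \<partial>lborel)) \<partial>M)"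
      proof (rule nn_integral_cong)
        fix \<omega> assume w[measurable]: "\<omega> \<in> space M"
        have i: "indicator {..<t} r = (indicator {r<..} t :: ennreal)" for t by (simp add: indicator_def)
        have sm: "(\<lambda>t. ?S t \<omega> r) \<in> borel_measurable lborel" by (rule S'[of _ lborel]) (use w in measurable)
        show "(\<integral>\<^sup>+t. ?F \<omega> t r \<partial>lborel) = ennreal (exp (- lam * (r - s))) * (Z \<omega> * W (Xp r \<omega>) * (\<integral>\<^sup>+t. indicator {r<..} t * ennreal (exp (- lam * (t - r))) * (?S t \<omega> r * g (Xp t \<omega>)) \<partial>lborel))"
          using True sm unfolding i by (simp add: nn_integral_cmult)
      qed
      also have "\<dots> = ennreal (exp (- lam * (r - s))) * (\<integral>\<^sup>+\<omega>. Z \<omega> * W (Xp r \<omega>) * (\<integral>\<^sup>+t. indicator {r<..} t * ennreal (exp (- lam * (t - r))) * (?S t \<omega> r * g (Xp t \<omega>)) \<partial>lborel) \<partial>M)"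
        by (rule nn_integral_cmult) measurable
      also have "\<dots> = ennreal (exp (- lam * (r - s))) * (\<integral>\<^sup>+\<omega>. Z \<omega> * W (Xp r \<omega>) * dyson lam W g n (Xp r \<omega>) \<partial>M)"
        by (simp only: Suc.IH[OF p pm])
      also have "\<dots> = (\<integral>\<^sup>+\<omega>. indicator {s<..} r * ennreal (exp (- lam * (r - s))) * (Z \<omega> * W (Xp r \<omega>) * dyson lam W g n (Xp r \<omega>)) \<partial>M)"
        using True by (simp add: nn_integral_cmult)
      finally show ?thesis .
    qed simp
  qed
  also have "\<dots> = (\<integral>\<^sup>+\<omega>. \<integral>\<^sup>+r. indicator {s<..} r * ennreal (exp (- lam * (r - s))) * (Z \<omega> * W (Xp r \<omega>) * dyson lam W g n (Xp r \<omega>)) \<partial>lborel \<partial>M)"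
    by (rule LM.Fubini'[symmetric]) measurable
  also have "\<dots> = (\<integral>\<^sup>+\<omega>. Z \<omega> * (\<integral>\<^sup>+r. indicator {s<..} r * ennreal (exp (- lam * (r - s))) * (W (Xp r \<omega>) * dyson lam W g n (Xp r \<omega>)) \<partial>lborel) \<partial>M)"
    by (intro nn_integral_cong, subst nn_integral_cmult[symmetric]) (auto intro!: nn_integral_cong simp: ac_simps)
  also have "\<dots> = (\<integral>\<^sup>+\<omega>. Z \<omega> * dyson lam W g (Suc n) (Xp s \<omega>) \<partial>M)"
    using resolvent_past[OF Suc.prems, of "\<lambda>y. W y * dyson lam W g n y" lam] by simp
  finally show ?case .
qed

definition path_resolvent :: "real \<Rightarrow> ('a \<Rightarrow> real) \<Rightarrow> ('a \<Rightarrow> ennreal) \<Rightarrow> 'a \<Rightarrow> ennreal" where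
  "path_resolvent lam W g x = (\<integral>\<^sup>+\<omega>. \<integral>\<^sup>+t. indicator {0<..} t * ennreal (exp (- lam * t)) *
     (ennreal (exp (LINT r|lborel. indicator {0..t} r * W (x + Xp r \<omega>))) * g (x + Xp t \<omega>)) \<partial>lborel \<partial>M)"

lemma simplex_integral_path_suminf:
  assumes W[measurable]: "W \<in> borel_measurable borel" and B: "\<And>y. 0 \<le> W y" "\<And>y. W y \<le> B" and w[measurable]: "\<omega> \<in> space M"
  shows "(\<Sum>n. simplex_integral (\<lambda>r. indicator {..<t} r * ennreal (W (Xp r \<omega>))) n 0)
    = ennreal (exp (LINT r|lborel. indicator {0..t} r * W (Xp r \<omega>)))"
proof (rule simplex_integral_suminf)
  have [measurable]: "(\<lambda>r. W (Xp r \<omega>)) \<in> borel_measurable borel" by measurable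
  show "(\<lambda>r. indicator {..<t} r * ennreal (W (Xp r \<omega>))) \<in> borel_measurable borel" by measurable
  have i: "integrable lborel (\<lambda>r. indicator {0..t} r * W (Xp r \<omega>))"
  proof (rule Bochner_Integration.integrable_bound)
    show "integrable lborel (\<lambda>r. B * indicator {0..t} r)"
      by (intro integrable_mult_right integrable_real_indicator) (auto simp: emeasure_lborel_Icc_eq)
    show "AE r in lborel. norm (indicator {0..t} r * W (Xp r \<omega>)) \<le> norm (B * indicator {0..t} r)"
      using B order_trans[OF B] by (intro AE_I2) (auto simp: indicator_def)
  qed measurable
  have "(\<integral>\<^sup>+r. indicator {0<..} r * (indicator {..<t} r * ennreal (W (Xp r \<omega>))) \<partial>lborel) =
     (\<integral>\<^sup>+r. ennreal (indicator {0..t} r * W (Xp r \<omega>)) \<partial>lborel)"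
  proof (rule nn_integral_cong_AE)
    show "AE r in lborel. indicator {0<..} r * (indicator {..<t} r * ennreal (W (Xp r \<omega>))) = ennreal (indicator {0..t} r * W (Xp r \<omega>))"
      using AE_lborel_singleton[of 0] AE_lborel_singleton[of t]
      by eventually_elim (auto simp: indicator_def)
  qed
  also have "\<dots> = ennreal (LINT r|lborel. indicator {0..t} r * W (Xp r \<omega>))"
    using B by (intro nn_integral_eq_integral i) (auto simp: indicator_def)
  finally show "(\<integral>\<^sup>+r. indicator {0<..} r * (indicator {..<t} r * ennreal (W (Xp r \<omega>))) \<partial>lborel) =
     ennreal (LINT r|lborel. indicator {0..t} r * W (Xp r \<omega>))" .
  show "0 \<le> (LINT r|lborel. indicator {0..t} r * W (Xp r \<omega>))"
    using B by (intro Bochner_Integration.integral_nonneg) (auto simp: indicator_def)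
qed

text \<open>The exponential is expanded along each path into simplex integrals. The process starts
  at 0, so the starting point \<open>x\<close> is built into the shifted functions, and each term is
  the case of time 0 with trivial past.\<close>

lemma path_resolvent_dyson:
  assumes W[measurable]: "W \<in> borel_measurable borel" and B: "\<And>y. 0 \<le> W y" "\<And>y. W y \<le> B"
    and g[measurable]: "g \<in> borel_measurable borel"
  shows "path_resolvent lam W g x = (\<Sum>n. dyson lam (\<lambda>y. ennreal (W y)) g n x)"
proof -
  let ?W = "\<lambda>y. W (x + y)" and ?g = "\<lambda>y. g (x + y)"
  let ?S = "\<lambda>n t \<omega>. simplex_integral (\<lambda>r. indicator {..<t} r * ennreal (?W (Xp r \<omega>))) n 0"
  let ?I = "\<lambda>n \<omega> t. indicator {0<..} t * ennreal (exp (- lam * t)) * (?S n t \<omega> * ?g (Xp t \<omega>))"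
  have [measurable]: "(\<lambda>y. ennreal (?W y)) \<in> borel_measurable borel" "?g \<in> borel_measurable borel" by measurable
  have Sm[measurable (raw)]: "(\<lambda>z. ?S n (f z) (h z)) \<in> borel_measurable N"
    if "f \<in> borel_measurable N" "h \<in> measurable N M" for n and f :: "'z \<Rightarrow> real" and h N
    by (rule path_simplex_measurable[OF _ that measurable_const]) simp_all
  have "dyson lam (\<lambda>y. ennreal (W y)) g n x = (\<integral>\<^sup>+\<omega>. \<integral>\<^sup>+t. ?I n \<omega> t \<partial>lborel \<partial>M)" for n
  proof -
    have "(\<integral>\<^sup>+\<omega>. \<integral>\<^sup>+t. ?I n \<omega> t \<partial>lborel \<partial>M) = (\<integral>\<^sup>+\<omega>. dyson lam (\<lambda>y. ennreal (?W y)) ?g n (Xp 0 \<omega>) \<partial>M)"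
      using dyson_past[OF _ _ past_0, of "\<lambda>y. ennreal (?W y)" ?g lam n] by simp
    also have "\<dots> = (\<integral>\<^sup>+\<omega>. dyson lam (\<lambda>y. ennreal (?W y)) ?g n 0 \<partial>M)"
      using AE_X0 by (intro nn_integral_cong_AE) (auto simp: Xp_eq)
    also have "\<dots> = dyson lam (\<lambda>y. ennreal (W y)) g n x"
      using dyson_shift[of lam "\<lambda>y. ennreal (W y)" x g n 0] by (simp add: emeasure_space_1)
    finally show ?thesis ..
  qed
  then have "(\<Sum>n. dyson lam (\<lambda>y. ennreal (W y)) g n x) = (\<integral>\<^sup>+\<omega>. (\<Sum>n. \<integral>\<^sup>+t. ?I n \<omega> t \<partial>lborel) \<partial>M)"
    by (simp add: nn_integral_suminf)
  also have "\<dots> = (\<integral>\<^sup>+\<omega>. \<integral>\<^sup>+t. (\<Sum>n. ?I n \<omega> t) \<partial>lborel \<partial>M)"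
  proof (rule nn_integral_cong)
    fix \<omega> assume w: "\<omega> \<in> space M"
    have [measurable]: "(\<lambda>t. ?S n t \<omega>) \<in> borel_measurable borel" for n by (rule Sm) (use w in auto)
    have [measurable]: "(\<lambda>t. ?g (Xp t \<omega>)) \<in> borel_measurable borel" using w by measurable
    show "(\<Sum>n. \<integral>\<^sup>+t. ?I n \<omega> t \<partial>lborel) = (\<integral>\<^sup>+t. (\<Sum>n. ?I n \<omega> t) \<partial>lborel)"
      by (rule nn_integral_suminf[symmetric]) measurable
  qed
  also have "\<dots> = path_resolvent lam W g x"
    unfolding path_resolvent_def
  proof (intro nn_integral_cong)
    fix \<omega> t assume w: "\<omega> \<in> space M"
    have "(\<Sum>n. ?S n t \<omega>) = ennreal (exp (LINT r|lborel. indicator {0..t} r * ?W (Xp r \<omega>)))"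
      by (rule simplex_integral_path_suminf) (use B w in auto)
    then show "(\<Sum>n. ?I n \<omega> t) = indicator {0<..} t * ennreal (exp (- lam * t)) *
       (ennreal (exp (LINT r|lborel. indicator {0..t} r * W (x + Xp r \<omega>))) * g (x + Xp t \<omega>))"
      by (simp add: ennreal_suminf_cmult ennreal_suminf_multc)
  qed
  finally show ?thesis ..
qed

lemma path_resolvent_measurable [measurable]:
  assumes [measurable]: "W \<in> borel_measurable borel" and B: "\<And>y. 0 \<le> W y" "\<And>y. W y \<le> B"
    and [measurable]: "g \<in> borel_measurable borel"
  shows "path_resolvent lam W g \<in> borel_measurable borel"
  unfolding path_resolvent_dyson[OF assms, abs_def] by measurable

lemma cauchy_resolvent_suminf:
  assumes [measurable]: "\<And>n. h n \<in> borel_measurable borel"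
  shows "cauchy_resolvent lam (\<lambda>y. \<Sum>n. h n y) x = (\<Sum>n. cauchy_resolvent lam (h n) x)"
  unfolding cauchy_resolvent_def ennreal_suminf_cmult[symmetric]
  by (simp add: nn_integral_suminf del: ennreal_suminf_cmult)

text \<open>Split off the zeroth term of the series and pull the resolvent out of the rest. All
  terms are nonnegative, so the equation holds even where its value is infinite.\<close>

lemma path_resolvent_fixpoint:
  assumes W[measurable]: "W \<in> borel_measurable borel" and B: "\<And>y. 0 \<le> W y" "\<And>y. W y \<le> B"
    and g[measurable]: "g \<in> borel_measurable borel"
  shows "path_resolvent lam W g x = cauchy_resolvent lam g x + cauchy_resolvent lam (\<lambda>y. ennreal (W y) * path_resolvent lam W g y) x"
proof -
  let ?d = "dyson lam (\<lambda>y. ennreal (W y)) g"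
  have "(\<lambda>n. ?d (Suc n) x) sums (\<Sum>n. ?d (Suc n) x)" by (rule summable_sums[OF summableI])
  then have "(\<lambda>n. ?d n x) sums ((\<Sum>n. ?d (Suc n) x) + ?d 0 x)" by (rule sums_Suc)
  then have 1: "(\<Sum>n. ?d n x) = cauchy_resolvent lam g x + (\<Sum>n. ?d (Suc n) x)" by (simp add: sums_iff add.commute)
  have "(\<Sum>n. ?d (Suc n) x) = cauchy_resolvent lam (\<lambda>y. \<Sum>n. ennreal (W y) * ?d n y) x"
    unfolding dyson.simps by (rule cauchy_resolvent_suminf[symmetric]) measurable
  then show ?thesis unfolding path_resolvent_dyson[OF W B g] 1 by simp
qed

end

section \<open>The resolvent of the perturbed operator\<close>

lemma integral_exp_ray:
  fixes a :: real assumes a: "a > 0"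
  shows "(\<integral>\<^sup>+t. indicator {0<..} t * ennreal (exp (- a * t)) \<partial>lborel) = ennreal (1 / a)"
    and "integrable lborel (\<lambda>t. indicator {0<..} t * exp (- a * t))"
    and "(LINT t|lborel. indicator {0<..} t * exp (- a * t)) = 1 / a"
proof -
  interpret prob_space "density lborel (exponential_density a)" by (rule prob_space_exponential_density[OF a])
  have "(\<integral>\<^sup>+t. ennreal (exponential_density a t) \<partial>lborel) = 1"
    using emeasure_space_1 by (simp add: emeasure_density)
  moreover have "(\<integral>\<^sup>+t. ennreal (exponential_density a t) \<partial>lborel) = (\<integral>\<^sup>+t. ennreal a * (indicator {0<..} t * ennreal (exp (- a * t))) \<partial>lborel)"
  proof (rule nn_integral_cong_AE)
    show "AE t in lborel. ennreal (exponential_density a t) = ennreal a * (indicator {0<..} t * ennreal (exp (- a * t)))"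
      using AE_lborel_singleton[of 0]
      by eventually_elim (use a in \<open>auto simp: exponential_density_def indicator_def ennreal_mult[symmetric] mult.commute\<close>)
  qed
  ultimately have *: "ennreal a * (\<integral>\<^sup>+t. indicator {0<..} t * ennreal (exp (- a * t)) \<partial>lborel) = 1"
    by (simp add: nn_integral_cmult)
  have "ennreal (1 / a) * (ennreal a * (\<integral>\<^sup>+t. indicator {0<..} t * ennreal (exp (- a * t)) \<partial>lborel)) = ennreal (1 / a)"
    unfolding * by simp
  moreover have "ennreal (1 / a) * ennreal a = 1" using a by (subst ennreal_mult[symmetric]) auto
  ultimately show nn: "(\<integral>\<^sup>+t. indicator {0<..} t * ennreal (exp (- a * t)) \<partial>lborel) = ennreal (1 / a)"
    by (simp add: mult.assoc[symmetric])
  have eq: "(\<integral>\<^sup>+t. ennreal (indicator {0<..} t * exp (- a * t)) \<partial>lborel) = ennreal (1 / a)"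
    using nn by (simp add: ennreal_mult' ennreal_indicator)
  show i: "integrable lborel (\<lambda>t. indicator {0<..} t * exp (- a * t))"
    by (rule integrableI_nonneg) (use eq in auto)
  show "(LINT t|lborel. indicator {0<..} t * exp (- a * t)) = 1 / a"
    using nn_integral_eq_integral[OF i] a unfolding eq by simp
qed

lemma inner_mult_L2_real:
  assumes m: "m \<in> borel_measurable borel" "\<And>x. \<bar>m x\<bar> \<le> K"
  shows "inner (mult_L2 (\<lambda>x. complex_of_real (m x)) F) G = inner F (mult_L2 (\<lambda>x. complex_of_real (m x)) G)"
proof -
  have l: "(\<lambda>x. complex_of_real (m x) * rep_L2 H x) \<in> l2" for H :: "'a L2"
    by (rule l2_bdd_mult[where K=K]) (use m in auto)
  have "inner (abs_L2 (\<lambda>x. complex_of_real (m x) * rep_L2 F x)) (abs_L2 (rep_L2 G)) =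
    inner (abs_L2 (rep_L2 F)) (abs_L2 (\<lambda>x. complex_of_real (m x) * rep_L2 G x))"
    unfolding inner_abs_L2[OF l rep_L2_l2] inner_abs_L2[OF rep_L2_l2 l] l2_inner_def
    by (simp add: mult_ac)
  then show ?thesis by (simp add: mult_L2_def)
qed

lemma real_part_l2:
  assumes "f \<in> l2" "\<phi> \<in> borel_measurable borel" "\<And>z. \<bar>\<phi> z\<bar> \<le> cmod z"
  shows "(\<lambda>x. complex_of_real (\<phi> (f x))) \<in> l2"
  by (rule l2_bound[where K=1, OF assms(1)])
     (use assms in \<open>auto intro!: measurable_compose[OF l2_measurable[OF assms(1)]]\<close>)

text \<open>Every function is \<open>(a - b) + \<i> (d - e)\<close> with nonnegative parts in
  \<open>l2\<close>. This carries identities obtained by extended nonnegative integration over to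
  all of L2.\<close>

lemma linear_eq_on_nonneg:
  fixes S T :: "'a::euclidean_space L2 \<Rightarrow> 'a L2"
  assumes S: "bounded_linear S" "\<And>F. S (iL2 F) = iL2 (S F)" and T: "bounded_linear T" "\<And>F. T (iL2 F) = iL2 (T F)"
    and eq: "\<And>u. u \<in> borel_measurable borel \<Longrightarrow> (\<And>x. 0 \<le> u x) \<Longrightarrow> (\<lambda>x. complex_of_real (u x)) \<in> l2 \<Longrightarrow>
      S (abs_L2 (\<lambda>x. complex_of_real (u x))) = T (abs_L2 (\<lambda>x. complex_of_real (u x)))"
  shows "S F = T F"
proof -
  define f where "f = rep_L2 F"
  have f: "f \<in> l2" "abs_L2 f = F" by (simp_all add: f_def)
  have [measurable]: "f \<in> borel_measurable borel" by (rule l2_measurable[OF f(1)])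
  let ?c = "\<lambda>u x. complex_of_real (u (f x))"
  let ?a = "\<lambda>z. max 0 (Re z)" and ?b = "\<lambda>z. max 0 (- Re z)" and ?d = "\<lambda>z. max 0 (Im z)" and ?e = "\<lambda>z. max 0 (- Im z)"
  have l: "?c ?a \<in> l2" "?c ?b \<in> l2" "?c ?d \<in> l2" "?c ?e \<in> l2"
    using abs_Re_le_cmod abs_Im_le_cmod
    by (auto intro!: real_part_l2[OF f(1)] simp: max_def abs_le_iff)
  have e1: "S (abs_L2 (?c ?a)) = T (abs_L2 (?c ?a))"
  proof (rule eq)
    show "(\<lambda>x. ?a (f x)) \<in> borel_measurable borel" by measurable
    show "0 \<le> ?a (f x)" for x by simp
  qed (rule l(1))
  have e2: "S (abs_L2 (?c ?b)) = T (abs_L2 (?c ?b))"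
  proof (rule eq)
    show "(\<lambda>x. ?b (f x)) \<in> borel_measurable borel" by measurable
    show "0 \<le> ?b (f x)" for x by simp
  qed (rule l(2))
  have e3: "S (abs_L2 (?c ?d)) = T (abs_L2 (?c ?d))"
  proof (rule eq)
    show "(\<lambda>x. ?d (f x)) \<in> borel_measurable borel" by measurable
    show "0 \<le> ?d (f x)" for x by simp
  qed (rule l(3))
  have e4: "S (abs_L2 (?c ?e)) = T (abs_L2 (?c ?e))"
  proof (rule eq)
    show "(\<lambda>x. ?e (f x)) \<in> borel_measurable borel" by measurable
    show "0 \<le> ?e (f x)" for x by simp
  qed (rule l(4))
  note e = e1 e2 e3 e4
  have "f = (\<lambda>x. (?c ?a x - ?c ?b x) + \<i> * (?c ?d x - ?c ?e x))"
    by (auto simp: fun_eq_iff complex_eq_iff max_def)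
  then have "abs_L2 f = abs_L2 (\<lambda>x. (?c ?a x - ?c ?b x) + \<i> * (?c ?d x - ?c ?e x))"
    by (rule arg_cong)
  also have "\<dots> = (abs_L2 (?c ?a) - abs_L2 (?c ?b)) + iL2 (abs_L2 (?c ?d) - abs_L2 (?c ?e))"
    by (simp only: abs_L2_add[OF l2_diff[OF l(1,2)] l2_scale[OF l2_diff[OF l(3,4)]]] abs_L2_diff[OF l(1,2)]
        abs_L2_i[OF l2_diff[OF l(3,4)]] abs_L2_diff[OF l(3,4)])
  finally have F: "F = (abs_L2 (?c ?a) - abs_L2 (?c ?b)) + iL2 (abs_L2 (?c ?d) - abs_L2 (?c ?e))"
    by (simp only: f(2))
  show ?thesis
    unfolding F using S(2) T(2) by (simp add: e bounded_linear.linear[OF S(1), THEN linear_add] bounded_linear.linear[OF T(1), THEN linear_add]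
        bounded_linear.linear[OF S(1), THEN linear_diff] bounded_linear.linear[OF T(1), THEN linear_diff])
qed

text \<open>The bridge between the operators on L2, defined by Bochner integrals, and the extended
  integrals of the path expansion, which turn out finite almost everywhere.\<close>

lemma (in translation_weight) weighted_translation_nonneg:
  assumes u[measurable]: "u \<in> borel_measurable borel" and u0: "\<And>x. 0 \<le> u x" and l: "(\<lambda>x. complex_of_real (u x)) \<in> l2"
    and k0: "\<And>x w. 0 \<le> k x w"
  shows "AE x in lborel. (\<integral>\<^sup>+w. ennreal (k x w * u (x + Y w)) \<partial>Q) < \<infinity> \<and>
    weighted_translation Q k Y (\<lambda>x. complex_of_real (u x)) x = complex_of_real (enn2real (\<integral>\<^sup>+w. ennreal (k x w * u (x + Y w)) \<partial>Q))"
  using AE_integrable_translate[OF l]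
proof eventually_elim
  case (elim x)
  then have "integrable Q (\<lambda>w. complex_of_real (k x w * u (x + Y w)))" by simp
  then have i: "integrable Q (\<lambda>w. k x w * u (x + Y w))" by (simp only: complex_of_real_integrable_eq)
  have nn: "(\<integral>\<^sup>+w. ennreal (k x w * u (x + Y w)) \<partial>Q) = ennreal (LINT w|Q. k x w * u (x + Y w))"
    using k0 u0 by (intro nn_integral_eq_integral i) auto
  have "0 \<le> (LINT w|Q. k x w * u (x + Y w))" using k0 u0 by (intro Bochner_Integration.integral_nonneg) auto
  then show ?case
    unfolding nn weighted_translation_def by (simp add: of_real_mult[symmetric] del: of_real_mult)
qed

text \<open>The bound is required everywhere, so that all estimates along paths hold pointwise; an
  essentially bounded potential is brought to this form by truncation.\<close>

locale bounded_potential = cauchy_process M X for M :: "'w measure" and X :: "real \<Rightarrow> 'w \<Rightarrow> 'a::euclidean_space" +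
  fixes V :: "'a \<Rightarrow> real" and C :: real
  assumes V_measurable [measurable]: "V \<in> borel_measurable borel" and V_bound: "\<And>y. \<bar>V y\<bar> \<le> C"
begin

lemma C_nonneg: "0 \<le> C" using V_bound[of 0] by linarith

definition W :: "'a \<Rightarrow> real" where "W y = C - V y"

lemma W_measurable [measurable]: "W \<in> borel_measurable borel" unfolding W_def[abs_def] by measurable
lemma W_nonneg: "0 \<le> W y" and W_le: "W y \<le> 2 * C" using V_bound[of y] by (auto simp: W_def)

sublocale LM: pair_sigma_finite "lborel :: real measure" M ..

text \<open>An exponential clock, of total mass \<open>1 / lam\<close>, together with an independent
  path. Under it a Laplace transform in time becomes one random translation.\<close>

definition Q :: "real \<Rightarrow> (real \<times> 'w) measure" where
  "Q lam = density (lborel \<Otimes>\<^sub>M M) (\<lambda>(t, \<omega>). ennreal (indicator {0<..} t * exp (- lam * t)))"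

definition Yq :: "real \<times> 'w \<Rightarrow> 'a" where "Yq = (\<lambda>(t, \<omega>). Xp t \<omega>)"

lemma sets_Q [simp, measurable_cong]: "sets (Q lam) = sets (borel \<Otimes>\<^sub>M M)"
  unfolding Q_def sets_density by (rule sets_pair_measure_cong) simp_all

lemma Yq_measurable [measurable]: "Yq \<in> borel_measurable (borel \<Otimes>\<^sub>M M)"
  unfolding Yq_def by (rule Xp_measurable)

lemma nn_integral_Q:
  assumes h: "h \<in> borel_measurable (borel \<Otimes>\<^sub>M M)"
  shows "(\<integral>\<^sup>+z. h z \<partial>Q lam) = (\<integral>\<^sup>+t. \<integral>\<^sup>+\<omega>. indicator {0<..} t * ennreal (exp (- lam * t)) * h (t, \<omega>) \<partial>M \<partial>lborel)"
proof -
  have [measurable]: "h \<in> borel_measurable (lborel \<Otimes>\<^sub>M M)"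
    using h by (simp add: measurable_cong_sets[OF sets_pair_measure_cong[OF sets_lborel refl] refl])
  have "(\<integral>\<^sup>+z. h z \<partial>Q lam) = (\<integral>\<^sup>+z. (case z of (t, \<omega>) \<Rightarrow> ennreal (indicator {0<..} t * exp (- lam * t))) * h z \<partial>(lborel \<Otimes>\<^sub>M M))"
    unfolding Q_def by (rule nn_integral_density) measurable
  also have "\<dots> = (\<integral>\<^sup>+t. \<integral>\<^sup>+\<omega>. ennreal (indicator {0<..} t * exp (- lam * t)) * h (t, \<omega>) \<partial>M \<partial>lborel)"
    by (subst nn_integral_fst[symmetric]) (simp_all add: split_beta')
  finally show ?thesis by (simp add: ennreal_mult' ennreal_indicator)
qed

lemma emeasure_Q: "lam > 0 \<Longrightarrow> emeasure (Q lam) (space (Q lam)) = ennreal (1 / lam)"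
  using nn_integral_Q[of "\<lambda>_. 1" lam] integral_exp_ray(1)[of lam]
  by (simp add: emeasure_space_1)

lemma finite_Q: "lam > 0 \<Longrightarrow> finite_measure (Q lam)"
  by (rule finite_measureI) (simp add: emeasure_Q)

lemma measure_Q: "lam > 0 \<Longrightarrow> measure (Q lam) (space (Q lam)) = 1 / lam"
  by (simp add: measure_def emeasure_Q)

lemma weight_C: "lam > 0 \<Longrightarrow> translation_weight (Q lam) (\<lambda>_ _. 1) Yq 1"
  by (intro translation_weight.intro translation_weight_axioms.intro finite_Q) simp_all

definition IV :: "'a \<Rightarrow> real \<Rightarrow> 'w \<Rightarrow> real" where
  "IV x t \<omega> = (LINT s|lborel. (if 0 \<le> s \<and> s \<le> t then V (x + Xp s \<omega>) else 0))"

lemma IV_measurable [measurable (raw)]: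
  assumes [measurable]: "f \<in> borel_measurable N" "g \<in> borel_measurable N" "h \<in> measurable N M"
  shows "(\<lambda>z. IV (f z) (g z) (h z)) \<in> borel_measurable N"
  unfolding IV_def by measurable

lemma integrable_IV:
  assumes "\<omega> \<in> space M" shows "integrable lborel (\<lambda>s. if 0 \<le> s \<and> s \<le> t then V (x + Xp s \<omega>) else 0)"
proof (rule Bochner_Integration.integrable_bound)
  show "integrable lborel (\<lambda>s. C * indicator {0..t} s)"
    by (intro integrable_mult_right integrable_real_indicator) (auto simp: emeasure_lborel_Icc_eq)
  show "(\<lambda>s. if 0 \<le> s \<and> s \<le> t then V (x + Xp s \<omega>) else 0) \<in> borel_measurable lborel"
    using assms by measurable
  show "AE s in lborel. norm (if 0 \<le> s \<and> s \<le> t then V (x + Xp s \<omega>) else 0) \<le> norm (C * indicator {0..t} s)"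
    using V_bound C_nonneg by (intro AE_I2) (auto simp: indicator_def)
qed

lemma integral_indicator_Icc: "(LINT s|lborel. c * indicator {0..t} s) = c * max 0 t" for c t :: real
  by (simp add: max_def)

lemma IV_bound: assumes "\<omega> \<in> space M" shows "\<bar>IV x t \<omega>\<bar> \<le> C * max 0 t"
proof -
  have "\<bar>IV x t \<omega>\<bar> \<le> (LINT s|lborel. \<bar>if 0 \<le> s \<and> s \<le> t then V (x + Xp s \<omega>) else 0\<bar>)"
    unfolding IV_def by (rule integral_abs_bound)
  also have "\<dots> \<le> (LINT s|lborel. C * indicator {0..t} s)"
  proof (rule integral_mono)
    show "integrable lborel (\<lambda>s. \<bar>if 0 \<le> s \<and> s \<le> t then V (x + Xp s \<omega>) else 0\<bar>)"
      by (rule integrable_abs[OF integrable_IV[OF assms]])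
    show "integrable lborel (\<lambda>s. C * indicator {0..t} s)"
      by (intro integrable_mult_right integrable_real_indicator) (auto simp: emeasure_lborel_Icc_eq)
  qed (use V_bound C_nonneg in \<open>auto simp: indicator_def\<close>)
  finally show ?thesis by (simp only: integral_indicator_Icc)
qed

lemma integral_W_path:
  assumes "\<omega> \<in> space M" "0 \<le> t"
  shows "(LINT r|lborel. indicator {0..t} r * W (x + Xp r \<omega>)) = C * t - IV x t \<omega>"
proof -
  have "(LINT r|lborel. indicator {0..t} r * W (x + Xp r \<omega>)) =
     (LINT s|lborel. C * indicator {0..t} s - (if 0 \<le> s \<and> s \<le> t then V (x + Xp s \<omega>) else 0))"
    by (intro Bochner_Integration.integral_cong) (auto simp: W_def indicator_def)
  also have "\<dots> = (LINT s|lborel. C * indicator {0..t} s) - IV x t \<omega>"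
    unfolding IV_def
    by (intro Bochner_Integration.integral_diff integrable_IV assms integrable_mult_right integrable_real_indicator)
       (auto simp: emeasure_lborel_Icc_eq)
  finally show ?thesis using assms by (simp add: integral_indicator_Icc del: integral_mult_right_zero)
qed

text \<open>The factor \<open>indicator (space M) \<omega>\<close> makes the weight bounded everywhere.\<close>

definition kG :: "'a \<Rightarrow> real \<times> 'w \<Rightarrow> real" where
  "kG x = (\<lambda>(t, \<omega>). indicator (space M) \<omega> * exp (- IV x t \<omega> - C * max 0 t))"

lemma kG_nonneg: "0 \<le> kG x z"
  by (auto simp: kG_def split: prod.split)

lemma kG_bound: "\<bar>kG x z\<bar> \<le> 1"
proof -
  obtain t \<omega> where z: "z = (t, \<omega>)" by (cases z)
  show ?thesis
  proof (cases "\<omega> \<in> space M")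
    case True
    then have "- IV x t \<omega> - C * max 0 t \<le> 0" using IV_bound[OF True, of x t] by linarith
    then show ?thesis using True by (simp add: kG_def z)
  qed (simp add: kG_def z)
qed

lemma kG_measurable [measurable]: "(\<lambda>(x, z). kG x z) \<in> borel_measurable (borel \<Otimes>\<^sub>M (borel \<Otimes>\<^sub>M M))"
  unfolding kG_def split_beta' by measurable

text \<open>The factor \<open>exp (- lam * t)\<close> is shared out: \<open>exp (- C * t)\<close>
  sits in \<open>kG\<close>, where it keeps the weight below 1, and
  \<open>exp (- (lam - C) * t)\<close> in the measure, which is finite exactly because
  \<open>lam > C\<close>.\<close>

lemma weight_G: "lam > C \<Longrightarrow> translation_weight (Q (lam - C)) kG Yq 1"
  by (intro translation_weight.intro translation_weight_axioms.intro finite_Q kG_bound)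
     (simp_all add: measurable_cong_sets[OF sets_pair_measure_cong[OF refl sets_Q] refl])

text \<open>\<open>free_resolvent lam\<close> is the inverse of \<open>\<surd>(-\<Delta>) + lam\<close> and, for \<open>lam > C\<close>, \<open>perturbed_resolvent lam\<close> is the inverse of
  \<open>\<surd>(-\<Delta>) + V + lam\<close>.\<close>

definition free_resolvent :: "real \<Rightarrow> 'a L2 \<Rightarrow> 'a L2" where "free_resolvent lam = translation_op (Q lam) (\<lambda>_ _. 1) Yq"
definition perturbed_resolvent :: "real \<Rightarrow> 'a L2 \<Rightarrow> 'a L2" where "perturbed_resolvent lam = translation_op (Q (lam - C)) kG Yq"
definition mult_W :: "'a L2 \<Rightarrow> 'a L2" where "mult_W = mult_L2 (\<lambda>x. complex_of_real (W x))"

lemma bounded_linear_free_resolvent: "lam > 0 \<Longrightarrow> bounded_linear (free_resolvent lam)"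
  unfolding free_resolvent_def by (rule translation_weight.bounded_linear_translation_op[OF weight_C])

lemma bounded_linear_perturbed_resolvent: "lam > C \<Longrightarrow> bounded_linear (perturbed_resolvent lam)"
  unfolding perturbed_resolvent_def by (rule translation_weight.bounded_linear_translation_op[OF weight_G])

lemma Wc: "(\<lambda>x. complex_of_real (W x)) \<in> borel_measurable borel" "cmod (complex_of_real (W x)) \<le> 2 * C"
  using W_nonneg[of x] W_le[of x] by auto

lemma bounded_linear_mult_W: "bounded_linear mult_W"
  unfolding mult_W_def by (rule bounded_linear_mult_L2[OF Wc])

lemma cauchy_resolvent_Q: "h \<in> borel_measurable borel \<Longrightarrow> (\<integral>\<^sup>+z. h (x + Yq z) \<partial>Q lam) = cauchy_resolvent lam h x"
  by (subst nn_integral_Q) (auto simp: cauchy_resolvent_def Yq_def)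

text \<open>Bookkeeping of exponents: \<open>- (lam - C) t - C t - \<integral>V = - (lam + C) t +
  \<integral>W\<close>, since the integral of \<open>W\<close> up to time \<open>t\<close> is
  \<open>C t - \<integral>V\<close>.\<close>

lemma path_resolvent_Q:
  assumes lam: "lam > C" and h[measurable]: "u \<in> borel_measurable borel" and u0: "\<And>y. 0 \<le> u y"
  shows "(\<integral>\<^sup>+z. ennreal (kG x z * u (x + Yq z)) \<partial>Q (lam - C)) = path_resolvent (lam + C) W (\<lambda>y. ennreal (u y)) x"
proof -
  have km: "(\<lambda>z. kG x z) \<in> borel_measurable (borel \<Otimes>\<^sub>M M)"
    using measurable_compose[OF measurable_Pair1' kG_measurable, of x] by simp
  note [measurable] = km
  have "(\<integral>\<^sup>+z. ennreal (kG x z * u (x + Yq z)) \<partial>Q (lam - C)) =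
     (\<integral>\<^sup>+t. \<integral>\<^sup>+\<omega>. indicator {0<..} t * ennreal (exp (- (lam - C) * t)) * ennreal (kG x (t, \<omega>) * u (x + Xp t \<omega>)) \<partial>M \<partial>lborel)"
    by (subst nn_integral_Q) (auto simp: Yq_def)
  also have "\<dots> = (\<integral>\<^sup>+\<omega>. \<integral>\<^sup>+t. indicator {0<..} t * ennreal (exp (- (lam - C) * t)) * ennreal (kG x (t, \<omega>) * u (x + Xp t \<omega>)) \<partial>lborel \<partial>M)"
    by (rule LM.Fubini'[symmetric]) measurable
  also have "\<dots> = path_resolvent (lam + C) W (\<lambda>y. ennreal (u y)) x"
    unfolding path_resolvent_def
  proof (rule nn_integral_cong, rule nn_integral_cong)
    fix \<omega> t assume w: "\<omega> \<in> space M"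
    show "indicator {0<..} t * ennreal (exp (- (lam - C) * t)) * ennreal (kG x (t, \<omega>) * u (x + Xp t \<omega>)) =
       indicator {0<..} t * ennreal (exp (- (lam + C) * t)) *
       (ennreal (exp (LINT r|lborel. indicator {0..t} r * W (x + Xp r \<omega>))) * ennreal (u (x + Xp t \<omega>)))"
    proof (cases "0 < t")
      case True
      have "exp (- (lam - C) * t) * exp (- IV x t \<omega> - C * t) = exp (- (lam + C) * t) * exp (C * t - IV x t \<omega>)"
        by (simp add: exp_add[symmetric] algebra_simps)
      then show ?thesis
        using True w u0 by (simp add: kG_def integral_W_path ennreal_mult[symmetric] mult.assoc[symmetric])
    qed simp
  qed
  finally show ?thesis .
qed

text \<open>Carries the extended fixed-point equation to L2. \<open>\<Gamma>\<close> is finite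
  almost everywhere, as the weighted translation of an element of \<open>l2\<close> exists almost
  everywhere, and its real version \<open>v\<close> represents the perturbed resolvent.\<close>

lemma perturbed_resolvent_eq_nonneg:
  assumes lam: "lam > C" and u[measurable]: "u \<in> borel_measurable borel" and u0: "\<And>x. 0 \<le> u x"
    and l: "(\<lambda>x. complex_of_real (u x)) \<in> l2"
  defines "F \<equiv> abs_L2 (\<lambda>x. complex_of_real (u x))"
  shows "perturbed_resolvent lam F = free_resolvent (lam + C) (F + mult_W (perturbed_resolvent lam F))"
proof -
  have lC: "lam + C > 0" using lam C_nonneg by linarith
  interpret G: translation_weight "Q (lam - C)" kG Yq 1 by (rule weight_G[OF lam])
  interpret Ct: translation_weight "Q (lam + C)" "\<lambda>_ _. 1" Yq 1 by (rule weight_C[OF lC])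
  define \<Gamma> where "\<Gamma> = path_resolvent (lam + C) W (\<lambda>y. ennreal (u y))"
  have \<Gamma>m[measurable]: "\<Gamma> \<in> borel_measurable borel" unfolding \<Gamma>_def by (rule path_resolvent_measurable[OF W_measurable W_nonneg W_le]) simp
  define v where "v x = enn2real (\<Gamma> x)" for x
  have v0: "0 \<le> v x" for x by (simp add: v_def)
  have [measurable]: "v \<in> borel_measurable borel" unfolding v_def[abs_def] by measurable
  have GA: "AE x in lborel. \<Gamma> x < \<infinity> \<and> weighted_translation (Q (lam - C)) kG Yq (\<lambda>x. complex_of_real (u x)) x = complex_of_real (v x)"
    using G.weighted_translation_nonneg[OF u u0 l kG_nonneg] unfolding path_resolvent_Q[OF lam u u0] \<Gamma>_def[symmetric] v_def .
  have wtl: "weighted_translation (Q (lam - C)) kG Yq (\<lambda>x. complex_of_real (u x)) \<in> l2" by (rule G.weighted_translation_l2[OF l])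
  have vl: "(\<lambda>x. complex_of_real (v x)) \<in> l2"
    by (rule l2_bound[where K=1, OF wtl]) (use GA in \<open>auto elim: AE_mp\<close>)
  have GF: "perturbed_resolvent lam F = abs_L2 (\<lambda>x. complex_of_real (v x))"
    unfolding F_def perturbed_resolvent_def G.translation_op_abs[OF l] using GA by (subst abs_L2_eq_iff[OF wtl vl]) (auto elim: AE_mp)
  define q where "q x = u x + W x * v x" for x
  have q0: "0 \<le> q x" for x using u0 v0 W_nonneg by (simp add: q_def)
  have [measurable]: "q \<in> borel_measurable borel" unfolding q_def[abs_def] by measurable
  have Wv: "(\<lambda>x. complex_of_real (W x) * complex_of_real (v x)) \<in> l2" by (rule l2_bdd_mult[OF vl Wc])
  have ql: "(\<lambda>x. complex_of_real (q x)) \<in> l2" using l2_add[OF l Wv] by (simp add: q_def)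
  have sumF: "F + mult_W (perturbed_resolvent lam F) = abs_L2 (\<lambda>x. complex_of_real (q x))"
  proof -
    have "F + mult_W (perturbed_resolvent lam F) = abs_L2 (\<lambda>x. complex_of_real (u x)) + abs_L2 (\<lambda>x. complex_of_real (W x) * complex_of_real (v x))"
      by (simp only: GF mult_W_def mult_L2_abs[OF Wc vl]) (simp only: F_def)
    then show ?thesis by (simp add: abs_L2_add[OF l Wv, symmetric] q_def)
  qed
  have CA: "AE x in lborel. weighted_translation (Q (lam + C)) (\<lambda>_ _. 1) Yq (\<lambda>x. complex_of_real (q x)) x = complex_of_real (enn2real (cauchy_resolvent (lam + C) (\<lambda>y. ennreal (q y)) x))"
    using Ct.weighted_translation_nonneg[OF _ q0 ql] by (simp add: cauchy_resolvent_Q[of "\<lambda>y. ennreal (q y)"])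
  \<comment> \<open>At a point with finite \<open>\<Gamma> x\<close> the integral of
    \<open>W * \<Gamma>\<close> along the shifts is finite, so an infinite value of
    \<open>\<Gamma>\<close> is met almost surely only where \<open>W\<close> vanishes. Replacing
    \<open>\<Gamma>\<close> by \<open>v\<close> under the integral is then harmless.\<close>
  have eqx: "cauchy_resolvent (lam + C) (\<lambda>y. ennreal (q y)) x = \<Gamma> x" if fin: "\<Gamma> x < \<infinity>" for x
  proof -
    have fx: "\<Gamma> x = cauchy_resolvent (lam + C) (\<lambda>y. ennreal (u y)) x + cauchy_resolvent (lam + C) (\<lambda>y. ennreal (W y) * \<Gamma> y) x"
      unfolding \<Gamma>_def by (rule path_resolvent_fixpoint[OF W_measurable W_nonneg W_le]) simp
    have "cauchy_resolvent (lam + C) (\<lambda>y. ennreal (q y)) x = (\<integral>\<^sup>+z. ennreal (u (x + Yq z)) + ennreal (W (x + Yq z) * v (x + Yq z)) \<partial>Q (lam + C))"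
      using u0 v0 W_nonneg by (subst cauchy_resolvent_Q[symmetric]) (simp_all add: q_def)
    also have "\<dots> = cauchy_resolvent (lam + C) (\<lambda>y. ennreal (u y)) x + (\<integral>\<^sup>+z. ennreal (W (x + Yq z) * v (x + Yq z)) \<partial>Q (lam + C))"
      by (subst nn_integral_add) (simp_all add: cauchy_resolvent_Q[of "\<lambda>y. ennreal (u y)"])
    also have "(\<integral>\<^sup>+z. ennreal (W (x + Yq z) * v (x + Yq z)) \<partial>Q (lam + C)) = (\<integral>\<^sup>+z. ennreal (W (x + Yq z)) * \<Gamma> (x + Yq z) \<partial>Q (lam + C))"
    proof (rule nn_integral_cong_AE)
      have "(\<integral>\<^sup>+z. ennreal (W (x + Yq z)) * \<Gamma> (x + Yq z) \<partial>Q (lam + C)) = cauchy_resolvent (lam + C) (\<lambda>y. ennreal (W y) * \<Gamma> y) x"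
        by (rule cauchy_resolvent_Q[of "\<lambda>y. ennreal (W y) * \<Gamma> y"]) measurable
      also have "\<dots> \<le> \<Gamma> x" by (subst fx) simp
      finally have "(\<integral>\<^sup>+z. ennreal (W (x + Yq z)) * \<Gamma> (x + Yq z) \<partial>Q (lam + C)) \<noteq> \<infinity>" using fin by auto
      then have "AE z in Q (lam + C). ennreal (W (x + Yq z)) * \<Gamma> (x + Yq z) \<noteq> \<infinity>"
        by (intro nn_integral_PInf_AE) measurable
      then show "AE z in Q (lam + C). ennreal (W (x + Yq z) * v (x + Yq z)) = ennreal (W (x + Yq z)) * \<Gamma> (x + Yq z)"
      proof eventually_elim
        case (elim z)
        show ?case
        proof (cases "W (x + Yq z) = 0")
          case False
          then have "\<Gamma> (x + Yq z) < \<top>" using elim W_nonneg[of "x + Yq z"]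
            by (auto simp: less_top[symmetric] ennreal_mult_eq_top_iff)
          then show ?thesis using W_nonneg v0 by (simp add: ennreal_mult v_def)
        qed simp
      qed
    qed
    also have "\<dots> = cauchy_resolvent (lam + C) (\<lambda>y. ennreal (W y) * \<Gamma> y) x"
      by (rule cauchy_resolvent_Q[of "\<lambda>y. ennreal (W y) * \<Gamma> y"]) measurable
    finally show ?thesis using fx by simp
  qed
  show ?thesis
    unfolding sumF unfolding GF free_resolvent_def Ct.translation_op_abs[OF ql]
  proof (subst abs_L2_eq_iff[OF vl Ct.weighted_translation_l2[OF ql]])
    show "AE x in lborel. complex_of_real (v x) = weighted_translation (Q (lam + C)) (\<lambda>_ _. 1) Yq (\<lambda>x. complex_of_real (q x)) x"
      using GA CA by eventually_elim (auto simp: eqx v_def)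
  qed
qed

lemma perturbed_resolvent_eq:
  assumes lam: "lam > C"
  shows "perturbed_resolvent lam F = free_resolvent (lam + C) (F + mult_W (perturbed_resolvent lam F))"
proof (rule linear_eq_on_nonneg[where T="\<lambda>F. free_resolvent (lam + C) (F + mult_W (perturbed_resolvent lam F))"])
  have lC: "lam + C > 0" using lam C_nonneg by linarith
  note i = translation_weight.translation_op_iL2[OF weight_G[OF lam], folded perturbed_resolvent_def]
    translation_weight.translation_op_iL2[OF weight_C[OF lC], folded free_resolvent_def] mult_L2_iL2[OF Wc, folded mult_W_def]
  show "bounded_linear (perturbed_resolvent lam)" by (rule bounded_linear_perturbed_resolvent[OF lam])
  show "bounded_linear (\<lambda>F. free_resolvent (lam + C) (F + mult_W (perturbed_resolvent lam F)))"
    by (intro bounded_linear_compose[OF bounded_linear_free_resolvent[OF lC]] bounded_linear_add bounded_linear_ident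
        bounded_linear_compose[OF bounded_linear_mult_W] bounded_linear_perturbed_resolvent lam)
  show "perturbed_resolvent lam (iL2 F) = iL2 (perturbed_resolvent lam F)" for F by (rule i)
  show "free_resolvent (lam + C) (iL2 F + mult_W (perturbed_resolvent lam (iL2 F))) = iL2 (free_resolvent (lam + C) (F + mult_W (perturbed_resolvent lam F)))" for F
    by (simp only: i iL2_add[symmetric])
qed (rule perturbed_resolvent_eq_nonneg[OF lam])

end

section \<open>Identification of the resolvents with inverses of the operators\<close>

context bounded_potential
begin

text \<open>Here the law of the process enters: the Laplace transform of
  \<open>exp (- t * norm k)\<close> is the Fourier multiplier of the resolvent.\<close>

lemma char_Q:
  assumes lam: "lam > 0"
  shows "(LINT z|Q lam. cis (k \<bullet> Yq z)) = complex_of_real (1 / (lam + norm k))"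
proof -
  let ?e = "\<lambda>t. indicator {0<..} t * exp (- lam * t)"
  have [measurable]: "Yq \<in> borel_measurable (lborel \<Otimes>\<^sub>M M)"
    using Yq_measurable by (simp add: measurable_cong_sets[OF sets_pair_measure_cong[OF sets_lborel refl] refl])
  have i: "integrable (lborel \<Otimes>\<^sub>M M) (\<lambda>(t, \<omega>). ?e t *\<^sub>R cis (k \<bullet> Xp t \<omega>))"
  proof (rule LM.Fubini_integrable)
    show "(\<lambda>(t, \<omega>). ?e t *\<^sub>R cis (k \<bullet> Xp t \<omega>)) \<in> borel_measurable (lborel \<Otimes>\<^sub>M M)"
      unfolding cis_conv_exp by measurable
    show "integrable lborel (\<lambda>t. LINT \<omega>|M. norm (case (t, \<omega>) of (t, \<omega>) \<Rightarrow> ?e t *\<^sub>R cis (k \<bullet> Xp t \<omega>)))"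
      using integral_exp_ray(2)[OF lam] by (simp add: prob_space)
    show "AE t in lborel. integrable M (\<lambda>\<omega>. case (t, \<omega>) of (t, \<omega>) \<Rightarrow> ?e t *\<^sub>R cis (k \<bullet> Xp t \<omega>))"
    proof (rule AE_I2)
      fix t
      have "integrable M (\<lambda>\<omega>. cis (k \<bullet> Xp t \<omega>))"
        by (rule integrable_const_bound[where B=1]) (simp_all add: cis_conv_exp)
      then show "integrable M (\<lambda>\<omega>. case (t, \<omega>) of (t, \<omega>) \<Rightarrow> ?e t *\<^sub>R cis (k \<bullet> Xp t \<omega>))" by simp
    qed
  qed
  have "(LINT z|Q lam. cis (k \<bullet> Yq z)) = (LINT z|(lborel \<Otimes>\<^sub>M M). (case z of (t, \<omega>) \<Rightarrow> ?e t) *\<^sub>R cis (k \<bullet> Yq z))"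
  proof -
    have "Q lam = density (lborel \<Otimes>\<^sub>M M) (\<lambda>z. ennreal (case z of (t, \<omega>) \<Rightarrow> ?e t))"
      unfolding Q_def by (rule arg_cong[where f="density _"]) (auto simp: fun_eq_iff)
    then show ?thesis
      by (simp only:) (subst integral_density, auto simp: cis_conv_exp)
  qed
  also have "\<dots> = (LINT t|lborel. LINT \<omega>|M. ?e t *\<^sub>R cis (k \<bullet> Xp t \<omega>))"
    using LM.integral_fst'[OF i] by (simp add: Yq_def split_beta')
  also have "\<dots> = (LINT t|lborel. complex_of_real (indicator {0<..} t * exp (- (lam + norm k) * t)))"
  proof (rule Bochner_Integration.integral_cong[OF refl])
    fix t :: real
    show "(LINT \<omega>|M. ?e t *\<^sub>R cis (k \<bullet> Xp t \<omega>)) = complex_of_real (indicator {0<..} t * exp (- (lam + norm k) * t))"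
    proof (cases "0 < t")
      case True
      then have "(LINT \<omega>|M. ?e t *\<^sub>R cis (k \<bullet> Xp t \<omega>)) = complex_of_real (exp (- lam * t)) * complex_of_real (exp (- t * norm k))"
        using characteristic_function[of t k] by (simp add: Xp_eq scaleR_conv_of_real)
      also have "\<dots> = complex_of_real (exp (- (lam + norm k) * t))"
        unfolding of_real_mult[symmetric] exp_add[symmetric] by (simp add: algebra_simps)
      finally show ?thesis using True by simp
    qed simp
  qed
  also have "\<dots> = complex_of_real (1 / (lam + norm k))"
    unfolding integral_complex_of_real using integral_exp_ray(3)[of "lam + norm k"] lam by (simp add: add_pos_nonneg)
  finally show ?thesis .
qed

lemma resolvent_multiplier:
  assumes "lam > 0"
  shows "(\<lambda>k::'a. 1 / (lam + norm k)) \<in> borel_measurable borel" "\<bar>1 / (lam + norm k)\<bar> \<le> 1 / lam" "0 \<le> 1 / (lam + norm k)"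
  using assms by (auto simp: abs_of_nonneg add_pos_nonneg intro!: divide_left_mono)

lemma resolvent_multiplier_complex:
  assumes "lam > 0"
  shows "(\<lambda>k::'a. complex_of_real (1 / (lam + norm k))) \<in> borel_measurable borel" "cmod (complex_of_real (1 / (lam + norm k))) \<le> 1 / lam"
  using resolvent_multiplier[OF assms] by (auto simp del: of_real_divide)

lemma fourier_free_resolvent:
  "lam > 0 \<Longrightarrow> fourier_op (free_resolvent lam F) = mult_L2 (\<lambda>k. complex_of_real (1 / (lam + norm k))) (fourier_op F)"
  unfolding free_resolvent_def using fourier_translation_op[OF weight_C, of lam F] by (simp only: char_Q)

lemma free_resolvent_sym:
  assumes "lam > 0" shows "inner (free_resolvent lam F) G = inner F (free_resolvent lam G)"
proof -
  have "inner (fourier_op (free_resolvent lam F)) (fourier_op G) = inner (fourier_op F) (fourier_op (free_resolvent lam G))"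
    unfolding fourier_free_resolvent[OF assms] by (rule inner_mult_L2_real[OF resolvent_multiplier(1,2)[OF assms]])
  then show ?thesis by (simp only: inner_fourier_op)
qed

lemma norm_free_resolvent: "lam > 0 \<Longrightarrow> norm (free_resolvent lam F) \<le> norm F / lam"
  unfolding free_resolvent_def using translation_weight.norm_translation_op[OF weight_C, of lam F] by (simp add: measure_Q)

lemma norm_mult_W: "norm (mult_W F) \<le> 2 * C * norm F"
  unfolding mult_W_def by (rule norm_mult_L2[OF Wc])

text \<open>After the Fourier transform, which is injective, both sides say
  \<open>(lam + norm k) g = u + lam g\<close> almost everywhere. Membership of \<open>norm k\<close>
  times the transform of \<open>g\<close> in \<open>l2\<close> comes for free, as it equals the
  transform of \<open>u\<close>.\<close>

lemma sqrt_neg_laplacian_iff: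
  assumes lam: "lam > 0" and g: "g \<in> l2" and u: "u \<in> l2"
  shows "(g, u) \<in> sqrt_neg_laplacian \<longleftrightarrow> abs_L2 g = free_resolvent lam (abs_L2 u + lam *\<^sub>R abs_L2 g)"
proof -
  have fg: "fourier_L2 g \<in> l2" and fu: "fourier_L2 u \<in> l2" using g u by (auto intro: fourier_L2)
  have [measurable]: "fourier_L2 g \<in> borel_measurable borel" by (rule l2_measurable[OF fg])
  let ?w = "\<lambda>k. fourier_L2 u k + lam *\<^sub>R fourier_L2 g k"
  have w: "?w \<in> l2" by (intro l2_add l2_scaleR fg fu)
  have fw: "fourier_op (abs_L2 u + lam *\<^sub>R abs_L2 g) = abs_L2 ?w"
    by (simp add: linear_add[OF bounded_linear.linear[OF bounded_linear_fourier_op]]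
        linear_cmul[OF bounded_linear.linear[OF bounded_linear_fourier_op]] fourier_op_abs g u abs_L2_add abs_L2_scaleR l2_scaleR fg fu)
  have mw: "(\<lambda>k. complex_of_real (1 / (lam + norm k)) * ?w k) \<in> l2"
    by (rule l2_bdd_mult[OF w resolvent_multiplier_complex[OF lam]])
  have "abs_L2 g = free_resolvent lam (abs_L2 u + lam *\<^sub>R abs_L2 g) \<longleftrightarrow> abs_L2 (fourier_L2 g) = abs_L2 (\<lambda>k. complex_of_real (1 / (lam + norm k)) * ?w k)"
    unfolding fourier_op_inject[of "abs_L2 g", symmetric] fourier_free_resolvent[OF lam] fw fourier_op_abs[OF g]
      mult_L2_abs[OF resolvent_multiplier_complex[OF lam] w] ..
  also have "\<dots> \<longleftrightarrow> (AE k in lborel. fourier_L2 g k = complex_of_real (1 / (lam + norm k)) * ?w k)"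
    by (rule abs_L2_eq_iff[OF fg mw])
  also have "\<dots> \<longleftrightarrow> (AE k in lborel. fourier_L2 u k = complex_of_real (norm k) * fourier_L2 g k)"
  proof (rule AE_cong)
    fix k :: 'a
    have "lam + norm k \<noteq> 0" using lam norm_ge_zero[of k] by linarith
    then have c: "complex_of_real (lam + norm k) \<noteq> 0" by (simp only: of_real_eq_0_iff not_False_eq_True)
    have "fourier_L2 g k = complex_of_real (1 / (lam + norm k)) * ?w k \<longleftrightarrow> complex_of_real (lam + norm k) * fourier_L2 g k = ?w k"
      using c by (auto simp: field_simps simp del: of_real_add)
    also have "\<dots> \<longleftrightarrow> fourier_L2 u k = complex_of_real (norm k) * fourier_L2 g k"
      by (auto simp: scaleR_conv_of_real algebra_simps)
    finally show "(fourier_L2 g k = complex_of_real (1 / (lam + norm k)) * ?w k) = (fourier_L2 u k = complex_of_real (norm k) * fourier_L2 g k)" .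
  qed
  also have "\<dots> \<longleftrightarrow> (g, u) \<in> sqrt_neg_laplacian"
  proof -
    have "(\<lambda>k. complex_of_real (norm k) * fourier_L2 g k) \<in> l2" if "AE k in lborel. fourier_L2 u k = complex_of_real (norm k) * fourier_L2 g k"
      by (rule l2_bound[where K=1, OF fu]) (use that in \<open>auto elim: AE_mp\<close>)
    then show ?thesis using g u by (auto simp: sqrt_neg_laplacian_def)
  qed
  finally show ?thesis by simp
qed

definition mult_V :: "'a L2 \<Rightarrow> 'a L2" where "mult_V = mult_L2 (\<lambda>x. complex_of_real (V x))"

lemma Vc: "(\<lambda>x. complex_of_real (V x)) \<in> borel_measurable borel" "cmod (complex_of_real (V x)) \<le> C"
  using V_bound[of x] by auto

lemma mult_W_eq: "mult_W F = C *\<^sub>R F - mult_V F"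
proof -
  define f where "f = rep_L2 F"
  have f: "f \<in> l2" "F = abs_L2 f" by (simp_all add: f_def)
  have "(\<lambda>x. complex_of_real (W x) * f x) = (\<lambda>x. C *\<^sub>R f x - complex_of_real (V x) * f x)"
    by (simp add: W_def fun_eq_iff scaleR_conv_of_real algebra_simps)
  then show ?thesis
    unfolding f(2) mult_W_def mult_V_def mult_L2_abs[OF Wc f(1)] mult_L2_abs[OF Vc f(1)]
    by (simp add: abs_L2_diff abs_L2_scaleR l2_scaleR f(1) l2_bdd_mult[OF f(1) Vc])
qed

lemma mult_op_iff:
  assumes "g \<in> l2" "b \<in> l2"
  shows "(g, b) \<in> mult_op V \<longleftrightarrow> abs_L2 b = mult_V (abs_L2 g)"
  unfolding mult_V_def mult_L2_abs[OF Vc assms(1)] abs_L2_eq_iff[OF assms(2) l2_bdd_mult[OF assms(1) Vc]]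
  using assms by (simp add: mult_op_def)

definition H :: "'a l2_operator" where "H = op_plus sqrt_neg_laplacian (mult_op V)"

lemma H_decompose:
  assumes g: "g \<in> l2" and u: "u \<in> l2"
  shows "(g, u) \<in> H \<longleftrightarrow> (g, rep_L2 (abs_L2 u - mult_V (abs_L2 g))) \<in> sqrt_neg_laplacian"
proof
  assume "(g, u) \<in> H"
  then obtain a b where ab: "(g, a) \<in> sqrt_neg_laplacian" "(g, b) \<in> mult_op V" "AE x in lborel. u x = a x + b x"
    by (auto simp: H_def op_plus_def)
  have l: "a \<in> l2" "b \<in> l2" using ab by (auto simp: sqrt_neg_laplacian_def mult_op_def)
  have "abs_L2 u = abs_L2 a + mult_V (abs_L2 g)"
    using ab l u by (simp add: abs_L2_add[symmetric] mult_op_iff[OF g l(2), symmetric] abs_L2_eq_iff l2_add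
        flip: mult_op_iff[OF g l(2), THEN iffD1, OF ab(2)])
  then have "abs_L2 a = abs_L2 (rep_L2 (abs_L2 u - mult_V (abs_L2 g)))" by simp
  then show "(g, rep_L2 (abs_L2 u - mult_V (abs_L2 g))) \<in> sqrt_neg_laplacian"
    using ab(1) sqrt_neg_laplacian_iff[of 1, OF _ g l(1)] sqrt_neg_laplacian_iff[of 1, OF _ g rep_L2_l2] by simp
next
  assume s: "(g, rep_L2 (abs_L2 u - mult_V (abs_L2 g))) \<in> sqrt_neg_laplacian"
  let ?a = "rep_L2 (abs_L2 u - mult_V (abs_L2 g))" and ?b = "rep_L2 (mult_V (abs_L2 g))"
  have "abs_L2 u = abs_L2 (\<lambda>x. ?a x + ?b x)" by (simp add: abs_L2_add)
  then have "AE x in lborel. u x = ?a x + ?b x" by (subst (asm) abs_L2_eq_iff) (auto intro: u l2_add)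
  moreover have "(g, ?b) \<in> mult_op V" using mult_op_iff[OF g, of ?b] by simp
  ultimately show "(g, u) \<in> H" unfolding H_def op_plus_def using s u by blast
qed

text \<open>Two solutions differ by a fixed point of the free resolvent composed with
  \<open>mult_W\<close>, whose norm is at most \<open>2 C / (lam + C)\<close>. This is less than 1
  exactly when \<open>lam > C\<close>.\<close>

lemma perturbed_resolvent_unique:
  assumes lam: "lam > C" and p: "p = free_resolvent (lam + C) (w + mult_W p)"
  shows "p = perturbed_resolvent lam w"
proof -
  have lC: "lam + C > 0" using lam C_nonneg by linarith
  define q where "q = perturbed_resolvent lam w"
  have q: "q = free_resolvent (lam + C) (w + mult_W q)" unfolding q_def by (rule perturbed_resolvent_eq[OF lam])
  have "p - q = free_resolvent (lam + C) (w + mult_W p) - free_resolvent (lam + C) (w + mult_W q)" using p q by simp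
  also have "\<dots> = free_resolvent (lam + C) (mult_W (p - q))"
    using bounded_linear_free_resolvent[OF lC] bounded_linear_mult_W by (simp add: linear_simps)
  finally have "norm (p - q) \<le> norm (mult_W (p - q)) / (lam + C)" using norm_free_resolvent[OF lC] by metis
  also have "\<dots> \<le> 2 * C * norm (p - q) / (lam + C)" using lC norm_mult_W by (intro divide_right_mono) auto
  finally have "(lam + C) * norm (p - q) \<le> 2 * C * norm (p - q)"
    using lC by (simp add: pos_le_divide_eq mult.commute)
  then have "(lam - C) * norm (p - q) \<le> 0" by (simp add: algebra_simps)
  then have "norm (p - q) = 0" using lam by (simp add: mult_le_0_iff)
  then show ?thesis by (simp add: q_def)
qed

text \<open>Adding \<open>W g\<close> to both sides of \<open>(H + lam) g = w\<close> turns
  \<open>V + W\<close> into the constant \<open>C\<close>: the equation becomes the fixed-point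
  equation for the free resolvent at \<open>lam + C\<close>, whose only solution is the perturbed
  resolvent.\<close>

lemma H_iff:
  assumes lam: "lam > C"
  shows "(g, u) \<in> H \<longleftrightarrow> g \<in> l2 \<and> u \<in> l2 \<and> abs_L2 g = perturbed_resolvent lam (abs_L2 u + lam *\<^sub>R abs_L2 g)"
proof (cases "g \<in> l2 \<and> u \<in> l2")
  case False
  then show ?thesis by (auto simp: H_def op_plus_def mult_op_def)
next
  case True
  then have g: "g \<in> l2" and u: "u \<in> l2" by auto
  have lC: "lam + C > 0" using lam C_nonneg by linarith
  have "abs_L2 u - mult_V (abs_L2 g) + (lam + C) *\<^sub>R abs_L2 g = (abs_L2 u + lam *\<^sub>R abs_L2 g) + mult_W (abs_L2 g)"
    by (simp add: mult_W_eq scaleR_add_left)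
  then have "(g, u) \<in> H \<longleftrightarrow> abs_L2 g = free_resolvent (lam + C) ((abs_L2 u + lam *\<^sub>R abs_L2 g) + mult_W (abs_L2 g))"
    unfolding H_decompose[OF g u] sqrt_neg_laplacian_iff[OF lC g rep_L2_l2] abs_rep_L2 by (simp only:)
  also have "\<dots> \<longleftrightarrow> abs_L2 g = perturbed_resolvent lam (abs_L2 u + lam *\<^sub>R abs_L2 g)"
    using perturbed_resolvent_unique[OF lam] perturbed_resolvent_eq[OF lam] by metis
  finally show ?thesis using True by simp
qed

lemma sqrt_neg_laplacian_nonneg:
  assumes "(g, a) \<in> sqrt_neg_laplacian"
  shows "0 \<le> inner (abs_L2 g) (abs_L2 a)"
proof -
  have g: "g \<in> l2" and a: "a \<in> l2" and e: "AE k in lborel. fourier_L2 a k = complex_of_real (norm k) * fourier_L2 g k"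
    using assms by (auto simp: sqrt_neg_laplacian_def)
  have fg: "fourier_L2 g \<in> l2" and fa: "fourier_L2 a \<in> l2" using g a by (auto intro: fourier_L2)
  have [measurable]: "fourier_L2 g \<in> borel_measurable borel" by (rule l2_measurable[OF fg])
  have "inner (abs_L2 g) (abs_L2 a) = Re (l2_inner (fourier_L2 g) (fourier_L2 a))"
    using inner_fourier_op[of "abs_L2 g" "abs_L2 a"] by (simp add: fourier_op_abs g a inner_abs_L2 fg fa)
  also have "l2_inner (fourier_L2 g) (fourier_L2 a) = (LINT k|lborel. complex_of_real (norm k * (cmod (fourier_L2 g k))\<^sup>2))"
    unfolding l2_inner_def
  proof (rule integral_cong_AE)
    show "AE k in lborel. cnj (fourier_L2 g k) * fourier_L2 a k = complex_of_real (norm k * (cmod (fourier_L2 g k))\<^sup>2)"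
      using e
    proof eventually_elim
      case (elim k)
      then show ?case unfolding elim of_real_mult complex_norm_square by (simp only: mult_ac)
    qed
  qed (use l2_integrable_inner[OF fg fa] in auto)
  also have "Re \<dots> = (LINT k|lborel. norm k * (cmod (fourier_L2 g k))\<^sup>2)" unfolding integral_complex_of_real by simp
  also have "\<dots> \<ge> 0" by (intro Bochner_Integration.integral_nonneg) simp
  finally show ?thesis .
qed

lemma H_lower:
  assumes "(g, u) \<in> H"
  shows "inner (abs_L2 g) (abs_L2 u) \<ge> - C * (norm (abs_L2 g))\<^sup>2"
proof -
  have g: "g \<in> l2" and u: "u \<in> l2" using assms H_iff[of "C + 1" g u] by auto
  have "0 \<le> inner (abs_L2 g) (abs_L2 u - mult_V (abs_L2 g))"
    using sqrt_neg_laplacian_nonneg[OF H_decompose[OF g u, THEN iffD1, OF assms]] by simp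
  moreover have "\<bar>inner (abs_L2 g) (mult_V (abs_L2 g))\<bar> \<le> norm (abs_L2 g) * (C * norm (abs_L2 g))"
    using Cauchy_Schwarz_ineq2[of "abs_L2 g" "mult_V (abs_L2 g)"] norm_mult_L2[OF Vc, of "abs_L2 g", folded mult_V_def]
    by (meson mult_left_mono norm_ge_zero order_trans)
  ultimately show ?thesis by (simp add: inner_diff_right power2_eq_square mult_ac)
qed

lemma perturbed_resolvent_H:
  assumes lam: "lam > C"
  shows "(rep_L2 (perturbed_resolvent lam w), rep_L2 (w - lam *\<^sub>R perturbed_resolvent lam w)) \<in> H"
  using H_iff[OF lam, of "rep_L2 (perturbed_resolvent lam w)" "rep_L2 (w - lam *\<^sub>R perturbed_resolvent lam w)"] by simp

lemma perturbed_resolvent_lower: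
  assumes lam: "lam > C"
  shows "(lam - C) * (norm (perturbed_resolvent lam w))\<^sup>2 \<le> inner (perturbed_resolvent lam w) w"
  using H_lower[OF perturbed_resolvent_H[OF lam, of w]] by (simp add: inner_diff_right power2_norm_eq_inner[symmetric] algebra_simps)

text \<open>Symmetry is read off the fixed-point equation. The free resolvent and
  \<open>mult_W\<close> are symmetric, so pairing the equations for \<open>F\<close> and
  \<open>G\<close> leaves two equal terms in \<open>mult_W\<close> that cancel.\<close>

lemma perturbed_resolvent_sym:
  assumes lam: "lam > C"
  shows "inner (perturbed_resolvent lam F) G = inner F (perturbed_resolvent lam G)"
proof -
  have lC: "lam + C > 0" using lam C_nonneg by linarith
  let ?p = "perturbed_resolvent lam F" and ?q = "perturbed_resolvent lam G"
  have Ws: "inner (mult_W a) b = inner a (mult_W b)" for a b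
    unfolding mult_W_def by (rule inner_mult_L2_real[where K="2 * C"]) (use W_nonneg W_le in auto)
  have "inner ?p (G + mult_W ?q) = inner (free_resolvent (lam + C) (F + mult_W ?p)) (G + mult_W ?q)"
    using perturbed_resolvent_eq[OF lam, of F] by simp
  also have "\<dots> = inner (F + mult_W ?p) ?q" unfolding free_resolvent_sym[OF lC] using perturbed_resolvent_eq[OF lam, of G] by simp
  finally show ?thesis by (simp add: inner_add_left inner_add_right Ws)
qed

text \<open>If the perturbed resolvent vanishes on \<open>w\<close>, the fixed-point equation leaves
  the free resolvent of \<open>w\<close>, whose multiplier has no zeros. Injectivity keeps the point
  0 from carrying spectral mass, so that \<open>1 / s\<close> is defined almost everywhere.\<close>

lemma perturbed_resolvent_eq_0:
  assumes lam: "lam > C" and z: "perturbed_resolvent lam w = 0"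
  shows "w = 0"
proof -
  have lC: "lam + C > 0" using lam C_nonneg by linarith
  define f where "f = rep_L2 (fourier_op w)"
  have f: "f \<in> l2" "fourier_op w = abs_L2 f" by (simp_all add: f_def)
  have "mult_W 0 = 0" using bounded_linear_mult_W by (simp add: linear_simps)
  then have "free_resolvent (lam + C) w = 0" using perturbed_resolvent_eq[OF lam, of w] z by simp
  moreover have "fourier_op 0 = (0 :: 'a L2)" by (rule linear_0[OF bounded_linear.linear[OF bounded_linear_fourier_op]])
  ultimately have "mult_L2 (\<lambda>k. complex_of_real (1 / (lam + C + norm k))) (fourier_op w) = 0"
    using fourier_free_resolvent[OF lC, of w] by simp
  then have "abs_L2 (\<lambda>k. complex_of_real (1 / (lam + C + norm k)) * f k) = abs_L2 (\<lambda>_. 0)"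
    unfolding f(2) mult_L2_abs[OF resolvent_multiplier_complex[OF lC] f(1)] abs_L2_zero .
  then have "AE k in lborel. complex_of_real (1 / (lam + C + norm k)) * f k = 0"
    by (simp only: abs_L2_eq_iff[OF l2_bdd_mult[OF f(1) resolvent_multiplier_complex[OF lC]] l2_zero])
  then have "AE k in lborel. f k = 0"
  proof eventually_elim
    case (elim k)
    have "1 / (lam + C + norm k) > 0" using lC by (simp add: add_pos_nonneg)
    then have "complex_of_real (1 / (lam + C + norm k)) \<noteq> 0" by (simp only: of_real_eq_0_iff)
    then show ?case using elim by (metis mult_eq_0_iff)
  qed
  then have "abs_L2 f = abs_L2 (\<lambda>_. 0)" by (subst abs_L2_eq_iff) (auto intro: l2_zero f)
  then have "norm (fourier_op w) = 0" by (simp add: f abs_L2_zero)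
  then show ?thesis by simp
qed

text \<open>The parameter \<open>C + 1\<close> makes the factor \<open>lam - C\<close> in
  \<open>perturbed_resolvent_lower\<close> equal to 1. The squared norm of the image is then at most
  its inner product with \<open>x\<close>, which gives positivity and, by Cauchy-Schwarz, norm at
  most 1.\<close>

lemma positive_contraction_perturbed_resolvent: "positive_contraction (perturbed_resolvent (C + 1))"
proof (rule positive_contraction.intro)
  have lam: "C + 1 > C" by simp
  show "bounded_linear (perturbed_resolvent (C + 1))" by (rule bounded_linear_perturbed_resolvent[OF lam])
  show "inner x (perturbed_resolvent (C + 1) y) = inner (perturbed_resolvent (C + 1) x) y" for x y by (rule perturbed_resolvent_sym[OF lam, symmetric])
  have low: "(norm (perturbed_resolvent (C + 1) x))\<^sup>2 \<le> inner x (perturbed_resolvent (C + 1) x)" for x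
    using perturbed_resolvent_lower[OF lam, of x] by (simp add: inner_commute)
  show "0 \<le> inner x (perturbed_resolvent (C + 1) x)" for x using low[of x] zero_le_power2[of "norm (perturbed_resolvent (C + 1) x)"] by linarith
  show "inner x (perturbed_resolvent (C + 1) x) \<le> inner x x" for x
  proof -
    have cs: "inner x (perturbed_resolvent (C + 1) x) \<le> norm x * norm (perturbed_resolvent (C + 1) x)" by (rule norm_cauchy_schwarz)
    then have "norm (perturbed_resolvent (C + 1) x) * norm (perturbed_resolvent (C + 1) x) \<le> norm x * norm (perturbed_resolvent (C + 1) x)"
      using low[of x] by (simp add: power2_eq_square)
    then have "norm (perturbed_resolvent (C + 1) x) \<le> norm x"
      by (cases "norm (perturbed_resolvent (C + 1) x) = 0") (auto simp: mult_le_cancel_right)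
    then have "norm x * norm (perturbed_resolvent (C + 1) x) \<le> norm x * norm x" by (intro mult_left_mono) auto
    with cs show ?thesis by (simp add: power2_norm_eq_inner[symmetric] power2_eq_square)
  qed
qed

lemma perturbed_resolvent_iL2: "lam > C \<Longrightarrow> perturbed_resolvent lam (iL2 F) = iL2 (perturbed_resolvent lam F)"
  unfolding perturbed_resolvent_def by (rule translation_weight.translation_op_iL2[OF weight_G])

end

section \<open>Spectral resolutions\<close>

context real_pvm
begin

lemma bform_commute: "bform \<phi> x y = bform \<phi> y x"
  using mu_minus[of "x - y"] by (simp add: bform_def add.commute)

lemma measurable_mu [simp]: "(f \<in> borel_measurable (\<mu> x)) = (f \<in> borel_measurable borel)"
  by (rule arg_cong[OF measurable_cong_sets]) simp_all

lemma integrable_mu_AE_bounded: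
  fixes \<phi> :: "real \<Rightarrow> real"
  shows "\<phi> \<in> borel_measurable borel \<Longrightarrow> AE r in \<mu> x. \<bar>\<phi> r\<bar> \<le> K \<Longrightarrow> integrable (\<mu> x) \<phi>"
  by (rule mu.integrable_const_bound[where B=K]) auto

lemma integrable_mu_of_square:
  fixes \<phi> :: "real \<Rightarrow> real"
  assumes \<phi>: "\<phi> \<in> borel_measurable borel" and i: "integrable (\<mu> x) (\<lambda>r. (\<phi> r)\<^sup>2)"
  shows "integrable (\<mu> x) \<phi>"
proof (rule Bochner_Integration.integrable_bound)
  show "integrable (\<mu> x) (\<lambda>r. 1 + (\<phi> r)\<^sup>2)" using i by (intro Bochner_Integration.integrable_add) auto
  have "\<bar>a\<bar> \<le> 1 + a\<^sup>2" for a :: real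
    using sum_squares_bound[of "\<bar>a\<bar>" 1] abs_ge_zero[of a] by simp
  then show "AE r in \<mu> x. norm (\<phi> r) \<le> norm (1 + (\<phi> r)\<^sup>2)" by (simp add: abs_of_nonneg add_nonneg_nonneg)
qed (use \<phi> in simp)

lemma bform_cong_AE:
  assumes "\<phi> \<in> borel_measurable borel" "\<psi> \<in> borel_measurable borel" "\<And>z. AE r in \<mu> z. \<phi> r = \<psi> r"
  shows "bform \<phi> x y = bform \<psi> x y"
  unfolding bform_def using assms by (intro arg_cong2[where f="\<lambda>a b. (a - b) / 4"] integral_cong_AE) auto

text \<open>The real counterpart of \<open>spectral_integral\<close>: the weak definition of the
  operator with symbol \<open>\<phi>\<close> on its natural domain.\<close>

definition pvm_integral :: "(real \<Rightarrow> real) \<Rightarrow> ('h \<times> 'h) set" where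
  "pvm_integral \<phi> = {(g, u). integrable (\<mu> g) (\<lambda>r. (\<phi> r)\<^sup>2) \<and>
     (\<forall>F. integrable (\<mu> F) (\<lambda>r. (\<phi> r)\<^sup>2) \<longrightarrow> inner F u = bform \<phi> F g)}"

end

text \<open>The axioms say that \<open>A\<close> is the bounded function
  \<open>1 / (r + lam)\<close> of \<open>E\<close>; from this the unbounded integral of
  \<open>r\<close> is recovered. The bound 1 reflects that \<open>A\<close> is a
  contraction.\<close>

locale pvm_resolvent = real_pvm E for E :: "real set \<Rightarrow> 'h::real_inner \<Rightarrow> 'h" +
  fixes A :: "'h \<Rightarrow> 'h" and lam :: real
  assumes resolvent_sym: "inner x (A y) = inner (A x) y"
    and inner_E_resolvent: "B \<in> sets borel \<Longrightarrow> inner x (E B (A y)) = bform (\<lambda>r. indicator B r * (1 / (r + lam))) x y"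
    and AE_resolvent: "AE r in \<mu> x. r \<noteq> - lam \<and> \<bar>1 / (r + lam)\<bar> \<le> 1"
begin

definition \<rho> :: "real \<Rightarrow> real" where "\<rho> r = 1 / (r + lam)"

lemma rho_measurable [measurable]: "\<rho> \<in> borel_measurable borel"
  unfolding \<rho>_def[abs_def] by measurable

lemma inner_E_rho: "B \<in> sets borel \<Longrightarrow> inner x (E B (A y)) = bform (\<lambda>r. indicator B r * \<rho> r) x y"
  unfolding \<rho>_def by (rule inner_E_resolvent)

lemma AE_rho: "AE r in \<mu> x. r \<noteq> - lam \<and> \<bar>\<rho> r\<bar> \<le> 1"
  unfolding \<rho>_def by (rule AE_resolvent)

lemma integrable_resolvent [simp]: "integrable (\<mu> x) \<rho>"
proof (rule integrable_mu_AE_bounded)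
  show "AE r in \<mu> x. \<bar>\<rho> r\<bar> \<le> 1" using AE_rho by (rule AE_mp) auto
qed simp

lemma integrable_resolvent_indicator:
  assumes B: "B \<in> sets borel"
  shows "integrable (\<mu> x) (\<lambda>r. indicator B r * \<rho> r)" "integrable (\<mu> x) (\<lambda>r. indicator B r * \<rho> r * \<rho> r)"
proof -
  have le: "\<bar>indicator B r * a\<bar> \<le> 1" "\<bar>indicator B r * a * a\<bar> \<le> 1" if "\<bar>a\<bar> \<le> 1" for a r :: real
    using that mult_le_one[of "\<bar>a\<bar>" "\<bar>a\<bar>"] by (auto simp: indicator_def abs_mult)
  show "integrable (\<mu> x) (\<lambda>r. indicator B r * \<rho> r)"
  proof (rule integrable_mu_AE_bounded)
    show "AE r in \<mu> x. \<bar>indicator B r * \<rho> r\<bar> \<le> 1" using AE_rho by (rule AE_mp) (use le in auto)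
  qed (use B in measurable)
  show "integrable (\<mu> x) (\<lambda>r. indicator B r * \<rho> r * \<rho> r)"
  proof (rule integrable_mu_AE_bounded)
    show "AE r in \<mu> x. \<bar>indicator B r * \<rho> r * \<rho> r\<bar> \<le> 1" using AE_rho by (rule AE_mp) (use le in auto)
  qed (use B in measurable)
qed

lemma measure_mu_resolvent:
  assumes B: "B \<in> sets borel"
  shows "measure (\<mu> (A x)) B = (LINT r|\<mu> x. (\<rho> r * \<rho> r) * indicator B r)"
proof -
  note i = integrable_resolvent_indicator[OF B]
  have "measure (\<mu> (A x)) B = bform (\<lambda>r. (indicator B r * \<rho> r) * 1) (A x) x"
    by (simp add: measure_mu B inner_E_rho)
  also have "\<dots> = bform (\<lambda>r. (indicator B r * \<rho> r) * \<rho> r) x x"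
  proof (rule bform_transfer)
    fix D :: "real set" assume D: "D \<in> sets borel"
    have "bform (\<lambda>r. indicator D r * 1) (A x) x = inner (E D x) (A x)"
      using sym[OF D, of "A x" x] sym[OF D, of x "A x"] by (simp add: bform_indicator D inner_commute)
    also have "\<dots> = inner x (E D (A x))" by (rule sym[OF D, symmetric])
    finally show "bform (\<lambda>r. indicator D r * 1) (A x) x = bform (\<lambda>r. indicator D r * \<rho> r) x x"
      by (simp add: inner_E_rho D)
  qed (use B i in simp_all)
  also have "\<dots> = (LINT r|\<mu> x. (indicator B r * \<rho> r) * \<rho> r)" by (rule bform_self) (use B i in simp_all)
  finally show ?thesis by (simp add: mult_ac)
qed

text \<open>Each of the two occurrences of \<open>A x\<close> in the quadratic form contributes one
  factor \<open>\<rho>\<close>, hence the density \<open>\<rho>\<close> squared.\<close>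

lemma mu_resolvent: "\<mu> (A x) = density (\<mu> x) (\<lambda>r. ennreal (\<rho> r * \<rho> r))"
proof (rule measure_eqI)
  fix B assume "B \<in> sets (\<mu> (A x))"
  then have B: "B \<in> sets borel" by simp
  have i: "integrable (\<mu> x) (\<lambda>r. (\<rho> r * \<rho> r) * indicator B r)"
    using integrable_resolvent_indicator(2)[OF B] by (simp add: mult_ac)
  have "emeasure (density (\<mu> x) (\<lambda>r. ennreal (\<rho> r * \<rho> r))) B = (\<integral>\<^sup>+r. ennreal (\<rho> r * \<rho> r * indicator B r) \<partial>\<mu> x)"
    by (subst emeasure_density) (use B in \<open>auto intro!: nn_integral_cong simp: indicator_def\<close>)
  also have "\<dots> = ennreal (measure (\<mu> (A x)) B)"
    unfolding measure_mu_resolvent[OF B] by (rule nn_integral_eq_integral[OF i]) (auto simp: indicator_def)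
  finally show "emeasure (\<mu> (A x)) B = emeasure (density (\<mu> x) (\<lambda>r. ennreal (\<rho> r * \<rho> r))) B"
    by (simp add: mu.emeasure_eq_measure)
qed simp

lemma AE_mult_resolvent: "AE r in \<mu> x. r * \<rho> r = 1 - lam * \<rho> r"
  using AE_rho
proof (rule AE_mp, intro AE_I2 impI)
  fix r assume "r \<noteq> - lam \<and> \<bar>\<rho> r\<bar> \<le> 1"
  then have "r + lam \<noteq> 0" by linarith
  then show "r * \<rho> r = 1 - lam * \<rho> r" by (simp add: \<rho>_def field_simps)
qed

lemma AE_mult_resolvent_le: "AE r in \<mu> x. \<bar>r * \<rho> r\<bar> \<le> 1 + \<bar>lam\<bar>"
  using AE_mult_resolvent AE_rho
proof eventually_elim
  case (elim r)
  have "\<bar>lam * \<rho> r\<bar> \<le> \<bar>lam\<bar>" using elim(2) by (simp only: abs_mult mult_left_le abs_ge_zero)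
  then show ?case unfolding elim(1) by linarith
qed

text \<open>The range of \<open>A\<close> lies in the domain because
  \<open>r * \<rho> r = 1 - lam * \<rho> r\<close> is bounded almost everywhere.\<close>

lemma resolvent_domain: "integrable (\<mu> (A x)) (\<lambda>r. r\<^sup>2)"
proof -
  have "integrable (\<mu> x) (\<lambda>r. (r * \<rho> r) * (r * \<rho> r))"
  proof (rule integrable_mu_AE_bounded[where K="(1 + \<bar>lam\<bar>) * (1 + \<bar>lam\<bar>)"])
    show "AE r in \<mu> x. \<bar>r * \<rho> r * (r * \<rho> r)\<bar> \<le> (1 + \<bar>lam\<bar>) * (1 + \<bar>lam\<bar>)"
      using AE_mult_resolvent_le
      by eventually_elim (subst abs_mult, intro mult_mono, auto)
  qed simp
  then show ?thesis
    unfolding mu_resolvent by (subst integrable_density) (auto simp: power2_eq_square mult_ac)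
qed

text \<open>\<open>A\<close> moves from the vector into the integrand as the factor
  \<open>\<rho>\<close>, and \<open>r * \<rho> r\<close> becomes
  \<open>1 - lam * \<rho> r\<close>.\<close>

lemma bform_id_resolvent:
  assumes F: "integrable (\<mu> F) (\<lambda>r. r\<^sup>2)"
  shows "bform (\<lambda>r. r) F (A w) = inner F w - lam * inner F (A w)"
proof -
  have i1: "integrable (\<mu> z) (\<lambda>r. r * \<rho> r)" for z
    by (rule integrable_mu_AE_bounded[OF _ AE_mult_resolvent_le]) simp
  have i2: "integrable (\<mu> (F + A w)) (\<lambda>r. r)" "integrable (\<mu> (F - A w)) (\<lambda>r. r)"
    by (rule integrable_mu_add[OF _ integrable_mu_of_square[OF _ F] integrable_mu_of_square[OF _ resolvent_domain]]; measurable)+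
  have "bform (\<lambda>r. r * 1) F (A w) = bform (\<lambda>r. r * \<rho> r) F w"
  proof (rule bform_transfer[where k="\<lambda>_. 1" and k'=\<rho> and \<phi>="\<lambda>r. r"])
    show "bform (\<lambda>r. indicator D r * 1) F (A w) = bform (\<lambda>r. indicator D r * \<rho> r) F w" if "D \<in> sets borel" for D
      using that by (simp add: bform_indicator inner_E_rho)
  qed (use i1 i2 in \<open>simp_all only: mult_1_right integrable_resolvent rho_measurable mu.integrable_const borel_measurable_const measurable_ident_sets[OF refl]\<close>)
  also have "\<dots> = bform (\<lambda>r. 1 - lam * \<rho> r) F w"
    by (rule bform_cong_AE) (simp_all add: AE_mult_resolvent)
  also have "\<dots> = bform (\<lambda>_. 1) F w - lam * bform \<rho> F w"
  proof -
    have "(LINT r|\<mu> z. 1 - lam * \<rho> r) = (LINT r|\<mu> z. 1) - lam * (LINT r|\<mu> z. \<rho> r)" for z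
      by (subst Bochner_Integration.integral_diff) auto
    then show ?thesis unfolding bform_def by (simp add: algebra_simps diff_divide_distrib add_divide_distrib)
  qed
  also have "bform (\<lambda>_. 1) F w = inner F w" using bform_indicator[of UNIV F w] by (simp add: E_UNIV)
  also have "bform \<rho> F w = inner F (A w)" using inner_E_rho[of UNIV F w] by (simp add: E_UNIV)
  finally show ?thesis by simp
qed

text \<open>In one direction the range of \<open>A\<close> is in the domain and the form is known
  there. In the other the weak equation is tested with \<open>A f\<close> for arbitrary
  \<open>f\<close>, which always lies in the domain, and symmetry of \<open>A\<close> frees
  \<open>f\<close>.\<close>

lemma pvm_integral_id: "(g, u) \<in> pvm_integral (\<lambda>r. r) \<longleftrightarrow> g = A (u + lam *\<^sub>R g)"
proof
  assume g: "g = A (u + lam *\<^sub>R g)"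
  define w where "w = u + lam *\<^sub>R g"
  have gw: "g = A w" and u: "u = w - lam *\<^sub>R g" using g by (simp_all add: w_def)
  show "(g, u) \<in> pvm_integral (\<lambda>r. r)"
    unfolding pvm_integral_def u by (auto simp: gw resolvent_domain bform_id_resolvent inner_diff_right)
next
  assume gu: "(g, u) \<in> pvm_integral (\<lambda>r. r)"
  then have D: "integrable (\<mu> g) (\<lambda>r. r\<^sup>2)" by (simp add: pvm_integral_def)
  have "inner f g = inner f (A (u + lam *\<^sub>R g))" for f
  proof -
    have "inner (A f) u = bform (\<lambda>r. r) g (A f)" using gu resolvent_domain[of f] bform_commute by (auto simp: pvm_integral_def)
    also have "\<dots> = inner g f - lam * inner g (A f)" by (rule bform_id_resolvent[OF D])
    finally have "inner f g = inner (A f) u + lam * inner (A f) g"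
      using inner_commute[of f g] inner_commute[of "A f" g] by simp
    also have "\<dots> = inner f (A (u + lam *\<^sub>R g))" by (simp only: resolvent_sym inner_add_right inner_scaleR_right)
    finally show ?thesis .
  qed
  then show "g = A (u + lam *\<^sub>R g)" using vector_eq_ldot by blast
qed

end

context positive_contraction
begin

text \<open>The image of the projections of \<open>A\<close> under the inverse of the map from
  \<open>r\<close> to \<open>1 / (r + lam)\<close>.\<close>

definition ER :: "real \<Rightarrow> real set \<Rightarrow> 'h \<Rightarrow> 'h" where "ER lam B = EA ((\<lambda>s. 1 / s - lam) -` B)"

lemma ER_vimage: "B \<in> sets borel \<Longrightarrow> (\<lambda>s::real. 1 / s - lam) -` B \<in> sets borel"
  using measurable_sets[of "\<lambda>s::real. 1 / s - lam" borel borel B] by simp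

lemma real_pvm_ER: "real_pvm (ER lam)"
proof (rule real_pvm.intro)
  show "inner x (ER lam B y) = inner (ER lam B x) y" if "B \<in> sets borel" for B x y
    unfolding ER_def by (rule EA_sym[OF ER_vimage[OF that]])
  show "ER lam B (ER lam D x) = ER lam (B \<inter> D) x" if "B \<in> sets borel" "D \<in> sets borel" for B D x
    unfolding ER_def vimage_Int by (rule EA_mult[OF that[THEN ER_vimage]])
  show "ER lam UNIV x = x" for x by (simp add: ER_def EA_UNIV)
  show "(\<lambda>n. \<Sum>i<n. ER lam (F i) x) \<longlonglongrightarrow> ER lam (\<Union>i. F i) x" if F: "range F \<subseteq> sets borel" "disjoint_family F" for F :: "nat \<Rightarrow> real set" and x
    unfolding ER_def vimage_UN
  proof (rule EA_sums)
    show "range (\<lambda>i. (\<lambda>s. 1 / s - lam) -` F i) \<subseteq> sets borel" using F(1) ER_vimage by blast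
    show "disjoint_family (\<lambda>i. (\<lambda>s. 1 / s - lam) -` F i)" using F(2) by (auto simp: disjoint_family_on_def)
  qed
qed

lemma mu_ER: "real_pvm.\<mu> (ER lam) x = distr (\<mu> x) borel (\<lambda>s. 1 / s - lam)"
proof -
  interpret R: real_pvm "ER lam" by (rule real_pvm_ER)
  show ?thesis
    by (rule measure_eqI) (auto simp: R.emeasure_mu emeasure_distr emeasure_mu ER_vimage ER_def)
qed

lemma pvm_resolvent_ER:
  assumes inj: "\<And>x. A x = 0 \<Longrightarrow> x = 0"
  shows "pvm_resolvent (ER lam) A lam"
proof (rule pvm_resolvent.intro[OF real_pvm_ER pvm_resolvent_axioms.intro])
  interpret R: real_pvm "ER lam" by (rule real_pvm_ER)
  \<comment> \<open>This holds at \<open>s = 0\<close> as well, by the convention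
    \<open>1 / 0 = 0\<close>.\<close>
  have h: "1 / ((1 / s - lam) + lam) = s" for s :: real by simp
  show "inner x (A y) = inner (A x) y" for x y by (rule A_sym)
  show "inner x (ER lam B (A y)) = R.bform (\<lambda>r. indicator B r * (1 / (r + lam))) x y" if B: "B \<in> sets borel" for B x y
    unfolding ER_def inner_EA_A[OF ER_vimage[OF B]] R.bform_def bform_def mu_ER using B
    by (subst (1 2) integral_distr) (auto simp: indicator_def)
  \<comment> \<open>The function \<open>s\<close> vanishes on the set \<open>{0}\<close>, so
    \<open>A\<close> annihilates the range of this projection, and injectivity makes the projection
    0. Thus almost no mass is sent to \<open>- lam\<close>.\<close>
  have E0: "EA {0} x = 0" for x
  proof (rule inj)
    have "inner z (A (EA {0} x)) = 0" for z
    proof -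
      have z0: "bform (\<lambda>s. indicator {0} s * s) a x = 0" for a
      proof -
        have "(\<lambda>s::real. indicator {0} s * s) = (\<lambda>_. 0)" by (auto simp: indicator_def)
        then show ?thesis by (simp add: bform_def)
      qed
      have "inner z (A (EA {0} x)) = inner (EA {0} (A z)) x"
        by (simp add: A_sym EA_sym)
      also have "\<dots> = inner x (EA {0} (A z))" by (rule inner_commute)
      also have "\<dots> = bform (\<lambda>s. indicator {0} s * s) x z" by (rule inner_EA_A) simp
      also have "\<dots> = bform (\<lambda>_. 0) x z" by (rule arg_cong[where f="\<lambda>f. bform f x z"]) (auto simp: indicator_def)
      finally show ?thesis by (simp add: bform_def)
    qed
    from this[of "A (EA {0} x)"] show "A (EA {0} x) = 0" by simp
  qed
  show "AE r in R.\<mu> x. r \<noteq> - lam \<and> \<bar>1 / (r + lam)\<bar> \<le> 1" for x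
    unfolding mu_ER
  proof (subst AE_distr_iff)
    have "{0::real} \<in> null_sets (\<mu> x)" using E0[of x] by (simp add: null_sets_def emeasure_mu)
    then have "AE s in \<mu> x. s \<noteq> 0" using AE_not_in by fastforce
    then show "AE s in \<mu> x. 1 / s - lam \<noteq> - lam \<and> \<bar>1 / (1 / s - lam + lam)\<bar> \<le> 1"
      unfolding mu_eq_nu using nu.AE_unit by eventually_elim auto
  qed auto
qed

end

section \<open>Passage between resolutions on functions and on classes\<close>

locale l2_pvm =
  fixes E :: "real set \<Rightarrow> ('a::euclidean_space \<Rightarrow> complex) \<Rightarrow> 'a \<Rightarrow> complex"
  assumes pvm: "projection_valued_measure E"
begin

definition LE :: "real set \<Rightarrow> 'a L2 \<Rightarrow> 'a L2" where "LE B F = abs_L2 (E B (rep_L2 F))"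

lemma E_l2: "B \<in> sets borel \<Longrightarrow> f \<in> l2 \<Longrightarrow> E B f \<in> l2"
  using pvm by (simp add: projection_valued_measure_def)

lemma E_sym: "B \<in> sets borel \<Longrightarrow> f \<in> l2 \<Longrightarrow> g \<in> l2 \<Longrightarrow> l2_inner f (E B g) = l2_inner (E B f) g"
  using pvm by (simp add: projection_valued_measure_def)

lemma abs_E_sym:
  assumes "B \<in> sets borel" "f \<in> l2" "g \<in> l2"
  shows "inner (abs_L2 f) (abs_L2 (E B g)) = inner (abs_L2 (E B f)) (abs_L2 g)"
    "inner (abs_L2 f) (iL2 (abs_L2 (E B g))) = inner (abs_L2 (E B f)) (iL2 (abs_L2 g))"
  using E_sym[OF assms] assms by (simp_all add: l2_inner_eq E_l2)

lemma LE_abs: assumes B: "B \<in> sets borel" and f: "f \<in> l2" shows "abs_L2 (E B f) = LE B (abs_L2 f)"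
proof (subst vector_eq_ldot[symmetric], rule allI)
  fix Y :: "'a L2"
  have Y: "abs_L2 (rep_L2 Y) = Y" by simp
  show "inner Y (abs_L2 (E B f)) = inner Y (LE B (abs_L2 f))"
    using abs_E_sym(1)[OF B rep_L2_l2[of Y] f] abs_E_sym(1)[OF B rep_L2_l2[of Y] rep_L2_l2[of "abs_L2 f"]]
    by (simp add: LE_def)
qed

lemma LE_sym: "B \<in> sets borel \<Longrightarrow> inner F (LE B G) = inner (LE B F) G"
  using abs_E_sym(1)[of B "rep_L2 F" "rep_L2 G"] by (simp add: LE_def)

text \<open>The symmetry axiom is complex; its imaginary part is the statement that the projections
  commute with \<open>\<i>\<close>.\<close>

lemma LE_iL2: assumes B: "B \<in> sets borel" shows "LE B (iL2 F) = iL2 (LE B F)"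
proof (subst vector_eq_ldot[symmetric], rule allI)
  fix Y :: "'a L2"
  have "inner Y (LE B (iL2 F)) = inner (LE B Y) (iL2 F)" by (rule LE_sym[OF B])
  also have "\<dots> = inner Y (iL2 (LE B F))"
    using abs_E_sym(2)[OF B rep_L2_l2[of Y] rep_L2_l2[of F]] by (simp add: LE_def)
  finally show "inner Y (LE B (iL2 F)) = inner Y (iL2 (LE B F))" .
qed

sublocale real_pvm LE
proof
  show "inner F (LE B G) = inner (LE B F) G" if "B \<in> sets borel" for B F G by (rule LE_sym[OF that])
  show "LE B (LE D F) = LE (B \<inter> D) F" if B: "B \<in> sets borel" and D: "D \<in> sets borel" for B D F
  proof -
    have "AE x in lborel. E B (E D (rep_L2 F)) x = E (B \<inter> D) (rep_L2 F) x"
      using pvm B D by (simp add: projection_valued_measure_def)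
    then have "abs_L2 (E B (E D (rep_L2 F))) = abs_L2 (E (B \<inter> D) (rep_L2 F))"
      by (subst abs_L2_eq_iff) (use B D in \<open>auto intro!: E_l2\<close>)
    then show ?thesis using B D by (simp add: LE_abs E_l2)
  qed
  show "LE UNIV F = F" for F
  proof -
    have "AE x in lborel. E UNIV (rep_L2 F) x = rep_L2 F x"
      using pvm by (simp add: projection_valued_measure_def)
    then have "abs_L2 (E UNIV (rep_L2 F)) = abs_L2 (rep_L2 F)"
      by (subst abs_L2_eq_iff) (auto intro!: E_l2)
    then show ?thesis by (simp add: LE_abs)
  qed
  show "(\<lambda>n. \<Sum>i<n. LE (A i) F) \<longlonglongrightarrow> LE (\<Union>i. A i) F" if A: "range A \<subseteq> sets borel" "disjoint_family A" for A F
  proof -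
    have Ai: "A i \<in> sets borel" for i using A by auto
    have "l2_tendsto (\<lambda>n x. \<Sum>i<n. E (A i) (rep_L2 F) x) (E (\<Union>i. A i) (rep_L2 F))"
      using pvm A by (simp add: projection_valued_measure_def)
    then have "(\<lambda>n. abs_L2 (\<lambda>x. \<Sum>i<n. E (A i) (rep_L2 F) x)) \<longlonglongrightarrow> abs_L2 (E (\<Union>i. A i) (rep_L2 F))"
      by (subst (asm) l2_tendsto_iff) (auto intro!: l2_sum E_l2 Ai sets.countable_UN)
    moreover have "abs_L2 (\<lambda>x. \<Sum>i<n. E (A i) (rep_L2 F) x) = (\<Sum>i<n. LE (A i) F)" for n
      by (induction n) (simp_all add: abs_L2_zero abs_L2_add l2_sum E_l2 Ai LE_def)
    ultimately show ?thesis by (simp add: LE_def)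
  qed
qed

lemma spectral_measure_eq: "f \<in> l2 \<Longrightarrow> spectral_measure E f = \<mu> (abs_L2 f)"
  unfolding spectral_measure_def \<mu>_def
proof (rule measure_of_eq)
  assume f: "f \<in> l2"
  fix B :: "real set" assume "B \<in> sigma_sets UNIV (sets borel)"
  then have "B \<in> sets borel" using sets.sigma_sets_eq[of "borel :: real measure"] by simp
  then show "ennreal (Re (l2_inner f (E B f))) = ennreal (inner (abs_L2 f) (LE B (abs_L2 f)))"
    using f by (simp add: inner_abs_L2[symmetric] E_l2 LE_abs)
qed simp

lemma mu_iL2: "\<mu> (iL2 F) = \<mu> F"
  by (rule mu_cong) (simp add: LE_iL2 inner_iL2)

lemma bform_iL2: "bform \<phi> (iL2 F) G = - bform \<phi> F (iL2 G)"
proof -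
  have "\<mu> (iL2 F + G) = \<mu> (F - iL2 G)" "\<mu> (iL2 F - G) = \<mu> (F + iL2 G)"
    using mu_iL2[of "F - iL2 G"] mu_iL2[of "F + iL2 G"] iL2_add[of F "- iL2 G"] iL2_scaleR[of "-1" "iL2 G"]
    by (simp_all add: iL2_add iL2_iL2)
  then show ?thesis unfolding bform_def by (simp only: minus_divide_left minus_diff_eq)
qed

text \<open>In the complex polarization the terms \<open>k = 0\<close> and \<open>k = 2\<close> form
  the real part, and \<open>k = 1\<close> and \<open>k = 3\<close> the imaginary part; each pair is
  a real polarization.\<close>

lemma spectral_form_eq:
  assumes f: "f \<in> l2" and g: "g \<in> l2"
  shows "spectral_form E \<phi> f g = Complex (bform \<phi> (abs_L2 f) (abs_L2 g)) (- bform \<phi> (abs_L2 f) (iL2 (abs_L2 g)))"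
proof -
  have m: "spectral_measure E (\<lambda>x. f x + 1 * g x) = \<mu> (abs_L2 f + abs_L2 g)"
    "spectral_measure E (\<lambda>x. f x + \<i> * g x) = \<mu> (abs_L2 f + iL2 (abs_L2 g))"
    "spectral_measure E (\<lambda>x. f x + (-1) * g x) = \<mu> (abs_L2 f - abs_L2 g)"
    "spectral_measure E (\<lambda>x. f x + (-\<i>) * g x) = \<mu> (abs_L2 f - iL2 (abs_L2 g))"
    using f g by (simp_all add: spectral_measure_eq l2_add l2_scale l2_diff abs_L2_add abs_L2_diff abs_L2_i)
  have p: "\<i> ^ 0 = (1::complex)" "\<i> ^ 1 = \<i>" "\<i> ^ 2 = -1" "\<i> ^ 3 = -\<i>" by (simp_all add: power3_eq_cube)
  have s: "(\<Sum>k<4. a k) = a 0 + a 1 + a 2 + a 3" for a :: "nat \<Rightarrow> complex" by (simp add: eval_nat_numeral)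
  show ?thesis
    unfolding spectral_form_def s p m bform_def by (simp add: complex_eq_iff field_simps)
qed

lemma spectral_domain_iff: "f \<in> spectral_domain E \<phi> \<longleftrightarrow> f \<in> l2 \<and> integrable (\<mu> (abs_L2 f)) (\<lambda>r. (\<phi> r)\<^sup>2)"
  by (auto simp: spectral_domain_def spectral_measure_eq)

text \<open>The domain is invariant under \<open>\<i>\<close>, so the real weak equation, tested
  with a vector and with \<open>\<i>\<close> times it, is equivalent to the complex one.\<close>

lemma spectral_integral_iff:
  "(g, u) \<in> spectral_integral E \<phi> \<longleftrightarrow> g \<in> l2 \<and> u \<in> l2 \<and> (abs_L2 g, abs_L2 u) \<in> pvm_integral \<phi>"
proof -
  have "(\<forall>f\<in>spectral_domain E \<phi>. l2_inner f u = spectral_form E \<phi> f g) \<longleftrightarrow>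
    (\<forall>F. integrable (\<mu> F) (\<lambda>r. (\<phi> r)\<^sup>2) \<longrightarrow> inner F (abs_L2 u) = bform \<phi> F (abs_L2 g))" (is "?l \<longleftrightarrow> ?r")
    if g: "g \<in> l2" and u: "u \<in> l2"
  proof
    assume l: ?l
    show ?r
    proof (intro allI impI)
      fix F assume "integrable (\<mu> F) (\<lambda>r. (\<phi> r)\<^sup>2)"
      then have "rep_L2 F \<in> spectral_domain E \<phi>" by (simp add: spectral_domain_iff)
      then have "l2_inner (rep_L2 F) u = spectral_form E \<phi> (rep_L2 F) g" using l by blast
      then show "inner F (abs_L2 u) = bform \<phi> F (abs_L2 g)" using g u by (simp add: l2_inner_eq spectral_form_eq)
    qed
  next
    assume r: ?r
    show ?l
    proof
      fix f assume "f \<in> spectral_domain E \<phi>"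
      then have f: "f \<in> l2" and i: "integrable (\<mu> (abs_L2 f)) (\<lambda>r. (\<phi> r)\<^sup>2)" by (auto simp: spectral_domain_iff)
      have "inner (abs_L2 f) (abs_L2 u) = bform \<phi> (abs_L2 f) (abs_L2 g)"
        "inner (iL2 (abs_L2 f)) (abs_L2 u) = bform \<phi> (iL2 (abs_L2 f)) (abs_L2 g)"
        using r i by (simp_all add: mu_iL2)
      then show "l2_inner f u = spectral_form E \<phi> f g"
        using f g u by (simp add: l2_inner_eq spectral_form_eq inner_iL2_left bform_iL2)
    qed
  qed
  then show ?thesis by (auto simp: spectral_integral_def pvm_integral_def spectral_domain_iff)
qed

end

text \<open>Symmetry for the real inner product is only the real part of complex symmetry; commuting
  with \<open>iL2\<close> supplies the imaginary part.\<close>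

lemma l2_pvm_of_real_pvm:
  fixes F :: "real set \<Rightarrow> 'a::euclidean_space L2 \<Rightarrow> 'a L2"
  assumes F: "real_pvm F" and i: "\<And>B x. B \<in> sets borel \<Longrightarrow> F B (iL2 x) = iL2 (F B x)"
  defines "E \<equiv> \<lambda>B f. rep_L2 (F B (abs_L2 f))"
  shows "l2_pvm E" "l2_pvm.LE E = F"
proof -
  interpret real_pvm F by (rule F)
  have abs_E: "abs_L2 (E B f) = F B (abs_L2 f)" for B f by (simp add: E_def)
  have l: "E B f \<in> l2" for B f by (simp add: E_def)
  show pvm: "l2_pvm E"
  proof (rule l2_pvm.intro, unfold projection_valued_measure_def, intro conjI ballI allI impI)
    show "E B f \<in> l2" for B f by (rule l)
    show "l2_inner f (E B g) = l2_inner (E B f) g" if "B \<in> sets borel" "f \<in> l2" "g \<in> l2" for B f g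
      using that sym[of B "abs_L2 f" "abs_L2 g"] sym[of B "abs_L2 f" "iL2 (abs_L2 g)"]
      by (simp add: l2_inner_eq l abs_E i)
    show "AE x in lborel. E A (E B f) x = E (A \<inter> B) f x" if "A \<in> sets borel" "B \<in> sets borel" "f \<in> l2" for A B f
      using that by (subst abs_L2_eq_iff[OF l l, symmetric]) (simp add: abs_E mult)
    show "AE x in lborel. E UNIV f x = f x" if "f \<in> l2" for f
      using that by (subst abs_L2_eq_iff[OF l that, symmetric]) (simp add: abs_E E_UNIV)
    show "l2_tendsto (\<lambda>n x. \<Sum>i<n. E (A i) f x) (E (\<Union>i. A i) f)"
      if A: "range A \<subseteq> sets borel" "disjoint_family A" and f: "f \<in> l2" for A f
    proof -
      have "abs_L2 (\<lambda>x. \<Sum>i<n. E (A i) f x) = (\<Sum>i<n. F (A i) (abs_L2 f))" for n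
        by (induction n) (simp_all add: abs_L2_zero abs_L2_add l2_sum l abs_E)
      then show ?thesis using sums[OF A, of "abs_L2 f"] by (simp add: l2_tendsto_iff l l2_sum abs_E)
    qed
  qed
  show "l2_pvm.LE E = F"
    by (intro ext) (simp add: l2_pvm.LE_def[OF pvm] abs_E)
qed

context bounded_potential
begin

text \<open>The resolvent at \<open>C + 1\<close> commutes with \<open>\<i>\<close>, hence so do its
  projections. The integral of \<open>r\<close> over the transformed projections is the inverse of
  the resolvent minus \<open>C + 1\<close>, and \<open>H\<close> is that same relation by
  \<open>H_iff\<close>.\<close>

lemma spectral_resolution_exists: "\<exists>E. spectral_resolution H E"
proof -
  define A where "A = perturbed_resolvent (C + 1)"
  have lam: "C + 1 > C" by simp
  interpret A: positive_contraction A unfolding A_def by (rule positive_contraction_perturbed_resolvent)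
  let ?F = "A.ER (C + 1)"
  define E where "E = (\<lambda>B f. rep_L2 (?F B (abs_L2 f)))"
  have i: "?F B (iL2 x) = iL2 (?F B x)" if "B \<in> sets borel" for B x
    unfolding A.ER_def
    by (rule A.EA_commute[OF bounded_linear_iL2 _ A.ER_vimage[OF that]]) (simp add: A_def perturbed_resolvent_iL2)
  have E: "l2_pvm E" "l2_pvm.LE E = ?F"
    unfolding E_def by (rule l2_pvm_of_real_pvm[OF A.real_pvm_ER], erule i)+
  interpret E: l2_pvm E by (rule E(1))
  interpret R: pvm_resolvent E.LE A "C + 1"
    by (subst E(2), rule A.pvm_resolvent_ER, rule perturbed_resolvent_eq_0[OF lam], simp only: A_def)
  have "spectral_integral E (\<lambda>r. r) = H"
    by (auto simp: set_eq_iff E.spectral_integral_iff R.pvm_integral_id H_iff[OF lam] A_def)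
  then show ?thesis using E.pvm by (auto simp: spectral_resolution_def)
qed

end

section \<open>Consequences of an arbitrary resolution\<close>

context real_pvm
begin

lemma bform_tendsto:
  assumes [measurable]: "\<And>n. \<phi> n \<in> borel_measurable borel" "\<psi> \<in> borel_measurable borel"
    and lim: "\<And>r. (\<lambda>n. \<phi> n r) \<longlonglongrightarrow> \<psi> r" and K: "\<And>n r. \<bar>\<phi> n r\<bar> \<le> K"
  shows "(\<lambda>n. bform (\<phi> n) x y) \<longlonglongrightarrow> bform \<psi> x y"
proof -
  have "(\<lambda>n. LINT r|\<mu> z. \<phi> n r) \<longlonglongrightarrow> (LINT r|\<mu> z. \<psi> r)" for z
    by (rule integral_dominated_convergence[where w="\<lambda>_. K"]) (use lim K in auto)
  then show ?thesis unfolding bform_def by (intro tendsto_intros) simp_all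
qed

lemma mu_E: assumes B: "B \<in> sets borel" shows "\<mu> (E B x) = density (\<mu> x) (indicator B)"
proof (rule measure_eqI)
  fix D assume "D \<in> sets (\<mu> (E B x))"
  then have D: "D \<in> sets borel" by simp
  have "inner (E B x) (E D (E B x)) = inner x (E (D \<inter> B) x)"
    using B D by (simp add: sym[symmetric] mult Int_ac)
  then show "emeasure (\<mu> (E B x)) D = emeasure (density (\<mu> x) (indicator B)) D"
    using B D by (simp add: emeasure_mu emeasure_density nn_integral_set_ennreal Int_commute
        flip: indicator_inter_arith)
qed simp

lemma integrable_mu_E:
  fixes \<phi> :: "real \<Rightarrow> real"
  assumes B: "B \<in> sets borel" and \<phi>: "\<phi> \<in> borel_measurable borel"
  shows "integrable (\<mu> (E B x)) \<phi> \<longleftrightarrow> integrable (\<mu> x) (\<lambda>r. indicator B r * \<phi> r)"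
    "(LINT r|\<mu> (E B x). \<phi> r) = (LINT r|\<mu> x. indicator B r * \<phi> r)"
proof -
  have "\<mu> (E B x) = density (\<mu> x) (\<lambda>r. ennreal (indicator B r))"
    unfolding mu_E[OF B] by (rule arg_cong[where f="density _"]) (auto simp: indicator_def)
  then show "integrable (\<mu> (E B x)) \<phi> \<longleftrightarrow> integrable (\<mu> x) (\<lambda>r. indicator B r * \<phi> r)"
    "(LINT r|\<mu> (E B x). \<phi> r) = (LINT r|\<mu> x. indicator B r * \<phi> r)"
    using B \<phi> by (simp_all add: integrable_density integral_density)
qed

lemma integrable_indicator_mu [simp]: "B \<in> sets borel \<Longrightarrow> integrable (\<mu> x) (indicator B :: real \<Rightarrow> real)"
  by (rule integrable_mu_bounded[where K=1]) auto

lemma integrable_mu_indicator: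
  fixes \<phi> :: "real \<Rightarrow> real"
  assumes "B \<in> sets borel" "integrable (\<mu> x) \<phi>"
  shows "integrable (\<mu> x) (\<lambda>r. indicator B r * \<phi> r)"
  using integrable_real_mult_indicator[of B "\<mu> x" \<phi>] assms by (simp add: mult.commute)

text \<open>Spectral projections reduce the operator: they preserve the domain, since the measure
  only gets restricted, and they can be moved across the form.\<close>

lemma pvm_integral_E:
  assumes gu: "(g, u) \<in> pvm_integral (\<lambda>r. r)" and B: "B \<in> sets borel"
  shows "(E B g, E B u) \<in> pvm_integral (\<lambda>r. r)"
proof -
  have D: "integrable (\<mu> (E B z)) (\<lambda>r. r\<^sup>2)" if "integrable (\<mu> z) (\<lambda>r. r\<^sup>2)" for z
    using that integrable_mu_indicator[OF B that] by (simp add: integrable_mu_E B)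
  have G: "integrable (\<mu> g) (\<lambda>r. r\<^sup>2)" using gu by (simp add: pvm_integral_def)
  have "inner F (E B u) = bform (\<lambda>r. r) F (E B g)" if F: "integrable (\<mu> F) (\<lambda>r. r\<^sup>2)" for F
  proof -
    have "inner F (E B u) = bform (\<lambda>r. r) (E B F) g"
      using gu D[OF F] by (simp add: pvm_integral_def sym B)
    also have "\<dots> = bform (\<lambda>r. r) F (E B g)"
    proof (rule bform_transfer_indicator)
      show "inner (E B F) (E A g) = inner F (E A (E B g))" if "A \<in> sets borel" for A
        using that B mult[of A B g] mult[of B A g] by (simp add: sym[symmetric] Int_commute)
      show "integrable (\<mu> (E B F + g)) (\<lambda>r. r)" "integrable (\<mu> (E B F - g)) (\<lambda>r. r)"
        by (rule integrable_mu_add[OF _ integrable_mu_of_square[OF _ D[OF F]] integrable_mu_of_square[OF _ G]]; measurable)+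
      show "integrable (\<mu> (F + E B g)) (\<lambda>r. r)" "integrable (\<mu> (F - E B g)) (\<lambda>r. r)"
        by (rule integrable_mu_add[OF _ integrable_mu_of_square[OF _ F] integrable_mu_of_square[OF _ D[OF G]]]; measurable)+
    qed measurable
    finally show ?thesis .
  qed
  then show ?thesis using D[OF G] by (simp add: pvm_integral_def)
qed

text \<open>On a bounded part of the spectrum every projected vector lies in the domain, so the weak
  equation can be tested with \<open>E B x\<close> for arbitrary \<open>x\<close>.\<close>

lemma pvm_integral_bounded:
  assumes gu: "(g, u) \<in> pvm_integral (\<lambda>r. r)" and B: "B \<in> sets borel" and K: "\<And>r. r \<in> B \<Longrightarrow> \<bar>r\<bar> \<le> K"
  shows "inner x (E B u) = bform (\<lambda>r. indicator B r * r) x g"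
proof -
  have G: "integrable (\<mu> g) (\<lambda>r. r\<^sup>2)" using gu by (simp add: pvm_integral_def)
  have i: "integrable (\<mu> z) (\<lambda>r. r * indicator B r)" for z
    by (rule integrable_mu_bounded[where K="\<bar>K\<bar>"]) (use B K in \<open>auto simp: indicator_def intro: order_trans[OF _ abs_ge_self]\<close>)
  have X: "integrable (\<mu> (E B x)) (\<lambda>r. r\<^sup>2)"
    unfolding integrable_mu_E[OF B borel_measurable_power[OF measurable_ident_sets[OF refl]]]
  proof (rule integrable_mu_bounded)
    show "\<bar>indicator B r * r\<^sup>2\<bar> \<le> K\<^sup>2" for r :: real
      using K[of r] power_mono[of "\<bar>r\<bar>" K 2] by (auto simp: indicator_def)
  qed (use B in measurable)
  have I: "integrable (\<mu> (E B x + g)) (\<lambda>r. r)" "integrable (\<mu> (E B x - g)) (\<lambda>r. r)"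
    by (rule integrable_mu_add[OF _ integrable_mu_of_square[OF _ X] integrable_mu_of_square[OF _ G]]; measurable)+
  have "inner x (E B u) = bform (\<lambda>r. r * 1) (E B x) g" using gu X by (simp add: pvm_integral_def sym B)
  also have "\<dots> = bform (\<lambda>r. r * indicator B r) x g"
  proof (rule bform_transfer[where k="\<lambda>_. 1" and k'="indicator B" and \<phi>="\<lambda>r. r"])
    show "bform (\<lambda>r. indicator A r * 1) (E B x) g = bform (\<lambda>r. indicator A r * indicator B r) x g" if "A \<in> sets borel" for A
      using that B mult[of B A g] by (simp add: bform_indicator sym[symmetric] Int_commute flip: indicator_inter_arith)
  qed (use B i I in \<open>simp_all only: mult_1_right integrable_indicator_mu mu.integrable_const borel_measurable_const borel_measurable_indicator measurable_ident_sets[OF refl]\<close>)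
  finally show ?thesis by (simp add: mult.commute)
qed

text \<open>On the range of the projection to \<open>{..<c}\<close> the quadratic form is the
  integral of \<open>r\<close> over values below \<open>c\<close>, while the assumption bounds it
  below by \<open>c\<close> times the mass. So the positive function \<open>c - r\<close> integrates
  to at most 0 over this set, which must be null.\<close>

lemma pvm_integral_lower:
  assumes low: "\<And>g u. (g, u) \<in> pvm_integral (\<lambda>r. r) \<Longrightarrow> inner g u \<ge> c * (norm g)\<^sup>2"
    and gu: "(g, u) \<in> pvm_integral (\<lambda>r. r)"
  shows "E {..<c} g = 0"
proof -
  define B :: "real set" where "B = {..<c}"
  have B: "B \<in> sets borel" by (simp add: B_def)
  have G: "integrable (\<mu> g) (\<lambda>r. r\<^sup>2)" using gu by (simp add: pvm_integral_def)
  note s = pvm_integral_E[OF gu B]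
  have D: "integrable (\<mu> (E B g)) (\<lambda>r. r\<^sup>2)" using s by (simp add: pvm_integral_def)
  have I: "integrable (\<mu> (E B g)) (\<lambda>r. r)" by (rule integrable_mu_of_square[OF _ D]) simp
  have J: "integrable (\<mu> g) (\<lambda>r. indicator B r * r)" using I by (simp add: integrable_mu_E B)
  have "inner (E B g) (E B u) = bform (\<lambda>r. r) (E B g) (E B g)" using s by (simp add: pvm_integral_def)
  also have "\<dots> = (LINT r|\<mu> (E B g). r)" by (rule bform_self[OF _ I]) simp
  also have "\<dots> = (LINT r|\<mu> g. indicator B r * r)" by (simp add: integrable_mu_E B)
  finally have "c * (norm (E B g))\<^sup>2 \<le> (LINT r|\<mu> g. indicator B r * r)" using low[OF s] by simp
  moreover have "(norm (E B g))\<^sup>2 = (LINT r|\<mu> g. indicator B r)"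
    using B by (simp add: measure_mu inner_E_self)
  ultimately have "(LINT r|\<mu> g. c * indicator B r - indicator B r * r) \<le> 0"
    using B J by (subst Bochner_Integration.integral_diff) auto
  moreover have i: "integrable (\<mu> g) (\<lambda>r. c * indicator B r - indicator B r * r)"
    using B J by (intro Bochner_Integration.integrable_diff) auto
  moreover have nn: "0 \<le> c * indicator B r - indicator B r * r" for r
    by (auto simp: B_def indicator_def)
  ultimately have "(LINT r|\<mu> g. c * indicator B r - indicator B r * r) = 0"
    using Bochner_Integration.integral_nonneg[of "\<mu> g" "\<lambda>r. c * indicator B r - indicator B r * r"] by (simp add: antisym)
  then have "AE r in \<mu> g. c * indicator B r - indicator B r * r = 0"
    using integral_nonneg_eq_0_iff_AE[OF i] nn by auto
  then have "AE r in \<mu> g. r \<notin> B" by (rule AE_mp) (auto simp: B_def indicator_def)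
  then have "B \<in> null_sets (\<mu> g)" using B by (simp add: AE_iff_null)
  then have "inner g (E B g) = 0" by (simp add: null_sets_def emeasure_mu B inner_E_self)
  then show ?thesis by (simp add: inner_E_self B B_def[symmetric])
qed

end

text \<open>\<open>E\<close> is any resolution of \<open>H\<close>, so the results apply to
  whichever one the choice in \<open>op_fun\<close> returns.\<close>

locale resolved_potential = bounded_potential M X V C
  for M :: "'w measure" and X :: "real \<Rightarrow> 'w \<Rightarrow> 'a::euclidean_space" and V C +
  fixes E
  assumes resolution: "spectral_resolution H E"
begin

sublocale l2_pvm E
  using resolution by (simp add: l2_pvm_def spectral_resolution_def)

lemma pvm_integral_H: "(g, u) \<in> H \<longleftrightarrow> g \<in> l2 \<and> u \<in> l2 \<and> (abs_L2 g, abs_L2 u) \<in> pvm_integral (\<lambda>r. r)"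
proof -
  have "spectral_integral E (\<lambda>r. r) = H" using resolution by (simp add: spectral_resolution_def)
  then show ?thesis using spectral_integral_iff[of g u "\<lambda>r. r"] by simp
qed

lemma pvm_integral_perturbed_resolvent:
  assumes lam: "lam > C"
  shows "(G, U) \<in> pvm_integral (\<lambda>r. r) \<longleftrightarrow> G = perturbed_resolvent lam (U + lam *\<^sub>R G)"
  using pvm_integral_H[of "rep_L2 G" "rep_L2 U"] H_iff[OF lam, of "rep_L2 G" "rep_L2 U"] by simp

lemma pvm_integral_H_lower: "(G, U) \<in> pvm_integral (\<lambda>r. r) \<Longrightarrow> inner G U \<ge> - C * (norm G)\<^sup>2"
  using pvm_integral_H[of "rep_L2 G" "rep_L2 U"] H_lower[of "rep_L2 G" "rep_L2 U"] by simp

text \<open>\<open>pvm_integral_lower\<close> covers only the domain. An arbitrary \<open>w\<close>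
  is \<open>u + (C + 1) g\<close> with \<open>(g, u)\<close> in the graph; the projection of
  \<open>g\<close> is 0, so that of \<open>u\<close> is the image of 0 with vanishing resolvent,
  hence 0 by injectivity.\<close>

lemma LE_lower: "LE {..<-C} w = 0"
proof -
  have lam: "C + 1 > C" by simp
  define g where "g = perturbed_resolvent (C + 1) w"
  define u where "u = w - (C + 1) *\<^sub>R g"
  have gu: "(g, u) \<in> pvm_integral (\<lambda>r. r)" by (simp add: pvm_integral_perturbed_resolvent[OF lam] u_def g_def)
  have g0: "LE {..<-C} g = 0" using pvm_integral_lower[OF pvm_integral_H_lower gu] .
  have "(0, LE {..<-C} u) \<in> pvm_integral (\<lambda>r. r)" using pvm_integral_E[OF gu, of "{..<-C}"] g0 by simp
  then have "perturbed_resolvent (C + 1) (LE {..<-C} u) = 0" unfolding pvm_integral_perturbed_resolvent[OF lam] by simp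
  then have "LE {..<-C} u = 0" by (rule perturbed_resolvent_eq_0[OF lam])
  moreover have "w = u + (C + 1) *\<^sub>R g" by (simp add: u_def)
  ultimately show ?thesis using g0 by (simp add: E_add E_scaleR)
qed

lemma AE_lower: "AE r in \<mu> x. - C \<le> r"
proof -
  have "{..<-C} \<in> null_sets (\<mu> x)" using LE_lower[of x] by (simp add: null_sets_def emeasure_mu)
  then have "AE r in \<mu> x. r \<notin> {..<-C}" by (rule AE_not_in)
  then show ?thesis by (rule AE_mp) auto
qed

lemma bform_lower:
  assumes "\<phi> \<in> borel_measurable borel"
  shows "bform (\<lambda>r. indicator {-C..} r * \<phi> r) x y = bform \<phi> x y"
proof (rule bform_cong_AE)
  show "AE r in \<mu> z. indicator {-C..} r * \<phi> r = \<phi> r" for z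
    using AE_lower by (rule AE_mp) auto
qed (use assms in measurable)

text \<open>On the window from \<open>-C\<close> to \<open>n\<close> the spectral measure of
  \<open>w\<close> is \<open>r + lam\<close> times that of \<open>g\<close>. Multiplying by the
  bounded inverse of this factor recovers the projection of \<open>g\<close> to the window, and the
  window is then enlarged to the whole spectrum.\<close>

lemma resolvent_bform:
  assumes lam: "lam > C"
  shows "inner x (perturbed_resolvent lam w) = bform (\<lambda>r. indicator {-C..} r * (1 / (r + lam))) x w"
proof -
  define g where "g = perturbed_resolvent lam w"
  define u where "u = w - lam *\<^sub>R g"
  have gu: "(g, u) \<in> pvm_integral (\<lambda>r. r)" by (simp add: pvm_integral_perturbed_resolvent[OF lam] u_def g_def)
  define K where "K n = {-C..real n}" for n
  \<comment> \<open>The inverse factor cut off to the window, where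
    \<open>r + lam \<ge> lam - C > 0\<close>; this gives a bound independent of
    \<open>n\<close>.\<close>
  define \<phi> where "\<phi> n r = indicator (K n) r * (1 / (r + lam))" for n r
  have K: "K n \<in> sets borel" for n by (simp add: K_def)
  have \<phi>m [measurable]: "\<phi> n \<in> borel_measurable borel" for n
    unfolding \<phi>_def[abs_def] using K by measurable
  have le: "\<bar>\<phi> n r\<bar> \<le> 1 / (lam - C)" for n r
    using lam by (auto simp: \<phi>_def K_def indicator_def abs_of_nonneg intro!: divide_left_mono)
  have wg: "inner x (LE B w) = bform (\<lambda>r. indicator B r * (r + lam)) x g" if B: "B \<in> sets borel" "B \<subseteq> K n" for B n
  proof -
    have r: "\<bar>r\<bar> \<le> real n + C" if "r \<in> B" for r using subsetD[OF B(2) that] C_nonneg by (auto simp: K_def)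
    have i: "integrable (\<mu> z) (\<lambda>r. indicator B r * r)" for z
      by (rule integrable_mu_bounded[where K="real n + C"]) (use B r C_nonneg in \<open>auto simp: indicator_def\<close>)
    have i': "integrable (\<mu> z) (\<lambda>r. lam * indicator B r)" for z using B by simp
    have "inner x (LE B w) = inner x (LE B u) + lam * inner x (LE B g)"
      using B by (simp add: u_def E_diff E_scaleR inner_diff_right)
    also have "\<dots> = bform (\<lambda>r. indicator B r * r) x g + lam * bform (indicator B) x g"
      using B by (simp add: pvm_integral_bounded[OF gu B(1) r] bform_indicator)
    also have "\<dots> = bform (\<lambda>r. indicator B r * r + lam * indicator B r) x g"
      unfolding bform_def using i i' B by (simp add: field_simps)
    finally show ?thesis by (simp add: algebra_simps)
  qed
  have eq: "bform (\<phi> n) x w = inner x (LE (K n) g)" for n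
  proof -
    have b: "\<bar>indicator (K n) r * (r + lam)\<bar> \<le> real n + C + lam" for r
      using lam C_nonneg by (auto simp: K_def indicator_def)
    have m: "(\<lambda>r. indicator (K n) r * (r + lam)) \<in> borel_measurable borel" using K by measurable
    have p1: "(\<lambda>r. \<phi> n r * indicator (K n) r) = \<phi> n" by (auto simp: \<phi>_def indicator_def)
    have p2: "(\<lambda>r. \<phi> n r * (indicator (K n) r * (r + lam))) = indicator (K n)"
      using lam by (auto simp: \<phi>_def K_def indicator_def)
    have "bform (\<lambda>r. \<phi> n r * indicator (K n) r) x w = bform (\<lambda>r. \<phi> n r * (indicator (K n) r * (r + lam))) x g"
    proof (rule bform_transfer[where k="indicator (K n)" and k'="\<lambda>r. indicator (K n) r * (r + lam)" and \<phi>="\<phi> n"])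
      fix B :: "real set" assume B: "B \<in> sets borel"
      have "bform (\<lambda>r. indicator B r * indicator (K n) r) x w = inner x (LE (B \<inter> K n) w)"
        using bform_indicator[of "B \<inter> K n" x w] B K by (simp add: indicator_inter_arith[abs_def])
      also have "\<dots> = bform (\<lambda>r. indicator (B \<inter> K n) r * (r + lam)) x g" by (rule wg) (use B K in auto)
      finally show "bform (\<lambda>r. indicator B r * indicator (K n) r) x w = bform (\<lambda>r. indicator B r * (indicator (K n) r * (r + lam))) x g"
        by (simp add: indicator_inter_arith mult.assoc)
    qed (use K integrable_mu_bounded[OF m b] integrable_mu_bounded[OF \<phi>m le] m in \<open>simp_all add: p1 p2\<close>)
    then show ?thesis unfolding p1 p2 using K by (simp add: bform_indicator)
  qed
  have ind: "(\<lambda>n. indicator (K n) r :: real) \<longlonglongrightarrow> indicator {-C..} r" for r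
  proof (rule tendsto_eventually)
    obtain N :: nat where "r \<le> N" using real_arch_simple by blast
    then show "\<forall>\<^sub>F n in sequentially. (indicator (K n) r :: real) = indicator {-C..} r"
      by (intro eventually_sequentiallyI[of N]) (auto simp: K_def indicator_def)
  qed
  have "(\<lambda>n. bform (\<phi> n) x w) \<longlonglongrightarrow> bform (\<lambda>r. indicator {-C..} r * (1 / (r + lam))) x w"
  proof (rule bform_tendsto[OF \<phi>m _ _ le])
    show "(\<lambda>n. \<phi> n r) \<longlonglongrightarrow> indicator {-C..} r * (1 / (r + lam))" for r
      unfolding \<phi>_def by (intro tendsto_intros ind)
  qed measurable
  moreover have "(\<lambda>n. bform (\<phi> n) x w) \<longlonglongrightarrow> inner x g"
  proof -
    have "(\<lambda>n. bform (indicator (K n)) x g) \<longlonglongrightarrow> bform (indicator {-C..}) x g"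
      by (rule bform_tendsto[where K=1, OF _ _ ind]) (use K in auto)
    moreover have "bform (indicator {-C..}) x g = inner x g"
      using bform_lower[of "\<lambda>_. 1" x g] bform_indicator[of UNIV x g] by (simp add: E_UNIV)
    ultimately show ?thesis unfolding eq using K by (simp add: bform_indicator)
  qed
  ultimately show ?thesis unfolding g_def by (rule LIMSEQ_unique[rotated])
qed

end

section \<open>Laplace transforms\<close>

text \<open>The substitution \<open>s = exp (- t)\<close> maps the positive half-line into the unit
  interval and turns the given integrals into moments. They vanish against polynomials, and by
  Weierstrass against continuous functions of \<open>s\<close>.\<close>

lemma laplace_transform_moments:
  fixes \<psi> :: "real \<Rightarrow> real"
  assumes i: "integrable lborel \<psi>" and neg: "\<And>t. t \<le> 0 \<Longrightarrow> \<psi> t = 0"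
    and mom: "\<And>n. (LINT t|lborel. \<psi> t * exp (- t) ^ n) = 0"
    and q: "continuous_on {0..1} q" "q \<in> borel_measurable borel"
  shows "(LINT t|lborel. \<psi> t * q (exp (- t))) = 0" "integrable lborel (\<lambda>t. \<psi> t * q (exp (- t)))"
proof -
  have [measurable]: "\<psi> \<in> borel_measurable borel" using i by auto
  have bound: "integrable lborel (\<lambda>t. \<psi> t * p (exp (- t)))"
    if p: "continuous_on {0..1} p" and [measurable]: "p \<in> borel_measurable borel" for p :: "real \<Rightarrow> real"
  proof -
    have "bounded (p ` {0..1})" by (intro compact_imp_bounded compact_continuous_image p compact_Icc)
    then obtain K where K: "\<And>s. s \<in> {0..1} \<Longrightarrow> \<bar>p s\<bar> \<le> K" unfolding bounded_iff by (metis imageI real_norm_def)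
    show ?thesis
    proof (rule Bochner_Integration.integrable_bound)
      show "integrable lborel (\<lambda>t. K * \<psi> t)" using i by simp
      show "AE t in lborel. norm (\<psi> t * p (exp (- t))) \<le> norm (K * \<psi> t)"
      proof (rule AE_I2)
        fix t
        have "\<bar>\<psi> t\<bar> * \<bar>p (exp (- t))\<bar> \<le> \<bar>\<psi> t\<bar> * \<bar>K\<bar>"
          using neg[of t] K[of "exp (- t)"] by (cases "t \<le> 0") (auto intro!: mult_left_mono intro: order_trans[OF _ abs_ge_self])
        then show "norm (\<psi> t * p (exp (- t))) \<le> norm (K * \<psi> t)" by (simp add: abs_mult mult.commute)
      qed
    qed measurable
  qed
  show "integrable lborel (\<lambda>t. \<psi> t * q (exp (- t)))" by (rule bound[OF q])
  have cp: "continuous_on A (poly p)" for A and p :: "real poly" by (intro continuous_intros)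
  have pm: "poly p \<in> borel_measurable borel" for p :: "real poly" by (rule borel_measurable_continuous_onI[OF cp])
  note ip = bound[OF cp pm]
  have poly0: "(LINT t|lborel. \<psi> t * poly p (exp (- t))) = 0" for p
  proof -
    have "(LINT t|lborel. \<psi> t * poly p (exp (- t))) = (LINT t|lborel. (\<Sum>n\<le>degree p. coeff p n * (\<psi> t * exp (- t) ^ n)))"
      unfolding poly_altdef sum_distrib_left by (intro Bochner_Integration.integral_cong sum.cong refl) (simp only: mult_ac)
    also have "\<dots> = (\<Sum>n\<le>degree p. LINT t|lborel. coeff p n * (\<psi> t * exp (- t) ^ n))"
    proof (rule Bochner_Integration.integral_sum)
      fix n
      have "integrable lborel (\<lambda>t. \<psi> t * exp (- t) ^ n)" using ip[of "monom 1 n"] by (simp add: poly_monom)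
      then show "integrable lborel (\<lambda>t. coeff p n * (\<psi> t * exp (- t) ^ n))" by (rule integrable_mult_right)
    qed
    also have "\<dots> = 0" using mom by simp
    finally show ?thesis .
  qed
  define I where "I = (LINT t|lborel. \<bar>\<psi> t\<bar>)"
  have le: "\<bar>LINT t|lborel. \<psi> t * q (exp (- t))\<bar> \<le> d * I" if d: "d > 0" for d
  proof -
    obtain p where p: "\<And>s. s \<in> {0..1} \<Longrightarrow> \<bar>q s - poly p s\<bar> < d"
      using continuous_poly_approx[OF q(1) d] by blast
    have "(LINT t|lborel. \<psi> t * q (exp (- t))) = (LINT t|lborel. \<psi> t * q (exp (- t)) - \<psi> t * poly p (exp (- t)))"
      using bound[OF q] ip[of p] by (simp add: poly0)
    also have "\<bar>\<dots>\<bar> \<le> (LINT t|lborel. \<bar>\<psi> t * q (exp (- t)) - \<psi> t * poly p (exp (- t))\<bar>)"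
      by (rule integral_abs_bound)
    also have "\<dots> \<le> (LINT t|lborel. d * \<bar>\<psi> t\<bar>)"
    proof (rule integral_mono)
      show "integrable lborel (\<lambda>t. \<bar>\<psi> t * q (exp (- t)) - \<psi> t * poly p (exp (- t))\<bar>)"
        by (intro integrable_abs Bochner_Integration.integrable_diff bound[OF q] ip)
      show "integrable lborel (\<lambda>t. d * \<bar>\<psi> t\<bar>)" using i by simp
      show "\<bar>\<psi> t * q (exp (- t)) - \<psi> t * poly p (exp (- t))\<bar> \<le> d * \<bar>\<psi> t\<bar>" for t
      proof (cases "t \<le> 0")
        case False
        then have "\<bar>\<psi> t\<bar> * \<bar>q (exp (- t)) - poly p (exp (- t))\<bar> \<le> \<bar>\<psi> t\<bar> * d"
          using p[of "exp (- t)"] by (intro mult_left_mono) auto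
        then show ?thesis by (simp add: abs_mult right_diff_distrib[symmetric] mult.commute)
      qed (simp add: neg)
    qed
    finally show ?thesis by (simp add: I_def)
  qed
  have I0: "0 \<le> I" by (simp add: I_def)
  have "\<bar>LINT t|lborel. \<psi> t * q (exp (- t))\<bar> \<le> 0 + e" if e: "e > 0" for e
  proof -
    have "e / (I + 1) * I \<le> e" using e I0 by (simp add: field_simps)
    then show ?thesis using le[of "e / (I + 1)"] e I0 by simp
  qed
  then have "\<bar>LINT t|lborel. \<psi> t * q (exp (- t))\<bar> \<le> 0" by (rule field_le_epsilon)
  then show "(LINT t|lborel. \<psi> t * q (exp (- t))) = 0" by simp
qed

text \<open>Strict positivity on an interval is contradicted by one continuous test function living
  on that interval.\<close>

lemma laplace_transform_not_pos:
  fixes \<psi> :: "real \<Rightarrow> real"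
  assumes i: "integrable lborel \<psi>" and neg: "\<And>t. t \<le> 0 \<Longrightarrow> \<psi> t = 0"
    and mom: "\<And>n. (LINT t|lborel. \<psi> t * exp (- t) ^ n) = 0"
    and ab: "0 \<le> a" "a < b"
  shows "\<not> (\<forall>t\<in>{a<..<b}. \<psi> t > 0)"
proof
  assume pos: "\<forall>t\<in>{a<..<b}. \<psi> t > 0"
  \<comment> \<open>A tent in the variable \<open>exp (- t)\<close>, positive exactly for
    \<open>a < t < b\<close>.\<close>
  let ?q = "\<lambda>s::real. max 0 (min (s - exp (- b)) (exp (- a) - s))"
  have q: "continuous_on {0..1} ?q" "?q \<in> borel_measurable borel" by (intro continuous_intros) measurable
  note Z = laplace_transform_moments[OF i neg mom q]
  have q0: "?q (exp (- t)) = 0" if "t \<notin> {a<..<b}" for t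
  proof -
    have "min (exp (- t) - exp (- b)) (exp (- a) - exp (- t)) \<le> 0" using that by (auto simp: min_le_iff_disj)
    then show ?thesis by simp
  qed
  have q1: "?q (exp (- t)) > 0" if "t \<in> {a<..<b}" for t using that by auto
  have nn: "0 \<le> \<psi> t * ?q (exp (- t))" for t
    using q0[of t] q1[of t] pos by (cases "t \<in> {a<..<b}") (auto intro!: mult_nonneg_nonneg less_imp_le simp del: max_less_iff_conj)
  have "AE t in lborel. \<psi> t * ?q (exp (- t)) = 0"
    using integral_nonneg_eq_0_iff_AE[OF Z(2)] nn Z(1) by simp
  then have "AE t in lborel. t \<notin> {a<..<b}"
  proof (rule AE_mp, intro AE_I2 impI notI)
    fix t assume "\<psi> t * ?q (exp (- t)) = 0" and t: "t \<in> {a<..<b}"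
    moreover have "\<psi> t * ?q (exp (- t)) > 0" using q1[OF t] pos t by (intro mult_pos_pos) auto
    ultimately show False by linarith
  qed
  then have "{a<..<b} \<in> null_sets lborel" using AE_iff_null_sets[of "{a<..<b}" lborel] by simp
  then show False using ab by (simp add: null_sets_def)
qed

text \<open>Only the parameters \<open>c + n\<close> enter: the factor \<open>exp (- c * t)\<close>
  goes into the function and \<open>exp (- t) ^ n\<close> gives the moments. A nonzero value
  \<open>D t\<close> would by right-continuity keep its sign on an interval to the right of
  \<open>t\<close>.\<close>

lemma laplace_transform_unique:
  fixes D :: "real \<Rightarrow> real"
  assumes i: "\<And>n::nat. integrable lborel (\<lambda>t. indicator {0<..} t * exp (- (c + n) * t) * D t)"
    and zero: "\<And>n::nat. (LINT t|lborel. indicator {0<..} t * exp (- (c + n) * t) * D t) = 0"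
    and t: "0 \<le> t" and cont: "(D \<longlongrightarrow> D t) (at_right t)"
  shows "D t = 0"
proof (rule ccontr)
  assume nz: "D t \<noteq> 0"
  \<comment> \<open>The sign reduces a negative value to the positive case.\<close>
  define s where "s = sgn (D t)"
  define \<psi> where "\<psi> r = indicator {0<..} r * exp (- c * r) * (s * D r)" for r
  have e: "\<psi> r * exp (- r) ^ n = s * (indicator {0<..} r * exp (- (c + n) * r) * D r)" for r n
  proof -
    have "exp (- c * r) * exp (- r) ^ n = exp (- (c + n) * r)"
      unfolding exp_of_nat_mult[symmetric] exp_add[symmetric] by (simp add: algebra_simps)
    then show ?thesis by (simp add: \<psi>_def mult_ac)
  qed
  have "integrable lborel \<psi>" unfolding \<psi>_def[abs_def] using i[of 0] integrable_mult_right[of s lborel, OF i[of 0]] by (simp add: mult_ac)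
  moreover have "\<psi> r = 0" if "r \<le> 0" for r using that by (simp add: \<psi>_def)
  moreover have "(LINT r|lborel. \<psi> r * exp (- r) ^ n) = 0" for n unfolding e using zero[of n] by simp
  ultimately have no: "\<not> (\<forall>r\<in>{t<..<b}. \<psi> r > 0)" if "t < b" for b
    using t that by (rule laplace_transform_not_pos)
  have "((\<lambda>r. s * D r) \<longlongrightarrow> s * D t) (at_right t)" by (intro tendsto_intros cont)
  moreover have "s * D t > 0" using nz by (auto simp: s_def sgn_if)
  ultimately have "\<forall>\<^sub>F r in at_right t. s * D r > 0" by (rule order_tendstoD(1))
  then obtain b where b: "t < b" "\<And>r. t < r \<Longrightarrow> r < b \<Longrightarrow> s * D r > 0" by (auto simp: eventually_at_right_field)
  have "\<psi> r > 0" if "r \<in> {t<..<b}" for r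
    using that t b(2)[of r] by (simp add: \<psi>_def)
  then show False using no[OF b(1)] by blast
qed

section \<open>Bounded functions and exponentials of a projection-valued measure\<close>

context real_pvm
begin

lemma bform_add_left:
  assumes \<phi>: "\<phi> \<in> borel_measurable borel" and K: "\<And>r. \<bar>\<phi> r\<bar> \<le> K"
  shows "bform \<phi> (x + x') y = bform \<phi> x y + bform \<phi> x' y"
proof -
  let ?L = "[(1::real, \<mu> (x + x' + y), \<lambda>_. 1), (-1, \<mu> (x + x' - y), \<lambda>_. 1), (-1, \<mu> (x + y), \<lambda>_. 1 :: real),
    (1, \<mu> (x - y), \<lambda>_. 1), (-1, \<mu> (x' + y), \<lambda>_. 1), (1, \<mu> (x' - y), \<lambda>_. 1)]"
  have "(\<Sum>(c, M, k)\<leftarrow>?L. c * (LINT r|M. \<phi> r * k r)) = 0"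
  proof (rule signed_integral_zero[where N=borel])
    show "(\<Sum>(c, M, k)\<leftarrow>?L. c * (LINT r|M. indicator B r * k r)) = 0" if B: "B \<in> sets borel" for B
    proof -
      have "inner (x + x' + y) (E B (x + x' + y)) - inner (x + x' - y) (E B (x + x' - y)) =
         (inner (x + y) (E B (x + y)) - inner (x - y) (E B (x - y))) + (inner (x' + y) (E B (x' + y)) - inner (x' - y) (E B (x' - y)))"
      proof -
        have "P = Q + R" if "a = P / 4" "b = Q / 4" "c = R / 4" "a = b + c" for a b c P Q R :: real
          using that by simp
        from this[OF inner_E_polar[OF B] inner_E_polar[OF B] inner_E_polar[OF B] inner_add_left[of x x' "E B y"]]
        show ?thesis .
      qed
      then show ?thesis using B by (simp add: measure_mu)
    qed
  qed (use \<phi> integrable_mu_bounded[OF \<phi> K] in auto)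
  then show ?thesis unfolding bform_def add_divide_distrib[symmetric] by simp
qed

lemma bform_scaleR_left:
  assumes \<phi>: "\<phi> \<in> borel_measurable borel" and K: "\<And>r. \<bar>\<phi> r\<bar> \<le> K"
  shows "bform \<phi> (a *\<^sub>R x) y = a * bform \<phi> x y"
proof -
  let ?L = "[(1::real, \<mu> (a *\<^sub>R x + y), \<lambda>_. 1), (-1, \<mu> (a *\<^sub>R x - y), \<lambda>_. 1), (- a, \<mu> (x + y), \<lambda>_. 1 :: real), (a, \<mu> (x - y), \<lambda>_. 1)]"
  have "(\<Sum>(c, M, k)\<leftarrow>?L. c * (LINT r|M. \<phi> r * k r)) = 0"
  proof (rule signed_integral_zero[where N=borel])
    show "(\<Sum>(c, M, k)\<leftarrow>?L. c * (LINT r|M. indicator B r * k r)) = 0" if B: "B \<in> sets borel" for B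
    proof -
      have "a * inner x (E B y) = a * ((inner (x + y) (E B (x + y)) - inner (x - y) (E B (x - y))) / 4)"
        using inner_E_polar[OF B, of x y] by simp
      then show ?thesis using inner_E_polar[OF B, of "a *\<^sub>R x" y] B
        by (simp add: measure_mu algebra_simps)
    qed
  qed (use \<phi> integrable_mu_bounded[OF \<phi> K] in auto)
  then have "(LINT r|\<mu> (a *\<^sub>R x + y). \<phi> r) - (LINT r|\<mu> (a *\<^sub>R x - y). \<phi> r) = a * ((LINT r|\<mu> (x + y). \<phi> r) - (LINT r|\<mu> (x - y). \<phi> r))"
    by (simp add: algebra_simps)
  then show ?thesis unfolding bform_def by simp
qed

text \<open>For unit vectors the parallelogram law gives the bound \<open>K\<close> itself, since
  the squared norms of \<open>a + b\<close> and \<open>a - b\<close> add up to 4; bilinearity scales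
  it to all vectors. The result extends identities from dense sets.\<close>

lemma bounded_bilinear_bform:
  assumes \<phi>: "\<phi> \<in> borel_measurable borel" and K: "\<And>r. \<bar>\<phi> r\<bar> \<le> K"
  shows "bounded_bilinear (bform \<phi>)"
proof
  note add = bform_add_left[OF \<phi> K] and scaleR = bform_scaleR_left[OF \<phi> K]
  show "bform \<phi> (a + a') b = bform \<phi> a b + bform \<phi> a' b" "bform \<phi> (r *\<^sub>R a) b = r *\<^sub>R bform \<phi> a b" for a a' b r
    by (simp_all add: add scaleR)
  show "bform \<phi> a (b + b') = bform \<phi> a b + bform \<phi> a b'" "bform \<phi> a (r *\<^sub>R b) = r *\<^sub>R bform \<phi> a b" for a b b' r
    using bform_commute[of \<phi> a] by (simp_all add: add scaleR)
  have K0: "0 \<le> K" using K[of 0] by linarith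
  have le: "\<bar>LINT r|\<mu> z. \<phi> r\<bar> \<le> K * (norm z)\<^sup>2" for z
  proof -
    have "\<bar>LINT r|\<mu> z. \<phi> r\<bar> \<le> (LINT r|\<mu> z. \<bar>\<phi> r\<bar>)" by (rule integral_abs_bound)
    also have "\<dots> \<le> (LINT r|\<mu> z. K)" by (intro integral_mono integrable_abs integrable_mu_bounded[OF \<phi> K] K mu.integrable_const)
    also have "\<dots> = K * (norm z)\<^sup>2" using measure_mu[of UNIV z] by (simp add: E_UNIV power2_norm_eq_inner)
    finally show ?thesis .
  qed
  have unit: "\<bar>bform \<phi> a b\<bar> \<le> K" if "norm a = 1" "norm b = 1" for a b
  proof -
    have "\<bar>bform \<phi> a b\<bar> \<le> (K * (norm (a + b))\<^sup>2 + K * (norm (a - b))\<^sup>2) / 4"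
      using le[of "a + b"] le[of "a - b"] unfolding bform_def by (simp add: abs_le_iff)
    also have "(norm (a + b))\<^sup>2 + (norm (a - b))\<^sup>2 = 2 * (norm a)\<^sup>2 + 2 * (norm b)\<^sup>2"
      by (simp add: power2_norm_eq_inner inner_add_left inner_add_right inner_diff_left inner_diff_right)
    then have "(K * (norm (a + b))\<^sup>2 + K * (norm (a - b))\<^sup>2) / 4 = K"
      using that by (simp add: distrib_left[symmetric])
    finally show ?thesis .
  qed
  have z: "bform \<phi> 0 b = 0" for b using scaleR[of 0 0 b] by simp
  have "norm (bform \<phi> a b) \<le> norm a * norm b * K" for a b
  proof (cases "a = 0 \<or> b = 0")
    case True
    then show ?thesis using z bform_commute[of \<phi> a b] by auto
  next
    case False
    have "bform \<phi> a b = norm a * norm b * bform \<phi> (sgn a) (sgn b)"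
    proof -
      have "bform \<phi> a b = bform \<phi> (norm a *\<^sub>R sgn a) (norm b *\<^sub>R sgn b)" using False by (simp add: sgn_div_norm)
      also have "\<dots> = norm a * bform \<phi> (norm b *\<^sub>R sgn b) (sgn a)" by (simp only: scaleR bform_commute[of \<phi> "sgn a"])
      also have "\<dots> = norm a * norm b * bform \<phi> (sgn a) (sgn b)" by (simp only: scaleR bform_commute[of \<phi> "sgn b"] mult.assoc)
      finally show ?thesis .
    qed
    then show ?thesis using unit[of "sgn a" "sgn b"] False
      by (simp add: norm_sgn abs_mult mult_left_mono)
  qed
  then show "\<exists>K. \<forall>a b. norm (bform \<phi> a b) \<le> norm a * norm b * K" by blast
qed

text \<open>The exponential cut off below \<open>-c\<close>, which makes it bounded on the whole
  line for each \<open>t \<ge> 0\<close>; for a resolution with spectrum above \<open>-c\<close> it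
  agrees with the exponential almost everywhere.\<close>

definition heat :: "real \<Rightarrow> real \<Rightarrow> real \<Rightarrow> real" where
  "heat c t r = indicator {-c..} r * exp (- t * r)"

lemma heat_measurable [measurable]: "(\<lambda>(t, r). heat c t r) \<in> borel_measurable (borel \<Otimes>\<^sub>M borel)" "heat c t \<in> borel_measurable borel"
  unfolding heat_def[abs_def] by measurable

lemma heat_bound: "0 \<le> t \<Longrightarrow> t \<le> T \<Longrightarrow> 0 \<le> c \<Longrightarrow> \<bar>heat c t r\<bar> \<le> exp (c * T)"
proof -
  assume t: "0 \<le> t" "t \<le> T" and c: "0 \<le> c"
  have "- t * r \<le> c * T" if "- c \<le> r"
  proof -
    have "t * (- r) \<le> t * c" using t that by (intro mult_left_mono) auto
    also have "\<dots> \<le> c * T" using mult_left_mono[OF t(2) c] by (simp only: mult.commute)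
    finally show ?thesis by simp
  qed
  then show ?thesis by (auto simp: heat_def indicator_def)
qed

lemma laplace_heat:
  assumes lam: "lam > c"
  shows "integrable lborel (\<lambda>t. indicator {0<..} t * exp (- lam * t) * bform (heat c t) x y)"
    "(LINT t|lborel. indicator {0<..} t * exp (- lam * t) * bform (heat c t) x y) = bform (\<lambda>r. indicator {-c..} r * (1 / (r + lam))) x y"
proof -
  let ?h = "\<lambda>(t, r). indicator {0<..} t * exp (- lam * t) * heat c t r"
  have L: "integrable lborel (\<lambda>t. indicator {0<..} t * exp (- lam * t) * (LINT r|\<mu> z. heat c t r)) \<and>
    (LINT t|lborel. indicator {0<..} t * exp (- lam * t) * (LINT r|\<mu> z. heat c t r)) = (LINT r|\<mu> z. indicator {-c..} r * (1 / (r + lam)))" for z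
  proof -
    interpret P: pair_sigma_finite lborel "\<mu> z" ..
    interpret Q: pair_sigma_finite "\<mu> z" "lborel :: real measure" ..
    have inner: "(LINT t|lborel. ?h (t, r)) = indicator {-c..} r * (1 / (r + lam))" "integrable lborel (\<lambda>t. ?h (t, r))" for r
    proof -
      have eq: "?h (t, r) = indicator {-c..} r * (indicator {0<..} t * exp (- (r + lam) * t))" for t
        by (simp add: heat_def exp_add[symmetric] algebra_simps mult_exp_exp)
      show "(LINT t|lborel. ?h (t, r)) = indicator {-c..} r * (1 / (r + lam))" "integrable lborel (\<lambda>t. ?h (t, r))"
        unfolding eq using integral_exp_ray(2,3)[of "r + lam"] lam by (auto simp: indicator_def)
    qed
    have m: "?h \<in> borel_measurable (lborel \<Otimes>\<^sub>M \<mu> z)" by measurable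
    have nn: "0 \<le> ?h (t, r)" for t r by (simp add: heat_def)
    have "integrable (\<mu> z \<Otimes>\<^sub>M lborel) (\<lambda>(r, t). ?h (t, r))"
    proof (rule Q.Fubini_integrable)
      show "integrable (\<mu> z) (\<lambda>r. LINT t|lborel. norm (case (r, t) of (r, t) \<Rightarrow> ?h (t, r)))"
      proof -
        have "(\<lambda>r. LINT t|lborel. norm (case (r, t) of (r, t) \<Rightarrow> ?h (t, r))) = (\<lambda>r. indicator {-c..} r * (1 / (r + lam)))"
          using inner(1) nn by (simp add: fun_eq_iff)
        moreover have "integrable (\<mu> z) (\<lambda>r. indicator {-c..} r * (1 / (r + lam)))"
          by (rule integrable_mu_bounded[where K="1 / (lam - c)"])
             (use lam in \<open>auto simp: indicator_def abs_of_nonneg intro!: divide_left_mono\<close>)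
        ultimately show ?thesis by simp
      qed
    qed (use inner m in auto)
    then have i: "integrable (lborel \<Otimes>\<^sub>M \<mu> z) ?h" by (subst (asm) P.integrable_product_swap_iff) simp
    have "(LINT t|lborel. LINT r|\<mu> z. ?h (t, r)) = (LINT r|\<mu> z. LINT t|lborel. ?h (t, r))"
      using P.Fubini_integral[of "\<lambda>t r. ?h (t, r)"] i by simp
    then show ?thesis using P.integrable_fst'[OF i] inner(1) by simp
  qed
  show "integrable lborel (\<lambda>t. indicator {0<..} t * exp (- lam * t) * bform (heat c t) x y)"
    using L[of "x + y"] L[of "x - y"] by (simp add: bform_def right_diff_distrib)
  show "(LINT t|lborel. indicator {0<..} t * exp (- lam * t) * bform (heat c t) x y) = bform (\<lambda>r. indicator {-c..} r * (1 / (r + lam))) x y"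
    using L[of "x + y"] L[of "x - y"] by (simp add: bform_def right_diff_distrib)
qed

lemma heat_right_continuous:
  assumes c: "0 \<le> c" and t: "0 \<le> t"
  shows "((\<lambda>s. bform (heat c s) x y) \<longlongrightarrow> bform (heat c t) x y) (at_right t)"
  unfolding tendsto_at_iff_sequentially comp_def
proof (intro allI impI)
  fix T :: "nat \<Rightarrow> real" assume T: "\<forall>i. T i \<in> {t<..} - {t}" "T \<longlonglongrightarrow> t"
  obtain K where K: "\<And>n. norm (T n) \<le> K" using convergent_imp_Bseq[of T] T(2) by (auto simp: convergent_def Bseq_def)
  show "(\<lambda>n. bform (heat c (T n)) x y) \<longlonglongrightarrow> bform (heat c t) x y"
  proof (rule bform_tendsto)
    show "(\<lambda>n. heat c (T n) r) \<longlonglongrightarrow> heat c t r" for r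
      unfolding heat_def by (intro tendsto_intros T)
    show "\<bar>heat c (T n) r\<bar> \<le> exp (c * K)" for n r
      using T(1)[rule_format, of n] K[of n] t c by (intro heat_bound) auto
  qed measurable
qed

end

section \<open>The Feynman-Kac formula\<close>

context bounded_potential
begin

definition kP :: "real \<Rightarrow> 'a \<Rightarrow> 'w \<Rightarrow> real" where
  "kP t x \<omega> = indicator (space M) \<omega> * exp (- IV x t \<omega>)"

lemma kP_bound: "0 \<le> kP t x \<omega>" "kP t x \<omega> \<le> exp (C * max 0 t)"
  using IV_bound[of \<omega> x t] by (auto simp: kP_def indicator_def abs_le_iff)

lemma weight_P: "translation_weight M (kP t) (Xp t) (exp (C * max 0 t))"
proof (intro translation_weight.intro translation_weight_axioms.intro)
  show "finite_measure M" by (rule finite_measure_axioms)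
  show "(\<lambda>(x, w). kP t x w) \<in> borel_measurable (borel \<Otimes>\<^sub>M M)" unfolding kP_def split_beta' by measurable
  show "Xp t \<in> borel_measurable M" by measurable
  show "\<bar>kP t x w\<bar> \<le> exp (C * max 0 t)" for x w using kP_bound[of t x w] by simp
qed

definition feynman_kac_op :: "real \<Rightarrow> 'a L2 \<Rightarrow> 'a L2" where "feynman_kac_op t = translation_op M (kP t) (Xp t)"

lemma bounded_linear_feynman_kac_op: "bounded_linear (feynman_kac_op t)"
  unfolding feynman_kac_op_def by (rule translation_weight.bounded_linear_translation_op[OF weight_P])

lemma inner_feynman_kac_op:
  assumes "f \<in> l2" "g \<in> l2"
  shows "inner (abs_L2 f) (feynman_kac_op t (abs_L2 g)) = Re (l2_inner f (weighted_translation M (kP t) (Xp t) g))"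
  unfolding feynman_kac_op_def using assms
  by (simp add: translation_weight.translation_op_abs[OF weight_P] inner_abs_L2 translation_weight.weighted_translation_l2[OF weight_P])

text \<open>Disintegrate \<open>Q (lam - C)\<close> into time and path: for positive
  \<open>t\<close> the factor \<open>exp (- C * t)\<close> in \<open>kG\<close> completes the
  density to \<open>exp (- lam * t)\<close> and leaves the weight \<open>kP\<close> at time
  \<open>t\<close>.\<close>

lemma laplace_feynman_kac_op:
  assumes lam: "lam > C"
  shows "integrable lborel (\<lambda>t. indicator {0<..} t * exp (- lam * t) * inner F (feynman_kac_op t G))"
    "(LINT t|lborel. indicator {0<..} t * exp (- lam * t) * inner F (feynman_kac_op t G)) = inner F (perturbed_resolvent lam G)"
proof -
  define f g where "f = rep_L2 F" and "g = rep_L2 G"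
  have f: "f \<in> l2" "abs_L2 f = F" and g: "g \<in> l2" "abs_L2 g = G" by (simp_all add: f_def g_def)
  have [measurable]: "f \<in> borel_measurable borel" "g \<in> borel_measurable borel" using f g by (auto dest: l2_measurable)
  interpret T: translation_weight "Q (lam - C)" kG Yq 1 by (rule weight_G[OF lam])
  define J where "J t \<omega> = (LINT x|lborel. cnj (f x) * (complex_of_real (kP t x \<omega>) * g (x + Xp t \<omega>)))" for t \<omega>
  define h where "h = (\<lambda>w. LINT x|lborel. cnj (f x) * (complex_of_real (kG x w) * g (x + Yq w)))"
  define e :: "real \<Rightarrow> real" where "e t = indicator {0<..} t * exp (- lam * t)" for t
  have h: "h (t, \<omega>) = exp (- C * max 0 t) *\<^sub>R J t \<omega>" for t \<omega>
  proof -
    have "cnj (f x) * (complex_of_real (kG x (t, \<omega>)) * g (x + Yq (t, \<omega>))) =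
      exp (- C * max 0 t) *\<^sub>R (cnj (f x) * (complex_of_real (kP t x \<omega>) * g (x + Xp t \<omega>)))" for x
      by (simp add: kG_def kP_def Yq_def scaleR_conv_of_real exp_diff exp_minus field_simps)
    then show ?thesis by (simp only: h_def J_def integral_scaleR_right)
  qed
  have eh: "(indicator {0<..} t * exp (- (lam - C) * t)) *\<^sub>R h (t, \<omega>) = e t *\<^sub>R J t \<omega>" for t \<omega>
    unfolding h e_def by (cases "0 < t") (auto simp: mult_exp_exp algebra_simps)
  have hQ: "integrable (Q (lam - C)) h"
    using T.P.integrable_snd[OF T.integrable_pair_inner[OF g(1) f(1)]] by (simp add: h_def)
  have hm: "h \<in> borel_measurable (lborel \<Otimes>\<^sub>M M)"
    using hQ[THEN borel_measurable_integrable]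
    by (simp add: measurable_cong_sets[OF _ refl, of "Q (lam - C)" "borel \<Otimes>\<^sub>M M"] measurable_cong_sets[OF sets_pair_measure_cong[OF sets_lborel refl] refl])
  have Qd: "Q (lam - C) = density (lborel \<Otimes>\<^sub>M M) (\<lambda>z. ennreal (case z of (t, \<omega>) \<Rightarrow> indicator {0<..} t * exp (- (lam - C) * t)))"
    unfolding Q_def by (rule arg_cong[where f="density _"]) (auto simp: fun_eq_iff)
  have i: "integrable (lborel \<Otimes>\<^sub>M M) (\<lambda>(t, \<omega>). e t *\<^sub>R J t \<omega>)"
    using hQ unfolding Qd by (subst (asm) integrable_density) (use hm in \<open>auto simp: split_beta' eh[symmetric]\<close>)
  have "(LINT w|Q (lam - C). h w) = (LINT z|(lborel \<Otimes>\<^sub>M M). (case z of (t, \<omega>) \<Rightarrow> e t *\<^sub>R J t \<omega>))"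
    unfolding Qd by (subst integral_density) (use hm in \<open>auto simp: split_beta' eh[symmetric]\<close>)
  also have "\<dots> = (LINT t|lborel. LINT \<omega>|M. e t *\<^sub>R J t \<omega>)" using LM.integral_fst'[OF i] by simp
  also have "\<dots> = (LINT t|lborel. e t *\<^sub>R l2_inner f (weighted_translation M (kP t) (Xp t) g))"
    by (simp add: translation_weight.l2_inner_weighted_translation[OF weight_P g(1) f(1)] J_def)
  finally have eq: "l2_inner f (weighted_translation (Q (lam - C)) kG Yq g) = (LINT t|lborel. e t *\<^sub>R l2_inner f (weighted_translation M (kP t) (Xp t) g))"
    unfolding T.l2_inner_weighted_translation[OF g(1) f(1)] h_def .
  have it: "integrable lborel (\<lambda>t. e t *\<^sub>R l2_inner f (weighted_translation M (kP t) (Xp t) g))"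
    using LM.integrable_fst'[OF i] by (simp add: translation_weight.l2_inner_weighted_translation[OF weight_P g(1) f(1)] J_def)
  have re: "indicator {0<..} t * exp (- lam * t) * inner F (feynman_kac_op t G) = Re (e t *\<^sub>R l2_inner f (weighted_translation M (kP t) (Xp t) g))" for t
    using inner_feynman_kac_op[OF f(1) g(1), of t] by (simp add: f g e_def)
  show "integrable lborel (\<lambda>t. indicator {0<..} t * exp (- lam * t) * inner F (feynman_kac_op t G))"
    unfolding re by (rule integrable_Re[OF it])
  have "inner F (perturbed_resolvent lam G) = Re (l2_inner f (weighted_translation (Q (lam - C)) kG Yq g))"
    using T.translation_op_abs[OF g(1)] inner_abs_L2[OF f(1) T.weighted_translation_l2[OF g(1)]]
    by (simp add: perturbed_resolvent_def f g)
  then show "(LINT t|lborel. indicator {0<..} t * exp (- lam * t) * inner F (feynman_kac_op t G)) = inner F (perturbed_resolvent lam G)"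
    unfolding re eq by (simp only: integral_Re[OF it])
qed

lemma IV_lipschitz:
  assumes \<omega>: "\<omega> \<in> space M" and t: "0 \<le> t" "t \<le> s"
  shows "\<bar>IV x s \<omega> - IV x t \<omega>\<bar> \<le> C * (s - t)"
proof -
  let ?v = "\<lambda>t r. if 0 \<le> r \<and> r \<le> t then V (x + Xp r \<omega>) else 0"
  have eq: "IV x s \<omega> - IV x t \<omega> = (LINT r|lborel. ?v s r - ?v t r)"
    unfolding IV_def by (rule Bochner_Integration.integral_diff[symmetric]) (rule integrable_IV[OF \<omega>])+
  have "\<bar>IV x s \<omega> - IV x t \<omega>\<bar> \<le> (LINT r|lborel. \<bar>?v s r - ?v t r\<bar>)"
    unfolding eq by (rule integral_abs_bound)
  also have "\<dots> \<le> (LINT r|lborel. C * indicator {t..s} r)"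
  proof (rule integral_mono)
    show "integrable lborel (\<lambda>r. \<bar>?v s r - ?v t r\<bar>)"
      by (intro integrable_abs Bochner_Integration.integrable_diff integrable_IV[OF \<omega>])
    show "integrable lborel (\<lambda>r. C * indicator {t..s} r)"
      by (intro integrable_mult_right integrable_real_indicator) (auto simp: emeasure_lborel_Icc_eq)
  qed (use V_bound C_nonneg t in \<open>auto simp: indicator_def\<close>)
  also have "\<dots> = C * (s - t)" using t by simp
  finally show ?thesis .
qed

text \<open>Along each path \<open>g\<close> of the position is right-continuous, as
  \<open>g\<close> is continuous and paths are cadlag, and the action is Lipschitz in time.
  Boundedness of \<open>g\<close> allows dominated convergence over paths, integrability of
  \<open>f\<close> over starting points.\<close>

lemma feynman_kac_op_right_continuous:
  assumes f: "nice f" and g: "nice g" and t: "0 \<le> t"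
  shows "((\<lambda>s. inner (abs_L2 f) (feynman_kac_op s (abs_L2 g))) \<longlongrightarrow> inner (abs_L2 f) (feynman_kac_op t (abs_L2 g))) (at_right t)"
  unfolding tendsto_at_iff_sequentially comp_def
proof (intro allI impI)
  fix T :: "nat \<Rightarrow> real" assume T: "\<forall>i. T i \<in> {t<..} - {t}" "T \<longlonglongrightarrow> t"
  have Tt: "t < T n" for n using T(1) by auto
  obtain L where L: "\<And>n. norm (T n) \<le> L" using convergent_imp_Bseq[of T] T(2) by (auto simp: convergent_def Bseq_def)
  obtain Kg where Kg: "\<And>x. cmod (g x) \<le> Kg" using g by (auto simp: nice_def)
  have gc: "continuous_on UNIV g" using g by (simp add: nice_def)
  have fm[measurable]: "f \<in> borel_measurable borel" and gm[measurable]: "g \<in> borel_measurable borel" using f g by (auto dest: nice_measurable)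
  have Kg0: "0 \<le> Kg" using Kg[of 0] norm_ge_zero order_trans by blast
  let ?w = "\<lambda>s. weighted_translation M (kP s) (Xp s) g"
  have [measurable]: "?w s \<in> borel_measurable borel" for s
    by (rule translation_weight.weighted_translation_measurable[OF weight_P gm])
  have km[measurable]: "(\<lambda>\<omega>. kP s x \<omega>) \<in> borel_measurable M" for s x unfolding kP_def by measurable
  have kb: "norm (complex_of_real (kP (T n) x \<omega>) * g (x + Xp (T n) \<omega>)) \<le> exp (C * L) * Kg" for n x \<omega>
  proof -
    have "kP (T n) x \<omega> \<le> exp (C * L)"
    proof -
      have "C * max 0 (T n) \<le> C * L" using Tt[of n] t L[of n] C_nonneg by (intro mult_left_mono) auto
      then show ?thesis using kP_bound(2)[of "T n" x \<omega>] by (meson exp_le_cancel_iff order_trans)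
    qed
    then show ?thesis using kP_bound(1)[of "T n" x \<omega>] Kg[of "x + Xp (T n) \<omega>"] by (simp add: norm_mult mult_mono)
  qed
  have wlim: "(\<lambda>n. ?w (T n) x) \<longlonglongrightarrow> ?w t x" for x
    unfolding weighted_translation_def
  proof (rule integral_dominated_convergence[where w="\<lambda>_. exp (C * L) * Kg"])
    show "AE \<omega> in M. (\<lambda>n. complex_of_real (kP (T n) x \<omega>) * g (x + Xp (T n) \<omega>)) \<longlonglongrightarrow> complex_of_real (kP t x \<omega>) * g (x + Xp t \<omega>)"
    proof (rule AE_I2)
      fix \<omega> assume \<omega>: "\<omega> \<in> space M"
      have "((\<lambda>s. X s \<omega>) \<longlongrightarrow> X t \<omega>) (at_right t)" using cadlag_paths[OF \<omega>] t by (simp add: cadlag_def)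
      then have "(\<lambda>n. X (T n) \<omega>) \<longlonglongrightarrow> X t \<omega>" using T unfolding tendsto_at_iff_sequentially comp_def by blast
      moreover have "Xp (T n) = X (T n)" for n using Tt[of n] t by (intro Xp_eq) simp
      ultimately have X: "(\<lambda>n. Xp (T n) \<omega>) \<longlonglongrightarrow> Xp t \<omega>" using Xp_eq[OF t] by simp
      have gl: "(\<lambda>n. g (x + Xp (T n) \<omega>)) \<longlonglongrightarrow> g (x + Xp t \<omega>)"
        by (rule continuous_on_tendsto_compose[OF gc]) (auto intro!: tendsto_intros X)
      have "(\<lambda>n. IV x (T n) \<omega> - IV x t \<omega>) \<longlonglongrightarrow> 0"
      proof (rule Lim_null_comparison)
        show "\<forall>\<^sub>F n in sequentially. norm (IV x (T n) \<omega> - IV x t \<omega>) \<le> C * (T n - t)"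
          using IV_lipschitz[OF \<omega> t less_imp_le[OF Tt]] by (simp add: always_eventually)
        have "(\<lambda>n. C * (T n - t)) \<longlonglongrightarrow> C * (t - t)" by (intro tendsto_intros T)
        then show "(\<lambda>n. C * (T n - t)) \<longlonglongrightarrow> 0" by simp
      qed
      then have "(\<lambda>n. IV x (T n) \<omega>) \<longlonglongrightarrow> IV x t \<omega>" by (simp add: LIM_zero_iff)
      then have "(\<lambda>n. kP (T n) x \<omega>) \<longlonglongrightarrow> kP t x \<omega>" unfolding kP_def by (intro tendsto_intros)
      then show "(\<lambda>n. complex_of_real (kP (T n) x \<omega>) * g (x + Xp (T n) \<omega>)) \<longlonglongrightarrow> complex_of_real (kP t x \<omega>) * g (x + Xp t \<omega>)"
        by (intro tendsto_intros gl)
    qed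
  qed (use kb in auto)
  have wb: "norm (?w (T n) x) \<le> exp (C * L) * Kg" for n x
  proof -
    have "norm (?w (T n) x) \<le> (LINT \<omega>|M. norm (complex_of_real (kP (T n) x \<omega>) * g (x + Xp (T n) \<omega>)))"
      unfolding weighted_translation_def by (rule integral_norm_bound)
    also have "\<dots> \<le> (LINT \<omega>|M. exp (C * L) * Kg)"
      by (rule integral_mono, rule integrable_const_bound[where B="exp (C * L) * Kg"]) (use kb in auto)
    finally show ?thesis by (simp add: prob_space)
  qed
  have "(\<lambda>n. l2_inner f (?w (T n))) \<longlonglongrightarrow> l2_inner f (?w t)"
    unfolding l2_inner_def
  proof (rule integral_dominated_convergence[where w="\<lambda>x. cmod (f x) * (exp (C * L) * Kg)"])
    show "integrable lborel (\<lambda>x. cmod (f x) * (exp (C * L) * Kg))" using nice_integrable[OF f] by simp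
    show "AE x in lborel. (\<lambda>n. cnj (f x) * ?w (T n) x) \<longlonglongrightarrow> cnj (f x) * ?w t x"
      by (intro AE_I2 tendsto_intros wlim)
    show "AE x in lborel. norm (cnj (f x) * ?w (T n) x) \<le> cmod (f x) * (exp (C * L) * Kg)" for n
      using wb by (intro AE_I2) (simp add: norm_mult mult_left_mono)
  qed measurable
  then show "(\<lambda>n. inner (abs_L2 f) (feynman_kac_op (T n) (abs_L2 g))) \<longlonglongrightarrow> inner (abs_L2 f) (feynman_kac_op t (abs_L2 g))"
    unfolding inner_feynman_kac_op[OF nice_l2[OF f] nice_l2[OF g]] by (rule tendsto_Re)
qed

end

context resolved_potential
begin

lemma inner_feynman_kac_op_nice:
  assumes f: "nice f" and g: "nice g" and t: "0 \<le> t"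
  shows "inner (abs_L2 f) (feynman_kac_op t (abs_L2 g)) = bform (heat C t) (abs_L2 f) (abs_L2 g)"
proof -
  let ?F = "abs_L2 f" and ?G = "abs_L2 g"
  let ?D = "\<lambda>t. inner ?F (feynman_kac_op t ?G) - bform (heat C t) ?F ?G"
  have "?D t = 0"
  \<comment> \<open>With \<open>c = C + 1\<close> all parameters \<open>c + n\<close> exceed
    \<open>C\<close>, where both Laplace transforms equal the matrix element of the perturbed
    resolvent.\<close>
  proof (rule laplace_transform_unique[where c="C + 1" and D="?D"])
    fix n :: nat
    have lam: "C + 1 + real n > C" by simp
    show "integrable lborel (\<lambda>t. indicator {0<..} t * exp (- (C + 1 + real n) * t) * ?D t)"
      using laplace_feynman_kac_op(1)[OF lam, of ?F ?G] laplace_heat(1)[OF lam, of ?F ?G] by (simp only: right_diff_distrib Bochner_Integration.integrable_diff)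
    show "(LINT t|lborel. indicator {0<..} t * exp (- (C + 1 + real n) * t) * ?D t) = 0"
      unfolding right_diff_distrib Bochner_Integration.integral_diff[OF laplace_feynman_kac_op(1)[OF lam, of ?F ?G] laplace_heat(1)[OF lam, of ?F ?G]]
        laplace_feynman_kac_op(2)[OF lam] laplace_heat(2)[OF lam] resolvent_bform[OF lam] by simp
    show "(?D \<longlongrightarrow> ?D t) (at_right t)"
      by (intro tendsto_diff feynman_kac_op_right_continuous[OF f g t] heat_right_continuous C_nonneg t)
  qed (rule t)
  then show ?thesis by simp
qed

lemma inner_feynman_kac_op_bform:
  assumes t: "0 \<le> t"
  shows "inner F (feynman_kac_op t G) = bform (heat C t) F G"
proof -
  have dense: "\<exists>k. (\<forall>n. nice (k n)) \<and> (\<lambda>n. abs_L2 (k n)) \<longlonglongrightarrow> H" for H :: "'a L2"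
  proof -
    have "\<forall>n. \<exists>k. nice k \<and> norm (abs_L2 k - H) < inverse (real (Suc n))"
      using nice_dense[of "inverse (real (Suc n))" H for n] by (metis inverse_positive_iff_positive of_nat_0_less_iff zero_less_Suc)
    from choice[OF this] obtain k where k: "\<And>n. nice (k n)" "\<And>n. norm (abs_L2 (k n) - H) < inverse (real (Suc n))" by blast
    have "(\<lambda>n. abs_L2 (k n) - H) \<longlonglongrightarrow> 0"
      by (rule Lim_null_comparison[OF _ LIMSEQ_inverse_real_of_nat]) (use k(2) in \<open>auto intro!: always_eventually less_imp_le simp del: of_nat_Suc\<close>)
    then show ?thesis using k(1) by (auto simp: LIM_zero_iff)
  qed
  obtain k where k: "\<And>n. nice (k n)" "(\<lambda>n. abs_L2 (k n)) \<longlonglongrightarrow> F" using dense by blast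
  obtain l where l: "\<And>n. nice (l n)" "(\<lambda>n. abs_L2 (l n)) \<longlonglongrightarrow> G" using dense by blast
  have "(\<lambda>n. inner (abs_L2 (k n)) (feynman_kac_op t (abs_L2 (l n)))) \<longlonglongrightarrow> inner F (feynman_kac_op t G)"
    by (intro tendsto_inner k bounded_linear.tendsto[OF bounded_linear_feynman_kac_op] l)
  moreover have "(\<lambda>n. bform (heat C t) (abs_L2 (k n)) (abs_L2 (l n))) \<longlonglongrightarrow> bform (heat C t) F G"
    by (intro bounded_bilinear.tendsto[OF bounded_bilinear_bform[where K="exp (C * t)"]] k l heat_measurable heat_bound t C_nonneg order_refl)
  ultimately show ?thesis unfolding inner_feynman_kac_op_nice[OF k(1) l(1) t] by (rule LIMSEQ_unique)
qed

text \<open>The exponential is bounded by \<open>exp (C * t)\<close> on the spectrum, so its domain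
  is the whole space and the weak equation, tested with all vectors, determines the image.\<close>

lemma pvm_integral_exp:
  assumes t: "0 \<le> t"
  shows "(G, U) \<in> pvm_integral (\<lambda>r. exp (- t * r)) \<longleftrightarrow> U = feynman_kac_op t G"
proof -
  have dom: "integrable (\<mu> F) (\<lambda>r. (exp (- t * r))\<^sup>2)" for F
  proof (rule integrable_mu_AE_bounded)
    show "AE r in \<mu> F. \<bar>(exp (- t * r))\<^sup>2\<bar> \<le> (exp (C * t))\<^sup>2"
      using AE_lower
    proof eventually_elim
      case (elim r)
      then have "\<bar>exp (- t * r)\<bar> \<le> exp (C * t)" using heat_bound[OF t order_refl C_nonneg, of r] by (simp add: heat_def)
      then show ?case by (simp add: power_mono)
    qed
  qed measurable
  have "bform (\<lambda>r. exp (- t * r)) F G = inner F (feynman_kac_op t G)" for F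
    unfolding inner_feynman_kac_op_bform[OF t] heat_def[abs_def] by (rule bform_lower[symmetric]) measurable
  then show ?thesis using dom vector_eq_ldot[of U "feynman_kac_op t G"] by (auto simp: pvm_integral_def)
qed

text \<open>\<open>op_apply\<close> picks some representative of the image; its class in the
  quotient is determined, and that is all the inner product sees.\<close>

lemma op_apply_exp:
  assumes g: "g \<in> l2" and t: "0 \<le> t"
  shows "op_apply (spectral_integral E (\<lambda>r. exp (- t * r))) g \<in> l2"
    "abs_L2 (op_apply (spectral_integral E (\<lambda>r. exp (- t * r))) g) = feynman_kac_op t (abs_L2 g)"
proof -
  let ?S = "spectral_integral E (\<lambda>r. exp (- t * r))"
  have iff: "(g, u) \<in> ?S \<longleftrightarrow> u \<in> l2 \<and> abs_L2 u = feynman_kac_op t (abs_L2 g)" for u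
    unfolding spectral_integral_iff pvm_integral_exp[OF t] using g by simp
  have "(g, op_apply ?S g) \<in> ?S"
    unfolding op_apply_def by (rule someI[of _ "rep_L2 (feynman_kac_op t (abs_L2 g))"], rule iff[THEN iffD2]) simp
  then show "op_apply ?S g \<in> l2" "abs_L2 (op_apply ?S g) = feynman_kac_op t (abs_L2 g)" unfolding iff by auto
qed

end

lemma (in bounded_potential) feynman_kac:
  assumes f: "f \<in> l2" and g: "g \<in> l2" and t: "0 \<le> t"
  shows "l2_inner f (op_apply (op_fun (\<lambda>r. exp (- t * r)) H) g) = l2_inner f (weighted_translation M (kP t) (Xp t) g)"
proof -
  have res: "spectral_resolution H (SOME E. spectral_resolution H E)"
    by (rule someI_ex[OF spectral_resolution_exists])
  interpret resolved_potential M X V C "SOME E. spectral_resolution H E"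
    by unfold_locales (rule res)
  show ?thesis
    using op_apply_exp[OF g t] translation_weight.translation_op_abs[OF weight_P g, of t] translation_weight.weighted_translation_l2[OF weight_P g, of t] f
    by (simp add: op_fun_def l2_inner_eq feynman_kac_op_def)
qed

text \<open>Every translate of a null set is null; Fubini then trades the almost every starting
  point for almost every path and time. A change of the potential on a null set therefore does not
  affect the action from almost every starting point.\<close>

lemma (in bounded_potential) AE_path_avoids_null_set:
  assumes N: "N \<in> null_sets lborel"
  shows "AE x in lborel. AE \<omega> in M. AE s in lborel. x + Xp s \<omega> \<notin> N"
proof -
  have [measurable]: "N \<in> sets borel" using N by (auto simp: null_sets_def)
  interpret Mb: pair_sigma_finite M "lborel :: real measure" ..
  interpret P: pair_sigma_finite "lborel :: 'a measure" "M \<Otimes>\<^sub>M (lborel :: real measure)" ..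
  have Xm: "(\<lambda>z. Xp (snd z) (fst z)) \<in> borel_measurable (M \<Otimes>\<^sub>M lborel)" by measurable
  have "AE x in lborel. x + a \<notin> N" for a
  proof -
    have "(\<integral>\<^sup>+x. indicator N (x + a) \<partial>lborel) = (\<integral>\<^sup>+x. indicator N x \<partial>lborel)"
      by (rule nn_integral_lborel_translate) measurable
    also have "\<dots> = 0" using N by (simp add: null_sets_def)
    finally have "AE x in lborel. indicator N (x + a) = (0::ennreal)"
      by (subst (asm) nn_integral_0_iff_AE) measurable
    then show ?thesis by (rule AE_mp) (auto simp: indicator_def)
  qed
  then have "AE z in M \<Otimes>\<^sub>M lborel. AE x in lborel. x + Xp (snd z) (fst z) \<notin> N" by simp
  then have "AE x in lborel. AE z in M \<Otimes>\<^sub>M lborel. x + Xp (snd z) (fst z) \<notin> N"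
    by (subst P.AE_commute) (use Xm in measurable)
  then show ?thesis
  proof eventually_elim
    case (elim x)
    from Mb.AE_pair[OF elim] show ?case by simp
  qed
qed

theorem theorem2p1:
  fixes V :: "'a::euclidean_space \<Rightarrow> real"
    and M :: "'w measure"
    and X :: "real \<Rightarrow> 'w \<Rightarrow> 'a"
    and f g :: "'a \<Rightarrow> complex"
    and t C :: real
  assumes "V \<in> borel_measurable borel"
    and "AE x in lborel. \<bar>V x\<bar> \<le> C"
    and "cauchy_process M X"
    and "f \<in> l2"
    and "g \<in> l2"
    and "t \<ge> 0"
  shows "l2_inner f
           (op_apply (op_fun (\<lambda>r. exp (- t * r)) (op_plus sqrt_neg_laplacian (mult_op V))) g) =
         (LINT x|lborel. LINT \<omega>|M.
            cnj (f (started_at X x 0 \<omega>)) * g (started_at X x t \<omega>) *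
            complex_of_real (exp (- (LINT s:{0..t}|lborel. V (started_at X x s \<omega>)))))"
proof -
  note [measurable] = assms(1)
  have [measurable]: "f \<in> borel_measurable borel" "g \<in> borel_measurable borel"
    using assms(4,5) by (auto dest: l2_measurable)
  \<comment> \<open>\<open>V\<close> is bounded only almost everywhere; truncation gives a
    representative bounded everywhere.\<close>
  define V' where "V' x = max (- C) (min C (V x))" for x
  \<comment> \<open>Lebesgue measure is not the null measure, so a bound that holds almost
    everywhere holds at some point.\<close>
  have C: "0 \<le> C"
  proof (rule ccontr)
    assume "\<not> 0 \<le> C"
    then have "AE x in (lborel :: 'a measure). False" using assms(2) by (auto elim: AE_mp)
    then show False by (simp add: trivial_limit_def[symmetric] ae_filter_eq_bot_iff)
  qed
  interpret cauchy_process M X by (rule assms(3))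
  interpret bounded_potential M X V' C
    by unfold_locales (use C in \<open>auto simp: V'_def[abs_def]\<close>)
  have VV: "AE x in lborel. V x = V' x"
    using assms(2) by (rule AE_mp) (auto simp: V'_def)
  \<comment> \<open>The operator side sees \<open>V\<close> only up to null sets, by the definition
    of the graph.\<close>
  have "mult_op V = mult_op V'"
    unfolding mult_op_def using VV by (auto elim!: AE_mp simp: AE_conj_iff)
  then have H: "op_plus sqrt_neg_laplacian (mult_op V) = H" by (simp add: H_def)
  have N: "{x. V x \<noteq> V' x} \<in> null_sets lborel"
  proof -
    have "{x. V x \<noteq> V' x} \<in> sets lborel" unfolding V'_def by measurable
    then show ?thesis using VV by (simp add: AE_iff_null_sets)
  qed
  let ?I = "\<lambda>x \<omega>. LINT s|lborel. indicator {0..t} s *\<^sub>R V (x + Xp s \<omega>)"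
  have X0: "AE \<omega> in M. Xp 0 \<omega> = 0" using AE_X0 by (simp add: Xp_eq)
  \<comment> \<open>The path side: for almost every \<open>x\<close> almost every path spends almost
    no time where \<open>V\<close> and \<open>V'\<close> differ, so the exponents agree; the value
    of \<open>f\<close> at time 0 becomes \<open>f x\<close> because the process starts at 0 almost
    surely.\<close>
  have inner: "AE x in lborel. (LINT \<omega>|M. cnj (f (x + Xp 0 \<omega>)) * g (x + Xp t \<omega>) * complex_of_real (exp (- ?I x \<omega>))) =
      cnj (f x) * weighted_translation M (kP t) (Xp t) g x"
    using AE_path_avoids_null_set[OF N]
  proof eventually_elim
    case (elim x)
    have "(LINT \<omega>|M. cnj (f (x + Xp 0 \<omega>)) * g (x + Xp t \<omega>) * complex_of_real (exp (- ?I x \<omega>))) =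
        (LINT \<omega>|M. cnj (f x) * (complex_of_real (kP t x \<omega>) * g (x + Xp t \<omega>)))"
    proof (rule integral_cong_AE)
      show "(\<lambda>\<omega>. cnj (f x) * (complex_of_real (kP t x \<omega>) * g (x + Xp t \<omega>))) \<in> borel_measurable M"
        unfolding kP_def by measurable
      show "AE \<omega> in M. cnj (f (x + Xp 0 \<omega>)) * g (x + Xp t \<omega>) * complex_of_real (exp (- ?I x \<omega>)) =
          cnj (f x) * (complex_of_real (kP t x \<omega>) * g (x + Xp t \<omega>))"
        using elim X0 AE_space
      proof eventually_elim
        case (elim \<omega>)
        have "?I x \<omega> = IV x t \<omega>"
          unfolding IV_def
        proof (rule integral_cong_AE)
          show "AE s in lborel. indicator {0..t} s *\<^sub>R V (x + Xp s \<omega>) = (if 0 \<le> s \<and> s \<le> t then V' (x + Xp s \<omega>) else 0)"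
            using elim(1) by (rule AE_mp) (auto simp: indicator_def)
        qed (use elim(3) in measurable)
        then show ?case using elim by (simp add: kP_def mult_ac)
      qed
    qed measurable
    then show ?case by (simp add: weighted_translation_def)
  qed
  have wm: "weighted_translation M (kP t) (Xp t) g \<in> borel_measurable borel"
    by (rule translation_weight.weighted_translation_measurable[OF weight_P]) measurable
  have "(LINT \<omega>|M. cnj (f (started_at X x 0 \<omega>)) * g (started_at X x t \<omega>) * complex_of_real (exp (- (LINT s:{0..t}|lborel. V (started_at X x s \<omega>))))) =
     (LINT \<omega>|M. cnj (f (x + Xp 0 \<omega>)) * g (x + Xp t \<omega>) * complex_of_real (exp (- ?I x \<omega>)))" for x
  proof -
    have "(LINT s:{0..t}|lborel. V (x + X s \<omega>)) = ?I x \<omega>" for \<omega>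
      unfolding set_lebesgue_integral_def
      by (rule Bochner_Integration.integral_cong) (auto simp: indicator_def Xp_eq)
    then show ?thesis using assms(6) by (simp add: started_at_def Xp_eq)
  qed
  then have "(LINT x|lborel. LINT \<omega>|M. cnj (f (started_at X x 0 \<omega>)) * g (started_at X x t \<omega>) *
      complex_of_real (exp (- (LINT s:{0..t}|lborel. V (started_at X x s \<omega>))))) =
     (LINT x|lborel. LINT \<omega>|M. cnj (f (x + Xp 0 \<omega>)) * g (x + Xp t \<omega>) * complex_of_real (exp (- ?I x \<omega>)))"
    by simp
  also have "\<dots> = l2_inner f (weighted_translation M (kP t) (Xp t) g)"
    unfolding l2_inner_def by (rule integral_cong_AE[OF _ _ inner]) (use wm in measurable)
  also have "\<dots> = l2_inner f (op_apply (op_fun (\<lambda>r. exp (- t * r)) H) g)"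
    by (rule feynman_kac[OF assms(4-6), symmetric])
  finally show ?thesis unfolding H ..
qed

end
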